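(* For every integer $\ell$, let $\mathfrak A_\ell$ be the associative subalgebra of $U(\mathfrak g)$ generated by $1$, $\mathfrak m$, $\mathfrak r_-$ and $\mathfrak r_+\mathfrak z_\ell$. Then for every integer $\ell$ there is a surjective algebra homomorphism $$\mathfrak A_\ell\longrightarrow \mathcal D_{\mathcal O(\ell D_0)}(\widetilde X).$$
   Context: Work over $\mathbb C$, $n\ge 2$. Lie algebra: $\mathfrak g=\mathfrak{sp}_{2n}$ with simple roots $\alpha_1,\dots,\alpha_n$ in Bourbaki's numbering ($\alpha_n$ the long simple root). Let $\mathfrak p=\mathfrak m\oplus\mathfrak r_+$ be the maximal parabolic subalgebra determined by $\alpha_n$: $\mathfrak m\cong\mathfrak{gl}_n$ is the sum of the Cartan subalgebra and the root spaces of roots whose $\alpha_n$-coefficient is $0$; $\mathfrak r_{\pm}$ is the sum of the root spaces of roots whose $\alpha_n$-coefficient is $\pm1$ (both are abelian), so $\mathfrak g=\mathfrak r_-\oplus\mathfrak m\oplus\mathfrak r_+$. The center $\mathfrak z$ of $\mathfrak m$ is one-dimensional; let $z$ be its generator normalized by $[z,x]=x$ for $x\in\mathfrak r_+$ and $[z,y]=-y$ for $y\in\mathfrak r_-$. Put $z_\ell:=z+\frac{\ell}{2}+\frac n4\in U(\mathfrak g)$, $\mathfrak z_\ell:=\mathbb C z_\ell$, and $\mathfrak r_+\mathfrak z_\ell:=\{xz_\ell: x\in\mathfrak r_+\}\subset U(\mathfrak g)$. Geometry: $\widetilde X$ is the smooth toric variety $\big((\mathbb A^n\smallsetminus\{0\})\times\mathbb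 A^1\big)/\mathbb C^\times$ for the action $u\cdot(Q_1,\dots,Q_{n+1})=(uQ_1,\dots,uQ_n,u^{-2}Q_{n+1})$, i.e. the total space of $\mathcal O(-2)$ over $\mathbb P^{n-1}$. Its Picard group is $\mathbb Z D_0$, where $D_0$ is the divisor $\{Q_1=0\}$; $\mathcal O(\ell D_0)$ is identified with the sheaf whose sections over an open $U$ are the regular functions $f$ on the preimage of $U$ in $(\mathbb A^n\smallsetminus\{0\})\times\mathbb A^1$ with $f(u\cdot Q)=u^\ell f(Q)$. $\mathcal D_{\mathcal O(\ell D_0)}(\widetilde X)$ is the ring of global sections of the sheaf of differential operators from the invertible sheaf $\mathcal O(\ell D_0)$ to itself. *)

theory Defs
  imports
    "Jordan_Normal_Form.Matrix"
    "HOL-Library.Poly_Mapping"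
    "HOL-Algebra.QuotRing"
begin

section \<open>Complex associative unital algebras\<close>

text \<open>
  A complex algebra is represented by a record of type \<^typ>\<open>(complex, 'a) module\<close>: a (not
  necessarily commutative) ring together with a scalar multiplication by complex numbers.
\<close>

definition alg_hom :: "(complex, 'a) module \<Rightarrow> (complex, 'b) module \<Rightarrow> ('a \<Rightarrow> 'b) set" where
  "alg_hom A B =
     {h \<in> ring_hom A B. \<forall>c. \<forall>x\<in>carrier A. h (c \<odot>\<^bsub>A\<^esub> x) = c \<odot>\<^bsub>B\<^esub> h x}"

inductive_set generate_alg :: "(complex, 'a) module \<Rightarrow> 'a set \<Rightarrow> 'a set"
  for A :: "(complex, 'a) module" and S :: "'a set" where
  one: "\<one>\<^bsub>A\<^esub> \<in> generate_alg A S"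
| incl: "x \<in> S \<Longrightarrow> x \<in> generate_alg A S"
| add: "x \<in> generate_alg A S \<Longrightarrow> y \<in> generate_alg A S \<Longrightarrow> x \<oplus>\<^bsub>A\<^esub> y \<in> generate_alg A S"
| mult: "x \<in> generate_alg A S \<Longrightarrow> y \<in> generate_alg A S \<Longrightarrow> x \<otimes>\<^bsub>A\<^esub> y \<in> generate_alg A S"
| scale: "x \<in> generate_alg A S \<Longrightarrow> c \<odot>\<^bsub>A\<^esub> x \<in> generate_alg A S"

definition subalgebra_generated ::
    "(complex, 'a) module \<Rightarrow> 'a set \<Rightarrow> (complex, 'a) module" where
  "subalgebra_generated A S = A\<lparr>carrier := generate_alg A S\<rparr>"


section \<open>Universal enveloping algebras of Lie algebras of matrices\<close>

datatype 'a free_monoid = Free (letters: "'a list")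

instantiation free_monoid :: (type) monoid_add
begin

definition zero_free_monoid :: "'a free_monoid" where
  "zero_free_monoid = Free []"

definition plus_free_monoid :: "'a free_monoid \<Rightarrow> 'a free_monoid \<Rightarrow> 'a free_monoid" where
  "plus_free_monoid v w = Free (letters v @ letters w)"

instance
  by standard (simp_all add: zero_free_monoid_def plus_free_monoid_def)

end

text \<open>
  The free algebra on \<open>S\<close> is the monoid algebra of the words over \<open>S\<close>; its product is the
  convolution product of \<^typ>\<open>'a free_monoid \<Rightarrow>\<^sub>0 complex\<close>.
\<close>

definition free_algebra :: "'a set \<Rightarrow> (complex, 'a free_monoid \<Rightarrow>\<^sub>0 complex) module" where
  "free_algebra S =
     \<lparr>carrier = {p. \<forall>w\<in>Poly_Mapping.keys p. set (letters w) \<subseteq> S},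
      monoid.mult = (*), one = 1, ring.zero = 0, add = (+),
      module.smult = (\<lambda>c p. Poly_Mapping.single 0 c * p)\<rparr>"

definition free_gen :: "'a \<Rightarrow> 'a free_monoid \<Rightarrow>\<^sub>0 complex" where
  "free_gen x = Poly_Mapping.single (Free [x]) 1"

definition lie_bracket :: "complex mat \<Rightarrow> complex mat \<Rightarrow> complex mat" where
  "lie_bracket X Y = X * Y - Y * X"

text \<open>
  \<open>U(\<gg>)\<close> is the tensor algebra of \<open>\<gg>\<close> modulo \<open>x \<otimes> y - y \<otimes> x - [x,y]\<close>. The tensor algebra is
  itself the free algebra on the set \<open>\<gg>\<close> modulo linearity of the inclusion of the generators,
  which accounts for the first two families of relations.
\<close>

definition env_relations ::
    "complex mat set \<Rightarrow> (complex mat free_monoid \<Rightarrow>\<^sub>0 complex) set" where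
  "env_relations \<gg> =
     {free_gen (x + y) - free_gen x - free_gen y | x y. x \<in> \<gg> \<and> y \<in> \<gg>}
   \<union> {free_gen (c \<cdot>\<^sub>m x) - Poly_Mapping.single 0 c * free_gen x | c x. x \<in> \<gg>}
   \<union> {free_gen x * free_gen y - free_gen y * free_gen x - free_gen (lie_bracket x y)
       | x y. x \<in> \<gg> \<and> y \<in> \<gg>}"

definition env_ideal ::
    "complex mat set \<Rightarrow> (complex mat free_monoid \<Rightarrow>\<^sub>0 complex) set" where
  "env_ideal \<gg> = genideal (free_algebra \<gg>) (env_relations \<gg>)"

definition env_class ::
    "complex mat set \<Rightarrow> (complex mat free_monoid \<Rightarrow>\<^sub>0 complex)
      \<Rightarrow> (complex mat free_monoid \<Rightarrow>\<^sub>0 complex) set" where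
  "env_class \<gg> p = env_ideal \<gg> +>\<^bsub>free_algebra \<gg>\<^esub> p"

definition env_algebra ::
    "complex mat set \<Rightarrow> (complex, (complex mat free_monoid \<Rightarrow>\<^sub>0 complex) set) module" where
  "env_algebra \<gg> =
     (let Q = free_algebra \<gg> Quot env_ideal \<gg> in
      \<lparr>carrier = carrier Q, monoid.mult = monoid.mult Q, one = one Q,
       ring.zero = ring.zero Q, add = add Q,
       module.smult = (\<lambda>c X. env_class \<gg> (Poly_Mapping.single 0 c) \<otimes>\<^bsub>Q\<^esub> X)\<rparr>)"

definition env_inj ::
    "complex mat set \<Rightarrow> complex mat \<Rightarrow> (complex mat free_monoid \<Rightarrow>\<^sub>0 complex) set" where
  "env_inj \<gg> x = env_class \<gg> (free_gen x)"


section \<open>The symplectic Lie algebra and its parabolic decomposition\<close>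

definition symp_form :: "nat \<Rightarrow> complex mat" where
  "symp_form n = four_block_mat (0\<^sub>m n n) (1\<^sub>m n) (- 1\<^sub>m n) (0\<^sub>m n n)"

definition sp :: "nat \<Rightarrow> complex mat set" where
  "sp n = {X \<in> carrier_mat (2 * n) (2 * n).
             transpose_mat X * symp_form n + symp_form n * X = 0\<^sub>m (2 * n) (2 * n)}"

definition cartan :: "nat \<Rightarrow> complex mat set" where
  "cartan n = {H \<in> sp n. diagonal_mat H}"

text \<open>
  Elements of the Cartan subalgebra are \<open>diag(h\<^sub>1,\<dots>,h\<^sub>n,-h\<^sub>1,\<dots>,-h\<^sub>n)\<close>, and \<open>\<epsilon>\<^sub>i\<close> reads off \<open>h\<^sub>i\<close>
  (matrix indices start at \<open>0\<close>). The simple roots are \<open>\<epsilon>\<^sub>i - \<epsilon>\<^sub>i\<^sub>+\<^sub>1\<close> for \<open>1 \<le> i < n\<close> and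
  \<open>\<alpha>\<^sub>n = 2\<epsilon>\<^sub>n\<close>. Only the values of a functional on the Cartan subalgebra are relevant.
\<close>

definition eps :: "nat \<Rightarrow> complex mat \<Rightarrow> complex" where
  "eps i H = H $$ (i - 1, i - 1)"

definition simple_root :: "nat \<Rightarrow> nat \<Rightarrow> complex mat \<Rightarrow> complex" where
  "simple_root n i H = (if i < n then eps i H - eps (i + 1) H else 2 * eps n H)"

definition root_space :: "nat \<Rightarrow> (complex mat \<Rightarrow> complex) \<Rightarrow> complex mat set" where
  "root_space n \<alpha> = {X \<in> sp n. \<forall>H\<in>cartan n. lie_bracket H X = \<alpha> H \<cdot>\<^sub>m X}"

text \<open>
  The linear functional with coordinates \<open>c 1, \<dots>, c n\<close> in the basis of simple roots; every root
  is of this form with integer coordinates.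
\<close>

definition root_comb :: "nat \<Rightarrow> (nat \<Rightarrow> int) \<Rightarrow> complex mat \<Rightarrow> complex" where
  "root_comb n c H = (\<Sum>i = 1..n. of_int (c i) * simple_root n i H)"

definition is_root :: "nat \<Rightarrow> (nat \<Rightarrow> int) \<Rightarrow> bool" where
  "is_root n c \<longleftrightarrow>
     (\<exists>H\<in>cartan n. root_comb n c H \<noteq> 0) \<and> root_space n (root_comb n c) \<noteq> {0\<^sub>m (2 * n) (2 * n)}"

inductive_set mat_span :: "nat \<Rightarrow> complex mat set \<Rightarrow> complex mat set"
  for N :: nat and S :: "complex mat set" where
  zero: "0\<^sub>m N N \<in> mat_span N S"
| incl: "X \<in> S \<Longrightarrow> X \<in> mat_span N S"
| add: "X \<in> mat_span N S \<Longrightarrow> Y \<in> mat_span N S \<Longrightarrow> X + Y \<in> mat_span N S"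
| scale: "X \<in> mat_span N S \<Longrightarrow> a \<cdot>\<^sub>m X \<in> mat_span N S"

definition levi :: "nat \<Rightarrow> complex mat set" where
  "levi n = mat_span (2 * n)
     (cartan n \<union> (\<Union>c\<in>{c. is_root n c \<and> c n = 0}. root_space n (root_comb n c)))"

definition rad_plus :: "nat \<Rightarrow> complex mat set" where
  "rad_plus n = mat_span (2 * n)
     (\<Union>c\<in>{c. is_root n c \<and> c n = 1}. root_space n (root_comb n c))"

definition rad_minus :: "nat \<Rightarrow> complex mat set" where
  "rad_minus n = mat_span (2 * n)
     (\<Union>c\<in>{c. is_root n c \<and> c n = -1}. root_space n (root_comb n c))"

definition levi_center :: "nat \<Rightarrow> complex mat set" where
  "levi_center n = {Z \<in> levi n. \<forall>X\<in>levi n. lie_bracket Z X = 0\<^sub>m (2 * n) (2 * n)}"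

definition z_elt :: "nat \<Rightarrow> complex mat" where
  "z_elt n = (THE z. z \<in> levi_center n \<and>
                (\<forall>x\<in>rad_plus n. lie_bracket z x = x) \<and>
                (\<forall>y\<in>rad_minus n. lie_bracket z y = - y))"

definition z_shift :: "nat \<Rightarrow> int \<Rightarrow> (complex mat free_monoid \<Rightarrow>\<^sub>0 complex) set" where
  "z_shift n l =
     env_inj (sp n) (z_elt n) \<oplus>\<^bsub>env_algebra (sp n)\<^esub>
     ((of_int l / 2 + of_nat n / 4) \<odot>\<^bsub>env_algebra (sp n)\<^esub> \<one>\<^bsub>env_algebra (sp n)\<^esub>)"

definition frakA ::
    "nat \<Rightarrow> int \<Rightarrow> (complex, (complex mat free_monoid \<Rightarrow>\<^sub>0 complex) set) module" where
  "frakA n l = subalgebra_generated (env_algebra (sp n))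
     ({\<one>\<^bsub>env_algebra (sp n)\<^esub>} \<union> env_inj (sp n) ` levi n \<union> env_inj (sp n) ` rad_minus n
      \<union> {env_inj (sp n) x \<otimes>\<^bsub>env_algebra (sp n)\<^esub> z_shift n l | x. x \<in> rad_plus n})"


section \<open>Zariski topology and regular functions on affine space\<close>

text \<open>Points of affine \<open>N\<close>-space are the vectors in \<^term>\<open>carrier_vec N\<close>.\<close>

inductive_set polynomial_fun :: "nat \<Rightarrow> (complex vec \<Rightarrow> complex) set" for N :: nat where
  const: "(\<lambda>_. c) \<in> polynomial_fun N"
| coord: "i < N \<Longrightarrow> (\<lambda>q. q $ i) \<in> polynomial_fun N"
| add: "f \<in> polynomial_fun N \<Longrightarrow> g \<in> polynomial_fun N \<Longrightarrow> (\<lambda>q. f q + g q) \<in> polynomial_fun N"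
| mult: "f \<in> polynomial_fun N \<Longrightarrow> g \<in> polynomial_fun N \<Longrightarrow> (\<lambda>q. f q * g q) \<in> polynomial_fun N"

definition zariski_open :: "nat \<Rightarrow> complex vec set \<Rightarrow> bool" where
  "zariski_open N W \<longleftrightarrow>
     (\<exists>F \<subseteq> polynomial_fun N. W = {q \<in> carrier_vec N. \<exists>f\<in>F. f q \<noteq> 0})"

definition regular_on :: "nat \<Rightarrow> complex vec set \<Rightarrow> (complex vec \<Rightarrow> complex) \<Rightarrow> bool" where
  "regular_on N W f \<longleftrightarrow>
     (\<forall>p\<in>W. \<exists>V. zariski_open N V \<and> p \<in> V \<and> V \<subseteq> W \<and>
        (\<exists>a\<in>polynomial_fun N. \<exists>b\<in>polynomial_fun N. \<forall>q\<in>V. b q \<noteq> 0 \<and> f q = a q / b q))"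


section \<open>The toric variety and its invertible sheaves\<close>

text \<open>The coordinates \<open>Q\<^sub>1, \<dots>, Q\<^sub>n\<^sub>+\<^sub>1\<close> have indices \<open>0, \<dots>, n\<close>.\<close>

definition cover :: "nat \<Rightarrow> complex vec set" where
  "cover n = {Q \<in> carrier_vec (n + 1). \<exists>i<n. Q $ i \<noteq> 0}"

definition torus_act :: "nat \<Rightarrow> complex \<Rightarrow> complex vec \<Rightarrow> complex vec" where
  "torus_act n u Q = vec (n + 1) (\<lambda>i. if i < n then u * Q $ i else u powi (-2) * Q $ i)"

definition torus_orbit :: "nat \<Rightarrow> complex vec \<Rightarrow> complex vec set" where
  "torus_orbit n Q = {torus_act n u Q | u. u \<noteq> 0}"

text \<open>
  The points of the quotient are the orbits, so the preimage in \<^term>\<open>cover n\<close> of a set \<open>U\<close> of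
  points is \<open>\<Union>U\<close>; the quotient carries the quotient topology.
\<close>

definition Xt :: "nat \<Rightarrow> complex vec set set" where
  "Xt n = torus_orbit n ` cover n"

definition Xt_open :: "nat \<Rightarrow> complex vec set set \<Rightarrow> bool" where
  "Xt_open n U \<longleftrightarrow> U \<subseteq> Xt n \<and> zariski_open (n + 1) (\<Union>U)"

text \<open>
  \<open>line_sheaf n l U\<close> is the space of sections over \<open>U\<close> of the sheaf \<open>\<O>(l D\<^sub>0)\<close>; for \<open>l = 0\<close> this is
  the structure sheaf. A section is extended by \<open>0\<close> outside the preimage of \<open>U\<close>, so that equality
  of sections is equality of functions and \<open>f * s\<close> (pointwise) is the product of \<open>s\<close> with the
  restriction of \<open>f\<close> whenever \<open>f\<close> is defined on a larger open set than \<open>s\<close>.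
\<close>

definition line_sheaf :: "nat \<Rightarrow> int \<Rightarrow> complex vec set set \<Rightarrow> (complex vec \<Rightarrow> complex) set" where
  "line_sheaf n l U =
     {f. regular_on (n + 1) (\<Union>U) f \<and>
         (\<forall>Q\<in>\<Union>U. \<forall>u. u \<noteq> 0 \<longrightarrow> f (torus_act n u Q) = u powi l * f Q) \<and>
         (\<forall>Q. Q \<notin> \<Union>U \<longrightarrow> f Q = 0)}"

definition restr :: "complex vec set set \<Rightarrow> (complex vec \<Rightarrow> complex) \<Rightarrow> complex vec \<Rightarrow> complex" where
  "restr U f = (\<lambda>Q. if Q \<in> \<Union>U then f Q else 0)"


section \<open>Differential operators\<close>

type_synonym sheaf_op =
  "complex vec set set \<Rightarrow> (complex vec \<Rightarrow> complex) \<Rightarrow> complex vec \<Rightarrow> complex"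

text \<open>
  Complex-linear endomorphisms of the sheaf \<open>\<O>(l D\<^sub>0)\<close>: families of maps indexed by the open sets
  and compatible with restriction. The last clause normalizes the irrelevant values.
\<close>

definition sheaf_endo :: "nat \<Rightarrow> int \<Rightarrow> sheaf_op set" where
  "sheaf_endo n l =
     {P. (\<forall>U. Xt_open n U \<longrightarrow>
            (\<forall>s\<in>line_sheaf n l U. P U s \<in> line_sheaf n l U) \<and>
            (\<forall>s\<in>line_sheaf n l U. \<forall>t\<in>line_sheaf n l U.
               P U (\<lambda>Q. s Q + t Q) = (\<lambda>Q. P U s Q + P U t Q)) \<and>
            (\<forall>c. \<forall>s\<in>line_sheaf n l U. P U (\<lambda>Q. c * s Q) = (\<lambda>Q. c * P U s Q))) \<and>
         (\<forall>U V. Xt_open n U \<and> Xt_open n V \<and> V \<subseteq> U \<longrightarrow>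
            (\<forall>s\<in>line_sheaf n l U. P V (restr V s) = restr V (P U s))) \<and>
         (\<forall>U s. \<not> (Xt_open n U \<and> s \<in> line_sheaf n l U) \<longrightarrow> P U s = (\<lambda>_. 0))}"

definition commutator :: "sheaf_op \<Rightarrow> (complex vec \<Rightarrow> complex) \<Rightarrow> sheaf_op" where
  "commutator P f = (\<lambda>W s Q. P W (\<lambda>Q. f Q * s Q) Q - f Q * P W s Q)"

text \<open>
  \<open>diff_order_less n l k U P\<close>: the restriction of \<open>P\<close> to \<open>U\<close> is a differential operator of order
  less than \<open>k\<close> in the sense of Grothendieck. Order less than \<open>0\<close> means that it vanishes.
\<close>

primrec diff_order_less ::
    "nat \<Rightarrow> int \<Rightarrow> nat \<Rightarrow> complex vec set set \<Rightarrow> sheaf_op \<Rightarrow> bool" where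
  "diff_order_less n l 0 U P \<longleftrightarrow>
     (\<forall>W. Xt_open n W \<and> W \<subseteq> U \<longrightarrow> (\<forall>s\<in>line_sheaf n l W. P W s = (\<lambda>_. 0)))"
| "diff_order_less n l (Suc k) U P \<longleftrightarrow>
     (\<forall>V. Xt_open n V \<and> V \<subseteq> U \<longrightarrow>
        (\<forall>f\<in>line_sheaf n 0 V. diff_order_less n l k V (commutator P f)))"

text \<open>
  Global sections of the sheaf of differential operators: the sheaf is the union of its subsheaves
  of operators of bounded order, so the order of an operator need only be bounded locally.
\<close>

definition diff_ops :: "nat \<Rightarrow> int \<Rightarrow> sheaf_op set" where
  "diff_ops n l =
     {P \<in> sheaf_endo n l. \<forall>x\<in>Xt n. \<exists>U k. Xt_open n U \<and> x \<in> U \<and> diff_order_less n l k U P}"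

definition diff_op_algebra :: "nat \<Rightarrow> int \<Rightarrow> (complex, sheaf_op) module" where
  "diff_op_algebra n l =
     \<lparr>carrier = diff_ops n l,
      monoid.mult = (\<lambda>P R U s. P U (R U s)),
      one = (\<lambda>U s. if Xt_open n U \<and> s \<in> line_sheaf n l U then s else (\<lambda>_. 0)),
      ring.zero = (\<lambda>U s Q. 0),
      add = (\<lambda>P R U s Q. P U s Q + R U s Q),
      module.smult = (\<lambda>c P U s Q. c * P U s Q)\<rparr>"

end

theory Submission
  imports Defs "HOL-Computational_Algebra.Fundamental_Theorem_Algebra"
begin

text \<open>
  The Lie algebra \<open>sp\<^sub>2\<^sub>n\<close> acts on Laurent series in \<open>x\<^sub>1, \<dots>, x\<^sub>n\<close> by quadratic operators \<open>x\<^sub>i x\<^sub>j\<close>,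
  \<open>x\<^sub>i \<partial>\<^sub>j\<close> and \<open>\<partial>\<^sub>i \<partial>\<^sub>j\<close>, and the exponents of the monomials in \<open>x\<close> of the same parity as \<open>l\<close>
  parametrize the monomial sections \<open>Q\<^sup>a t\<^sup>m\<close>, \<open>|a| - 2 m = l\<close>, of \<open>\<O>(l D\<^sub>0)\<close> over the torus, where
  \<open>t = Q\<^sub>n\<^sub>+\<^sub>1\<close>. In these terms \<open>z\<^sub>l\<close> is \<open>- t \<partial>\<^sub>t\<close>, so the generators of \<open>\<AA>\<^sub>l\<close> act as \<open>t Q\<^sub>i Q\<^sub>j\<close>,
  \<open>Q\<^sub>i \<partial>\<^sub>j\<close> and \<open>\<partial>\<^sub>i \<partial>\<^sub>j \<partial>\<^sub>t\<close>, which are global differential operators. A differential operator is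
  determined by its action on the monomial sections, which gives the homomorphism.

  For surjectivity, a differential operator sends the monomial with exponent \<open>a\<close> to
  \<open>\<Sum>e. p\<^sub>e(a) x\<^sup>a\<^sup>+\<^sup>e\<close> with finitely many polynomials \<open>p\<^sub>e\<close>. Since it is regular across each
  coordinate divisor, it cannot create a pole there, so \<open>p\<^sub>e\<close> vanishes on hyperplanes and is divisible
  by the product of the falling factorials of length \<open>- e\<^sub>i\<close> in the exponents of the \<open>Q\<^sub>i\<close> and of \<open>t\<close>.
  The shift by \<open>e\<close> whose symbol is exactly this product is a composition of the generators, and so
  are all operators \<open>x\<^sup>a \<mapsto> \<psi>(a) x\<^sup>a\<close> with \<open>\<psi>\<close> polynomial.
\<close>


section \<open>Linear operators on functions of an exponent vector\<close>

text \<open>Three algebras are compared: classes in U(sp), the ring \<open>lin_op\<close> of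
  operators on exponents, and sheaf operators. \<open>good\<close> relates the first two and
  \<open>matched\<close> the last two. Both determine the next value uniquely
  (\<open>good_unique\<close>, \<open>matched_unique\<close>), so the homomorphism is the composite
  relation, and its multiplicativity can be checked on each half. The middle ring does not see t:
  the exponent of t is fixed by those of the Q_i and by l, so multiplication by t becomes the
  identity operator and the derivative in t becomes multiplication by (|a| - l)/2. Hence x_i x_j is
  represented by an operator independent of l, whereas a product of two derivatives alone lowers the
  twist by 2 and must be completed by a derivative in t; the factor z_l supplies it. The obstacle in
  surjectivity is to pass from local fractions and Grothendieck's commutator condition to global
  finite data. Regular functions on the torus are first shown to be Laurent polynomials; commutators
  with chart monomials then become finite differences, and Newton interpolation yields polynomial
  symbols with one finite set of shifts for all exponents.\<close>

type_synonym exp_fun = "(nat \<Rightarrow> int) \<Rightarrow> complex"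

typedef lin_op = "{T :: exp_fun \<Rightarrow> exp_fun.
    (\<forall>u v. T (\<lambda>a. u a + v a) = (\<lambda>a. T u a + T v a)) \<and> (\<forall>c u. T (\<lambda>a. c * u a) = (\<lambda>a. c * T u a))}"
  morphisms app Lin_op
  by (rule exI[of _ "\<lambda>u. u"]) simp

setup_lifting type_definition_lin_op

instantiation lin_op :: ring_1
begin
lift_definition zero_lin_op :: lin_op is "\<lambda>u a. 0" by simp
lift_definition one_lin_op :: lin_op is "\<lambda>u. u" by simp
lift_definition plus_lin_op :: "lin_op \<Rightarrow> lin_op \<Rightarrow> lin_op" is "\<lambda>S T u a. S u a + T u a"
  by (simp add: algebra_simps)
lift_definition minus_lin_op :: "lin_op \<Rightarrow> lin_op \<Rightarrow> lin_op" is "\<lambda>S T u a. S u a - T u a"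
  by (simp add: algebra_simps)
lift_definition uminus_lin_op :: "lin_op \<Rightarrow> lin_op" is "\<lambda>S u a. - S u a"
  by simp
lift_definition times_lin_op :: "lin_op \<Rightarrow> lin_op \<Rightarrow> lin_op" is "\<lambda>S T u. S (T u)"
  by simp
instance
proof
  show "(0::lin_op) \<noteq> 1"
    by transfer (auto simp: fun_eq_iff intro!: exI[of _ "\<lambda>_. 1"])
qed (transfer; simp add: fun_eq_iff algebra_simps)+
end

text \<open>
  A function \<open>u\<close> of type \<open>exp_fun\<close> encodes the Laurent series \<open>\<Sum>a. u a x\<^sup>a\<close>; then \<open>Sh e \<phi>\<close> is the linear
  operator \<open>x\<^sup>a \<mapsto> \<phi> a x\<^sup>a\<^sup>+\<^sup>e\<close>.
\<close>

lift_definition Sh :: "(nat \<Rightarrow> int) \<Rightarrow> exp_fun \<Rightarrow> lin_op" is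
  "\<lambda>e \<phi> u a. \<phi> (\<lambda>i. a i - e i) * u (\<lambda>i. a i - e i)"
  by (simp add: algebra_simps)

lemma app_simps:
  "app 0 u = (\<lambda>a. 0)" "app 1 u = u" "app (S + T) u = (\<lambda>a. app S u a + app T u a)"
  "app (S * T) u = app S (app T u)"
  "app (Sh e \<phi>) u = (\<lambda>a. \<phi> (\<lambda>i. a i - e i) * u (\<lambda>i. a i - e i))"
  by (transfer; simp)+

lemma app_scale: "app T (\<lambda>a. c * u a) = (\<lambda>a. c * app T u a)"
  by transfer simp

lemma Sh_mult: "Sh e \<phi> * Sh e' \<phi>' = Sh (\<lambda>i. e i + e' i) (\<lambda>a. \<phi> (\<lambda>i. a i + e' i) * \<phi>' a)"
  by transfer (simp add: fun_eq_iff algebra_simps)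

lemma Sh_add: "Sh e \<phi> + Sh e \<psi> = Sh e (\<lambda>a. \<phi> a + \<psi> a)"
  by transfer (simp add: fun_eq_iff algebra_simps)

lemma Sh_diff: "Sh e \<phi> - Sh e \<psi> = Sh e (\<lambda>a. \<phi> a - \<psi> a)"
  by transfer (simp add: fun_eq_iff algebra_simps)

lemma Sh_one: "Sh (\<lambda>_. 0) (\<lambda>_. 1) = 1"
  by transfer simp

lemma Sh_zero: "Sh e (\<lambda>_. 0) = 0"
  by transfer simp

text \<open>Scalars are placed inside the ring as multiplication operators. Being central
  (\<open>scal_central\<close>), they replace an algebra structure over the complex numbers.\<close>

definition scal :: "complex \<Rightarrow> lin_op" where
  "scal c = Sh (\<lambda>_. 0) (\<lambda>_. c)"

lemma scal_simps: "scal 0 = 0" "scal 1 = 1" "scal (c + d) = scal c + scal d"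
  "scal (c * d) = scal c * scal d" "scal (c - d) = scal c - scal d" "scal (- c) = - scal c"
proof -
  show "scal (- c) = - scal c"
    using Sh_diff[of "\<lambda>_. 0" "\<lambda>_. 0" "\<lambda>_. c"] by (simp add: scal_def Sh_zero)
qed (simp_all add: scal_def Sh_zero Sh_one Sh_add Sh_mult Sh_diff)

lemma scal_sum: "scal (\<Sum>i\<in>A. f i) = (\<Sum>i\<in>A. scal (f i))"
  by (induction A rule: infinite_finite_induct) (auto simp: scal_simps)

lemma app_scal: "app (scal c) u = (\<lambda>a. c * u a)"
  by (simp add: scal_def app_simps)

lemma scal_central: "T * scal c = scal c * T"
  unfolding app_inject[symmetric] by (simp add: fun_eq_iff app_simps app_scal app_scale)

lemma scal_left_commute: "T * (scal c * S) = scal c * (T * S)"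
  by (metis mult.assoc scal_central)

section \<open>The Weyl algebra acting on exponents, and its commutation relations\<close>

definition unit_exp :: "nat \<Rightarrow> nat \<Rightarrow> int" where
  "unit_exp i = (\<lambda>j. if j = i then 1 else 0)"

definition Xop :: "nat \<Rightarrow> lin_op" where
  "Xop i = Sh (unit_exp i) (\<lambda>_. 1)"

definition Dop :: "nat \<Rightarrow> lin_op" where
  "Dop i = Sh (\<lambda>j. - unit_exp i j) (\<lambda>a. of_int (a i))"

definition wop :: "nat \<Rightarrow> nat \<Rightarrow> lin_op" where
  "wop n k = (if k < n then Dop k else Xop (k - n))"

lemma scal_mult: "scal c * (scal d * T) = scal (c * d) * T"
  by (simp add: scal_simps(4) mult.assoc)

lemma wop_scal: "wop n r * (scal c * T) = scal c * (wop n r * T)"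
  by (rule scal_left_commute)

lemma wop_scal0: "wop n r * scal c = scal c * wop n r"
  by (rule scal_central)

text \<open>Entry of \<open>symp_form n\<close>, written without block matrices
  (\<open>symp_form_entry\<close>). The same numbers are the commutators of the operators
  \<open>wop\<close> (\<open>wop_commute\<close>).\<close>

definition Jc :: "nat \<Rightarrow> nat \<Rightarrow> nat \<Rightarrow> complex" where
  "Jc n r c = (if c = r + n then 1 else if r = c + n then -1 else 0)"

lemma Xop_Dop_simps:
  "Xop i * Xop j = Xop j * Xop i"
  "Dop i * Dop j = Dop j * Dop i"
  "Dop i * Xop j - Xop j * Dop i = scal (if i = j then 1 else 0)"
proof -
  show "Dop i * Xop j - Xop j * Dop i = scal (if i = j then 1 else 0)"
    by (auto simp: Xop_def Dop_def Sh_mult Sh_diff scal_def unit_exp_def Sh_zero add.commute cong: if_cong)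
qed (auto simp: Xop_def Dop_def Sh_mult unit_exp_def add.commute mult.commute intro!: arg_cong2[where f = Sh])

lemma wop_commute:
  assumes "r < 2 * n" "c < 2 * n"
  shows "wop n r * wop n c - wop n c * wop n r = scal (Jc n r c)"
proof -
  have *: "Xop i * Dop j - Dop j * Xop i = scal (if i = j then -1 else 0)" for i j
    using Xop_Dop_simps(3)[of j i]
    by (metis (full_types) minus_diff_eq scal_simps(1) scal_simps(6) minus_zero)
  have eq: "Xop i * Dop j = Dop j * Xop i" if "i \<noteq> j" for i j
    using *[of i j] that by (simp add: scal_simps)
  show ?thesis
    using assms by (auto simp: wop_def Jc_def Xop_Dop_simps * scal_simps intro!: eq eq[symmetric])
qed

section \<open>The oscillator representation\<close>

text \<open>
  With \<open>w = (\<partial>\<^sub>1, \<dots>, \<partial>\<^sub>n, x\<^sub>1, \<dots>, x\<^sub>n)\<close> and \<open>J\<close> the symplectic form, \<open>X\<close> is symplectic iff \<open>S = - X J\<close> is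
  symmetric, and then the quadratic operator \<open>1/2 \<Sum> S\<^sub>r\<^sub>c w\<^sub>r w\<^sub>c\<close> acts on the span of the \<open>w\<^sub>k\<close> by
  commutators through the matrix \<open>X\<close>.
\<close>

definition Sm :: "nat \<Rightarrow> complex mat \<Rightarrow> nat \<Rightarrow> nat \<Rightarrow> complex" where
  "Sm n M r c = (if c < n then M $$ (r, c + n) else - M $$ (r, c - n))"

definition rho :: "nat \<Rightarrow> complex mat \<Rightarrow> lin_op" where
  "rho n M = scal (1/2) * (\<Sum>r<2*n. \<Sum>c<2*n. scal (Sm n M r c) * (wop n r * wop n c))"

definition com :: "lin_op \<Rightarrow> lin_op \<Rightarrow> lin_op" where
  "com S T = S * T - T * S"

lemma com_sum_left: "com (\<Sum>i\<in>A. f i) T = (\<Sum>i\<in>A. com (f i) T)"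
  by (simp add: com_def sum_distrib_left sum_distrib_right sum_subtractf)

lemma com_sum_right: "com T (\<Sum>i\<in>A. f i) = (\<Sum>i\<in>A. com T (f i))"
  by (simp add: com_def sum_distrib_left sum_distrib_right sum_subtractf)

lemma com_scal_left: "com (scal c * S) T = scal c * com S T"
  by (simp add: com_def algebra_simps scal_left_commute)

lemma com_scal_right: "com S (scal c * T) = scal c * com S T"
  by (simp add: com_def algebra_simps scal_left_commute)

lemma com_mult_left: "com (scal c * (S * S')) T = scal c * (S * com S' T + com S T * S')"
  unfolding com_scal_left by (simp add: com_def algebra_simps)

lemma com_mult_right: "com T (scal c * (S * S')) = scal c * (com T S * S' + S * com T S')"
  unfolding com_scal_right by (simp add: com_def algebra_simps)

lemma sum_Jc:
  assumes "p < 2 * n"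
  shows "(\<Sum>c<2*n. f c * Jc n c p) = (if p < n then - f (p + n) else f (p - n))"
proof (cases "p < n")
  case True
  have "(\<Sum>c<2*n. f c * Jc n c p) = (\<Sum>c<2*n. if c = p + n then - f c else 0)"
    using True by (intro sum.cong) (auto simp: Jc_def)
  then show ?thesis using True by (simp add: sum.delta)
next
  case False
  have "(\<Sum>c<2*n. f c * Jc n c p) = (\<Sum>c<2*n. if c = p - n then f c else 0)"
    using False assms by (intro sum.cong) (auto simp: Jc_def)
  then show ?thesis using False assms by (simp add: sum.delta)
qed

text \<open>Both factors of \<open>w_r w_c\<close> contribute the same amount because S is
  symmetric, which cancels the 1/2 in \<open>rho\<close>. Contracting S = - M J with J gives back M,
  as the square of J is -1.\<close>

lemma rho_wop:
  assumes sym: "\<And>r c. r < 2*n \<Longrightarrow> c < 2*n \<Longrightarrow> Sm n M r c = Sm n M c r" and p: "p < 2*n"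
  shows "com (rho n M) (wop n p) = (\<Sum>k<2*n. scal (M $$ (k, p)) * wop n k)"
proof -
  let ?S = "Sm n M"
  have "com (rho n M) (wop n p) =
      scal (1/2) * (\<Sum>r<2*n. \<Sum>c<2*n. scal (?S r c) * (wop n r * scal (Jc n c p) + scal (Jc n r p) * wop n c))"
    unfolding rho_def com_scal_left[of "1/2"] com_sum_left com_mult_left
    using p by (intro arg_cong2[where f = "(*)"] refl sum.cong) (simp add: com_def wop_commute)
  also have "(\<Sum>r<2*n. \<Sum>c<2*n. scal (?S r c) * (wop n r * scal (Jc n c p) + scal (Jc n r p) * wop n c))
     = (\<Sum>r<2*n. \<Sum>c<2*n. scal (?S r c * Jc n c p) * wop n r) + (\<Sum>r<2*n. \<Sum>c<2*n. scal (?S r c * Jc n r p) * wop n c)"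
    by (simp add: sum.distrib[symmetric] distrib_left mult.assoc[symmetric] scal_simps(4) wop_scal0)
  also have "(\<Sum>r<2*n. \<Sum>c<2*n. scal (?S r c * Jc n r p) * wop n c) = (\<Sum>c<2*n. \<Sum>r<2*n. scal (?S r c * Jc n r p) * wop n c)"
    by (rule sum.swap)
  also have "\<dots> = (\<Sum>c<2*n. \<Sum>r<2*n. scal (?S c r * Jc n r p) * wop n c)"
    by (intro sum.cong refl) (simp add: sym)
  also have "(\<Sum>r<2*n. \<Sum>c<2*n. scal (?S r c * Jc n c p) * wop n r) + \<dots>
      = scal 2 * (\<Sum>r<2*n. \<Sum>c<2*n. scal (?S r c * Jc n c p) * wop n r)"
    using scal_simps(3)[of 1 1] by (simp add: scal_simps(2) mult_2)
  also have "(\<Sum>r<2*n. \<Sum>c<2*n. scal (?S r c * Jc n c p) * wop n r)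
     = (\<Sum>r<2*n. scal (\<Sum>c<2*n. ?S r c * Jc n c p) * wop n r)"
    by (simp add: scal_sum sum_distrib_right)
  also have "\<dots> = (\<Sum>k<2*n. scal (M $$ (k, p)) * wop n k)"
    using p by (intro sum.cong refl) (auto simp: sum_Jc Sm_def)
  finally show ?thesis
    by (simp add: mult.assoc[symmetric] scal_simps(4)[symmetric] scal_simps(2))
qed

text \<open>S transforms like a quadratic form. With T = - N J one has - [M, N] J = M T + N M J, and
  the symmetry of M J turns N M J into T times the transpose of M.\<close>

lemma Sm_lie_bracket:
  fixes M N :: "complex mat"
  assumes symM: "\<And>r c. r < 2*n \<Longrightarrow> c < 2*n \<Longrightarrow> Sm n M r c = Sm n M c r"
    and M: "M \<in> carrier_mat (2*n) (2*n)" and N: "N \<in> carrier_mat (2*n) (2*n)"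
    and rc: "r < 2*n" "c < 2*n"
  shows "Sm n (lie_bracket M N) r c = (\<Sum>k<2*n. M $$ (r, k) * Sm n N k c) + (\<Sum>k<2*n. Sm n N r k * M $$ (c, k))"
proof -
  let ?I = "{..<2*n}"
  let ?T = "Sm n N"
    have 1: "(\<Sum>k\<in>?I. ?T r k * M $$ (c, k)) = - (\<Sum>k\<in>?I. N $$ (r, k) * Sm n M c k)"
    proof -
      \<comment> \<open>Multiplication by J permutes indices, up to sign, by this
        involution.\<close>
      define h where "h k = (if k < n then k + n else k - n)" for k
      have "(\<Sum>k\<in>?I. ?T r k * M $$ (c, k)) = (\<Sum>k\<in>?I. ?T r (h k) * M $$ (c, h k))"
        by (rule sum.reindex_bij_witness[of _ h h]) (auto simp: h_def)
      also have "\<dots> = (\<Sum>k\<in>?I. - (N $$ (r, k) * Sm n M c k))"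
        by (intro sum.cong refl) (auto simp: h_def Sm_def)
      finally show ?thesis by (simp add: sum_negf)
    qed
    also have "\<dots> = - (\<Sum>k\<in>?I. N $$ (r, k) * Sm n M k c)"
      using rc by (simp add: symM)
    finally have 2: "(\<Sum>k\<in>?I. ?T r k * M $$ (c, k)) = - (\<Sum>k\<in>?I. N $$ (r, k) * Sm n M k c)" .
    have L: "lie_bracket M N $$ (r, d) = (\<Sum>k\<in>?I. M $$ (r, k) * N $$ (k, d)) - (\<Sum>k\<in>?I. N $$ (r, k) * M $$ (k, d))"
      if "d < 2 * n" for d
      using M N rc that by (simp add: lie_bracket_def scalar_prod_def lessThan_atLeast0)
    show ?thesis
      unfolding 2 using rc by (auto simp: Sm_def L sum_negf)
qed

text \<open>By the Leibniz rule the commutator with \<open>w_r w_c\<close> is known from the action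
  on each factor (\<open>rho_wop\<close>). Collecting the coefficients of the resulting quadratic
  operator gives the matrix in \<open>Sm_lie_bracket\<close>.\<close>

lemma rho_com:
  fixes M N :: "complex mat"
  assumes symM: "\<And>r c. r < 2*n \<Longrightarrow> c < 2*n \<Longrightarrow> Sm n M r c = Sm n M c r"
    and M: "M \<in> carrier_mat (2*n) (2*n)" and N: "N \<in> carrier_mat (2*n) (2*n)"
  shows "com (rho n M) (rho n N) = rho n (lie_bracket M N)"
proof -
  let ?I = "{..<2*n}"
  let ?T = "Sm n N"
  let ?w = "wop n"
  have "com (rho n M) (rho n N) = scal (1/2) * (\<Sum>r\<in>?I. \<Sum>c\<in>?I. scal (?T r c) *
      ((\<Sum>k\<in>?I. scal (M $$ (k, r)) * ?w k) * ?w c + ?w r * (\<Sum>k\<in>?I. scal (M $$ (k, c)) * ?w k)))"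
    unfolding rho_def[of n N] com_scal_right[of _ "1/2"] com_sum_right com_mult_right
    by (intro arg_cong2[where f = "(*)"] refl sum.cong) (simp add: rho_wop[OF symM])
  also have "(\<Sum>r\<in>?I. \<Sum>c\<in>?I. scal (?T r c) *
      ((\<Sum>k\<in>?I. scal (M $$ (k, r)) * ?w k) * ?w c + ?w r * (\<Sum>k\<in>?I. scal (M $$ (k, c)) * ?w k)))
    = (\<Sum>r\<in>?I. \<Sum>c\<in>?I. \<Sum>k\<in>?I. scal (M $$ (k, r) * ?T r c) * (?w k * ?w c))
    + (\<Sum>r\<in>?I. \<Sum>c\<in>?I. \<Sum>k\<in>?I. scal (?T r c * M $$ (k, c)) * (?w r * ?w k))"
    by (simp add: sum.distrib[symmetric] distrib_left distrib_right mult.assoc scal_mult wop_scal sum_distrib_left sum_distrib_right mult.commute[of "_ :: complex"])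
  also have "(\<Sum>r\<in>?I. \<Sum>c\<in>?I. \<Sum>k\<in>?I. scal (M $$ (k, r) * ?T r c) * (?w k * ?w c))
     = (\<Sum>k\<in>?I. \<Sum>c\<in>?I. \<Sum>r\<in>?I. scal (M $$ (k, r) * ?T r c) * (?w k * ?w c))"
    by (subst sum.swap, rule sum.swap[THEN trans], intro sum.cong refl sum.swap)
  also have "(\<Sum>r\<in>?I. \<Sum>c\<in>?I. \<Sum>k\<in>?I. scal (?T r c * M $$ (k, c)) * (?w r * ?w k))
     = (\<Sum>r\<in>?I. \<Sum>k\<in>?I. \<Sum>c\<in>?I. scal (?T r c * M $$ (k, c)) * (?w r * ?w k))"
    by (intro sum.cong refl sum.swap)
  also have "(\<Sum>k\<in>?I. \<Sum>c\<in>?I. \<Sum>r\<in>?I. scal (M $$ (k, r) * ?T r c) * (?w k * ?w c)) + \<dots>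
     = (\<Sum>r\<in>?I. \<Sum>c\<in>?I. scal ((\<Sum>k\<in>?I. M $$ (r, k) * ?T k c) + (\<Sum>k\<in>?I. ?T r k * M $$ (c, k))) * (?w r * ?w c))"
    by (simp add: sum.distrib[symmetric] scal_simps(3) scal_sum sum_distrib_right distrib_right)
  also have "\<dots> = (\<Sum>r\<in>?I. \<Sum>c\<in>?I. scal (Sm n (lie_bracket M N) r c) * (?w r * ?w c))"
    using Sm_lie_bracket[OF symM M N] by (intro sum.cong refl) simp
  finally show ?thesis by (simp add: rho_def)
qed

lemma rho_add:
  assumes "M \<in> carrier_mat (2*n) (2*n)" "N \<in> carrier_mat (2*n) (2*n)"
  shows "rho n (M + N) = rho n M + rho n N"
proof -
  have "Sm n (M + N) r c = Sm n M r c + Sm n N r c" if "r < 2*n" "c < 2*n" for r c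
    using that assms by (auto simp: Sm_def)
  then show ?thesis
    by (simp add: rho_def scal_simps algebra_simps sum.distrib)
qed

lemma rho_smult:
  assumes "M \<in> carrier_mat (2*n) (2*n)"
  shows "rho n (a \<cdot>\<^sub>m M) = scal a * rho n M"
proof -
  have "Sm n (a \<cdot>\<^sub>m M) r c = a * Sm n M r c" if "r < 2*n" "c < 2*n" for r c
    using that assms by (auto simp: Sm_def)
  then show ?thesis
    by (simp add: rho_def sum_distrib_left scal_mult mult.assoc mult.commute[of "_ :: complex"] mult.left_commute[of "_ :: complex"])
qed

section \<open>Evaluation of enveloping algebra classes\<close>

definition ev :: "('x \<Rightarrow> lin_op) \<Rightarrow> ('x free_monoid \<Rightarrow>\<^sub>0 complex) \<Rightarrow> lin_op" where
  "ev g p = (\<Sum>w\<in>Poly_Mapping.keys p. scal (Poly_Mapping.lookup p w) * prod_list (map g (letters w)))"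

lemma ev_superset:
  assumes "finite A" "Poly_Mapping.keys p \<subseteq> A"
  shows "ev g p = (\<Sum>w\<in>A. scal (Poly_Mapping.lookup p w) * prod_list (map g (letters w)))"
  unfolding ev_def using assms
  by (intro sum.mono_neutral_left) (auto simp: in_keys_iff scal_simps)

lemma ev_add: "ev g (p + q) = ev g p + ev g q"
proof -
  let ?A = "Poly_Mapping.keys p \<union> Poly_Mapping.keys q"
  have "Poly_Mapping.keys (p + q) \<subseteq> ?A" by (rule Poly_Mapping.keys_add)
  then show ?thesis
    by (simp add: ev_superset[of ?A] lookup_add scal_simps distrib_right sum.distrib)
qed

lemma ev_zero [simp]: "ev g 0 = 0"
  by (simp add: ev_def)

lemma ev_uminus: "ev g (- p) = - ev g p"
  using ev_add[of g p "- p"] by (simp add: eq_neg_iff_add_eq_0 add.commute)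

lemma ev_diff: "ev g (p - q) = ev g p - ev g q"
  using ev_add[of g p "- q"] by (simp add: ev_uminus)

lemma ev_single: "ev g (Poly_Mapping.single w c) = scal c * prod_list (map g (letters w))"
  by (simp add: ev_def scal_simps)

lemma poly_mapping_induct_single [case_names zero add]:
  assumes "P 0" and "\<And>p k c. P p \<Longrightarrow> P (p + Poly_Mapping.single k c)"
  shows "P p"
proof (induction p rule: update_induct)
  case const
  then show ?case by (rule assms(1))
next
  case (update f a b)
  have "Poly_Mapping.update a b f = f + Poly_Mapping.single a b"
    using update by (intro poly_mapping_eqI) (auto simp: lookup_update lookup_add lookup_single in_keys_iff)
  then show ?case using update assms(2) by simp
qed

lemma ev_mult: "ev g (p * q) = ev g p * ev g q"
proof (induction p rule: poly_mapping_induct_single)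
  case zero
  then show ?case by simp
next
  case (add p v c)
  have "ev g (Poly_Mapping.single v c * q) = ev g (Poly_Mapping.single v c) * ev g q"
  proof (induction q rule: poly_mapping_induct_single)
    case zero
    then show ?case by simp
  next
    case (add q w d)
    have "ev g (Poly_Mapping.single v c * Poly_Mapping.single w d)
        = ev g (Poly_Mapping.single v c) * ev g (Poly_Mapping.single w d)"
      by (simp add: mult_single ev_single plus_free_monoid_def scal_simps(4)
          mult.assoc[of "scal c" "prod_list (map g (letters v))"] scal_left_commute[of "prod_list (map g (letters v))"])
         (simp add: mult.assoc)
    then show ?case using add by (simp add: distrib_left ev_add)
  qed
  then show ?case using add by (simp add: distrib_right ev_add)
qed

lemma ev_const: "ev g (Poly_Mapping.single 0 c) = scal c"
  by (simp add: ev_single zero_free_monoid_def)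

lemma ev_one: "ev g 1 = 1"
  using ev_const[of g 1] by (simp add: scal_simps)

lemma ev_free_gen: "ev g (free_gen x) = g x"
  by (simp add: free_gen_def ev_single scal_simps)

lemma free_algebra_simps:
  "x \<otimes>\<^bsub>free_algebra S\<^esub> y = x * y" "x \<oplus>\<^bsub>free_algebra S\<^esub> y = x + y"
  "\<one>\<^bsub>free_algebra S\<^esub> = 1" "\<zero>\<^bsub>free_algebra S\<^esub> = 0"
  "carrier (free_algebra S) = {p. \<forall>w\<in>Poly_Mapping.keys p. set (letters w) \<subseteq> S}"
  by (simp_all add: free_algebra_def)

lemma free_algebra_closed:
  assumes "p \<in> carrier (free_algebra S)" "q \<in> carrier (free_algebra S)"
  shows "p + q \<in> carrier (free_algebra S)" "p * q \<in> carrier (free_algebra S)"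
    "- p \<in> carrier (free_algebra S)"
  using assms Poly_Mapping.keys_add[of p q] keys_mult[of p q]
  by (fastforce simp: free_algebra_simps plus_free_monoid_def)+

lemma ring_free_algebra: "ring (free_algebra S)"
proof (rule ringI)
  show "abelian_group (free_algebra S)"
  proof (rule abelian_groupI)
    fix x assume x: "x \<in> carrier (free_algebra S)"
    show "\<exists>y\<in>carrier (free_algebra S). y \<oplus>\<^bsub>free_algebra S\<^esub> x = \<zero>\<^bsub>free_algebra S\<^esub>"
      using free_algebra_closed(3)[OF x x] by (intro bexI[of _ "- x"]) (simp_all add: free_algebra_simps(1-4))
  next
    show "\<zero>\<^bsub>free_algebra S\<^esub> \<in> carrier (free_algebra S)"
      by (simp add: free_algebra_simps)
  qed (simp_all only: free_algebra_simps(1-4) free_algebra_closed ac_simps add_0 add_0_right)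
  show "Group.monoid (free_algebra S)"
  proof (rule Group.monoidI)
    show "\<one>\<^bsub>free_algebra S\<^esub> \<in> carrier (free_algebra S)"
      by (simp add: free_algebra_simps zero_free_monoid_def flip: single_one)
  qed (simp_all only: free_algebra_simps(1-4) free_algebra_closed mult.assoc mult_1_left mult_1_right)
qed (simp_all add: free_algebra_simps(1-4) algebra_simps)

text \<open>The kernel of \<open>ev g\<close> inside the free algebra is a two-sided ideal, and
  \<open>env_ideal\<close> is contained in every ideal that contains the relations.\<close>

lemma env_ideal_subset_kernel:
  assumes rel: "\<And>p. p \<in> env_relations \<gg> \<Longrightarrow> p \<in> carrier (free_algebra \<gg>) \<and> ev g p = 0"
  shows "p \<in> env_ideal \<gg> \<Longrightarrow> ev g p = 0"
proof -
  let ?R = "free_algebra \<gg>"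
  let ?K = "{p \<in> carrier ?R. ev g p = 0}"
  interpret R: ring ?R by (rule ring_free_algebra)
  have uminus: "\<ominus>\<^bsub>?R\<^esub> p = - p" if "p \<in> carrier ?R" for p
    using that free_algebra_closed[of p \<gg> p]
    by (intro R.minus_equality) (auto simp: free_algebra_simps(1-4))
  have "ideal ?K ?R"
  proof (rule idealI)
    show "subgroup ?K (add_monoid ?R)"
    proof
      fix x assume x: "x \<in> ?K"
      have "inv\<^bsub>add_monoid ?R\<^esub> x = - x"
        using x uminus[of x] by (simp add: a_inv_def)
      then show "inv\<^bsub>add_monoid ?R\<^esub> x \<in> ?K"
        using x free_algebra_closed[of x \<gg> x] by (auto simp: ev_uminus)
    next
      show "\<one>\<^bsub>add_monoid ?R\<^esub> \<in> ?K"
        by (simp add: free_algebra_simps)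
    qed (auto simp only: mem_Collect_eq partial_object.simps monoid.simps free_algebra_simps(1-4) free_algebra_closed ev_add add_0)
  qed (auto simp only: mem_Collect_eq free_algebra_simps(1-4) free_algebra_closed ev_mult R.ring_axioms mult_zero_left mult_zero_right)
  then show "p \<in> env_ideal \<gg> \<Longrightarrow> ev g p = 0"
    using rel by (force simp: env_ideal_def genideal_def)
qed

text \<open>Ensures that cosets are nonempty, which \<open>good\<close> demands so that the value at
  a class is unique.\<close>

lemma zero_in_env_ideal: "0 \<in> env_ideal \<gg>"
proof -
  have "0 \<in> I" if "ideal I (free_algebra \<gg>)" for I
    using additive_subgroup.zero_closed[OF ideal.axioms(1)[OF that]] by (simp only: free_algebra_simps)
  then show ?thesis by (auto simp: env_ideal_def genideal_def)
qed

text \<open>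
  Classes in the enveloping algebra are cosets, so \<open>good g Z v\<close> says that the homomorphism of \<open>U(\<gg>)\<close>
  induced by \<open>g\<close> takes the value \<open>v\<close> at the class \<open>Z\<close>.
\<close>

definition good :: "('x \<Rightarrow> lin_op) \<Rightarrow> ('x free_monoid \<Rightarrow>\<^sub>0 complex) set \<Rightarrow> lin_op \<Rightarrow> bool" where
  "good g Z v \<longleftrightarrow> Z \<noteq> {} \<and> (\<forall>p\<in>Z. ev g p = v)"

lemma good_unique: "good g Z v \<Longrightarrow> good g Z w \<Longrightarrow> v = w"
  by (auto simp: good_def)

context
  fixes \<gg> :: "complex mat set" and g :: "complex mat \<Rightarrow> lin_op"
  assumes kernel: "\<And>p. p \<in> env_ideal \<gg> \<Longrightarrow> ev g p = 0"
begin

lemma good_env_class: "good g (env_class \<gg> p) (ev g p)"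
  using zero_in_env_ideal[of \<gg>] kernel
  by (auto simp: good_def env_class_def a_r_coset_def' free_algebra_simps ev_add)

lemma good_env_inj: "good g (env_inj \<gg> x) (g x)"
  using good_env_class[of "free_gen x"] by (simp add: env_inj_def ev_free_gen)

lemma good_one: "good g \<one>\<^bsub>env_algebra \<gg>\<^esub> 1"
proof -
  have "\<one>\<^bsub>env_algebra \<gg>\<^esub> = env_class \<gg> 1"
    by (simp add: env_algebra_def FactRing_def Let_def env_class_def free_algebra_simps)
  then show ?thesis using good_env_class[of 1] by (simp add: ev_one)
qed

lemma good_add:
  assumes "good g Z v" "good g W w"
  shows "good g (Z \<oplus>\<^bsub>env_algebra \<gg>\<^esub> W) (v + w)"
  using assms
  by (auto simp: good_def env_algebra_def FactRing_def Let_def set_add_def' free_algebra_simps ev_add)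

text \<open>The product in the quotient is a union of the cosets of products of representatives, and
  each of these cosets has the required value.\<close>

lemma good_mult:
  assumes "good g Z v" "good g W w"
  shows "good g (Z \<otimes>\<^bsub>env_algebra \<gg>\<^esub> W) (v * w)"
proof -
  have "Z \<otimes>\<^bsub>env_algebra \<gg>\<^esub> W = (\<Union>a\<in>Z. \<Union>b\<in>W. env_class \<gg> (a * b))"
    by (simp add: env_algebra_def FactRing_def Let_def rcoset_mult_def env_class_def free_algebra_simps)
  moreover have "good g (env_class \<gg> (a * b)) (v * w)" if "a \<in> Z" "b \<in> W" for a b
    using good_env_class[of "a * b"] assms that by (auto simp: ev_mult good_def)
  ultimately show ?thesis using assms by (fastforce simp: good_def)
qed

lemma good_scale:
  assumes "good g Z v"
  shows "good g (c \<odot>\<^bsub>env_algebra \<gg>\<^esub> Z) (scal c * v)"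
proof -
  have "c \<odot>\<^bsub>env_algebra \<gg>\<^esub> Z = env_class \<gg> (Poly_Mapping.single 0 c) \<otimes>\<^bsub>env_algebra \<gg>\<^esub> Z"
    by (simp add: env_algebra_def Let_def)
  then show ?thesis
    using good_mult[OF good_env_class[of "Poly_Mapping.single 0 c"] assms] by (simp add: ev_const)
qed

end

section \<open>The parabolic decomposition in coordinates\<close>

lemma symp_form_entry:
  assumes "r < 2 * n" "c < 2 * n"
  shows "symp_form n $$ (r, c) = Jc n r c"
proof -
  obtain m where "n = Suc m" using assms by (cases n) auto
  then show ?thesis
    using assms by (auto simp: symp_form_def Jc_def)
qed

text \<open>As J is antisymmetric, the defining equation says that J X is symmetric; congruence by J
  carries this to X J. On indices this is the involution \<open>h\<close>, up to signs.\<close>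

lemma sp_iff_Sm:
  "X \<in> sp n \<longleftrightarrow> X \<in> carrier_mat (2 * n) (2 * n) \<and>
     (\<forall>r<2*n. \<forall>c<2*n. Sm n X r c = Sm n X c r)"
proof (cases "X \<in> carrier_mat (2 * n) (2 * n)")
  case True
  have J: "symp_form n \<in> carrier_mat (2 * n) (2 * n)"
    by (auto simp: symp_form_def)
  have Jneg: "Jc n r c = - Jc n c r" if "r < 2 * n" for r c
    using that by (auto simp: Jc_def)
  have entry: "(transpose_mat X * symp_form n + symp_form n * X) $$ (r, c)
      = (if c < n then - X $$ (c + n, r) else X $$ (c - n, r))
        + (if r < n then X $$ (r + n, c) else - X $$ (r - n, c))"
    if "r < 2 * n" "c < 2 * n" for r c
  proof -
    have "(transpose_mat X * symp_form n + symp_form n * X) $$ (r, c)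
       = (\<Sum>k<2*n. X $$ (k, r) * Jc n k c) + (\<Sum>k<2*n. Jc n r k * X $$ (k, c))"
      using that True J by (simp add: scalar_prod_def symp_form_entry lessThan_atLeast0)
    also have "(\<Sum>k<2*n. Jc n r k * X $$ (k, c)) = (\<Sum>k<2*n. - X $$ (k, c) * Jc n k r)"
      using that by (intro sum.cong refl) (simp add: Jneg[of r])
    finally show ?thesis
      using that by (simp only: sum_Jc) auto
  qed
  have "X \<in> sp n \<longleftrightarrow> (\<forall>r<2*n. \<forall>c<2*n. (transpose_mat X * symp_form n + symp_form n * X) $$ (r, c) = 0)"
    using True J by (auto simp: sp_def mat_eq_iff)
  also have "\<dots> \<longleftrightarrow> (\<forall>r<2*n. \<forall>c<2*n. Sm n X r c = Sm n X c r)"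
  proof (intro iffI allI impI)
    fix r c assume *: "\<forall>r<2*n. \<forall>c<2*n. (transpose_mat X * symp_form n + symp_form n * X) $$ (r, c) = 0"
      and rc: "r < 2*n" "c < 2*n"
    define h where "h k = (if k < n then k + n else k - n)" for k
    have "h r < 2*n" "h c < 2*n" using rc by (auto simp: h_def)
    with *[rule_format, of "h r" "h c"] entry[of "h r" "h c"] rc show "Sm n X r c = Sm n X c r"
      by (auto simp: Sm_def h_def eq_neg_iff_add_eq_0 neg_eq_iff_add_eq_0 add.commute split: if_splits)
  next
    fix r c assume *: "\<forall>r<2*n. \<forall>c<2*n. Sm n X r c = Sm n X c r"
      and rc: "r < 2*n" "c < 2*n"
    define h where "h k = (if k < n then k + n else k - n)" for k
    have "h r < 2*n" "h c < 2*n" using rc by (auto simp: h_def)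
    with *[rule_format, of "h r" "h c"] entry[of r c] rc
    show "(transpose_mat X * symp_form n + symp_form n * X) $$ (r, c) = 0"
      by (auto simp: Sm_def h_def eq_neg_iff_add_eq_0 neg_eq_iff_add_eq_0 add.commute split: if_splits)
  qed
  finally show ?thesis using True by simp
qed (simp add: sp_def)

lemma sp_carrier: "X \<in> sp n \<Longrightarrow> X \<in> carrier_mat (2 * n) (2 * n)"
  by (simp add: sp_def)

lemma sp_Sm: "X \<in> sp n \<Longrightarrow> r < 2*n \<Longrightarrow> c < 2*n \<Longrightarrow> Sm n X r c = Sm n X c r"
  by (simp add: sp_iff_Sm)

lemma sp_blocks:
  assumes "X \<in> sp n" "i < n" "j < n"
  shows "X $$ (n + i, n + j) = - X $$ (j, i)" "X $$ (i, n + j) = X $$ (j, n + i)"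
    "X $$ (n + i, j) = X $$ (n + j, i)"
  using sp_Sm[OF assms(1), of "n + i" j] sp_Sm[OF assms(1), of i j] sp_Sm[OF assms(1), of "n + i" "n + j"] assms
  by (auto simp: Sm_def add.commute)

lemma sp_blocksI:
  assumes "X \<in> carrier_mat (2 * n) (2 * n)"
    and "\<And>i j. i < n \<Longrightarrow> j < n \<Longrightarrow> X $$ (n + i, n + j) = - X $$ (j, i)"
    and "\<And>i j. i < n \<Longrightarrow> j < n \<Longrightarrow> X $$ (i, n + j) = X $$ (j, n + i)"
    and "\<And>i j. i < n \<Longrightarrow> j < n \<Longrightarrow> X $$ (n + i, j) = X $$ (n + j, i)"
  shows "X \<in> sp n"
  unfolding sp_iff_Sm
proof (intro conjI allI impI)
  fix r c assume rc: "r < 2*n" "c < 2*n"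
  have split: "k < n \<or> (\<exists>k'<n. k = k' + n)" if "k < 2*n" for k
    using that by (cases "k < n") (auto intro!: exI[of _ "k - n"])
  have *: "X $$ (i + n, j + n) = - X $$ (j, i)" "X $$ (i, j + n) = X $$ (j, i + n)"
    "X $$ (i + n, j) = X $$ (j + n, i)" if "i < n" "j < n" for i j
    using assms(2-4)[OF that] by (simp_all add: add.commute)
  show "Sm n X r c = Sm n X c r"
    using split[OF rc(1)] split[OF rc(2)] by (auto simp: Sm_def *)
qed (use assms in auto)

lemma sp_add: "X \<in> sp n \<Longrightarrow> Y \<in> sp n \<Longrightarrow> X + Y \<in> sp n"
proof -
  assume X: "X \<in> sp n" and Y: "Y \<in> sp n"
  have "Sm n (X + Y) r c = Sm n X r c + Sm n Y r c" if "r < 2*n" "c < 2*n" for r c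
    using that sp_carrier[OF X] sp_carrier[OF Y] by (auto simp: Sm_def)
  then show ?thesis using X Y by (simp add: sp_iff_Sm)
qed

lemma sp_smult: "X \<in> sp n \<Longrightarrow> a \<cdot>\<^sub>m X \<in> sp n"
proof -
  assume X: "X \<in> sp n"
  have "Sm n (a \<cdot>\<^sub>m X) r c = a * Sm n X r c" if "r < 2*n" "c < 2*n" for r c
    using that sp_carrier[OF X] by (auto simp: Sm_def)
  then show ?thesis using X by (simp add: sp_iff_Sm)
qed

lemma sp_lie_bracket:
  assumes "X \<in> sp n" "Y \<in> sp n"
  shows "lie_bracket X Y \<in> sp n"
proof -
  have X: "X \<in> carrier_mat (2*n) (2*n)" and Y: "Y \<in> carrier_mat (2*n) (2*n)"
    using assms by (auto intro: sp_carrier)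
  have swap: "(\<Sum>k<2*n. X $$ (r, k) * Sm n Y k c) = (\<Sum>k<2*n. Sm n Y c k * X $$ (r, k))" if "c < 2*n" for r c
    using that by (intro sum.cong refl) (simp add: sp_Sm[OF assms(2), of _ c])
  have "Sm n (lie_bracket X Y) r c = Sm n (lie_bracket X Y) c r" if "r < 2*n" "c < 2*n" for r c
    using Sm_lie_bracket[OF _ X Y that] Sm_lie_bracket[OF _ X Y that(2,1)] sp_Sm[OF assms(1)]
      swap[OF that(1), of c] swap[OF that(2), of r] by simp
  then show ?thesis using X Y by (auto simp: sp_iff_Sm lie_bracket_def)
qed

text \<open>The oscillator representation respects the relations of U(sp), so its values can be read
  off from classes. The Lie bracket relation is \<open>rho_com\<close>.\<close>

lemma rho_kernel: "p \<in> env_ideal (sp n) \<Longrightarrow> ev (rho n) p = 0"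
proof (rule env_ideal_subset_kernel[where \<gg> = "sp n"])
  fix q assume q: "q \<in> env_relations (sp n)"
  have F: "free_gen x \<in> carrier (free_algebra (sp n))" if "x \<in> sp n" for x
    using that by (auto simp: free_algebra_simps free_gen_def)
  have C: "Poly_Mapping.single 0 c \<in> carrier (free_algebra (sp n))" for c
    by (auto simp: free_algebra_simps zero_free_monoid_def)
  have M: "x - y \<in> carrier (free_algebra (sp n))"
    if "x \<in> carrier (free_algebra (sp n))" "y \<in> carrier (free_algebra (sp n))" for x y
    using free_algebra_closed(1)[OF that(1) free_algebra_closed(3)[OF that(2) that(2)]] by simp
  have com: "rho n x * rho n y - rho n y * rho n x = rho n (lie_bracket x y)" if "x \<in> sp n" "y \<in> sp n" for x y
    using rho_com[OF sp_Sm[OF that(1)] sp_carrier[OF that(1)] sp_carrier[OF that(2)]] by (simp add: com_def)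
  from q show "q \<in> carrier (free_algebra (sp n)) \<and> ev (rho n) q = 0"
    unfolding env_relations_def
    by (auto intro!: M F C free_algebra_closed sp_add sp_smult sp_lie_bracket
        simp: ev_diff ev_mult ev_free_gen ev_const rho_add rho_smult sp_carrier com)
qed

text \<open>The coweight dual to \<alpha>_n: the simple roots with index below n vanish on it, and
  \<alpha>_n, being twice the last coordinate, takes the value 1. It is identified with
  \<open>z_elt n\<close> in \<open>z_elt_eq\<close>.\<close>

definition z0 :: "nat \<Rightarrow> complex mat" where
  "z0 n = mat (2*n) (2*n) (\<lambda>(r, c). if r = c then (if r < n then 1/2 else -1/2) else 0)"

lemma z0_sp: "z0 n \<in> sp n"
  by (rule sp_blocksI) (auto simp: z0_def)

lemma z0_cartan: "z0 n \<in> cartan n"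
  using z0_sp by (auto simp: cartan_def diagonal_mat_def z0_def)

lemma diagonal_lie_bracket:
  assumes "diagonal_mat H" "H \<in> carrier_mat N N" "X \<in> carrier_mat N N" "r < N" "c < N"
  shows "lie_bracket H X $$ (r, c) = (H $$ (r, r) - H $$ (c, c)) * X $$ (r, c)"
proof -
  have "(\<Sum>k = 0..<N. H $$ (r, k) * X $$ (k, c)) = (\<Sum>k = 0..<N. if k = r then H $$ (r, r) * X $$ (r, c) else 0)"
    using assms by (intro sum.cong) (auto simp: diagonal_mat_def)
  moreover have "(\<Sum>k = 0..<N. X $$ (r, k) * H $$ (k, c)) = (\<Sum>k = 0..<N. if k = c then H $$ (c, c) * X $$ (r, c) else 0)"
    using assms by (intro sum.cong) (auto simp: diagonal_mat_def)
  ultimately show ?thesis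
    using assms by (simp add: lie_bracket_def scalar_prod_def algebra_simps)
qed

lemma root_comb_z0:
  assumes "n \<ge> 1"
  shows "root_comb n c (z0 n) = of_int (c n)"
proof -
  have "simple_root n i (z0 n) = (if i = n then 1 else 0)" if "i \<in> {1..n}" for i
    using that by (auto simp: simple_root_def eps_def z0_def)
  then have "root_comb n c (z0 n) = (\<Sum>i = 1..n. if i = n then of_int (c n) else 0)"
    unfolding root_comb_def by (intro sum.cong) auto
  then show ?thesis using assms by simp
qed

text \<open>The eigenvalue of the bracket with \<open>z0 n\<close> on the matrix unit at position
  (r, c).\<close>

definition wt :: "nat \<Rightarrow> nat \<Rightarrow> nat \<Rightarrow> int" where
  "wt n r c = (if r < n \<and> n \<le> c then 1 else if n \<le> r \<and> c < n then -1 else 0)"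

text \<open>An eigenspace of the bracket with \<open>z0 n\<close>, described by supports. It serves
  as an upper bound for the spans of root spaces \<open>levi\<close>, \<open>rad_plus\<close> and
  \<open>rad_minus\<close>; from below only the elementary matrices in them are needed.\<close>

definition graded_part :: "nat \<Rightarrow> int \<Rightarrow> complex mat set" where
  "graded_part n k = {X \<in> sp n. \<forall>r<2*n. \<forall>c<2*n. X $$ (r, c) \<noteq> 0 \<longrightarrow> wt n r c = k}"

lemma z0_lie_bracket:
  assumes "X \<in> carrier_mat (2*n) (2*n)" "r < 2*n" "c < 2*n"
  shows "lie_bracket (z0 n) X $$ (r, c) = of_int (wt n r c) * X $$ (r, c)"
  using diagonal_lie_bracket[of "z0 n" "2*n" X r c] z0_cartan[of n] assms sp_carrier[OF z0_sp[of n]]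
  by (auto simp: cartan_def z0_def wt_def)

lemma root_space_graded:
  assumes "n \<ge> 1" "X \<in> root_space n (root_comb n c)"
  shows "X \<in> graded_part n (c n)"
  unfolding graded_part_def
proof safe
  show X: "X \<in> sp n" using assms by (simp add: root_space_def)
  fix r d assume rd: "r < 2*n" "d < 2*n" "X $$ (r, d) \<noteq> 0"
  have "lie_bracket (z0 n) X = of_int (c n) \<cdot>\<^sub>m X"
    using assms z0_cartan[of n] root_comb_z0[OF assms(1), of c] by (auto simp: root_space_def)
  then have "(of_int (wt n r d) :: complex) * X $$ (r, d) = of_int (c n) * X $$ (r, d)"
    using z0_lie_bracket[OF sp_carrier[OF X] rd(1,2)] rd sp_carrier[OF X] by simp
  then show "wt n r d = c n" using rd by simp
qed

lemma mat_span_graded: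
  assumes "S \<subseteq> graded_part n k" "X \<in> mat_span (2*n) S"
  shows "X \<in> graded_part n k"
  using assms(2)
proof (induction rule: mat_span.induct)
  case zero
  have "0\<^sub>m (2*n) (2*n) \<in> sp n" by (rule sp_blocksI) auto
  then show ?case by (auto simp: graded_part_def)
next
  case (incl X)
  then show ?case using assms by auto
next
  case (add X Y)
  then show ?case
    unfolding graded_part_def using sp_add[of X n Y] sp_carrier[of X n] sp_carrier[of Y n]
    by (auto; metis (no_types, lifting) add.left_neutral)
next
  case (scale X a)
  then show ?case
    unfolding graded_part_def using sp_smult[of X n a] sp_carrier[of X n] by auto
qed

lemma rad_graded:
  assumes "n \<ge> 1"
  shows "X \<in> rad_plus n \<Longrightarrow> X \<in> graded_part n 1" "X \<in> rad_minus n \<Longrightarrow> X \<in> graded_part n (-1)"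
  unfolding rad_plus_def rad_minus_def
  using root_space_graded[OF assms]
  by (auto elim!: mat_span_graded[rotated]; metis)+

lemma cartan_graded: "H \<in> cartan n \<Longrightarrow> H \<in> graded_part n 0"
  by (auto simp: cartan_def graded_part_def diagonal_mat_def wt_def dest: sp_carrier)

lemma levi_graded:
  assumes "n \<ge> 1"
  shows "X \<in> levi n \<Longrightarrow> X \<in> graded_part n 0"
  unfolding levi_def
  using root_space_graded[OF assms] cartan_graded
  by (auto elim!: mat_span_graded[rotated]; metis)

text \<open>\<open>mA\<close>, \<open>mB\<close>, \<open>mC\<close> are root vectors for the
  differences, the sums and the negative sums of two coordinates, and \<open>mA n i i\<close> lies
  in the Cartan subalgebra. For i = j the nonzero entry of \<open>mB\<close> and \<open>mC\<close>
  is 2, which makes \<open>rho_mB\<close> and \<open>rho_mC\<close> uniform in i and j.\<close>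

definition mA :: "nat \<Rightarrow> nat \<Rightarrow> nat \<Rightarrow> complex mat" where
  "mA n i j = mat (2*n) (2*n) (\<lambda>(r, c). (if r = i \<and> c = j then 1 else 0) - (if r = n + j \<and> c = n + i then 1 else 0))"

definition mB :: "nat \<Rightarrow> nat \<Rightarrow> nat \<Rightarrow> complex mat" where
  "mB n i j = mat (2*n) (2*n) (\<lambda>(r, c). (if r = i \<and> c = n + j then 1 else 0) + (if r = j \<and> c = n + i then 1 else 0))"

definition mC :: "nat \<Rightarrow> nat \<Rightarrow> nat \<Rightarrow> complex mat" where
  "mC n i j = mat (2*n) (2*n) (\<lambda>(r, c). (if r = n + i \<and> c = j then 1 else 0) + (if r = n + j \<and> c = i then 1 else 0))"

lemma elementary_sp:
  assumes "i < n" "j < n"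
  shows "mA n i j \<in> sp n" "mB n i j \<in> sp n" "mC n i j \<in> sp n"
proof -
  show "mA n i j \<in> sp n"
    using assms by (intro sp_blocksI) (simp_all add: mA_def conj_commute)
  show "mB n i j \<in> sp n"
    using assms by (intro sp_blocksI) (simp_all add: mB_def conj_commute add.commute)
  show "mC n i j \<in> sp n"
    using assms by (intro sp_blocksI) (simp_all add: mC_def conj_commute add.commute)
qed

text \<open>Simple root coordinates of the difference between the coordinate with matrix index i and
  the last one. Matrix indices start at 0 and simple roots at 1, so it is the sum of the \<alpha>_k
  with i < k < n.\<close>

definition eps_coords :: "nat \<Rightarrow> nat \<Rightarrow> nat \<Rightarrow> int" where
  "eps_coords n i k = (if i < k \<and> k < n then 1 else 0)"

lemma root_comb_eps_coords:
  assumes "i < n"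
  shows "root_comb n (eps_coords n i) H = H $$ (i, i) - H $$ (n - 1, n - 1)"
proof -
  have "root_comb n (eps_coords n i) H = (\<Sum>k\<in>{Suc i..<n}. H $$ (k - 1, k - 1) - H $$ (k, k))"
    unfolding root_comb_def
    by (intro sum.mono_neutral_cong_right) (auto simp: eps_coords_def simple_root_def eps_def)
  also have "\<dots> = (\<Sum>k\<in>{i..<n - 1}. H $$ (k, k) - H $$ (Suc k, Suc k))"
    using assms by (intro sum.reindex_bij_witness[of _ Suc "\<lambda>k. k - 1"]) auto
  also have "\<dots> = H $$ (i, i) - H $$ (n - 1, n - 1)"
    using sum_Suc_diff'[of i "n - 1" "\<lambda>k. - H $$ (k, k)"] assms by simp
  finally show ?thesis .
qed

lemma root_comb_last:
  assumes "n \<ge> 1"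
  shows "root_comb n (\<lambda>k. if k = n then 1 else 0) H = 2 * H $$ (n - 1, n - 1)"
proof -
  have "root_comb n (\<lambda>k. if k = n then 1 else 0) H = (\<Sum>k = 1..n. if k = n then simple_root n n H else 0)"
    unfolding root_comb_def by (intro sum.cong) auto
  then show ?thesis using assms by (simp add: simple_root_def eps_def)
qed

lemma root_comb_add: "root_comb n (\<lambda>k. c k + d k) H = root_comb n c H + root_comb n d H"
  by (simp add: root_comb_def algebra_simps sum.distrib)

lemma root_comb_minus: "root_comb n (\<lambda>k. - c k) H = - root_comb n c H"
  by (simp add: root_comb_def sum_negf)

lemma root_spaceI:
  assumes X: "X \<in> sp n"
    and "\<And>H r c. H \<in> cartan n \<Longrightarrow> r < 2*n \<Longrightarrow> c < 2*n \<Longrightarrow> X $$ (r, c) \<noteq> 0 \<Longrightarrow> H $$ (r, r) - H $$ (c, c) = \<alpha> H"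
  shows "X \<in> root_space n \<alpha>"
  unfolding root_space_def
proof safe
  fix H assume H: "H \<in> cartan n"
  show "lie_bracket H X = \<alpha> H \<cdot>\<^sub>m X"
  proof (rule eq_matI)
    fix r c assume rc: "r < dim_row (\<alpha> H \<cdot>\<^sub>m X)" "c < dim_col (\<alpha> H \<cdot>\<^sub>m X)"
    show "lie_bracket H X $$ (r, c) = (\<alpha> H \<cdot>\<^sub>m X) $$ (r, c)"
      using diagonal_lie_bracket[of H "2*n" X r c] H sp_carrier[of H n] sp_carrier[OF X] assms(2)[OF H, of r c] rc
      by (cases "X $$ (r, c) = 0") (auto simp: cartan_def)
  qed (use H sp_carrier[of H n] sp_carrier[OF X] in \<open>auto simp: cartan_def lie_bracket_def\<close>)
qed (rule X)

lemma cartan_lower: "H \<in> cartan n \<Longrightarrow> i < n \<Longrightarrow> H $$ (n + i, n + i) = - H $$ (i, i)"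
  by (simp add: cartan_def sp_blocks)

lemma mA_cartan: "i < n \<Longrightarrow> mA n i i \<in> cartan n"
  using elementary_sp(1)[of i n i] by (auto simp: cartan_def diagonal_mat_def mA_def)

lemma is_rootI:
  assumes "X \<in> root_space n (root_comb n c)" "r < 2*n" "d < 2*n" "X $$ (r, d) \<noteq> 0"
    and "i < n" "root_comb n c (mA n i i) \<noteq> 0"
  shows "is_root n c"
  using assms mA_cartan[of i n] by (auto simp: is_root_def intro!: bexI[of _ "mA n i i"])

text \<open>The roots are assembled from differences with the last coordinate; the sum of two
  coordinates needs the long root \<alpha>_n once in addition. The coefficient of \<alpha>_n is
  therefore visible, as \<open>eps_coords\<close> vanishes at n.\<close>

lemma elementary_parts:
  assumes ij: "i < n" "j < n"
  shows "mA n i j \<in> levi n" "mB n i j \<in> rad_plus n" "mC n i j \<in> rad_minus n"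
proof -
  let ?d = "\<lambda>k. if k = n then 1 else 0 :: int"
  let ?c = "\<lambda>k. eps_coords n i k + (- eps_coords n j k)"
  let ?p = "\<lambda>k. eps_coords n i k + (eps_coords n j k + ?d k)"
  let ?m = "\<lambda>k. - (eps_coords n i k + (eps_coords n j k + ?d k))"
  have c: "root_comb n ?c H = H $$ (i, i) - H $$ (j, j)" for H
    unfolding root_comb_add root_comb_minus using ij by (simp add: root_comb_eps_coords)
  have p: "root_comb n ?p H = H $$ (i, i) + H $$ (j, j)" for H
    unfolding root_comb_add using ij by (simp add: root_comb_eps_coords root_comb_last)
  have m: "root_comb n ?m H = - H $$ (i, i) - H $$ (j, j)" for H
    unfolding root_comb_minus p by simp
  show "mA n i j \<in> levi n"
  proof (cases "i = j")
    case True
    then show ?thesis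
      using mA_cartan[OF ij(1)] by (auto simp: levi_def intro: mat_span.incl)
  next
    case False
    have "mA n i j \<in> root_space n (root_comb n ?c)"
      by (rule root_spaceI[OF elementary_sp(1)[OF ij]], unfold c)
         (use ij in \<open>auto simp: mA_def cartan_lower split: if_splits\<close>)
    moreover from this have "is_root n ?c"
      by (rule is_rootI[of _ _ _ i j i], unfold c) (use ij False in \<open>auto simp: mA_def\<close>)
    moreover have "?c n = 0" by (simp add: eps_coords_def)
    ultimately show ?thesis unfolding levi_def
      by (intro mat_span.incl UnI2) blast
  qed
  have "mB n i j \<in> root_space n (root_comb n ?p)"
    by (rule root_spaceI[OF elementary_sp(2)[OF ij]], unfold p)
       (use ij in \<open>auto simp: mB_def cartan_lower split: if_splits\<close>)
  moreover from this have "is_root n ?p"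
    by (rule is_rootI[of _ _ _ i "n + j" i], unfold p) (use ij in \<open>auto simp: mA_def mB_def\<close>)
  moreover have "?p n = 1" by (simp add: eps_coords_def)
  ultimately show "mB n i j \<in> rad_plus n" unfolding rad_plus_def
    by (intro mat_span.incl) blast
  have "mC n i j \<in> root_space n (root_comb n ?m)"
    by (rule root_spaceI[OF elementary_sp(3)[OF ij]], unfold m)
       (use ij in \<open>auto simp: mC_def cartan_lower split: if_splits\<close>)
  moreover from this have "is_root n ?m"
    by (rule is_rootI[of _ _ _ "n + i" j i], unfold m) (use ij in \<open>auto simp: mA_def mC_def\<close>)
  moreover have "?m n = -1" by (simp add: eps_coords_def)
  ultimately show "mC n i j \<in> rad_minus n" unfolding rad_minus_def
    by (intro mat_span.incl) blast
qed

lemma graded_bracket_z0: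
  assumes "X \<in> graded_part n k"
  shows "lie_bracket (z0 n) X = of_int k \<cdot>\<^sub>m X"
proof (rule eq_matI)
  have X: "X \<in> carrier_mat (2*n) (2*n)" using assms sp_carrier by (auto simp: graded_part_def)
  fix r c assume rc: "r < dim_row (of_int k \<cdot>\<^sub>m X)" "c < dim_col (of_int k \<cdot>\<^sub>m X)"
  show "lie_bracket (z0 n) X $$ (r, c) = (of_int k \<cdot>\<^sub>m X) $$ (r, c)"
    using z0_lie_bracket[OF X, of r c] rc X assms by (cases "X $$ (r, c) = 0") (auto simp: graded_part_def)
qed (use assms sp_carrier[OF z0_sp[of n]] sp_carrier[of X n] in \<open>auto simp: graded_part_def lie_bracket_def\<close>)

text \<open>For uniqueness, a candidate z has degree 0 and so is block diagonal, with lower block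
  the negative transpose of the upper one. The equation [z, x] = x for x = \<open>mB n i i\<close>,
  read off in column n + i, determines column i of the upper block.\<close>

lemma z_elt_eq:
  assumes n: "n \<ge> 1"
  shows "z_elt n = z0 n"
  unfolding z_elt_def
proof (rule the_equality)
  have "z0 n \<in> levi n"
    using z0_cartan by (auto simp: levi_def intro: mat_span.incl)
  moreover have "lie_bracket (z0 n) X = 0\<^sub>m (2*n) (2*n)" if "X \<in> levi n" for X
    using graded_bracket_z0[OF levi_graded[OF n that]] sp_carrier[of X n] levi_graded[OF n that]
    by (auto simp: graded_part_def)
  moreover have "lie_bracket (z0 n) x = x" if "x \<in> rad_plus n" for x
    using graded_bracket_z0[OF rad_graded(1)[OF n that]] by (auto simp: mat_eq_iff)
  moreover have "lie_bracket (z0 n) y = - y" if "y \<in> rad_minus n" for y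
    using graded_bracket_z0[OF rad_graded(2)[OF n that]] by (auto simp: mat_eq_iff)
  ultimately show "z0 n \<in> levi_center n \<and> (\<forall>x\<in>rad_plus n. lie_bracket (z0 n) x = x) \<and>
      (\<forall>y\<in>rad_minus n. lie_bracket (z0 n) y = - y)"
    by (auto simp: levi_center_def)
next
  fix z assume z: "z \<in> levi_center n \<and> (\<forall>x\<in>rad_plus n. lie_bracket z x = x) \<and> (\<forall>y\<in>rad_minus n. lie_bracket z y = - y)"
  then have zg: "z \<in> graded_part n 0" using levi_graded[OF n] by (auto simp: levi_center_def)
  then have zsp: "z \<in> sp n" and zc: "z \<in> carrier_mat (2*n) (2*n)" by (auto simp: graded_part_def intro: sp_carrier)
  have off: "z $$ (r, c) = 0" if "r < 2*n" "c < 2*n" "wt n r c \<noteq> 0" for r c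
    using zg that by (auto simp: graded_part_def)
  have diag: "z $$ (k, i) = (if k = i then 1/2 else 0)" if k: "k < n" and i: "i < n" for k i
  proof -
    have "lie_bracket z (mB n i i) $$ (k, n + i) = mB n i i $$ (k, n + i)"
      using z elementary_parts(2)[OF i i] by simp
    moreover have "lie_bracket z (mB n i i) $$ (k, n + i)
       = (\<Sum>m<2*n. z $$ (k, m) * mB n i i $$ (m, n + i)) - (\<Sum>m<2*n. mB n i i $$ (k, m) * z $$ (m, n + i))"
      using zc k i by (simp add: lie_bracket_def scalar_prod_def lessThan_atLeast0 mB_def)
    moreover have "(\<Sum>m<2*n. z $$ (k, m) * mB n i i $$ (m, n + i)) = (\<Sum>m<2*n. if m = i then 2 * z $$ (k, i) else 0)"
      using i k by (intro sum.cong) (auto simp: mB_def)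
    moreover have "(\<Sum>m<2*n. mB n i i $$ (k, m) * z $$ (m, n + i)) = (\<Sum>m<2*n. if m = n + i then (if k = i then 2 * z $$ (n + i, n + i) else 0) else 0)"
      using i k by (intro sum.cong) (auto simp: mB_def)
    ultimately show ?thesis
      using i k sp_blocks(1)[OF zsp i i] by (auto simp: mB_def split: if_splits) (metis mult.commute)
  qed
  show "z = z0 n"
  proof (rule eq_matI)
    fix r c assume "r < dim_row (z0 n)" "c < dim_col (z0 n)"
    then have rc: "r < 2*n" "c < 2*n" by (auto simp: z0_def)
    show "z $$ (r, c) = z0 n $$ (r, c)"
    proof (cases "wt n r c = 0")
      case False
      have "wt n c c = 0" by (simp add: wt_def)
      with False have "r \<noteq> c" by auto
      then have "z0 n $$ (r, c) = 0" using rc by (simp add: z0_def)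
      then show ?thesis using off[OF rc False] by simp
    next
      case wt: True
      show ?thesis
      proof (cases "r < n")
        case True
        then have "c < n" using wt by (auto simp: wt_def split: if_splits)
        then show ?thesis using diag[OF True] True by (simp add: z0_def)
      next
        case False
        then have "n \<le> r" "n \<le> c" using wt by (simp_all add: wt_def split: if_splits)
        then obtain r' c' where eq: "r = n + r'" "c = n + c'" by (meson le_Suc_ex)
        have lt: "r' < n" "c' < n" using rc unfolding eq by simp_all
        show ?thesis unfolding eq sp_blocks(1)[OF zsp lt] diag[OF lt(2,1)]
          using lt by (simp add: z0_def)
      qed
    qed
  qed (use zc in \<open>auto simp: z0_def\<close>)
qed

section \<open>Polynomial and regular functions\<close>

text \<open>The degree bound is uniform over all lines. \<open>torus_interpolation\<close> depends
  on this, because a single interpolation formula has to serve all lines in a coordinate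
  direction.\<close>

lemma polynomial_fun_line:
  assumes "a \<in> polynomial_fun N"
  shows "\<exists>D. \<forall>q\<in>carrier_vec N. \<forall>v\<in>carrier_vec N. \<exists>p. degree p \<le> D \<and> (\<forall>z. a (q + z \<cdot>\<^sub>v v) = poly p z)"
  using assms
proof induction
  case (const c)
  show ?case by (intro exI[of _ "0::nat"] ballI exI[of _ "[:c:]"]) auto
next
  case (coord i)
  show ?case
  proof (intro exI[of _ "1::nat"] ballI)
    fix q v :: "complex vec" assume "q \<in> carrier_vec N" "v \<in> carrier_vec N"
    then show "\<exists>p. degree p \<le> 1 \<and> (\<forall>z. (q + z \<cdot>\<^sub>v v) $ i = poly p z)"
      using coord by (intro exI[of _ "[:q $ i, v $ i:]"]) auto
  qed
next
  case (add f g)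
  then obtain D E where
    "\<forall>q\<in>carrier_vec N. \<forall>v\<in>carrier_vec N. \<exists>p. degree p \<le> D \<and> (\<forall>z. f (q + z \<cdot>\<^sub>v v) = poly p z)"
    "\<forall>q\<in>carrier_vec N. \<forall>v\<in>carrier_vec N. \<exists>p. degree p \<le> E \<and> (\<forall>z. g (q + z \<cdot>\<^sub>v v) = poly p z)" by blast
  then show ?case
    by (intro exI[of _ "max D E"] ballI) (metis degree_add_le_max max.mono order.trans poly_add)
next
  case (mult f g)
  then obtain D E where
    "\<forall>q\<in>carrier_vec N. \<forall>v\<in>carrier_vec N. \<exists>p. degree p \<le> D \<and> (\<forall>z. f (q + z \<cdot>\<^sub>v v) = poly p z)"
    "\<forall>q\<in>carrier_vec N. \<forall>v\<in>carrier_vec N. \<exists>p. degree p \<le> E \<and> (\<forall>z. g (q + z \<cdot>\<^sub>v v) = poly p z)" by blast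
  then show ?case
    by (intro exI[of _ "D + E"] ballI) (metis degree_mult_le add_mono order.trans poly_mult)
qed

text \<open>Irreducibility of affine space: on the line through p and r both functions become
  nonzero polynomials in one variable, and their product has only finitely many roots.\<close>

lemma polynomial_fun_common_nonzero:
  assumes f: "f \<in> polynomial_fun N" and g: "g \<in> polynomial_fun N"
    and p: "p \<in> carrier_vec N" "f p \<noteq> 0" and r: "r \<in> carrier_vec N" "g r \<noteq> 0"
  obtains q where "q \<in> carrier_vec N" "f q \<noteq> 0" "g q \<noteq> 0"
proof -
  have v: "r - p \<in> carrier_vec N" using p r by simp
  obtain F G where F: "\<And>z. f (p + z \<cdot>\<^sub>v (r - p)) = poly F z" and G: "\<And>z. g (p + z \<cdot>\<^sub>v (r - p)) = poly G z"
    using polynomial_fun_line[OF f] polynomial_fun_line[OF g] p(1) v by blast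
  have "p + 0 \<cdot>\<^sub>v (r - p) = p" "p + 1 \<cdot>\<^sub>v (r - p) = r"
    using p r by (auto intro!: eq_vecI)
  then have "poly F 0 \<noteq> 0" "poly G 1 \<noteq> 0" using F[of 0] G[of 1] p r by auto
  then have "F * G \<noteq> 0" by auto
  then have "finite {z. poly (F * G) z = 0}" by (rule poly_roots_finite)
  then obtain z where "poly (F * G) z \<noteq> 0"
    using infinite_UNIV_char_0 by (metis (mono_tags, lifting) UNIV_I finite_subset mem_Collect_eq subsetI)
  then show thesis using that[of "p + z \<cdot>\<^sub>v (r - p)"] F G p v by auto
qed

lemma polynomial_fun_uminus: "f \<in> polynomial_fun N \<Longrightarrow> (\<lambda>q. - f q) \<in> polynomial_fun N"
  using polynomial_fun.mult[OF polynomial_fun.const[of "-1"], of f N] by simp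

section \<open>Principal open sets, and regular functions as local fractions\<close>

lemma zariski_open_iff:
  "zariski_open N W \<longleftrightarrow> W \<subseteq> carrier_vec N \<and>
     (\<forall>p\<in>W. \<exists>g\<in>polynomial_fun N. g p \<noteq> 0 \<and> (\<forall>q\<in>carrier_vec N. g q \<noteq> 0 \<longrightarrow> q \<in> W))"
proof
  assume R: "W \<subseteq> carrier_vec N \<and>
     (\<forall>p\<in>W. \<exists>g\<in>polynomial_fun N. g p \<noteq> 0 \<and> (\<forall>q\<in>carrier_vec N. g q \<noteq> 0 \<longrightarrow> q \<in> W))"
  show "zariski_open N W"
    unfolding zariski_open_def
    by (rule exI[of _ "{g \<in> polynomial_fun N. \<forall>q\<in>carrier_vec N. g q \<noteq> 0 \<longrightarrow> q \<in> W}"]) (use R in blast)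
qed (unfold zariski_open_def, blast)

lemma zariski_open_Int:
  assumes "zariski_open N V" "zariski_open N W"
  shows "zariski_open N (V \<inter> W)"
  unfolding zariski_open_iff
proof (intro conjI ballI)
  show "V \<inter> W \<subseteq> carrier_vec N" using assms by (auto simp: zariski_open_iff)
  fix p assume "p \<in> V \<inter> W"
  then obtain g h where "g \<in> polynomial_fun N" "g p \<noteq> 0" "\<forall>q\<in>carrier_vec N. g q \<noteq> 0 \<longrightarrow> q \<in> V"
    "h \<in> polynomial_fun N" "h p \<noteq> 0" "\<forall>q\<in>carrier_vec N. h q \<noteq> 0 \<longrightarrow> q \<in> W"
    using assms unfolding zariski_open_iff by (metis IntD1 IntD2)
  then show "\<exists>g\<in>polynomial_fun N. g p \<noteq> 0 \<and> (\<forall>q\<in>carrier_vec N. g q \<noteq> 0 \<longrightarrow> q \<in> V \<inter> W)"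
    by (intro bexI[of _ "\<lambda>q. g q * h q"] polynomial_fun.mult) auto
qed

lemma zariski_open_Int_nonempty:
  assumes "zariski_open N V" "zariski_open N W" "V \<noteq> {}" "W \<noteq> {}"
  shows "V \<inter> W \<noteq> {}"
proof -
  obtain p r where pr: "p \<in> V" "r \<in> W" using assms by auto
  then obtain g h where g: "g \<in> polynomial_fun N" "g p \<noteq> 0" "\<forall>q\<in>carrier_vec N. g q \<noteq> 0 \<longrightarrow> q \<in> V"
    and h: "h \<in> polynomial_fun N" "h r \<noteq> 0" "\<forall>q\<in>carrier_vec N. h q \<noteq> 0 \<longrightarrow> q \<in> W"
    using assms unfolding zariski_open_iff by metis
  have "p \<in> carrier_vec N" "r \<in> carrier_vec N" using pr assms by (auto simp: zariski_open_iff)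
  from polynomial_fun_common_nonzero[OF g(1) h(1) this(1) g(2) this(2) h(2)] g h show ?thesis by blast
qed

lemma regular_on_iff:
  assumes W: "W \<subseteq> carrier_vec N"
  shows "regular_on N W f \<longleftrightarrow>
    (\<forall>p\<in>W. \<exists>g\<in>polynomial_fun N. \<exists>a\<in>polynomial_fun N. \<exists>b\<in>polynomial_fun N.
       g p \<noteq> 0 \<and> (\<forall>q\<in>carrier_vec N. g q \<noteq> 0 \<longrightarrow> q \<in> W \<and> b q \<noteq> 0 \<and> f q = a q / b q))" (is "_ \<longleftrightarrow> ?R")
proof
  assume L: "regular_on N W f"
  show ?R
  proof
    fix p assume "p \<in> W"
    then obtain V a b where "zariski_open N V" "p \<in> V" "V \<subseteq> W" "a \<in> polynomial_fun N" "b \<in> polynomial_fun N"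
      "\<forall>q\<in>V. b q \<noteq> 0 \<and> f q = a q / b q"
      using L unfolding regular_on_def by metis
    moreover from this obtain g where "g \<in> polynomial_fun N" "g p \<noteq> 0" "\<forall>q\<in>carrier_vec N. g q \<noteq> 0 \<longrightarrow> q \<in> V"
      unfolding zariski_open_iff by metis
    ultimately show "\<exists>g\<in>polynomial_fun N. \<exists>a\<in>polynomial_fun N. \<exists>b\<in>polynomial_fun N.
       g p \<noteq> 0 \<and> (\<forall>q\<in>carrier_vec N. g q \<noteq> 0 \<longrightarrow> q \<in> W \<and> b q \<noteq> 0 \<and> f q = a q / b q)" by blast
  qed
next
  assume R: ?R
  show "regular_on N W f"
    unfolding regular_on_def
  proof
    fix p assume p: "p \<in> W"
    with R obtain g a b where *: "g \<in> polynomial_fun N" "a \<in> polynomial_fun N" "b \<in> polynomial_fun N"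
       "g p \<noteq> 0" "\<forall>q\<in>carrier_vec N. g q \<noteq> 0 \<longrightarrow> q \<in> W \<and> b q \<noteq> 0 \<and> f q = a q / b q" by metis
    show "\<exists>V. zariski_open N V \<and> p \<in> V \<and> V \<subseteq> W \<and>
        (\<exists>a\<in>polynomial_fun N. \<exists>b\<in>polynomial_fun N. \<forall>q\<in>V. b q \<noteq> 0 \<and> f q = a q / b q)"
      using * p W by (intro exI[of _ "{q \<in> carrier_vec N. g q \<noteq> 0}"]) (auto simp: zariski_open_iff)
  qed
qed

text \<open>The neighbourhood is normalized to a principal open set, the nonvanishing locus of g, so
  that intersecting neighbourhoods means multiplying polynomials.\<close>

definition is_fraction :: "nat \<Rightarrow> complex vec set \<Rightarrow> (complex vec \<Rightarrow> complex) \<Rightarrow>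
    (complex vec \<Rightarrow> complex) \<Rightarrow> (complex vec \<Rightarrow> complex) \<Rightarrow> (complex vec \<Rightarrow> complex) \<Rightarrow> bool" where
  "is_fraction N W f g a b \<longleftrightarrow> g \<in> polynomial_fun N \<and> a \<in> polynomial_fun N \<and> b \<in> polynomial_fun N \<and>
     (\<forall>q\<in>carrier_vec N. g q \<noteq> 0 \<longrightarrow> q \<in> W \<and> b q \<noteq> 0 \<and> f q = a q / b q)"

lemma is_fractionD:
  assumes "is_fraction N W f g a b"
  shows "g \<in> polynomial_fun N" "a \<in> polynomial_fun N" "b \<in> polynomial_fun N"
    "\<And>q. q \<in> carrier_vec N \<Longrightarrow> g q \<noteq> 0 \<Longrightarrow> q \<in> W"
    "\<And>q. q \<in> carrier_vec N \<Longrightarrow> g q \<noteq> 0 \<Longrightarrow> b q \<noteq> 0"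
    "\<And>q. q \<in> carrier_vec N \<Longrightarrow> g q \<noteq> 0 \<Longrightarrow> f q = a q / b q"
  using assms by (auto simp: is_fraction_def)

lemma regular_on_fraction:
  assumes "regular_on N W f" "W \<subseteq> carrier_vec N" "p \<in> W"
  shows "\<exists>g a b. g p \<noteq> 0 \<and> is_fraction N W f g a b"
  using assms(1)[unfolded regular_on_iff[OF assms(2)], THEN bspec, OF assms(3)]
  unfolding is_fraction_def Bex_def by blast

lemma regular_onI:
  assumes "W \<subseteq> carrier_vec N"
    and "\<And>p. p \<in> W \<Longrightarrow> \<exists>g\<in>polynomial_fun N. \<exists>a\<in>polynomial_fun N. \<exists>b\<in>polynomial_fun N.
       g p \<noteq> 0 \<and> (\<forall>q\<in>carrier_vec N. g q \<noteq> 0 \<longrightarrow> q \<in> W \<and> b q \<noteq> 0 \<and> f q = a q / b q)"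
  shows "regular_on N W f"
  using assms by (simp add: regular_on_iff)

lemma regular_on_local:
  assumes "\<And>p. p \<in> W \<Longrightarrow> \<exists>V \<subseteq> W. p \<in> V \<and> regular_on N V f"
  shows "regular_on N W f"
  unfolding regular_on_def
proof
  fix p assume "p \<in> W"
  then obtain V where V: "V \<subseteq> W" "p \<in> V" "regular_on N V f" using assms by blast
  then obtain V' where "zariski_open N V'" "p \<in> V'" "V' \<subseteq> V"
    "\<exists>a\<in>polynomial_fun N. \<exists>b\<in>polynomial_fun N. \<forall>q\<in>V'. b q \<noteq> 0 \<and> f q = a q / b q"
    using V(3)[unfolded regular_on_def, THEN bspec, OF V(2)] by (elim exE conjE)
  then show "\<exists>V. zariski_open N V \<and> p \<in> V \<and> V \<subseteq> W \<and>
        (\<exists>a\<in>polynomial_fun N. \<exists>b\<in>polynomial_fun N. \<forall>q\<in>V. b q \<noteq> 0 \<and> f q = a q / b q)"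
    using V by (intro exI[of _ V']) blast
qed

lemma regular_on_poly:
  assumes "zariski_open N W" "f \<in> polynomial_fun N"
  shows "regular_on N W f"
  unfolding regular_on_def
proof (intro ballI exI[of _ W] conjI)
  show "\<exists>a\<in>polynomial_fun N. \<exists>b\<in>polynomial_fun N. \<forall>q\<in>W. b q \<noteq> 0 \<and> f q = a q / b q"
    using assms(2) by - (rule bexI[of _ f], rule bexI[of _ "\<lambda>_. 1"], auto intro: polynomial_fun.const)
qed (use assms in auto)

lemma regular_on_subset:
  assumes "regular_on N W f" "W \<subseteq> carrier_vec N" "zariski_open N V" "V \<subseteq> W"
  shows "regular_on N V f"
proof (rule regular_onI)
  show V: "V \<subseteq> carrier_vec N" using assms by blast
  fix p assume p: "p \<in> V"
  obtain g a b where gp1: "g p \<noteq> 0" and R1: "is_fraction N W f g a b"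
    using regular_on_fraction[OF assms(1,2) subsetD[OF assms(4) p]] by blast
  note 1 = is_fractionD(1-3)[OF R1] gp1 is_fractionD(4-6)[OF R1]
  obtain h where 2: "h \<in> polynomial_fun N" "h p \<noteq> 0" "\<forall>q\<in>carrier_vec N. h q \<noteq> 0 \<longrightarrow> q \<in> V"
    using assms(3) p unfolding zariski_open_iff by metis
  show "\<exists>g\<in>polynomial_fun N. \<exists>a\<in>polynomial_fun N. \<exists>b\<in>polynomial_fun N.
       g p \<noteq> 0 \<and> (\<forall>q\<in>carrier_vec N. g q \<noteq> 0 \<longrightarrow> q \<in> V \<and> b q \<noteq> 0 \<and> f q = a q / b q)"
    using 1 2 by - (rule bexI[of _ "\<lambda>q. g q * h q"], rule bexI[of _ a], rule bexI[of _ b], auto intro!: polynomial_fun.mult)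
qed

lemma regular_on_cong:
  assumes "\<And>q. q \<in> W \<Longrightarrow> f q = f' q"
  shows "regular_on N W f \<longleftrightarrow> regular_on N W f'"
  unfolding regular_on_def using assms by (intro ball_cong refl ex_cong conj_cong) (metis subsetD)

lemma regular_on_binop:
  assumes "regular_on N W f" "regular_on N W f'" "W \<subseteq> carrier_vec N"
    and op: "\<And>a b a' b'. a \<in> polynomial_fun N \<Longrightarrow> b \<in> polynomial_fun N \<Longrightarrow> a' \<in> polynomial_fun N \<Longrightarrow> b' \<in> polynomial_fun N
      \<Longrightarrow> \<exists>c\<in>polynomial_fun N. \<exists>d\<in>polynomial_fun N. \<forall>q. b q \<noteq> 0 \<longrightarrow> b' q \<noteq> 0 \<longrightarrow> d q \<noteq> 0 \<and> F (a q / b q) (a' q / b' q) = c q / d q"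
  shows "regular_on N W (\<lambda>q. F (f q) (f' q))"
proof (rule regular_onI[OF assms(3)])
  fix p assume p: "p \<in> W"
  obtain g a b where gp1: "g p \<noteq> 0" and R1: "is_fraction N W f g a b"
    using regular_on_fraction[OF assms(1,3) p] by blast
  note 1 = is_fractionD(1-3)[OF R1] gp1 is_fractionD(4-6)[OF R1]
  obtain g' a' b' where gp2: "g' p \<noteq> 0" and R2: "is_fraction N W f' g' a' b'"
    using regular_on_fraction[OF assms(2,3) p] by blast
  note 2 = is_fractionD(1-3)[OF R2] gp2 is_fractionD(4-6)[OF R2]
  obtain c d where 3: "c \<in> polynomial_fun N" "d \<in> polynomial_fun N"
    "\<forall>q. b q \<noteq> 0 \<longrightarrow> b' q \<noteq> 0 \<longrightarrow> d q \<noteq> 0 \<and> F (a q / b q) (a' q / b' q) = c q / d q"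
    using op[OF 1(2,3) 2(2,3)] by blast
  show "\<exists>g\<in>polynomial_fun N. \<exists>a\<in>polynomial_fun N. \<exists>b\<in>polynomial_fun N.
       g p \<noteq> 0 \<and> (\<forall>q\<in>carrier_vec N. g q \<noteq> 0 \<longrightarrow> q \<in> W \<and> b q \<noteq> 0 \<and> F (f q) (f' q) = a q / b q)"
    using 1 2 3 by - (rule bexI[of _ "\<lambda>q. g q * g' q"], rule bexI[of _ c], rule bexI[of _ d], auto intro!: polynomial_fun.mult)
qed

lemma regular_on_add:
  assumes "regular_on N W f" "regular_on N W f'" "W \<subseteq> carrier_vec N"
  shows "regular_on N W (\<lambda>q. f q + f' q)"
proof (rule regular_on_binop[OF assms])
  fix a b a' b' assume "a \<in> polynomial_fun N" "b \<in> polynomial_fun N" "a' \<in> polynomial_fun N" "b' \<in> polynomial_fun N"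
  then show "\<exists>c\<in>polynomial_fun N. \<exists>d\<in>polynomial_fun N. \<forall>q. b q \<noteq> 0 \<longrightarrow> b' q \<noteq> 0 \<longrightarrow> d q \<noteq> 0 \<and> a q / b q + a' q / b' q = c q / d q"
    by - (rule bexI[of _ "\<lambda>q. a q * b' q + a' q * b q"], rule bexI[of _ "\<lambda>q. b q * b' q"], auto intro!: polynomial_fun.intros simp: add_frac_eq)
qed

lemma regular_on_mult:
  assumes "regular_on N W f" "regular_on N W f'" "W \<subseteq> carrier_vec N"
  shows "regular_on N W (\<lambda>q. f q * f' q)"
proof (rule regular_on_binop[OF assms])
  fix a b a' b' assume "a \<in> polynomial_fun N" "b \<in> polynomial_fun N" "a' \<in> polynomial_fun N" "b' \<in> polynomial_fun N"
  then show "\<exists>c\<in>polynomial_fun N. \<exists>d\<in>polynomial_fun N. \<forall>q. b q \<noteq> 0 \<longrightarrow> b' q \<noteq> 0 \<longrightarrow> d q \<noteq> 0 \<and> a q / b q * (a' q / b' q) = c q / d q"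
    by - (rule bexI[of _ "\<lambda>q. a q * a' q"], rule bexI[of _ "\<lambda>q. b q * b' q"], auto intro!: polynomial_fun.intros)
qed

lemma regular_on_const: "zariski_open N W \<Longrightarrow> regular_on N W (\<lambda>_. c)"
  by (intro regular_on_poly polynomial_fun.const)

lemma regular_on_coord: "zariski_open N W \<Longrightarrow> i < N \<Longrightarrow> regular_on N W (\<lambda>q. q $ i)"
  by (intro regular_on_poly polynomial_fun.coord)

lemma regular_on_scale:
  assumes "regular_on N W f" "zariski_open N W"
  shows "regular_on N W (\<lambda>q. c * f q)"
  using regular_on_mult[OF regular_on_const assms(1), of c] assms(2) by (simp add: zariski_open_iff)

lemma regular_on_diff:
  assumes "regular_on N W f" "regular_on N W f'" "zariski_open N W"
  shows "regular_on N W (\<lambda>q. f q - f' q)"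
  using regular_on_add[OF assms(1) regular_on_scale[OF assms(2,3), of "-1"]] assms(3) by (simp add: zariski_open_iff)

lemma regular_on_sum:
  assumes "\<And>i. i \<in> A \<Longrightarrow> regular_on N W (f i)" "zariski_open N W"
  shows "regular_on N W (\<lambda>q. \<Sum>i\<in>A. f i q)"
  using assms(1)
  by (induction A rule: infinite_finite_induct)
     (use assms(2) in \<open>auto intro!: regular_on_const regular_on_add simp: zariski_open_iff\<close>)

lemma regular_on_prod:
  assumes "\<And>i. i \<in> A \<Longrightarrow> regular_on N W (f i)" "zariski_open N W"
  shows "regular_on N W (\<lambda>q. \<Prod>i\<in>A. f i q)"
  using assms(1)
  by (induction A rule: infinite_finite_induct)
     (use assms(2) in \<open>auto intro!: regular_on_const regular_on_mult simp: zariski_open_iff\<close>)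

lemma regular_on_inverse:
  assumes "regular_on N W f" "W \<subseteq> carrier_vec N" "\<And>q. q \<in> W \<Longrightarrow> f q \<noteq> 0"
  shows "regular_on N W (\<lambda>q. inverse (f q))"
proof (rule regular_onI[OF assms(2)])
  fix p assume p: "p \<in> W"
  obtain g a b where gp1: "g p \<noteq> 0" and R1: "is_fraction N W f g a b"
    using regular_on_fraction[OF assms(1,2) p] by blast
  note 1 = is_fractionD(1-3)[OF R1] gp1 is_fractionD(4-6)[OF R1]
  show "\<exists>g\<in>polynomial_fun N. \<exists>a\<in>polynomial_fun N. \<exists>b\<in>polynomial_fun N.
       g p \<noteq> 0 \<and> (\<forall>q\<in>carrier_vec N. g q \<noteq> 0 \<longrightarrow> q \<in> W \<and> b q \<noteq> 0 \<and> inverse (f q) = a q / b q)"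
  proof (rule bexI[of _ g], rule bexI[of _ b], rule bexI[of _ a], intro conjI ballI impI)
    show "g p \<noteq> 0" by (rule 1)
    fix q assume q: "q \<in> carrier_vec N" "g q \<noteq> 0"
    show "q \<in> W" using 1 q by blast
    show "a q \<noteq> 0" using assms(3)[OF 1(5)[OF q]] 1(7)[OF q] by auto
    show "inverse (f q) = b q / a q" using 1(7)[OF q] by simp
  qed (use 1 in auto)
qed

lemma regular_on_powi:
  assumes "regular_on N W f" "zariski_open N W" "\<And>q. q \<in> W \<Longrightarrow> f q \<noteq> 0"
  shows "regular_on N W (\<lambda>q. f q powi k)"
proof -
  have W: "W \<subseteq> carrier_vec N" using assms by (simp add: zariski_open_iff)
  have pw: "regular_on N W (\<lambda>q. h q ^ j)" if "regular_on N W h" for h j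
    by (induction j) (auto intro!: regular_on_const regular_on_mult that assms W)
  show ?thesis
    unfolding power_int_def using pw[OF assms(1)] pw[OF regular_on_inverse[OF assms(1) W assms(3)]]
    by (cases "k \<ge> 0") auto
qed

lemma zariski_open_nonzero:
  assumes "regular_on N W f" "zariski_open N W"
  shows "zariski_open N {q \<in> W. f q \<noteq> 0}"
  unfolding zariski_open_iff
proof (intro conjI ballI)
  have W: "W \<subseteq> carrier_vec N" using assms by (simp add: zariski_open_iff)
  then show "{q \<in> W. f q \<noteq> 0} \<subseteq> carrier_vec N" by auto
  fix p assume p: "p \<in> {q \<in> W. f q \<noteq> 0}"
  then have "p \<in> W" by simp
  obtain g a b where gp1: "g p \<noteq> 0" and R1: "is_fraction N W f g a b"
    using regular_on_fraction[OF assms(1) W \<open>p \<in> W\<close>] by blast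
  note 1 = is_fractionD(1-3)[OF R1] gp1 is_fractionD(4-6)[OF R1]
  have "p \<in> carrier_vec N" using p W by auto
  then have "a p \<noteq> 0" using 1(4) 1(6,7)[of p] p by auto
  then show "\<exists>g\<in>polynomial_fun N. g p \<noteq> 0 \<and> (\<forall>q\<in>carrier_vec N. g q \<noteq> 0 \<longrightarrow> q \<in> {q \<in> W. f q \<noteq> 0})"
    using 1 by (intro bexI[of _ "\<lambda>q. g q * a q"] polynomial_fun.mult) auto
qed

lemma regular_on_poly_compose:
  assumes "a \<in> polynomial_fun M" "zariski_open N W" "\<And>i. i < M \<Longrightarrow> regular_on N W (\<lambda>q. \<phi> q $ i)"
  shows "regular_on N W (\<lambda>q. a (\<phi> q))"
  using assms(1)
  by induction (use assms(2,3) in \<open>auto intro!: regular_on_const regular_on_add regular_on_mult simp: zariski_open_iff\<close>)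

lemma regular_on_compose:
  assumes f: "regular_on M V f" "V \<subseteq> carrier_vec M" and W: "zariski_open N W"
    and \<phi>: "\<And>q. q \<in> W \<Longrightarrow> \<phi> q \<in> V" "\<And>i. i < M \<Longrightarrow> regular_on N W (\<lambda>q. \<phi> q $ i)"
  shows "regular_on N W (\<lambda>q. f (\<phi> q))"
proof (rule regular_on_local)
  fix p assume p: "p \<in> W"
  obtain g a b where gp1: "g (\<phi> p) \<noteq> 0" and R1: "is_fraction M V f g a b"
    using regular_on_fraction[OF f \<phi>(1)[OF p]] by blast
  note 1 = is_fractionD(1-3)[OF R1] gp1 is_fractionD(4-6)[OF R1]
  let ?V = "{q \<in> W. g (\<phi> q) \<noteq> 0}"
  have R: "regular_on N W (\<lambda>q. h (\<phi> q))" if "h \<in> polynomial_fun M" for h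
    by (rule regular_on_poly_compose[OF that W \<phi>(2)])
  have V: "zariski_open N ?V"
    by (rule zariski_open_nonzero[OF R[OF 1(1)] W])
  have W': "W \<subseteq> carrier_vec N" and V': "?V \<subseteq> carrier_vec N"
    using W V by (auto simp: zariski_open_iff)
  have R': "regular_on N ?V (\<lambda>q. h (\<phi> q))" if "h \<in> polynomial_fun M" for h
    by (rule regular_on_subset[OF R[OF that] W' V]) auto
  have \<phi>c: "\<phi> q \<in> carrier_vec M" if "q \<in> W" for q using \<phi>(1)[OF that] f(2) by auto
  have "regular_on N ?V (\<lambda>q. a (\<phi> q) * inverse (b (\<phi> q)))"
    by (intro regular_on_mult regular_on_inverse R' 1 V') (use 1(6) \<phi>c in auto)
  moreover have "regular_on N ?V (\<lambda>q. a (\<phi> q) * inverse (b (\<phi> q))) \<longleftrightarrow> regular_on N ?V (\<lambda>q. f (\<phi> q))"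
    by (rule regular_on_cong) (use 1(7) \<phi>c in \<open>auto simp: divide_inverse\<close>)
  ultimately show "\<exists>V\<subseteq>W. p \<in> V \<and> regular_on N V (\<lambda>q. f (\<phi> q))"
    using p 1(4) by (intro exI[of _ ?V]) auto
qed

text \<open>Identity theorem. If f p were nonzero, the open set where the local numerator and g do
  not vanish would be nonempty and would meet V by irreducibility.\<close>

lemma regular_on_eq_zero:
  assumes "regular_on N W f" "W \<subseteq> carrier_vec N" "zariski_open N V" "V \<noteq> {}"
    and "\<And>q. q \<in> V \<Longrightarrow> q \<in> W \<Longrightarrow> f q = 0" "p \<in> W"
  shows "f p = 0"
proof (rule ccontr)
  assume fp: "f p \<noteq> 0"
  obtain g a b where gp1: "g p \<noteq> 0" and R1: "is_fraction N W f g a b"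
    using regular_on_fraction[OF assms(1,2,6)] by blast
  note 1 = is_fractionD(1-3)[OF R1] gp1 is_fractionD(4-6)[OF R1]
  have pc: "p \<in> carrier_vec N" using assms by auto
  obtain v where v: "v \<in> V" using assms(4) by auto
  then have vc: "v \<in> carrier_vec N" using assms(3) by (auto simp: zariski_open_iff)
  obtain h where h: "h \<in> polynomial_fun N" "h v \<noteq> 0" "\<forall>q\<in>carrier_vec N. h q \<noteq> 0 \<longrightarrow> q \<in> V"
    using assms(3) v unfolding zariski_open_iff by metis
  have "a p * g p \<noteq> 0" using fp 1(4) 1(7)[OF pc 1(4)] by auto
  from polynomial_fun_common_nonzero[OF polynomial_fun.mult[OF 1(2,1)] h(1) pc this vc h(2)]
  obtain q where "q \<in> carrier_vec N" "a q * g q \<noteq> 0" "h q \<noteq> 0" by metis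
  then show False using assms(5)[of q] 1(5-7)[of q] h(3) by auto
qed

lemma regular_on_eq:
  assumes "regular_on N W f" "regular_on N W f'" "zariski_open N W" "zariski_open N V" "V \<noteq> {}"
    and "\<And>q. q \<in> V \<Longrightarrow> q \<in> W \<Longrightarrow> f q = f' q" "p \<in> W"
  shows "f p = f' p"
  using regular_on_eq_zero[OF regular_on_diff[OF assms(1-3)] _ assms(4,5) _ assms(7)] assms(3,6)
  by (auto simp: zariski_open_iff)

section \<open>Partial derivatives\<close>

text \<open>The derivative is taken analytically along a coordinate line, so that linearity, the
  Leibniz rule and locality come from \<open>has_field_derivative\<close>. Regularity of the result
  is recovered through the quotient rule in \<open>regular_on_pd_aux\<close>.\<close>

definition pd :: "nat \<Rightarrow> nat \<Rightarrow> (complex vec \<Rightarrow> complex) \<Rightarrow> complex vec \<Rightarrow> complex" where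
  "pd N i f q = (THE D. ((\<lambda>z. f (q + z \<cdot>\<^sub>v unit_vec N i)) has_field_derivative D) (at 0))"

lemma polynomial_fun_derivative:
  assumes "a \<in> polynomial_fun N" "i < N"
  shows "\<exists>a'\<in>polynomial_fun N. \<forall>q\<in>carrier_vec N. ((\<lambda>z. a (q + z \<cdot>\<^sub>v unit_vec N i)) has_field_derivative a' q) (at 0)"
  using assms(1)
proof induction
  case (const c)
  show ?case by (rule bexI[OF _ polynomial_fun.const[of 0]]) simp
next
  case (coord j)
  have "((\<lambda>z. (q + z \<cdot>\<^sub>v unit_vec N i) $ j) has_field_derivative (if j = i then 1 else 0)) (at 0)"
    if "q \<in> carrier_vec N" for q :: "complex vec"
  proof -
    have "(\<lambda>z. (q + z \<cdot>\<^sub>v unit_vec N i) $ j) = (\<lambda>z. q $ j + z * (if j = i then 1 else 0))"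
      using that coord assms(2) by (auto simp: fun_eq_iff)
    then show ?thesis by (auto intro!: derivative_eq_intros)
  qed
  then show ?case by (intro bexI[OF _ polynomial_fun.const[of "if j = i then 1 else 0"]]) auto
next
  case (add f g)
  then obtain f' g' where *: "f' \<in> polynomial_fun N" "g' \<in> polynomial_fun N"
    "\<And>q. q \<in> carrier_vec N \<Longrightarrow> ((\<lambda>z. f (q + z \<cdot>\<^sub>v unit_vec N i)) has_field_derivative f' q) (at 0)"
    "\<And>q. q \<in> carrier_vec N \<Longrightarrow> ((\<lambda>z. g (q + z \<cdot>\<^sub>v unit_vec N i)) has_field_derivative g' q) (at 0)" by blast
  then show ?case
    by (intro bexI[of _ "\<lambda>q. f' q + g' q"] ballI polynomial_fun.add) (auto intro!: DERIV_add)
next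
  case (mult f g)
  then obtain f' g' where *: "f' \<in> polynomial_fun N" "g' \<in> polynomial_fun N"
    "\<And>q. q \<in> carrier_vec N \<Longrightarrow> ((\<lambda>z. f (q + z \<cdot>\<^sub>v unit_vec N i)) has_field_derivative f' q) (at 0)"
    "\<And>q. q \<in> carrier_vec N \<Longrightarrow> ((\<lambda>z. g (q + z \<cdot>\<^sub>v unit_vec N i)) has_field_derivative g' q) (at 0)" by blast
  have z: "q + 0 \<cdot>\<^sub>v unit_vec N i = q" if "q \<in> carrier_vec N" for q :: "complex vec"
    using that assms(2) by (auto intro!: eq_vecI)
  show ?case
  proof (intro bexI[of _ "\<lambda>q. f' q * g q + f q * g' q"] ballI)
    fix q :: "complex vec" assume q: "q \<in> carrier_vec N"
    show "((\<lambda>z. f (q + z \<cdot>\<^sub>v unit_vec N i) * g (q + z \<cdot>\<^sub>v unit_vec N i)) has_field_derivative f' q * g q + f q * g' q) (at 0)"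
      by (rule DERIV_cong[OF DERIV_mult[OF *(3)[OF q] *(4)[OF q]]]) (simp add: z[OF q] mult.commute)
  qed (use * mult.hyps in \<open>auto intro!: polynomial_fun.intros\<close>)
qed

lemma line_zero: "q \<in> carrier_vec N \<Longrightarrow> q + 0 \<cdot>\<^sub>v unit_vec N i = (q :: complex vec)"
  by (auto intro!: eq_vecI simp: unit_vec_def)

lemma eventually_line_nonzero:
  assumes "g \<in> polynomial_fun N" "i < N" "q \<in> carrier_vec N" "g q \<noteq> 0"
  shows "eventually (\<lambda>z. g (q + z \<cdot>\<^sub>v unit_vec N i) \<noteq> 0) (nhds 0)"
proof -
  obtain g' where "((\<lambda>z. g (q + z \<cdot>\<^sub>v unit_vec N i)) has_field_derivative g') (at 0)"
    using polynomial_fun_derivative[OF assms(1,2)] assms(3) by blast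
  then have "isCont (\<lambda>z. g (q + z \<cdot>\<^sub>v unit_vec N i)) 0" by (rule DERIV_isCont)
  then have "(\<lambda>z. g (q + z \<cdot>\<^sub>v unit_vec N i)) \<midarrow>0\<rightarrow> g q" using line_zero[OF assms(3)] by (simp add: isCont_def)
  then have "eventually (\<lambda>z. g (q + z \<cdot>\<^sub>v unit_vec N i) \<noteq> 0) (at 0)"
    by (rule tendsto_imp_eventually_ne) (rule assms(4))
  then show ?thesis using assms(4) line_zero[OF assms(3)] by (simp add: eventually_nhds_conv_at)
qed

lemma regular_on_pd_aux:
  assumes "regular_on N W f" "W \<subseteq> carrier_vec N" "i < N"
  shows "regular_on N W (pd N i f) \<and>
    (\<forall>q\<in>W. ((\<lambda>z. f (q + z \<cdot>\<^sub>v unit_vec N i)) has_field_derivative pd N i f q) (at 0))"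
proof -
  have *: "\<exists>g\<in>polynomial_fun N. \<exists>c\<in>polynomial_fun N. \<exists>d\<in>polynomial_fun N.
       g p \<noteq> 0 \<and> (\<forall>q\<in>carrier_vec N. g q \<noteq> 0 \<longrightarrow> q \<in> W \<and> d q \<noteq> 0 \<and> 
         ((\<lambda>z. f (q + z \<cdot>\<^sub>v unit_vec N i)) has_field_derivative c q / d q) (at 0))" if p: "p \<in> W" for p
  proof -
    obtain g a b where gp1: "g p \<noteq> 0" and R1: "is_fraction N W f g a b"
    using regular_on_fraction[OF assms(1,2) p] by blast
  note 1 = is_fractionD(1-3)[OF R1] gp1 is_fractionD(4-6)[OF R1]
    obtain a' b' where 2: "a' \<in> polynomial_fun N" "b' \<in> polynomial_fun N"
      "\<And>q. q \<in> carrier_vec N \<Longrightarrow> ((\<lambda>z. a (q + z \<cdot>\<^sub>v unit_vec N i)) has_field_derivative a' q) (at 0)"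
      "\<And>q. q \<in> carrier_vec N \<Longrightarrow> ((\<lambda>z. b (q + z \<cdot>\<^sub>v unit_vec N i)) has_field_derivative b' q) (at 0)"
      using polynomial_fun_derivative[OF 1(2) assms(3)] polynomial_fun_derivative[OF 1(3) assms(3)] by blast
    show ?thesis
    proof (rule bexI[of _ g], rule bexI[of _ "\<lambda>q. a' q * b q + - (a q * b' q)"], rule bexI[of _ "\<lambda>q. b q * b q"],
        intro conjI ballI impI)
      show "g p \<noteq> 0" by (rule 1)
      fix q assume q: "q \<in> carrier_vec N" "g q \<noteq> 0"
      show "q \<in> W" "b q * b q \<noteq> 0" using 1(5,6)[OF q] by auto
      have "((\<lambda>z. a (q + z \<cdot>\<^sub>v unit_vec N i) / b (q + z \<cdot>\<^sub>v unit_vec N i)) has_field_derivative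
          (a' q * b q + - (a q * b' q)) / (b q * b q)) (at 0)"
        by (rule DERIV_cong[OF DERIV_divide[OF 2(3)[OF q(1)] 2(4)[OF q(1)]]])
           (use 1(6)[OF q] in \<open>simp_all add: line_zero[OF q(1)]\<close>)
      moreover have "eventually (\<lambda>z. f (q + z \<cdot>\<^sub>v unit_vec N i) =
          a (q + z \<cdot>\<^sub>v unit_vec N i) / b (q + z \<cdot>\<^sub>v unit_vec N i)) (nhds 0)"
        by (rule eventually_mono[OF eventually_line_nonzero[OF 1(1) assms(3) q]]) (use q 1(7) in auto)
      ultimately show "((\<lambda>z. f (q + z \<cdot>\<^sub>v unit_vec N i)) has_field_derivative
          (a' q * b q + - (a q * b' q)) / (b q * b q)) (at 0)"
        by (simp only: DERIV_cong_ev[OF refl _ refl])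
    qed (intro polynomial_fun.intros polynomial_fun_uminus 1 2)+
  qed
  have pdI: "pd N i f q = D" if "((\<lambda>z. f (q + z \<cdot>\<^sub>v unit_vec N i)) has_field_derivative D) (at 0)" for q D
    unfolding pd_def using that DERIV_unique by blast
  show ?thesis
  proof (intro conjI ballI regular_onI[OF assms(2)])
    fix p assume p: "p \<in> W"
    from *[OF p] show "\<exists>g\<in>polynomial_fun N. \<exists>a\<in>polynomial_fun N. \<exists>b\<in>polynomial_fun N.
       g p \<noteq> 0 \<and> (\<forall>q\<in>carrier_vec N. g q \<noteq> 0 \<longrightarrow> q \<in> W \<and> b q \<noteq> 0 \<and> pd N i f q = a q / b q)"
      apply (elim bexE)
      subgoal for g c d
        using pdI by - (rule bexI[of _ g], rule bexI[of _ c], rule bexI[of _ d], auto)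
      done
  next
    fix q assume q: "q \<in> W"
    then have qc: "q \<in> carrier_vec N" using assms(2) by auto
    from *[OF q] obtain c d where "((\<lambda>z. f (q + z \<cdot>\<^sub>v unit_vec N i)) has_field_derivative c q / d q) (at 0)"
      using qc by (elim bexE conjE) blast
    then show "((\<lambda>z. f (q + z \<cdot>\<^sub>v unit_vec N i)) has_field_derivative pd N i f q) (at 0)" using pdI by simp
  qed
qed

lemmas regular_on_pd = regular_on_pd_aux[THEN conjunct1]
lemmas has_derivative_pd = regular_on_pd_aux[THEN conjunct2, rule_format]

lemma pd_eqI: "((\<lambda>z. f (q + z \<cdot>\<^sub>v unit_vec N i)) has_field_derivative D) (at 0) \<Longrightarrow> pd N i f q = D"
  unfolding pd_def using DERIV_unique by blast

section \<open>Regular functions on a torus are Laurent polynomials\<close>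

lemma poly_eq_cofinite:
  fixes p q :: "complex poly"
  assumes "finite S" "\<And>z. z \<notin> S \<Longrightarrow> poly p z = poly q z"
  shows "p = q"
proof (rule ccontr)
  assume "p \<noteq> q"
  then have "finite {z. poly (p - q) z = 0}" by (intro poly_roots_finite) simp
  then have "finite (S \<union> {z. poly (p - q) z = 0})" using assms(1) by simp
  moreover have "S \<union> {z. poly (p - q) z = 0} = UNIV" using assms(2) by auto
  ultimately show False using infinite_UNIV_char_0[where 'a = complex] by metis
qed

text \<open>The nodes 1, ..., D + 1 avoid 0, because the interpolated functions are given only on
  the torus. The basis polynomials do not depend on p.\<close>

lemma lagrange_interpolation:
  "\<exists>L :: nat \<Rightarrow> complex poly. \<forall>p z. degree p \<le> D \<longrightarrow>
     poly p z = (\<Sum>j\<le>D. poly (L j) z * poly p (of_nat j + 1))"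
proof -
  define x :: "nat \<Rightarrow> complex" where "x j = of_nat j + 1" for j
  have xinj: "x i = x j \<longleftrightarrow> i = j" for i j by (simp add: x_def)
  define L where "L j = smult (inverse (\<Prod>i\<in>{..D} - {j}. x j - x i)) (\<Prod>i\<in>{..D} - {j}. [:- x i, 1:])" for j
  have deg: "degree (L j) \<le> D" if "j \<le> D" for j
  proof -
    have "degree (\<Prod>i\<in>{..D} - {j}. [:- x i, 1:]) = (\<Sum>i\<in>{..D} - {j}. degree [:- x i, 1:])"
      by (rule degree_prod_eq_sum_degree) simp
    also have "\<dots> = D" using that by simp
    finally show ?thesis using degree_smult_le[of "inverse (\<Prod>i\<in>{..D} - {j}. x j - x i)" "\<Prod>i\<in>{..D} - {j}. [:- x i, 1:]"]
      by (simp add: L_def)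
  qed
  have val: "poly (L j) (x i) = (if i = j then 1 else 0)" if "i \<le> D" "j \<le> D" for i j
  proof (cases "i = j")
    case True
    have "(\<Prod>k\<in>{..D} - {j}. x j - x k) \<noteq> 0" using xinj by auto
    then show ?thesis using True by (simp add: L_def poly_prod)
  next
    case False
    then have "(\<Prod>k\<in>{..D} - {j}. x i - x k) = 0" using that by (intro prod_zero) auto
    then show ?thesis using False by (simp add: L_def poly_prod)
  qed
  have "poly p z = (\<Sum>j\<le>D. poly (L j) z * poly p (of_nat j + 1))" if p: "degree p \<le> D" for p z
  proof -
    define q where "q = (\<Sum>j\<le>D. smult (poly p (x j)) (L j))"
    have "p = q"
    proof (rule poly_eqI_degree[where A = "x ` {..D}"])
      fix y assume "y \<in> x ` {..D}"
      then obtain i where i: "i \<le> D" "y = x i" by auto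
      have "poly q (x i) = (\<Sum>j\<le>D. if j = i then poly p (x j) else 0)"
        unfolding q_def poly_sum using val i by (intro sum.cong) auto
      then show "poly p y = poly q y" using i by simp
    next
      have c: "card (x ` {..D}) = Suc D" using xinj by (subst card_image) (auto simp: inj_on_def)
      then show "card (x ` {..D}) > degree p" using p by simp
      have "degree q \<le> D" unfolding q_def
        by (rule degree_sum_le) (auto intro: order.trans[OF degree_smult_le] deg)
      then show "card (x ` {..D}) > degree q" using c by simp
    qed
    then have "poly p z = poly q z" by simp
    then show ?thesis by (simp add: q_def poly_sum x_def mult.commute)
  qed
  then show ?thesis by blast
qed

text \<open>After the power of z at the root 0 is split off, the remaining factor has no complex
  root at all and is constant.\<close>

lemma poly_no_nonzero_root:
  fixes B :: "complex poly"
  assumes "B \<noteq> 0" "\<And>z. z \<noteq> 0 \<Longrightarrow> poly B z \<noteq> 0"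
  obtains c r where "c \<noteq> 0" "r \<le> degree B" "\<And>z. poly B z = c * z ^ r"
proof -
  obtain q where q: "B = [:- 0, 1:] ^ order 0 B * q" "\<not> [:- 0, 1:] dvd q"
    using order_decomp[OF assms(1)] by blast
  have "poly q 0 \<noteq> 0" using q(2) by (simp add: poly_eq_0_iff_dvd)
  moreover have "poly q z \<noteq> 0" if "z \<noteq> 0" for z
    using assms(2)[OF that] by (subst (asm) q(1)) auto
  ultimately have "constant (poly q)" using fundamental_theorem_of_algebra[of q] by metis
  then have "degree q = 0" by (simp add: constant_degree)
  then obtain c where c: "q = [:c:]" by (rule degree_eq_zeroE)
  have B: "poly B z = c * z ^ order 0 B" for z by (subst q(1)) (simp add: c)
  show thesis
    by (rule that[of c "order 0 B"]) (use B assms order_degree c \<open>poly q 0 \<noteq> 0\<close> in auto)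
qed

text \<open>The denominator is cleared root by root: at a nonzero root of B the numerator vanishes
  as well and a linear factor cancels. What remains is a denominator c z^r. The degrees never grow,
  which keeps the bound 2 D.\<close>

lemma punctured_line_rational:
  fixes f :: "complex \<Rightarrow> complex"
  assumes loc: "\<And>z0. z0 \<noteq> 0 \<Longrightarrow> \<exists>A B. poly B z0 \<noteq> 0 \<and> (\<forall>z. z \<noteq> 0 \<longrightarrow> poly B z * f z = poly A z)"
    and "B \<noteq> 0" "degree A \<le> D" "degree B \<le> D" "\<And>z. z \<noteq> 0 \<Longrightarrow> poly B z * f z = poly A z"
  shows "\<exists>p. degree p \<le> 2 * D \<and> (\<forall>z. z \<noteq> 0 \<longrightarrow> z ^ D * f z = poly p z)"
  using assms(2-5)
proof (induction "degree B" arbitrary: A B rule: less_induct)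
  case less
  show ?case
  proof (cases "\<exists>z0. z0 \<noteq> 0 \<and> poly B z0 = 0")
    case True
    then obtain z0 where z0: "z0 \<noteq> 0" "poly B z0 = 0" by blast
    have "poly A z0 = 0" using less.prems(4)[OF z0(1)] z0(2) by simp
    then obtain A1 where A1: "A = [:- z0, 1:] * A1" by (auto simp: poly_eq_0_iff_dvd)
    obtain B1 where B1: "B = [:- z0, 1:] * B1" using z0(2) by (auto simp: poly_eq_0_iff_dvd)
    have B1nz: "B1 \<noteq> 0" using B1 less.prems(1) by auto
    have dB: "degree B = Suc (degree B1)" using B1nz by (subst B1, subst degree_mult_eq) auto
    have dA: "degree A1 \<le> degree A"
    proof (cases "A1 = 0")
      case False
      then have "degree A = Suc (degree A1)" by (subst A1, subst degree_mult_eq) auto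
      then show ?thesis by simp
    qed simp
    have eq: "poly B1 z * f z = poly A1 z" if "z \<noteq> 0" "z \<noteq> z0" for z
    proof -
      have "(z - z0) * (poly B1 z * f z) = (z - z0) * poly A1 z"
        using less.prems(4)[OF that(1)] by (simp add: A1 B1 algebra_simps)
      then show ?thesis using that by simp
    qed
    \<comment> \<open>Cancelling the linear factor loses the identity at \<open>z0\<close> itself.
      The local fraction there recovers it, because the two fractions agree as polynomials after
      cross multiplication.\<close>
    obtain A' B' where AB: "poly B' z0 \<noteq> 0" "\<And>z. z \<noteq> 0 \<Longrightarrow> poly B' z * f z = poly A' z"
      using loc[OF z0(1)] by blast
    have "B1 * A' = A1 * B'"
    proof (rule poly_eq_cofinite[of "{0, z0}"])
      fix z assume "z \<notin> {0, z0}"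
      then show "poly (B1 * A') z = poly (A1 * B') z"
        using eq[of z] AB(2)[of z] by (simp, metis mult.assoc mult.commute)
    qed simp
    then have "poly B1 z0 * poly A' z0 = poly A1 z0 * poly B' z0" by (metis poly_mult)
    then have "poly B' z0 * (poly B1 z0 * f z0) = poly B' z0 * poly A1 z0"
      using AB(2)[OF z0(1)] by (metis mult.assoc mult.commute)
    then have "poly B1 z0 * f z0 = poly A1 z0" using AB(1) by simp
    then have eq': "poly B1 z * f z = poly A1 z" if "z \<noteq> 0" for z using eq that by (cases "z = z0") auto
    show ?thesis
      by (rule less.hyps[of B1 A1]) (use dB dA B1nz less.prems(2,3) eq' in auto)
  next
    case False
    obtain c r where c: "c \<noteq> 0" "r \<le> degree B" "\<And>z. poly B z = c * z ^ r"
      by (rule poly_no_nonzero_root[OF less.prems(1)]) (use False in auto)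
    define p where "p = smult (1 / c) (monom 1 (D - r) * A)"
    have "degree p \<le> (D - r) + degree A"
      unfolding p_def by (rule order.trans[OF degree_smult_le order.trans[OF degree_mult_le]]) (simp add: degree_monom_eq)
    then have "degree p \<le> 2 * D" using less.prems(2) by simp
    moreover have "z ^ D * f z = poly p z" if "z \<noteq> 0" for z
    proof -
      have "z ^ D = z ^ (D - r) * z ^ r" using c(2) less.prems(3) by (simp flip: power_add)
      then show ?thesis using less.prems(4)[OF that] c(1) by (simp add: c(3) p_def poly_monom field_simps)
    qed
    ultimately show ?thesis by blast
  qed
qed

lemma polynomial_fun_prod:
  "(\<And>i. i \<in> A \<Longrightarrow> f i \<in> polynomial_fun N) \<Longrightarrow> (\<lambda>q. \<Prod>i\<in>A. f i q) \<in> polynomial_fun N"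
  by (induction A rule: infinite_finite_induct) (auto intro: polynomial_fun.intros)

section \<open>Coordinate tori and restriction to coordinate lines\<close>

definition nz :: "nat \<Rightarrow> nat set \<Rightarrow> complex vec set" where
  "nz N I = {q \<in> carrier_vec N. \<forall>i\<in>I. q $ i \<noteq> 0}"

lemma nz_subset: "nz N I \<subseteq> carrier_vec N"
  by (auto simp: nz_def)

lemma zariski_open_nz:
  assumes "I \<subseteq> {..<N}"
  shows "zariski_open N (nz N I)"
  unfolding zariski_open_iff
proof (intro conjI ballI nz_subset)
  have fin: "finite I" using assms finite_subset by blast
  fix p assume "p \<in> nz N I"
  then show "\<exists>g\<in>polynomial_fun N. g p \<noteq> 0 \<and> (\<forall>q\<in>carrier_vec N. g q \<noteq> 0 \<longrightarrow> q \<in> nz N I)"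
    using assms fin by (intro bexI[of _ "\<lambda>q. \<Prod>i\<in>I. q $ i"] polynomial_fun_prod polynomial_fun.coord) (auto simp: nz_def)
qed

definition ones :: "nat \<Rightarrow> complex vec" where
  "ones N = vec N (\<lambda>_. 1)"

lemma ones_nz: "I \<subseteq> {..<N} \<Longrightarrow> ones N \<in> nz N I"
  by (auto simp: nz_def ones_def)

abbreviation tor :: "nat \<Rightarrow> complex vec set" where
  "tor N \<equiv> nz N {..<N}"

definition upd :: "nat \<Rightarrow> complex vec \<Rightarrow> nat \<Rightarrow> complex \<Rightarrow> complex vec" where
  "upd N q k z = vec N (\<lambda>j. if j = k then z else q $ j)"

lemma upd_simps [simp]: "upd N q k z \<in> carrier_vec N" "j < N \<Longrightarrow> upd N q k z $ j = (if j = k then z else q $ j)"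
  by (simp_all add: upd_def)

lemma upd_tor: "q \<in> tor N \<Longrightarrow> z \<noteq> 0 \<Longrightarrow> upd N q k z \<in> tor N"
  by (auto simp: nz_def)

lemma upd_self: "q \<in> carrier_vec N \<Longrightarrow> upd N q k (q $ k) = q"
  by (auto simp: upd_def)

lemma upd_line: "q \<in> carrier_vec N \<Longrightarrow> k < N \<Longrightarrow> upd N q k z = upd N q k 0 + z \<cdot>\<^sub>v unit_vec N k"
  by (intro eq_vecI) (auto simp: upd_def)

lemma polynomial_fun_upd:
  assumes "a \<in> polynomial_fun N" "k < N"
  shows "\<exists>D. \<forall>q\<in>carrier_vec N. \<exists>p. degree p \<le> D \<and> (\<forall>z. a (upd N q k z) = poly p z)"
proof -
  obtain D where D: "\<And>q v. q \<in> carrier_vec N \<Longrightarrow> v \<in> carrier_vec N \<Longrightarrow> \<exists>p. degree p \<le> D \<and> (\<forall>z. a (q + z \<cdot>\<^sub>v v) = poly p z)"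
    using polynomial_fun_line[OF assms(1)] by blast
  have "\<exists>p. degree p \<le> D \<and> (\<forall>z. a (upd N q k z) = poly p z)" if q: "q \<in> carrier_vec N" for q
  proof -
    obtain p where p: "degree p \<le> D" "\<And>z. a (upd N q k 0 + z \<cdot>\<^sub>v unit_vec N k) = poly p z"
      using D[of "upd N q k 0" "unit_vec N k"] by auto
    have "a (upd N q k z) = poly p z" for z
      by (subst upd_line[OF q assms(2)]) (rule p)
    then show ?thesis using p(1) by blast
  qed
  then show ?thesis by blast
qed

text \<open>A local identity f = a / b, cleared of the denominator, is an identity of regular
  functions on a nonempty open set and thus holds on all of W.\<close>

lemma global_fraction:
  assumes "regular_on N W f" "zariski_open N W" "p \<in> W"
  shows "\<exists>a\<in>polynomial_fun N. \<exists>b\<in>polynomial_fun N. b p \<noteq> 0 \<and> (\<forall>q\<in>W. b q * f q = a q)"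
proof -
  have W: "W \<subseteq> carrier_vec N" using assms(2) by (simp add: zariski_open_iff)
  then have pc: "p \<in> carrier_vec N" using assms(3) by auto
  obtain g a b where gp1: "g p \<noteq> 0" and R1: "is_fraction N W f g a b"
    using regular_on_fraction[OF assms(1) W assms(3)] by blast
  note 1 = is_fractionD(1-3)[OF R1] gp1 is_fractionD(4-6)[OF R1]
  have V: "zariski_open N {q \<in> W. g q \<noteq> 0}"
    by (rule zariski_open_nonzero[OF regular_on_poly[OF assms(2) 1(1)] assms(2)])
  have "b q * f q = a q" if "q \<in> W" for q
    by (rule regular_on_eq[OF regular_on_mult[OF regular_on_poly[OF assms(2) 1(3)] assms(1) W]
          regular_on_poly[OF assms(2) 1(2)] assms(2) V _ _ that])
       (use 1 assms(3) W in auto)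
  then show ?thesis using 1(2,3) 1(6)[OF pc 1(4)] by (intro bexI[OF bexI[OF _ 1(3)] 1(2)]) auto
qed

lemma regular_on_poly1:
  assumes "regular_on N W f" "zariski_open N W"
  shows "regular_on N W (\<lambda>q. poly p (f q))"
  using assms by (induction p) (auto intro!: regular_on_const regular_on_add regular_on_mult simp: zariski_open_iff)

lemma regular_on_upd:
  assumes "regular_on N (tor N) f" "z \<noteq> 0"
  shows "regular_on N (tor N) (\<lambda>q. f (upd N q k z))"
proof (rule regular_on_compose[OF assms(1) nz_subset zariski_open_nz])
  fix i assume i: "i < N"
  have "regular_on N (tor N) (\<lambda>q. if i = k then z else q $ i)"
    by (cases "i = k") (auto intro!: regular_on_const regular_on_coord zariski_open_nz i)
  then show "regular_on N (tor N) (\<lambda>q. upd N q k z $ i)" using i by simp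
qed (use assms upd_tor in auto)

text \<open>Along the k-th coordinate line f is a Laurent polynomial of uniformly bounded degree, so
  finitely many values determine it; the right-hand side involves f only with its k-th coordinate
  frozen. This is shown where the global denominator b is nonzero and then extended by the identity
  theorem.\<close>

lemma torus_interpolation:
  assumes f: "regular_on N (tor N) f" and k: "k < N"
  shows "\<exists>D L. \<forall>q\<in>tor N. (q $ k) ^ D * f q =
    (\<Sum>j\<le>2 * D. poly (L j) (q $ k) * ((of_nat j + 1) ^ D * f (upd N q k (of_nat j + 1))))"
proof -
  have W: "zariski_open N (tor N)" by (rule zariski_open_nz) simp
  obtain a b where ab: "a \<in> polynomial_fun N" "b \<in> polynomial_fun N" "b (ones N) \<noteq> 0" "\<And>q. q \<in> tor N \<Longrightarrow> b q * f q = a q"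
    using global_fraction[OF f W ones_nz] by blast
  obtain Da where Da: "\<And>q. q \<in> carrier_vec N \<Longrightarrow> \<exists>p. degree p \<le> Da \<and> (\<forall>z. a (upd N q k z) = poly p z)"
    using polynomial_fun_upd[OF ab(1) k] by blast
  obtain Db where Db: "\<And>q. q \<in> carrier_vec N \<Longrightarrow> \<exists>p. degree p \<le> Db \<and> (\<forall>z. b (upd N q k z) = poly p z)"
    using polynomial_fun_upd[OF ab(2) k] by blast
  define D where "D = max Da Db"
  obtain L :: "nat \<Rightarrow> complex poly" where
    L: "\<And>p z. degree p \<le> 2 * D \<Longrightarrow> poly p z = (\<Sum>j\<le>2 * D. poly (L j) z * poly p (of_nat j + 1))"
    using lagrange_interpolation[of "2 * D"] by blast
  have nz1: "of_nat j + 1 \<noteq> (0::complex)" for j by (metis of_nat_Suc of_nat_0_eq_iff nat.distinct(2) add.commute)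
  let ?R = "\<lambda>q. \<Sum>j\<le>2 * D. poly (L j) (q $ k) * ((of_nat j + 1) ^ D * f (upd N q k (of_nat j + 1)))"
  have dense: "(q $ k) ^ D * f q = ?R q" if q: "q \<in> tor N" and bq: "b q \<noteq> 0" for q
  proof -
    have qc: "q \<in> carrier_vec N" and qk: "q $ k \<noteq> 0" using q k by (auto simp: nz_def)
    obtain A where A: "degree A \<le> Da" "\<And>z. a (upd N q k z) = poly A z"
      using Da[OF qc] by blast
    obtain B where B: "degree B \<le> Db" "\<And>z. b (upd N q k z) = poly B z"
      using Db[OF qc] by blast
    have "\<exists>p. degree p \<le> 2 * D \<and> (\<forall>z. z \<noteq> 0 \<longrightarrow> z ^ D * f (upd N q k z) = poly p z)"
    proof (rule punctured_line_rational)
      show "B \<noteq> 0" using bq B(2)[of "q $ k"] upd_self[OF qc] by auto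
      show "degree A \<le> D" "degree B \<le> D" using A B by (auto simp: D_def)
      show "poly B z * f (upd N q k z) = poly A z" if "z \<noteq> 0" for z
        using ab(4)[OF upd_tor[OF q that, of k]] A B by simp
      fix z0 :: complex assume z0: "z0 \<noteq> 0"
      obtain a' b' where ab': "a' \<in> polynomial_fun N" "b' \<in> polynomial_fun N" "b' (upd N q k z0) \<noteq> 0"
        "\<And>q. q \<in> tor N \<Longrightarrow> b' q * f q = a' q"
        using global_fraction[OF f W upd_tor[OF q z0]] by blast
      obtain A' where A': "\<And>z. a' (upd N q k z) = poly A' z"
        using polynomial_fun_upd[OF ab'(1) k] qc by blast
      obtain B' where B': "\<And>z. b' (upd N q k z) = poly B' z"
        using polynomial_fun_upd[OF ab'(2) k] qc by blast
      show "\<exists>A B. poly B z0 \<noteq> 0 \<and> (\<forall>z. z \<noteq> 0 \<longrightarrow> poly B z * f (upd N q k z) = poly A z)"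
        using ab'(3) ab'(4)[OF upd_tor[OF q, of _ k]] A' B' by (intro exI[of _ A'] exI[of _ B']) auto
    qed
    then obtain p where p: "degree p \<le> 2 * D" "\<And>z. z \<noteq> 0 \<Longrightarrow> z ^ D * f (upd N q k z) = poly p z" by blast
    have "(q $ k) ^ D * f q = poly p (q $ k)" using p(2)[OF qk] upd_self[OF qc] by simp
    also have "\<dots> = (\<Sum>j\<le>2 * D. poly (L j) (q $ k) * poly p (of_nat j + 1))" by (rule L[OF p(1)])
    also have "\<dots> = ?R q" using p(2)[OF nz1] by simp
    finally show ?thesis .
  qed
  have V: "zariski_open N {q \<in> tor N. b q \<noteq> 0}"
    by (rule zariski_open_nonzero[OF regular_on_poly[OF W ab(2)] W])
  have Rreg: "regular_on N (tor N) ?R"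
    by (intro regular_on_sum regular_on_mult regular_on_poly1 regular_on_const regular_on_coord regular_on_upd f W k nz_subset nz1)
  have kpow: "regular_on N (tor N) (\<lambda>q. (q $ k) ^ D)"
    using regular_on_powi[OF regular_on_coord[OF W k] W, of "int D"] k by (auto simp: nz_def)
  have "(q $ k) ^ D * f q = ?R q" if q: "q \<in> tor N" for q
    by (rule regular_on_eq[OF regular_on_mult[OF kpow f nz_subset] Rreg W V _ _ q])
       (use dense ab(3) ones_nz[of "{..<N}" N] in auto)
  then show ?thesis by blast
qed

definition lm :: "nat \<Rightarrow> (nat \<Rightarrow> int) \<Rightarrow> complex vec \<Rightarrow> complex" where
  "lm N \<beta> q = (\<Prod>i<N. q $ i powi \<beta> i)"

text \<open>Exponents are functions on all natural numbers; requiring them to vanish from N on makes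
  distinct exponents give distinct monomials.\<close>

definition laurent :: "nat \<Rightarrow> (complex vec \<Rightarrow> complex) \<Rightarrow> bool" where
  "laurent N f \<longleftrightarrow> (\<exists>S c. finite S \<and> (\<forall>\<beta>\<in>S. \<forall>i\<ge>N. \<beta> i = 0) \<and> (\<forall>q\<in>tor N. f q = (\<Sum>\<beta>\<in>S. c \<beta> * lm N \<beta> q)))"

lemma laurent_zero: "laurent N (\<lambda>_. 0)"
  unfolding laurent_def by (rule exI[of _ "{}"]) simp

lemma laurent_const: "laurent N (\<lambda>_. c)"
  unfolding laurent_def by (rule exI[of _ "{\<lambda>_. 0}"], rule exI[of _ "\<lambda>_. c"]) (simp add: lm_def)

lemma laurent_cong: "laurent N f \<Longrightarrow> (\<And>q. q \<in> tor N \<Longrightarrow> g q = f q) \<Longrightarrow> laurent N g"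
  unfolding laurent_def by simp

lemma laurent_add:
  assumes "laurent N f" "laurent N g"
  shows "laurent N (\<lambda>q. f q + g q)"
proof -
  obtain S c where S: "finite S" "\<forall>\<beta>\<in>S. \<forall>i\<ge>N. \<beta> i = 0" "\<And>q. q \<in> tor N \<Longrightarrow> f q = (\<Sum>\<beta>\<in>S. c \<beta> * lm N \<beta> q)"
    using assms(1) unfolding laurent_def by blast
  obtain T d where T: "finite T" "\<forall>\<beta>\<in>T. \<forall>i\<ge>N. \<beta> i = 0" "\<And>q. q \<in> tor N \<Longrightarrow> g q = (\<Sum>\<beta>\<in>T. d \<beta> * lm N \<beta> q)"
    using assms(2) unfolding laurent_def by blast
  have "f q + g q = (\<Sum>\<beta>\<in>S \<union> T. ((if \<beta> \<in> S then c \<beta> else 0) + (if \<beta> \<in> T then d \<beta> else 0)) * lm N \<beta> q)" if "q \<in> tor N" for q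
  proof -
    have "f q = (\<Sum>\<beta>\<in>S \<union> T. (if \<beta> \<in> S then c \<beta> else 0) * lm N \<beta> q)"
      unfolding S(3)[OF that] using S(1) T(1) by (intro sum.mono_neutral_cong_left) auto
    moreover have "g q = (\<Sum>\<beta>\<in>S \<union> T. (if \<beta> \<in> T then d \<beta> else 0) * lm N \<beta> q)"
      unfolding T(3)[OF that] using S(1) T(1) by (intro sum.mono_neutral_cong_left) auto
    ultimately show ?thesis by (simp add: distrib_right sum.distrib)
  qed
  then show ?thesis unfolding laurent_def using S(1,2) T(1,2)
    by - (rule exI[of _ "S \<union> T"], rule exI[of _ "\<lambda>\<beta>. (if \<beta> \<in> S then c \<beta> else 0) + (if \<beta> \<in> T then d \<beta> else 0)"], auto)
qed

lemma laurent_scale: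
  assumes "laurent N f"
  shows "laurent N (\<lambda>q. a * f q)"
proof -
  obtain S c where S: "finite S" "\<forall>\<beta>\<in>S. \<forall>i\<ge>N. \<beta> i = 0" "\<And>q. q \<in> tor N \<Longrightarrow> f q = (\<Sum>\<beta>\<in>S. c \<beta> * lm N \<beta> q)"
    using assms unfolding laurent_def by blast
  then show ?thesis unfolding laurent_def
    by - (rule exI[of _ S], rule exI[of _ "\<lambda>\<beta>. a * c \<beta>"], auto simp: sum_distrib_left mult.assoc)
qed

lemma laurent_sum: "(\<And>i. i \<in> A \<Longrightarrow> laurent N (f i)) \<Longrightarrow> laurent N (\<lambda>q. \<Sum>i\<in>A. f i q)"
  by (induction A rule: infinite_finite_induct) (auto intro: laurent_zero laurent_add)

lemma lm_add: "q \<in> tor N \<Longrightarrow> lm N (\<lambda>i. \<beta> i + \<gamma> i) q = lm N \<beta> q * lm N \<gamma> q"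
  unfolding lm_def prod.distrib[symmetric]
  by (intro prod.cong) (auto simp: nz_def power_int_add)

lemma laurent_mult_monomial:
  assumes "laurent N f" "\<forall>i\<ge>N. \<gamma> i = 0"
  shows "laurent N (\<lambda>q. lm N \<gamma> q * f q)"
proof -
  obtain S c where S: "finite S" "\<forall>\<beta>\<in>S. \<forall>i\<ge>N. \<beta> i = 0" "\<And>q. q \<in> tor N \<Longrightarrow> f q = (\<Sum>\<beta>\<in>S. c \<beta> * lm N \<beta> q)"
    using assms unfolding laurent_def by blast
  define sh where "sh = (\<lambda>\<beta> i. \<gamma> i + \<beta> i :: int)"
  have inj: "inj_on sh S" by (auto simp: sh_def inj_on_def fun_eq_iff)
  have "lm N \<gamma> q * f q = (\<Sum>\<beta>\<in>sh ` S. c (\<lambda>i. \<beta> i - \<gamma> i) * lm N \<beta> q)" if "q \<in> tor N" for q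
    unfolding S(3)[OF that] sum.reindex[OF inj] using lm_add[OF that]
    by (auto simp: sum_distrib_left sh_def intro!: sum.cong)
  then show ?thesis unfolding laurent_def using S(1,2) assms(2)
    by - (rule exI[of _ "sh ` S"], rule exI[of _ "\<lambda>\<beta>. c (\<lambda>i. \<beta> i - \<gamma> i)"], auto simp: sh_def)
qed

lemma lm_single: "k < N \<Longrightarrow> lm N (\<lambda>i. if i = k then m else 0) q = q $ k powi m"
  unfolding lm_def by (subst prod.remove[of _ k]) auto

lemma laurent_mult_powi:
  assumes "laurent N f" "k < N"
  shows "laurent N (\<lambda>q. q $ k powi m * f q)"
  using laurent_mult_monomial[OF assms(1), of "\<lambda>i. if i = k then m else 0"] assms(2) by (simp add: lm_single)

lemma laurent_mult_poly:
  assumes "laurent N f" "k < N"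
  shows "laurent N (\<lambda>q. poly p (q $ k) * f q)"
proof (induction p)
  case 0
  then show ?case by (simp add: laurent_zero)
next
  case (pCons a p)
  have "laurent N (\<lambda>q. a * f q + q $ k powi 1 * (poly p (q $ k) * f q))"
    by (intro laurent_add laurent_scale assms laurent_mult_powi pCons)
  then show ?case by (simp add: algebra_simps)
qed

text \<open>Induction on the number of coordinates on which f depends.
  \<open>torus_interpolation\<close> expresses f through functions that no longer depend on the last
  of these coordinates; a function independent of all coordinates is constant, as its arguments can
  be replaced by 1 one at a time.\<close>

lemma laurent_if_regular_partial:
  assumes "regular_on N (tor N) f" "k \<le> N"
    and "\<And>q i z. q \<in> tor N \<Longrightarrow> k \<le> i \<Longrightarrow> i < N \<Longrightarrow> z \<noteq> 0 \<Longrightarrow> f (upd N q i z) = f q"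
  shows "laurent N f"
  using assms
proof (induction k arbitrary: f)
  case 0
  have "f q = f (ones N)" if q: "q \<in> tor N" for q
  proof -
    define h where "h j = vec N (\<lambda>i. if i < j then 1 else q $ i)" for j
    have "f (h j) = f q" if "j \<le> N" for j
      using that
    proof (induction j)
      case 0
      have "h 0 = q" using q by (auto simp: h_def nz_def)
      then show ?case by simp
    next
      case (Suc j)
      have "h (Suc j) = upd N (h j) j 1" using Suc.prems by (auto simp: h_def upd_def)
      moreover have "h j \<in> tor N" using q by (auto simp: h_def nz_def)
      ultimately show ?case using "0.prems"(3)[of "h j" j 1] Suc by simp
    qed
    moreover have "h N = ones N" by (auto simp: h_def ones_def)
    ultimately show ?thesis by (metis order_refl)
  qed
  then show ?case by (intro laurent_cong[OF laurent_const]) auto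
next
  case (Suc k)
  then have k: "k < N" by simp
  obtain D and L :: "nat \<Rightarrow> complex poly" where DL: "\<And>q. q \<in> tor N \<Longrightarrow> (q $ k) ^ D * f q =
    (\<Sum>j\<le>2 * D. poly (L j) (q $ k) * ((of_nat j + 1) ^ D * f (upd N q k (of_nat j + 1))))"
    using torus_interpolation[OF Suc.prems(1) k] by blast
  have nz1: "of_nat j + 1 \<noteq> (0::complex)" for j by (metis of_nat_Suc of_nat_0_eq_iff nat.distinct(2) add.commute)
  have "laurent N (\<lambda>q. f (upd N q k (of_nat j + 1)))" for j
  proof (rule Suc.IH)
    show "regular_on N (tor N) (\<lambda>q. f (upd N q k (of_nat j + 1)))"
      by (rule regular_on_upd[OF Suc.prems(1) nz1])
    fix q i and z :: complex assume q: "q \<in> tor N" and i: "k \<le> i" "i < N" and z: "z \<noteq> 0"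
    show "f (upd N (upd N q i z) k (of_nat j + 1)) = f (upd N q k (of_nat j + 1))"
    proof (cases "i = k")
      case True
      then have "upd N (upd N q i z) k (of_nat j + 1) = upd N q k (of_nat j + 1)"
        by (auto simp: upd_def)
      then show ?thesis by simp
    next
      case False
      then have "upd N (upd N q i z) k (of_nat j + 1) = upd N (upd N q k (of_nat j + 1)) i z"
        by (auto simp: upd_def)
      then show ?thesis using Suc.prems(3)[OF upd_tor[OF q nz1] _ i(2) z] i(1) False by simp
    qed
  qed (use k in simp)
  then have "laurent N (\<lambda>q. q $ k powi (- int D) *
      (\<Sum>j\<le>2 * D. poly (L j) (q $ k) * ((of_nat j + 1) ^ D * f (upd N q k (of_nat j + 1)))))"
    by (intro laurent_mult_powi laurent_sum laurent_mult_poly laurent_scale k)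
  then show ?case
  proof (rule laurent_cong)
    fix q assume q: "q \<in> tor N"
    then have "q $ k \<noteq> 0" using k by (auto simp: nz_def)
    then show "f q = q $ k powi (- int D) *
      (\<Sum>j\<le>2 * D. poly (L j) (q $ k) * ((of_nat j + 1) ^ D * f (upd N q k (of_nat j + 1))))"
      unfolding DL[OF q, symmetric] by (simp add: power_int_minus)
  qed
qed

lemma laurent_if_regular: "regular_on N (tor N) f \<Longrightarrow> laurent N f"
  by (rule laurent_if_regular_partial[of N f N]) auto

text \<open>Dedekind's argument: comparing a relation with its translate by a point p eliminates one
  monomial. The point p has the entry 2 at an index where two exponents differ, and the two
  monomials then differ in absolute value at p.\<close>

lemma lm_independent:
  assumes "finite S" "\<And>\<beta>. \<beta> \<in> S \<Longrightarrow> \<forall>i\<ge>N. \<beta> i = 0" "\<And>q. q \<in> tor N \<Longrightarrow> (\<Sum>\<beta>\<in>S. c \<beta> * lm N \<beta> q) = 0" "\<beta> \<in> S"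
  shows "c \<beta> = 0"
  using assms
proof (induction S arbitrary: c \<beta> rule: finite_induct)
  case (insert \<gamma> S)
  have lm_mult: "lm N \<beta> (vec N (\<lambda>i. p $ i * q $ i)) = lm N \<beta> p * lm N \<beta> q" for \<beta> p q
    by (simp add: lm_def prod.distrib[symmetric] power_int_mult_distrib)
  have S0: "c \<delta> = 0" if \<delta>: "\<delta> \<in> S" for \<delta>
  proof -
    have "\<delta> \<noteq> \<gamma>" using insert.hyps \<delta> by auto
    then obtain k where k: "\<delta> k \<noteq> \<gamma> k" by auto
    then have kN: "k < N" using insert.prems(1)[of \<delta>] insert.prems(1)[of \<gamma>] \<delta> by (metis insertCI leI)
    define p where "p = vec N (\<lambda>i. if i = k then 2 else 1 :: complex)"
    have p: "p \<in> tor N" by (auto simp: p_def nz_def)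
    have lmp: "lm N \<beta> p = 2 powi \<beta> k" for \<beta>
      unfolding lm_def by (subst prod.remove[of _ k]) (use kN in \<open>auto simp: p_def\<close>)
    have "(\<Sum>\<beta>\<in>S. c \<beta> * (lm N \<beta> p - lm N \<gamma> p) * lm N \<beta> q) = 0" if q: "q \<in> tor N" for q
    proof -
      have "vec N (\<lambda>i. p $ i * q $ i) \<in> tor N" using p q by (auto simp: nz_def)
      from insert.prems(2)[OF this] have "(\<Sum>\<beta>\<in>insert \<gamma> S. c \<beta> * (lm N \<beta> p * lm N \<beta> q)) = 0"
        by (simp only: lm_mult)
      moreover have "(\<Sum>\<beta>\<in>insert \<gamma> S. c \<beta> * lm N \<beta> q) * lm N \<gamma> p = 0" using insert.prems(2)[OF q] by simp
      ultimately have "(\<Sum>\<beta>\<in>insert \<gamma> S. c \<beta> * (lm N \<beta> p * lm N \<beta> q) - c \<beta> * lm N \<beta> q * lm N \<gamma> p) = 0"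
        by (simp only: sum_subtractf sum_distrib_right) simp
      then show ?thesis using insert.hyps by (simp add: algebra_simps)
    qed
    from insert.IH[OF _ this \<delta>] insert.prems(1) have "c \<delta> * (lm N \<delta> p - lm N \<gamma> p) = 0" by blast
    moreover have "lm N \<delta> p \<noteq> lm N \<gamma> p"
    proof
      assume "lm N \<delta> p = lm N \<gamma> p"
      then have "norm (2 powi \<delta> k :: complex) = norm (2 powi \<gamma> k :: complex)" by (simp add: lmp)
      then have "(2::real) powr real_of_int (\<delta> k) = 2 powr real_of_int (\<gamma> k)"
        by (simp add: norm_power_int powr_real_of_int')
      then show False using k powr_inj[of 2 "real_of_int (\<delta> k)" "real_of_int (\<gamma> k)"] by simp
    qed
    ultimately show ?thesis by simp
  qed
  have "c \<gamma> * lm N \<gamma> (ones N) = 0"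
    using insert.prems(2)[OF ones_nz] insert.hyps S0 by simp
  then have "c \<gamma> = 0" by (simp add: lm_def ones_def)
  then show ?case using S0 insert.prems(3) by auto
qed simp

section \<open>Sheaf homomorphisms between the invertible sheaves\<close>

definition wgt :: "nat \<Rightarrow> nat \<Rightarrow> int" where
  "wgt n i = (if i < n then 1 else -2)"

lemma torus_act_carrier [simp]: "torus_act n u Q \<in> carrier_vec (n + 1)"
  by (simp add: torus_act_def)

lemma torus_act_index: "i < n + 1 \<Longrightarrow> torus_act n u Q $ i = u powi wgt n i * Q $ i"
  by (auto simp: torus_act_def wgt_def)

lemma torus_act_one: "Q \<in> carrier_vec (n + 1) \<Longrightarrow> torus_act n 1 Q = Q"
  by (auto simp: torus_act_def)

lemma torus_act_act: "u \<noteq> 0 \<Longrightarrow> v \<noteq> 0 \<Longrightarrow> torus_act n u (torus_act n v Q) = torus_act n (u * v) Q"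
  by (rule eq_vecI) (auto simp: torus_act_def power_int_mult_distrib)

lemma torus_orbit_act:
  assumes "u \<noteq> 0" "Q \<in> carrier_vec (n + 1)"
  shows "torus_orbit n (torus_act n u Q) = torus_orbit n Q"
proof -
  show ?thesis
  proof
    show "torus_orbit n (torus_act n u Q) \<subseteq> torus_orbit n Q"
      using assms by (auto simp: torus_orbit_def torus_act_act)
    show "torus_orbit n Q \<subseteq> torus_orbit n (torus_act n u Q)"
    proof
      fix R assume "R \<in> torus_orbit n Q"
      then obtain v where v: "v \<noteq> 0" "R = torus_act n v Q" by (auto simp: torus_orbit_def)
      have "v / u \<noteq> 0" "R = torus_act n (v / u) (torus_act n u Q)"
        using v assms by (simp_all add: torus_act_act)
      then show "R \<in> torus_orbit n (torus_act n u Q)" unfolding torus_orbit_def by blast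
    qed
  qed
qed

text \<open>Open sets of the quotient are handled through invariant open sets of the cover;
  \<open>orb\<close> leads down to the quotient and the union of orbits leads back
  (\<open>Union_orb\<close>).\<close>

definition torus_inv :: "nat \<Rightarrow> complex vec set \<Rightarrow> bool" where
  "torus_inv n W \<longleftrightarrow> W \<subseteq> cover n \<and> (\<forall>Q\<in>W. \<forall>u. u \<noteq> 0 \<longrightarrow> torus_act n u Q \<in> W)"

definition orb :: "nat \<Rightarrow> complex vec set \<Rightarrow> complex vec set set" where
  "orb n W = torus_orbit n ` W"

lemma cover_carrier: "cover n \<subseteq> carrier_vec (n + 1)"
  by (auto simp: cover_def)

lemma Union_orb:
  assumes "torus_inv n W"
  shows "\<Union>(orb n W) = W"
proof
  show "\<Union>(orb n W) \<subseteq> W"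
    using assms by (auto simp: torus_inv_def orb_def torus_orbit_def)
  show "W \<subseteq> \<Union>(orb n W)"
  proof
    fix Q assume Q: "Q \<in> W"
    then have "Q \<in> carrier_vec (n + 1)" using assms cover_carrier by (auto simp: torus_inv_def)
    then have "Q \<in> torus_orbit n Q"
      unfolding torus_orbit_def mem_Collect_eq by (intro exI[of _ 1]) (simp add: torus_act_one)
    then show "Q \<in> \<Union>(orb n W)" using Q by (auto simp: orb_def)
  qed
qed

lemma Xt_open_orb:
  assumes "torus_inv n W" "zariski_open (n + 1) W"
  shows "Xt_open n (orb n W)"
  unfolding Xt_open_def Union_orb[OF assms(1)]
  using assms by (auto simp: Xt_def orb_def torus_inv_def)

lemma torus_inv_cover: "torus_inv n (cover n)"
  by (auto simp: torus_inv_def cover_def torus_act_def)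

lemma subset_Xt_inv:
  assumes "U \<subseteq> Xt n"
  shows "torus_inv n (\<Union>U)"
  unfolding torus_inv_def
proof safe
  fix Q x assume *: "Q \<in> x" "x \<in> U"
  then obtain P where P: "P \<in> cover n" "x = torus_orbit n P" using assms by (auto simp: Xt_def)
  then obtain v where v: "v \<noteq> 0" "Q = torus_act n v P" using * by (auto simp: torus_orbit_def)
  show "Q \<in> cover n" using P v torus_inv_cover by (auto simp: torus_inv_def)
  fix u :: complex assume u: "u \<noteq> 0"
  have "torus_act n u Q = torus_act n (u * v) P" using u v by (simp add: torus_act_act)
  then have "torus_act n u Q \<in> x" using P u v by (auto simp: torus_orbit_def)
  then show "torus_act n u Q \<in> \<Union>U" using * by blast
qed

lemma Xt_openD:
  assumes "Xt_open n U"
  shows "torus_inv n (\<Union>U)" "zariski_open (n + 1) (\<Union>U)" "\<Union>U \<subseteq> carrier_vec (n + 1)"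
  using assms subset_Xt_inv[of U n] by (auto simp: Xt_open_def zariski_open_iff)

lemma Xt_subset_iff:
  assumes "U \<subseteq> Xt n" "V \<subseteq> Xt n"
  shows "U \<subseteq> V \<longleftrightarrow> \<Union>U \<subseteq> \<Union>V"
proof
  assume sub: "\<Union>U \<subseteq> \<Union>V"
  show "U \<subseteq> V"
  proof
    fix x assume x: "x \<in> U"
    then obtain P where P: "P \<in> cover n" "x = torus_orbit n P" using assms by (auto simp: Xt_def)
    have Pc: "P \<in> carrier_vec (n + 1)" using P cover_carrier by auto
    then have "P \<in> x" unfolding P(2) torus_orbit_def mem_Collect_eq by (intro exI[of _ 1]) (simp add: torus_act_one)
    then obtain y where y: "y \<in> V" "P \<in> y" using sub x by auto
    then obtain R where R: "R \<in> cover n" "y = torus_orbit n R" using assms by (auto simp: Xt_def)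
    then obtain v where "v \<noteq> 0" "P = torus_act n v R" using y by (auto simp: torus_orbit_def)
    moreover have "R \<in> carrier_vec (n + 1)" using R cover_carrier by auto
    ultimately have "x = y" using P R torus_orbit_act by simp
    then show "x \<in> V" using y by simp
  qed
qed auto

lemma orb_subset_iff:
  assumes "torus_inv n W" "U \<subseteq> Xt n"
  shows "orb n W \<subseteq> U \<longleftrightarrow> W \<subseteq> \<Union>U"
proof -
  have "orb n W \<subseteq> Xt n" using assms by (auto simp: orb_def Xt_def torus_inv_def)
  then show ?thesis using Xt_subset_iff[OF _ assms(2), of "orb n W"] Union_orb[OF assms(1)] by simp
qed

lemma torus_inv_Int: "torus_inv n V \<Longrightarrow> torus_inv n W \<Longrightarrow> torus_inv n (V \<inter> W)"
  by (auto simp: torus_inv_def)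

lemma Xt_open_Xt: "Xt_open n (Xt n)"
proof -
  have "zariski_open (n + 1) (cover n)"
    unfolding zariski_open_iff
  proof (intro conjI ballI cover_carrier)
    fix p assume "p \<in> cover n"
    then obtain i where "i < n" "p $ i \<noteq> 0" by (auto simp: cover_def)
    then show "\<exists>g\<in>polynomial_fun (n + 1). g p \<noteq> 0 \<and> (\<forall>q\<in>carrier_vec (n + 1). g q \<noteq> 0 \<longrightarrow> q \<in> cover n)"
      by (intro bexI[of _ "\<lambda>q. q $ i"] polynomial_fun.coord) (auto simp: cover_def)
  qed
  then show ?thesis using Xt_open_orb[OF torus_inv_cover] by (simp add: Xt_def orb_def)
qed

section \<open>Sections of the invertible sheaves and maps between different twists\<close>

lemma line_sheafI:
  assumes "regular_on (n + 1) (\<Union>U) f" "\<And>Q u. Q \<in> \<Union>U \<Longrightarrow> u \<noteq> 0 \<Longrightarrow> f (torus_act n u Q) = u powi l * f Q"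
    "\<And>Q. Q \<notin> \<Union>U \<Longrightarrow> f Q = 0"
  shows "f \<in> line_sheaf n l U"
  using assms unfolding line_sheaf_def by blast

lemma line_sheafD:
  assumes "f \<in> line_sheaf n l U"
  shows "regular_on (n + 1) (\<Union>U) f" "\<And>Q u. Q \<in> \<Union>U \<Longrightarrow> u \<noteq> 0 \<Longrightarrow> f (torus_act n u Q) = u powi l * f Q"
    "\<And>Q. Q \<notin> \<Union>U \<Longrightarrow> f Q = 0"
  using assms unfolding line_sheaf_def by blast+

lemma line_sheaf_zero: "Xt_open n U \<Longrightarrow> (\<lambda>_. 0) \<in> line_sheaf n l U"
  by (intro line_sheafI regular_on_const) (auto dest: Xt_openD)

lemma line_sheaf_add:
  assumes "Xt_open n U" "s \<in> line_sheaf n l U" "t \<in> line_sheaf n l U"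
  shows "(\<lambda>Q. s Q + t Q) \<in> line_sheaf n l U"
  using line_sheafD[OF assms(2)] line_sheafD[OF assms(3)] Xt_openD[OF assms(1)]
  by (intro line_sheafI regular_on_add) (auto simp: distrib_left)

lemma line_sheaf_scale:
  assumes "Xt_open n U" "s \<in> line_sheaf n l U"
  shows "(\<lambda>Q. c * s Q) \<in> line_sheaf n l U"
  using line_sheafD[OF assms(2)] Xt_openD[OF assms(1)]
  by (intro line_sheafI regular_on_scale) auto

lemma line_sheaf_diff:
  assumes "Xt_open n U" "s \<in> line_sheaf n l U" "t \<in> line_sheaf n l U"
  shows "(\<lambda>Q. s Q - t Q) \<in> line_sheaf n l U"
  using line_sheaf_add[OF assms(1,2) line_sheaf_scale[OF assms(1,3), of "-1"]] by simp

lemma line_sheaf_mult: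
  assumes V: "Xt_open n V" and W: "Xt_open n W" "W \<subseteq> V"
    and f: "f \<in> line_sheaf n k V" and s: "s \<in> line_sheaf n l W"
  shows "(\<lambda>Q. f Q * s Q) \<in> line_sheaf n (k + l) W"
proof (rule line_sheafI)
  have sub: "\<Union>W \<subseteq> \<Union>V" using W(2) by auto
  have "regular_on (n + 1) (\<Union>W) f"
    by (rule regular_on_subset[OF line_sheafD(1)[OF f] Xt_openD(3)[OF V] Xt_openD(2)[OF W(1)] sub])
  then show "regular_on (n + 1) (\<Union>W) (\<lambda>Q. f Q * s Q)"
    by (rule regular_on_mult[OF _ line_sheafD(1)[OF s] Xt_openD(3)[OF W(1)]])
  fix Q u assume "Q \<in> \<Union>W" and u: "(u::complex) \<noteq> 0"
  then show "f (torus_act n u Q) * s (torus_act n u Q) = u powi (k + l) * (f Q * s Q)"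
    using line_sheafD(2)[OF f _ u, of Q] line_sheafD(2)[OF s _ u, of Q] sub u by (auto simp: power_int_add)
qed (use line_sheafD(3)[OF s] in auto)

lemmas line_sheaf_mult0 = line_sheaf_mult[where k = 0, simplified]

lemma restr_line_sheaf:
  assumes "Xt_open n U" "Xt_open n V" "V \<subseteq> U" "s \<in> line_sheaf n l U"
  shows "restr V s \<in> line_sheaf n l V"
proof (rule line_sheafI)
  have sub: "\<Union>V \<subseteq> \<Union>U" using assms(3) by auto
  have "regular_on (n + 1) (\<Union>V) s"
    by (rule regular_on_subset[OF line_sheafD(1)[OF assms(4)] Xt_openD(3)[OF assms(1)] Xt_openD(2)[OF assms(2)] sub])
  then show "regular_on (n + 1) (\<Union>V) (restr V s)"
    using regular_on_cong[of "\<Union>V" "restr V s" s] by (simp add: restr_def)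
  fix Q u assume Q: "Q \<in> \<Union>V" and u: "(u::complex) \<noteq> 0"
  then have "torus_act n u Q \<in> \<Union>V" using Xt_openD(1)[OF assms(2)] unfolding torus_inv_def by blast
  then show "restr V s (torus_act n u Q) = u powi l * restr V s Q"
    using Q u line_sheafD(2)[OF assms(4), of Q u] sub by (auto simp: restr_def)
qed (simp add: restr_def)

text \<open>Off the preimage of U both sides are 0, as sections are extended by 0 and the complement
  is invariant too. This allows equivariance to be used along a whole line in
  \<open>pd_equivariant\<close>.\<close>

lemma line_sheaf_act:
  assumes U: "Xt_open n U" and s: "s \<in> line_sheaf n l U" and u: "u \<noteq> 0" and Q: "Q \<in> carrier_vec (n + 1)"
  shows "s (torus_act n u Q) = u powi l * s Q"
proof (cases "Q \<in> \<Union>U")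
  case True
  then show ?thesis using line_sheafD(2)[OF s _ u] by blast
next
  case False
  have "torus_act n u Q \<notin> \<Union>U"
  proof
    assume "torus_act n u Q \<in> \<Union>U"
    then have "torus_act n (inverse u) (torus_act n u Q) \<in> \<Union>U"
      using Xt_openD(1)[OF U] u unfolding torus_inv_def by (metis inverse_nonzero_iff_nonzero)
    then show False using False u Q by (simp add: torus_act_act torus_act_one)
  qed
  then show ?thesis using line_sheafD(3)[OF s] False by simp
qed

text \<open>\<open>sheaf_endo\<close> with possibly different source and target twists: a single
  coordinate or a single partial derivative changes the twist, and only suitable products of them
  are endomorphisms.\<close>

definition shom :: "nat \<Rightarrow> int \<Rightarrow> int \<Rightarrow> sheaf_op set" where
  "shom n l l' =
     {P. (\<forall>U. Xt_open n U \<longrightarrow>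
            (\<forall>s\<in>line_sheaf n l U. P U s \<in> line_sheaf n l' U) \<and>
            (\<forall>s\<in>line_sheaf n l U. \<forall>t\<in>line_sheaf n l U.
               P U (\<lambda>Q. s Q + t Q) = (\<lambda>Q. P U s Q + P U t Q)) \<and>
            (\<forall>c. \<forall>s\<in>line_sheaf n l U. P U (\<lambda>Q. c * s Q) = (\<lambda>Q. c * P U s Q))) \<and>
         (\<forall>U V. Xt_open n U \<and> Xt_open n V \<and> V \<subseteq> U \<longrightarrow>
            (\<forall>s\<in>line_sheaf n l U. P V (restr V s) = restr V (P U s))) \<and>
         (\<forall>U s. \<not> (Xt_open n U \<and> s \<in> line_sheaf n l U) \<longrightarrow> P U s = (\<lambda>_. 0))}"

lemma sheaf_endo_eq: "sheaf_endo n l = shom n l l"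
  by (simp add: sheaf_endo_def shom_def)

lemma shomD:
  assumes "P \<in> shom n l l'"
  shows "\<And>U s. Xt_open n U \<Longrightarrow> s \<in> line_sheaf n l U \<Longrightarrow> P U s \<in> line_sheaf n l' U"
    "\<And>U s t. Xt_open n U \<Longrightarrow> s \<in> line_sheaf n l U \<Longrightarrow> t \<in> line_sheaf n l U \<Longrightarrow>
        P U (\<lambda>Q. s Q + t Q) = (\<lambda>Q. P U s Q + P U t Q)"
    "\<And>U s c. Xt_open n U \<Longrightarrow> s \<in> line_sheaf n l U \<Longrightarrow> P U (\<lambda>Q. c * s Q) = (\<lambda>Q. c * P U s Q)"
    "\<And>U V s. Xt_open n U \<Longrightarrow> Xt_open n V \<Longrightarrow> V \<subseteq> U \<Longrightarrow> s \<in> line_sheaf n l U \<Longrightarrow> P V (restr V s) = restr V (P U s)"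
    "\<And>U s. \<not> (Xt_open n U \<and> s \<in> line_sheaf n l U) \<Longrightarrow> P U s = (\<lambda>_. 0)"
proof -
  note S = assms[unfolded shom_def mem_Collect_eq]
  fix U V s t and c :: complex
  show "P U s = (\<lambda>_. 0)" if "\<not> (Xt_open n U \<and> s \<in> line_sheaf n l U)"
    by (rule S[THEN conjunct2, THEN conjunct2, THEN spec, THEN spec, THEN mp, OF that])
  assume U: "Xt_open n U" and s: "s \<in> line_sheaf n l U"
  note SU = S[THEN conjunct1, THEN spec, THEN mp, OF U]
  show "P U s \<in> line_sheaf n l' U"
    by (rule SU[THEN conjunct1, THEN bspec, OF s])
  show "P U (\<lambda>Q. s Q + t Q) = (\<lambda>Q. P U s Q + P U t Q)" if "t \<in> line_sheaf n l U"
    by (rule SU[THEN conjunct2, THEN conjunct1, THEN bspec, OF s, THEN bspec, OF that])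
  show "P U (\<lambda>Q. c * s Q) = (\<lambda>Q. c * P U s Q)"
    by (rule SU[THEN conjunct2, THEN conjunct2, THEN spec, THEN bspec, OF s])
  show "P V (restr V s) = restr V (P U s)" if "Xt_open n V" "V \<subseteq> U"
    by (rule S[THEN conjunct2, THEN conjunct1, THEN spec, THEN spec, THEN mp, THEN bspec, OF _ s])
       (use U that in blast)
qed

lemma shomI:
  assumes "\<And>U s. Xt_open n U \<Longrightarrow> s \<in> line_sheaf n l U \<Longrightarrow> P U s \<in> line_sheaf n l' U"
    "\<And>U s t. Xt_open n U \<Longrightarrow> s \<in> line_sheaf n l U \<Longrightarrow> t \<in> line_sheaf n l U \<Longrightarrow>
        P U (\<lambda>Q. s Q + t Q) = (\<lambda>Q. P U s Q + P U t Q)"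
    "\<And>U s c. Xt_open n U \<Longrightarrow> s \<in> line_sheaf n l U \<Longrightarrow> P U (\<lambda>Q. c * s Q) = (\<lambda>Q. c * P U s Q)"
    "\<And>U V s. Xt_open n U \<Longrightarrow> Xt_open n V \<Longrightarrow> V \<subseteq> U \<Longrightarrow> s \<in> line_sheaf n l U \<Longrightarrow> P V (restr V s) = restr V (P U s)"
    "\<And>U s. \<not> (Xt_open n U \<and> s \<in> line_sheaf n l U) \<Longrightarrow> P U s = (\<lambda>_. 0)"
  shows "P \<in> shom n l l'"
  using assms unfolding shom_def by blast

lemma shom_zero:
  assumes "P \<in> shom n l l'"
  shows "P U (\<lambda>_. 0) = (\<lambda>_. 0)"
proof (cases "Xt_open n U")
  case True
  show ?thesis using shomD(3)[OF assms True line_sheaf_zero[OF True], of 0] by simp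
next
  case False
  then show ?thesis using shomD(5)[OF assms, of U "\<lambda>_. 0"] by simp
qed

lemma shom_comp:
  assumes P: "P \<in> shom n l' l''" and R: "R \<in> shom n l l'"
  shows "(\<lambda>U s. P U (R U s)) \<in> shom n l l''"
  by (rule shomI) (simp_all add: shomD(1-4)[OF R] shomD(1-4)[OF P] shomD(5)[OF R] shom_zero[OF P])

lemma restr_add: "restr V (\<lambda>Q. s Q + t Q) = (\<lambda>Q. restr V s Q + restr V t Q)"
  by (auto simp: restr_def)

lemma restr_scale: "restr V (\<lambda>Q. c * s Q) = (\<lambda>Q. c * restr V s Q)"
  by (auto simp: restr_def)

lemma shom_add:
  assumes P: "P \<in> shom n l l'" and R: "R \<in> shom n l l'"
  shows "(\<lambda>U s Q. P U s Q + R U s Q) \<in> shom n l l'"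
  by (rule shomI)
     (simp_all add: shomD(1-4)[OF R] shomD(1-4)[OF P] shomD(5)[OF R] shomD(5)[OF P] line_sheaf_add
        ac_simps distrib_left restr_add)

lemma shom_scale:
  assumes P: "P \<in> shom n l l'"
  shows "(\<lambda>U s Q. c * P U s Q) \<in> shom n l l'"
  by (rule shomI)
     (simp_all add: shomD(1-4)[OF P] shomD(5)[OF P] line_sheaf_scale
        ac_simps distrib_left restr_scale)

section \<open>Order of differential operators\<close>

lemma diff_order_0I:
  assumes "\<And>W s. Xt_open n W \<Longrightarrow> W \<subseteq> U \<Longrightarrow> s \<in> line_sheaf n l W \<Longrightarrow> P W s = (\<lambda>_. 0)"
  shows "diff_order_less n l 0 U P"
  unfolding diff_order_less.simps using assms by blast

lemma diff_order_SucI: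
  assumes "\<And>V f. Xt_open n V \<Longrightarrow> V \<subseteq> U \<Longrightarrow> f \<in> line_sheaf n 0 V \<Longrightarrow> diff_order_less n l k V (commutator P f)"
  shows "diff_order_less n l (Suc k) U P"
  unfolding diff_order_less.simps using assms by blast

lemma diff_order_cong:
  assumes "\<And>W s. Xt_open n W \<Longrightarrow> W \<subseteq> U \<Longrightarrow> s \<in> line_sheaf n l W \<Longrightarrow> P W s = R W s"
    and "diff_order_less n l k U P"
  shows "diff_order_less n l k U R"
  using assms
proof (induction k arbitrary: U P R)
  case 0
  then show ?case by simp
next
  case (Suc k)
  show ?case
    unfolding diff_order_less.simps
  proof (intro allI impI ballI)
    fix V f assume V: "Xt_open n V \<and> V \<subseteq> U" and f: "f \<in> line_sheaf n 0 V"
    show "diff_order_less n l k V (commutator R f)"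
    proof (rule Suc.IH[of V "commutator P f"])
      show "diff_order_less n l k V (commutator P f)" using Suc.prems(2) V f by simp
      fix W s assume W: "Xt_open n W" "W \<subseteq> V" and s: "s \<in> line_sheaf n l W"
      have "(\<lambda>Q. f Q * s Q) \<in> line_sheaf n l W" using line_sheaf_mult0 V W f s by blast
      moreover have "W \<subseteq> U" using W V by blast
      ultimately show "commutator P f W s = commutator R f W s"
        using Suc.prems(1)[of W] W s by (simp add: commutator_def)
    qed
  qed
qed

lemma diff_order_subset: "diff_order_less n l k U P \<Longrightarrow> V \<subseteq> U \<Longrightarrow> diff_order_less n l k V P"
  by (cases k) auto

lemma diff_order_Suc: "diff_order_less n l k U P \<Longrightarrow> diff_order_less n l (Suc k) U P"
proof (induction k arbitrary: U P)
  case 0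
  have "commutator P f W s = (\<lambda>_. 0)"
    if "Xt_open n V" "V \<subseteq> U" "f \<in> line_sheaf n 0 V" "Xt_open n W" "W \<subseteq> V" "s \<in> line_sheaf n l W" for V W f s
  proof -
    have "(\<lambda>Q. f Q * s Q) \<in> line_sheaf n l W" using line_sheaf_mult0 that by blast
    moreover have "W \<subseteq> U" using that by blast
    ultimately show ?thesis using 0 that by (simp add: commutator_def)
  qed
  then show ?case by (intro diff_order_SucI diff_order_0I)
next
  case (Suc k)
  then show ?case by (metis diff_order_less.simps(2))
qed

lemma diff_order_mono: "k \<le> k' \<Longrightarrow> diff_order_less n l k U P \<Longrightarrow> diff_order_less n l k' U P"
  by (induction rule: dec_induct) (auto simp del: diff_order_less.simps intro: diff_order_Suc)

lemma diff_order_lincomb: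
  assumes "diff_order_less n l k U P" "diff_order_less n l k U R"
  shows "diff_order_less n l k U (\<lambda>W s Q. a * P W s Q + b * R W s Q)"
  using assms
proof (induction k arbitrary: U P R)
  case (Suc k)
  have "commutator (\<lambda>W s Q. a * P W s Q + b * R W s Q) f
      = (\<lambda>W s Q. a * commutator P f W s Q + b * commutator R f W s Q)" for f
    by (simp add: commutator_def fun_eq_iff algebra_simps)
  then show ?case using Suc by simp
qed simp

text \<open>What remains of \<open>shom\<close> for \<open>commutator P f\<close> when f is given
  only over a smaller open set. The induction in \<open>diff_order_comp\<close> has to pass to such
  commutators.\<close>

definition linear_on :: "nat \<Rightarrow> int \<Rightarrow> int \<Rightarrow> complex vec set set \<Rightarrow> sheaf_op \<Rightarrow> bool" where
  "linear_on n l l' U P \<longleftrightarrow> (\<forall>W. Xt_open n W \<and> W \<subseteq> U \<longrightarrow>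
     (\<forall>s\<in>line_sheaf n l W. P W s \<in> line_sheaf n l' W) \<and>
     (\<forall>s\<in>line_sheaf n l W. \<forall>t\<in>line_sheaf n l W. P W (\<lambda>Q. s Q + t Q) = (\<lambda>Q. P W s Q + P W t Q)))"

lemma linear_onD:
  assumes "linear_on n l l' U P" "Xt_open n W" "W \<subseteq> U"
  shows "\<And>s. s \<in> line_sheaf n l W \<Longrightarrow> P W s \<in> line_sheaf n l' W"
    "\<And>s t. s \<in> line_sheaf n l W \<Longrightarrow> t \<in> line_sheaf n l W \<Longrightarrow> P W (\<lambda>Q. s Q + t Q) = (\<lambda>Q. P W s Q + P W t Q)"
  using assms unfolding linear_on_def by blast+

lemma shom_linear_on: "P \<in> shom n l l' \<Longrightarrow> linear_on n l l' U P"
  unfolding linear_on_def using shomD(1,2)[of P n l l'] by blast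

lemma linear_on_subset: "linear_on n l l' U P \<Longrightarrow> V \<subseteq> U \<Longrightarrow> linear_on n l l' V P"
  unfolding linear_on_def by blast

lemma linear_on_commutator:
  assumes P: "linear_on n l l' U P" and V: "Xt_open n V" "V \<subseteq> U" and f: "f \<in> line_sheaf n 0 V"
  shows "linear_on n l l' V (commutator P f)"
  unfolding linear_on_def
proof (intro allI impI conjI ballI)
  fix W s assume W: "Xt_open n W \<and> W \<subseteq> V" and s: "s \<in> line_sheaf n l W"
  have WU: "W \<subseteq> U" using W V by blast
  have fm: "(\<lambda>Q. f Q * t Q) \<in> line_sheaf n k W" if "t \<in> line_sheaf n k W" for t k
    using line_sheaf_mult0 V W f that by blast
  note D = linear_onD[OF P conjunct1[OF W] WU]
  show "commutator P f W s \<in> line_sheaf n l' W"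
    unfolding commutator_def using W by (intro line_sheaf_diff D(1) fm s) auto
  fix t assume t: "t \<in> line_sheaf n l W"
  show "commutator P f W (\<lambda>Q. s Q + t Q) = (\<lambda>Q. commutator P f W s Q + commutator P f W t Q)"
    using D(2)[OF fm[OF s] fm[OF t]] D(2)[OF s t]
    by (simp add: commutator_def distrib_left) (simp add: fun_eq_iff algebra_simps)
qed

text \<open>Induction on p + r by the identity [P R, f] = [P, f] R + P [R, f]. If p or r is 0, the
  composite vanishes by additivity.\<close>

lemma diff_order_comp:
  assumes "diff_order_less n l' p U P" "diff_order_less n l r U R"
    and "linear_on n l' l'' U P" "linear_on n l l' U R"
  shows "diff_order_less n l (p + r) U (\<lambda>W s. P W (R W s))"
  using assms
proof (induction "p + r" arbitrary: p r U P R)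
  case 0
  then show ?case using linear_onD(1)[OF "0.prems"(4)] by auto
next
  case (Suc m)
  show ?case
  proof (cases "p = 0 \<or> r = 0")
    case True
    have "P W (R W s) = (\<lambda>_. 0)" if W: "Xt_open n W" "W \<subseteq> U" and s: "s \<in> line_sheaf n l W" for W s
    proof -
      have Rs: "R W s \<in> line_sheaf n l' W" using linear_onD(1)[OF Suc.prems(4) W s] .
      have z: "P W (\<lambda>_. 0) = (\<lambda>_. 0)"
        using linear_onD(2)[OF Suc.prems(3) W line_sheaf_zero[OF W(1)] line_sheaf_zero[OF W(1)]] by (simp add: fun_eq_iff)
      show ?thesis using True
      proof
        assume "p = 0"
        then show ?thesis using Suc.prems(1) Rs W by simp
      next
        assume "r = 0"
        then have "R W s = (\<lambda>_. 0)" using Suc.prems(2) W s by simp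
        then show ?thesis using z by simp
      qed
    qed
    then have "diff_order_less n l 0 U (\<lambda>W s. P W (R W s))" by simp
    then show ?thesis using diff_order_mono[of 0 "p + r"] by blast
  next
    case False
    then obtain p' r' where pr: "p = Suc p'" "r = Suc r'" by (metis not0_implies_Suc)
    have "diff_order_less n l (p' + r) V (commutator (\<lambda>W s. P W (R W s)) f)"
      if V: "Xt_open n V" "V \<subseteq> U" and f: "f \<in> line_sheaf n 0 V" for V f
    proof -
      have lP: "linear_on n l' l'' V P" "linear_on n l' l'' V (commutator P f)"
        and lR: "linear_on n l l' V R" "linear_on n l l' V (commutator R f)"
        using linear_on_subset[OF Suc.prems(3) V(2)] linear_on_commutator[OF Suc.prems(3) V f]
          linear_on_subset[OF Suc.prems(4) V(2)] linear_on_commutator[OF Suc.prems(4) V f] by auto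
      have "diff_order_less n l' p' V (commutator P f)" "diff_order_less n l r' V (commutator R f)"
        using Suc.prems(1,2) V f pr by auto
      moreover have "diff_order_less n l' p V P" "diff_order_less n l r V R"
        using Suc.prems(1,2) V(2) diff_order_subset by blast+
      ultimately have 1: "diff_order_less n l (p' + r) V (\<lambda>W s. commutator P f W (R W s))"
        and 2: "diff_order_less n l (p + r') V (\<lambda>W s. P W (commutator R f W s))"
        using Suc.hyps(1)[of p' r "V" "commutator P f" R] Suc.hyps(1)[of p r' V P "commutator R f"] lP lR Suc.hyps(2) pr
        by auto
      have "diff_order_less n l (p' + r) V (\<lambda>W s Q. 1 * commutator P f W (R W s) Q + 1 * P W (commutator R f W s) Q)"
        by (rule diff_order_lincomb[OF 1]) (use 2 pr in simp)
      then show ?thesis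
      proof (rule diff_order_cong[rotated])
        fix W s assume W: "Xt_open n W" "W \<subseteq> V" and s: "s \<in> line_sheaf n l W"
        have Rs: "R W s \<in> line_sheaf n l' W" "commutator R f W s \<in> line_sheaf n l' W"
          using linear_onD(1)[OF lR(1) W s] linear_onD(1)[OF lR(2) W s] by auto
        have fRs: "(\<lambda>Q. f Q * R W s Q) \<in> line_sheaf n l' W" using line_sheaf_mult0 V W f Rs by blast
        have "R W (\<lambda>Q. f Q * s Q) = (\<lambda>Q. commutator R f W s Q + f Q * R W s Q)"
          by (simp add: commutator_def)
        then have "P W (R W (\<lambda>Q. f Q * s Q)) = (\<lambda>Q. P W (commutator R f W s) Q + P W (\<lambda>Q. f Q * R W s Q) Q)"
          using linear_onD(2)[OF lP(1) W Rs(2) fRs] by simp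
        then show "(\<lambda>Q. 1 * commutator P f W (R W s) Q + 1 * P W (commutator R f W s) Q)
            = commutator (\<lambda>W s. P W (R W s)) f W s"
          by (simp add: commutator_def fun_eq_iff)
      qed
    qed
    then show ?thesis unfolding pr(1) add_Suc by (intro diff_order_SucI)
  qed
qed

lemma diff_order_mult_op:
  assumes "\<And>W s. Xt_open n W \<Longrightarrow> W \<subseteq> U \<Longrightarrow> s \<in> line_sheaf n l W \<Longrightarrow> P W s = (\<lambda>Q. g Q * s Q)"
  shows "diff_order_less n l 1 U P"
proof -
  have "commutator P f W s = (\<lambda>_. 0)"
    if "Xt_open n V" "V \<subseteq> U" "f \<in> line_sheaf n 0 V" "Xt_open n W" "W \<subseteq> V" "s \<in> line_sheaf n l W" for V W f s
  proof -
    have "(\<lambda>Q. f Q * s Q) \<in> line_sheaf n l W" using line_sheaf_mult0 that by blast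
    moreover have "W \<subseteq> U" using that by blast
    ultimately show ?thesis using assms[of W] that by (simp add: commutator_def fun_eq_iff)
  qed
  then show ?thesis unfolding One_nat_def by (intro diff_order_SucI diff_order_0I)
qed

text \<open>One order bound on all of \<open>Xt n\<close> is stronger than the local bounds in
  \<open>diff_ops\<close> and passes directly to composites and linear combinations.\<close>

definition gdop :: "nat \<Rightarrow> int \<Rightarrow> int \<Rightarrow> sheaf_op \<Rightarrow> bool" where
  "gdop n l l' P \<longleftrightarrow> P \<in> shom n l l' \<and> (\<exists>k. diff_order_less n l k (Xt n) P)"

lemma gdop_comp:
  assumes "gdop n l' l'' P" "gdop n l l' R"
  shows "gdop n l l'' (\<lambda>U s. P U (R U s))"
proof -
  obtain p r where *: "diff_order_less n l' p (Xt n) P" "diff_order_less n l r (Xt n) R"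
    and **: "P \<in> shom n l' l''" "R \<in> shom n l l'" using assms by (auto simp: gdop_def)
  show ?thesis unfolding gdop_def
    using shom_comp[OF **] diff_order_comp[OF * shom_linear_on[OF **(1)] shom_linear_on[OF **(2)]] by blast
qed

lemma gdop_lincomb:
  assumes "gdop n l l' P" "gdop n l l' R"
  shows "gdop n l l' (\<lambda>U s Q. a * P U s Q + b * R U s Q)"
proof -
  obtain p r where "diff_order_less n l p (Xt n) P" "diff_order_less n l r (Xt n) R"
    using assms by (auto simp: gdop_def)
  then have "diff_order_less n l (max p r) (Xt n) P" "diff_order_less n l (max p r) (Xt n) R"
    using diff_order_mono[of _ "max p r"] by (meson max.cobounded1 max.cobounded2)+
  then show ?thesis
    using diff_order_lincomb shom_add[OF shom_scale shom_scale] assms unfolding gdop_def by blast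
qed

lemma gdop_diff_ops: "gdop n l l P \<Longrightarrow> P \<in> diff_ops n l"
  unfolding gdop_def diff_ops_def sheaf_endo_eq using Xt_open_Xt by blast

section \<open>Coordinates and partial derivatives as sheaf homomorphisms\<close>

definition bop :: "nat \<Rightarrow> int \<Rightarrow> ((complex vec \<Rightarrow> complex) \<Rightarrow> complex vec \<Rightarrow> complex) \<Rightarrow> sheaf_op" where
  "bop n l D = (\<lambda>U s. if Xt_open n U \<and> s \<in> line_sheaf n l U then restr U (D s) else (\<lambda>_. 0))"

lemma bop_shom:
  assumes reg: "\<And>U s. Xt_open n U \<Longrightarrow> s \<in> line_sheaf n l U \<Longrightarrow> regular_on (n + 1) (\<Union>U) (D s)"
    and equi: "\<And>U s Q u. Xt_open n U \<Longrightarrow> s \<in> line_sheaf n l U \<Longrightarrow> Q \<in> \<Union>U \<Longrightarrow> u \<noteq> 0 \<Longrightarrow>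
        D s (torus_act n u Q) = u powi l' * D s Q"
    and add: "\<And>U s t Q. Xt_open n U \<Longrightarrow> s \<in> line_sheaf n l U \<Longrightarrow> t \<in> line_sheaf n l U \<Longrightarrow> Q \<in> \<Union>U \<Longrightarrow>
        D (\<lambda>Q. s Q + t Q) Q = D s Q + D t Q"
    and scale: "\<And>U s c Q. Xt_open n U \<Longrightarrow> s \<in> line_sheaf n l U \<Longrightarrow> Q \<in> \<Union>U \<Longrightarrow> D (\<lambda>Q. c * s Q) Q = c * D s Q"
    and loc: "\<And>U V s Q. Xt_open n U \<Longrightarrow> Xt_open n V \<Longrightarrow> V \<subseteq> U \<Longrightarrow> s \<in> line_sheaf n l U \<Longrightarrow> Q \<in> \<Union>V \<Longrightarrow>
        D (restr V s) Q = D s Q"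
  shows "bop n l D \<in> shom n l l'"
proof (rule shomI)
  fix U s assume U: "Xt_open n U" and s: "s \<in> line_sheaf n l U"
  have e: "bop n l D U t = restr U (D t)" if "t \<in> line_sheaf n l U" for t using U that by (simp add: bop_def)
  show "bop n l D U s \<in> line_sheaf n l' U"
    unfolding e[OF s]
  proof (rule line_sheafI)
    show "regular_on (n + 1) (\<Union>U) (restr U (D s))"
      using regular_on_cong[of "\<Union>U" "restr U (D s)" "D s"] reg[OF U s] by (simp add: restr_def)
    fix Q u assume Q: "Q \<in> \<Union>U" and u: "(u::complex) \<noteq> 0"
    then have "torus_act n u Q \<in> \<Union>U" using Xt_openD(1)[OF U] unfolding torus_inv_def by blast
    then show "restr U (D s) (torus_act n u Q) = u powi l' * restr U (D s) Q"
      using equi[OF U s Q u] Q by (simp add: restr_def)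
  qed (simp add: restr_def)
  show "bop n l D U (\<lambda>Q. c * s Q) = (\<lambda>Q. c * bop n l D U s Q)" for c
    unfolding e[OF s] e[OF line_sheaf_scale[OF U s]] using scale[OF U s] by (auto simp: restr_def fun_eq_iff)
  show "bop n l D U (\<lambda>Q. s Q + t Q) = (\<lambda>Q. bop n l D U s Q + bop n l D U t Q)" if t: "t \<in> line_sheaf n l U" for t
    unfolding e[OF s] e[OF t] e[OF line_sheaf_add[OF U s t]] using add[OF U s t] by (auto simp: restr_def fun_eq_iff)
  show "bop n l D V (restr V s) = restr V (bop n l D U s)" if V: "Xt_open n V" "V \<subseteq> U" for V
  proof -
    have "restr V s \<in> line_sheaf n l V" by (rule restr_line_sheaf[OF U V s])
    then show ?thesis
      unfolding e[OF s] using loc[OF U V s] V by (auto simp: restr_def bop_def fun_eq_iff)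
  qed
qed (auto simp: bop_def)

definition mulop :: "nat \<Rightarrow> int \<Rightarrow> nat \<Rightarrow> sheaf_op" where
  "mulop n l i = bop n l (\<lambda>s Q. Q $ i * s Q)"

definition pdop :: "nat \<Rightarrow> int \<Rightarrow> nat \<Rightarrow> sheaf_op" where
  "pdop n l i = bop n l (pd (n + 1) i)"

definition idop :: "nat \<Rightarrow> int \<Rightarrow> sheaf_op" where
  "idop n l = (\<lambda>U s. if Xt_open n U \<and> s \<in> line_sheaf n l U then s else (\<lambda>_. 0))"

lemma restr_self: "s \<in> line_sheaf n l U \<Longrightarrow> restr U s = s"
  using line_sheafD(3)[of s n l U] by (auto simp: restr_def fun_eq_iff)

lemma gdop_idop: "gdop n l l (idop n l)"
proof -
  have "bop n l (\<lambda>s. s) \<in> shom n l l"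
    by (rule bop_shom) (auto simp: restr_def dest: line_sheafD)
  moreover have "bop n l (\<lambda>s. s) = idop n l"
    by (intro ext) (auto simp: bop_def idop_def restr_self)
  moreover have "diff_order_less n l 1 (Xt n) (idop n l)"
    by (rule diff_order_mult_op[where g = "\<lambda>_. 1"]) (simp add: idop_def)
  ultimately show ?thesis unfolding gdop_def by metis
qed

lemma gdop_mulop:
  assumes i: "i < n + 1"
  shows "gdop n l (l + wgt n i) (mulop n l i)"
proof -
  have "mulop n l i \<in> shom n l (l + wgt n i)"
    unfolding mulop_def
  proof (rule bop_shom)
    fix U s assume U: "Xt_open n U" and s: "s \<in> line_sheaf n l U"
    show "regular_on (n + 1) (\<Union>U) (\<lambda>Q. Q $ i * s Q)"
      by (intro regular_on_mult regular_on_coord Xt_openD[OF U] line_sheafD(1)[OF s] i)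
    show "torus_act n u Q $ i * s (torus_act n u Q) = u powi (l + wgt n i) * (Q $ i * s Q)"
      if "Q \<in> \<Union>U" "u \<noteq> 0" for Q u
      using torus_act_index[OF i, of u Q] line_sheafD(2)[OF s that] that(2) by (simp add: power_int_add)
  qed (auto simp: algebra_simps restr_def)
  moreover have "diff_order_less n l 1 (Xt n) (mulop n l i)"
  proof (rule diff_order_mult_op)
    fix W s assume "Xt_open n W" and s: "s \<in> line_sheaf n l W"
    then show "mulop n l i W s = (\<lambda>Q. Q $ i * s Q)"
      using line_sheafD(3)[OF s] by (auto simp: mulop_def bop_def restr_def fun_eq_iff)
  qed
  ultimately show ?thesis unfolding gdop_def by blast
qed

lemma eventually_line_in:
  assumes "zariski_open N W" "Q \<in> W" "i < N"
  shows "eventually (\<lambda>z. Q + z \<cdot>\<^sub>v unit_vec N i \<in> W) (nhds 0)"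
proof -
  have Qc: "Q \<in> carrier_vec N" using assms by (auto simp: zariski_open_iff)
  obtain g where g: "g \<in> polynomial_fun N" "g Q \<noteq> 0" "\<forall>q\<in>carrier_vec N. g q \<noteq> 0 \<longrightarrow> q \<in> W"
    using assms(1,2) unfolding zariski_open_iff by blast
  show ?thesis
    by (rule eventually_mono[OF eventually_line_nonzero[OF g(1) assms(3) Qc g(2)]]) (use g(3) Qc in auto)
qed

lemma pd_cong:
  assumes "zariski_open N W" "Q \<in> W" "i < N" "regular_on N W f" "\<And>q. q \<in> W \<Longrightarrow> g q = f q"
  shows "pd N i g Q = pd N i f Q"
proof (rule pd_eqI)
  have W: "W \<subseteq> carrier_vec N" using assms(1) by (simp add: zariski_open_iff)
  have "eventually (\<lambda>z. g (Q + z \<cdot>\<^sub>v unit_vec N i) = f (Q + z \<cdot>\<^sub>v unit_vec N i)) (nhds 0)"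
    by (rule eventually_mono[OF eventually_line_in[OF assms(1-3)]]) (rule assms(5))
  then show "((\<lambda>z. g (Q + z \<cdot>\<^sub>v unit_vec N i)) has_field_derivative pd N i f Q) (at 0)"
    using has_derivative_pd[OF assms(4) W assms(3,2)] by (simp only: DERIV_cong_ev[OF refl _ refl])
qed

text \<open>The action of u rescales the i-th coordinate direction by u to the power
  \<open>wgt n i\<close>, so by the chain rule the derivative loses that weight.\<close>

lemma pd_equivariant:
  assumes U: "Xt_open n U" and s: "s \<in> line_sheaf n l U" and Q: "Q \<in> \<Union>U" and u: "u \<noteq> 0" and i: "i < n + 1"
  shows "pd (n + 1) i s (torus_act n u Q) = u powi (l - wgt n i) * pd (n + 1) i s Q"
proof (rule pd_eqI)
  let ?e = "unit_vec (n + 1) i :: complex vec"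
  let ?k = "u powi (- wgt n i)"
  have Qc: "Q \<in> carrier_vec (n + 1)" using Xt_openD(3)[OF U] Q by blast
  have line: "torus_act n u Q + z \<cdot>\<^sub>v ?e = torus_act n u (Q + (z * ?k) \<cdot>\<^sub>v ?e)" for z
  proof (rule eq_vecI)
    fix j assume "j < dim_vec (torus_act n u (Q + (z * ?k) \<cdot>\<^sub>v ?e))"
    then have j: "j < n + 1" by (simp add: torus_act_def)
    then have "(torus_act n u Q + z \<cdot>\<^sub>v ?e) $ j = torus_act n u Q $ j + z * (if j = i then 1 else 0)"
      using i by auto
    moreover have "torus_act n u (Q + (z * ?k) \<cdot>\<^sub>v ?e) $ j = u powi wgt n j * (Q $ j + z * ?k * (if j = i then 1 else 0))"
      using i j Qc by (subst torus_act_index[OF j]) auto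
    ultimately show "(torus_act n u Q + z \<cdot>\<^sub>v ?e) $ j = torus_act n u (Q + (z * ?k) \<cdot>\<^sub>v ?e) $ j"
      using u by (simp add: torus_act_index[OF j] distrib_left power_int_minus)
  qed (simp add: torus_act_def)
  have eq: "s (torus_act n u Q + z \<cdot>\<^sub>v ?e) = u powi l * s (Q + (z * ?k) \<cdot>\<^sub>v ?e)" for z
    unfolding line using Qc by (intro line_sheaf_act[OF U s u]) auto
  have "((\<lambda>z. s (Q + z \<cdot>\<^sub>v ?e)) has_field_derivative pd (n + 1) i s Q) (at (0 * ?k))"
    using has_derivative_pd[OF line_sheafD(1)[OF s] Xt_openD(3)[OF U] i Q] by simp
  then have "((\<lambda>z. s (Q + (z * ?k) \<cdot>\<^sub>v ?e)) has_field_derivative pd (n + 1) i s Q * ?k) (at 0)"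
    by (rule DERIV_chain2) (auto intro!: derivative_eq_intros)
  then have "((\<lambda>z. u powi l * s (Q + (z * ?k) \<cdot>\<^sub>v ?e)) has_field_derivative u powi l * (pd (n + 1) i s Q * ?k)) (at 0)"
    by (rule DERIV_cmult)
  moreover have "u powi l * (pd (n + 1) i s Q * ?k) = u powi (l - wgt n i) * pd (n + 1) i s Q"
    using u by (simp add: power_int_diff power_int_minus field_simps)
  ultimately show "((\<lambda>z. s (torus_act n u Q + z \<cdot>\<^sub>v ?e)) has_field_derivative
      u powi (l - wgt n i) * pd (n + 1) i s Q) (at 0)"
    by (simp only: eq)
qed

lemma gdop_pdop:
  assumes i: "i < n + 1"
  shows "gdop n l (l - wgt n i) (pdop n l i)"
proof -
  have D: "((\<lambda>z. s (Q + z \<cdot>\<^sub>v unit_vec (n + 1) i)) has_field_derivative pd (n + 1) i s Q) (at 0)"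
    if "Xt_open n U" "s \<in> line_sheaf n k U" "Q \<in> \<Union>U" for U s Q k
    by (rule has_derivative_pd[OF line_sheafD(1)[OF that(2)] Xt_openD(3)[OF that(1)] i that(3)])
  have "pdop n l i \<in> shom n l (l - wgt n i)"
    unfolding pdop_def
  proof (rule bop_shom)
    fix U s assume U: "Xt_open n U" and s: "s \<in> line_sheaf n l U"
    show "regular_on (n + 1) (\<Union>U) (pd (n + 1) i s)"
      by (rule regular_on_pd[OF line_sheafD(1)[OF s] Xt_openD(3)[OF U] i])
    show "pd (n + 1) i (\<lambda>Q. c * s Q) Q = c * pd (n + 1) i s Q" if "Q \<in> \<Union>U" for c Q
      by (rule pd_eqI) (rule DERIV_cmult[OF D[OF U s that]])
    show "pd (n + 1) i (\<lambda>Q. s Q + t Q) Q = pd (n + 1) i s Q + pd (n + 1) i t Q"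
      if "t \<in> line_sheaf n l U" "Q \<in> \<Union>U" for t Q
      by (rule pd_eqI) (rule DERIV_add[OF D[OF U s that(2)] D[OF U that]])
    show "pd (n + 1) i (restr V s) Q = pd (n + 1) i s Q"
      if V: "Xt_open n V" "V \<subseteq> U" and Q: "Q \<in> \<Union>V" for V Q
    proof (rule pd_cong[OF Xt_openD(2)[OF V(1)] Q i])
      show "regular_on (n + 1) (\<Union>V) s"
        using regular_on_subset[OF line_sheafD(1)[OF s] Xt_openD(3)[OF U] Xt_openD(2)[OF V(1)]] V(2) by blast
    qed (auto simp: restr_def)
  qed (rule pd_equivariant[OF _ _ _ _ i])
  \<comment> \<open>By the Leibniz rule the commutator with f is multiplication by the derivative of
    f. \<open>Suc 1\<close> appears because the order is bounded strictly.\<close>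
  moreover have "diff_order_less n l (Suc 1) (Xt n) (pdop n l i)"
  proof (rule diff_order_SucI)
    fix V f assume V: "Xt_open n V" and f: "f \<in> line_sheaf n 0 V"
    show "diff_order_less n l 1 V (commutator (pdop n l i) f)"
    proof (rule diff_order_mult_op)
      fix W s assume W: "Xt_open n W" "W \<subseteq> V" and s: "s \<in> line_sheaf n l W"
      have fs: "(\<lambda>Q. f Q * s Q) \<in> line_sheaf n l W" by (rule line_sheaf_mult0[OF V W f s])
      have "pd (n + 1) i (\<lambda>Q. f Q * s Q) Q = pd (n + 1) i f Q * s Q + f Q * pd (n + 1) i s Q" if Q: "Q \<in> \<Union>W" for Q
      proof (rule pd_eqI)
        have "Q \<in> \<Union>V" using Q W(2) by blast
        moreover have "Q \<in> carrier_vec (n + 1)" using Q Xt_openD(3)[OF W(1)] by blast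
        ultimately show "((\<lambda>z. f (Q + z \<cdot>\<^sub>v unit_vec (n + 1) i) * s (Q + z \<cdot>\<^sub>v unit_vec (n + 1) i)) has_field_derivative
            pd (n + 1) i f Q * s Q + f Q * pd (n + 1) i s Q) (at 0)"
          by (intro DERIV_cong[OF DERIV_mult[OF D[OF V f] D[OF W(1) s Q]]]) (simp_all add: line_zero mult.commute)
      qed
      then show "commutator (pdop n l i) f W s = (\<lambda>Q. pd (n + 1) i f Q * s Q)"
        using W s fs line_sheafD(3)[OF s] by (auto simp: commutator_def pdop_def bop_def restr_def fun_eq_iff)
    qed
  qed
  ultimately show ?thesis unfolding gdop_def by blast
qed

section \<open>Laurent series expansions of sections over the torus\<close>

text \<open>The open dense torus of the toric variety.\<close>

definition TT :: "nat \<Rightarrow> complex vec set set" where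
  "TT n = orb n (tor (n + 1))"

text \<open>
  The monomial \<open>Q\<^sub>1\<^sup>a\<^sup>1 \<cdots> Q\<^sub>n\<^sup>a\<^sup>n t\<^sup>m\<close> with \<open>t = Q\<^sub>n\<^sub>+\<^sub>1\<close> has weight \<open>|a| - 2 m\<close>, so it is a section of
  \<open>\<O>(l D\<^sub>0)\<close> iff \<open>a \<in> lat n l\<close> and \<open>m = tdeg n l a\<close>.
\<close>

definition lat :: "nat \<Rightarrow> int \<Rightarrow> (nat \<Rightarrow> int) set" where
  "lat n l = {a. (\<forall>i\<ge>n. a i = 0) \<and> even (sum a {..<n} - l)}"

definition tdeg :: "nat \<Rightarrow> int \<Rightarrow> (nat \<Rightarrow> int) \<Rightarrow> int" where
  "tdeg n l a = (sum a {..<n} - l) div 2"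

definition mono_exp :: "nat \<Rightarrow> int \<Rightarrow> (nat \<Rightarrow> int) \<Rightarrow> nat \<Rightarrow> int" where
  "mono_exp n l a = a(n := tdeg n l a)"

definition lmono :: "nat \<Rightarrow> int \<Rightarrow> (nat \<Rightarrow> int) \<Rightarrow> complex vec \<Rightarrow> complex" where
  "lmono n l a Q = (if Q \<in> tor (n + 1) then lm (n + 1) (mono_exp n l a) Q else 0)"

definition fsupp :: "nat \<Rightarrow> int \<Rightarrow> exp_fun set" where
  "fsupp n l = {u. finite {a. u a \<noteq> 0} \<and> (\<forall>a. u a \<noteq> 0 \<longrightarrow> a \<in> lat n l)}"

definition lser :: "nat \<Rightarrow> int \<Rightarrow> exp_fun \<Rightarrow> complex vec \<Rightarrow> complex" where
  "lser n l u Q = (\<Sum>a | u a \<noteq> 0. u a * lmono n l a Q)"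

lemma tdeg_eq: "a \<in> lat n l \<Longrightarrow> 2 * tdeg n l a = sum a {..<n} - l"
  by (simp add: lat_def tdeg_def)

lemma torus_inv_nz:
  assumes "I \<subseteq> {..<n + 1}" "i \<in> I" "i < n"
  shows "torus_inv n (nz (n + 1) I)"
  unfolding torus_inv_def
proof safe
  fix Q assume Q: "Q \<in> nz (n + 1) I"
  then show "Q \<in> cover n" using assms by (auto simp: nz_def cover_def)
  fix u :: complex assume "u \<noteq> 0"
  then show "torus_act n u Q \<in> nz (n + 1) I"
    using Q assms(1) torus_act_carrier[of n u Q] by (auto simp: nz_def torus_act_index simp del: torus_act_carrier)
qed

lemma torus_inv_tor: "n \<ge> 1 \<Longrightarrow> torus_inv n (tor (n + 1))"
  by (rule torus_inv_nz[of _ _ 0]) auto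

lemma zariski_open_tor: "zariski_open N (tor N)"
  by (rule zariski_open_nz) simp

lemma Union_TT: "n \<ge> 1 \<Longrightarrow> \<Union>(TT n) = tor (n + 1)"
  unfolding TT_def by (rule Union_orb[OF torus_inv_tor])

lemma Xt_open_TT: "n \<ge> 1 \<Longrightarrow> Xt_open n (TT n)"
  unfolding TT_def by (rule Xt_open_orb[OF torus_inv_tor zariski_open_tor])

lemma regular_on_lm: "regular_on N (tor N) (lm N \<beta>)"
  unfolding lm_def
  by (intro regular_on_prod regular_on_powi regular_on_coord zariski_open_tor) (auto simp: nz_def)

lemma lm_act:
  assumes "u \<noteq> 0"
  shows "lm (n + 1) \<beta> (torus_act n u Q) = u powi (sum \<beta> {..<n} - 2 * \<beta> n) * lm (n + 1) \<beta> Q"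
proof -
  have "lm (n + 1) \<beta> (torus_act n u Q) = (\<Prod>i<n + 1. u powi (wgt n i * \<beta> i) * Q $ i powi \<beta> i)"
    unfolding lm_def by (intro prod.cong refl) (simp add: torus_act_index power_int_mult_distrib power_int_mult)
  also have "\<dots> = (\<Prod>i<n + 1. u powi (wgt n i * \<beta> i)) * lm (n + 1) \<beta> Q"
    by (simp add: prod.distrib lm_def)
  also have "(\<Prod>i<m. u powi (wgt n i * \<beta> i)) = u powi (\<Sum>i<m. wgt n i * \<beta> i)" for m
    using assms by (induction m) (simp_all add: power_int_add)
  also have "(\<Sum>i<n + 1. wgt n i * \<beta> i) = sum \<beta> {..<n} - 2 * \<beta> n"
    by (simp add: wgt_def)
  finally show ?thesis .
qed

lemma lmono_section:
  assumes n: "n \<ge> 1" and a: "a \<in> lat n l"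
  shows "lmono n l a \<in> line_sheaf n l (TT n)"
proof (rule line_sheafI, unfold Union_TT[OF n])
  show "regular_on (n + 1) (tor (n + 1)) (lmono n l a)"
    using regular_on_cong[of "tor (n + 1)" "lmono n l a" "lm (n + 1) (mono_exp n l a)"] regular_on_lm
    by (simp add: lmono_def)
  fix Q u assume Q: "Q \<in> tor (n + 1)" and u: "(u::complex) \<noteq> 0"
  have "torus_act n u Q \<in> tor (n + 1)" using torus_inv_tor[OF n] Q u unfolding torus_inv_def by blast
  moreover have "sum (mono_exp n l a) {..<n} - 2 * mono_exp n l a n = l"
    using tdeg_eq[OF a] by (simp add: mono_exp_def)
  ultimately show "lmono n l a (torus_act n u Q) = u powi l * lmono n l a Q"
    using Q lm_act[OF u, of n "mono_exp n l a" Q] by (simp add: lmono_def)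
qed (simp add: lmono_def)

lemma line_sheaf_sum:
  assumes "Xt_open n U" "\<And>i. i \<in> A \<Longrightarrow> s i \<in> line_sheaf n l U"
  shows "(\<lambda>Q. \<Sum>i\<in>A. c i * s i Q) \<in> line_sheaf n l U"
  using assms(2)
  by (induction A rule: infinite_finite_induct)
     (auto intro!: line_sheaf_zero line_sheaf_add line_sheaf_scale assms(1))

lemma shom_sum:
  assumes P: "P \<in> shom n l l'" and U: "Xt_open n U" and s: "\<And>i. i \<in> A \<Longrightarrow> s i \<in> line_sheaf n l U"
  shows "P U (\<lambda>Q. \<Sum>i\<in>A. c i * s i Q) = (\<lambda>Q. \<Sum>i\<in>A. c i * P U (s i) Q)"
  using s
proof (induction A rule: infinite_finite_induct)
  case (insert i A)
  have "P U (\<lambda>Q. c i * s i Q + (\<Sum>i\<in>A. c i * s i Q)) = (\<lambda>Q. c i * P U (s i) Q + (\<Sum>i\<in>A. c i * P U (s i) Q))"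
    using shomD(2)[OF P U line_sheaf_scale[OF U] line_sheaf_sum[OF U], of "s i" A s "c i" c]
      shomD(3)[OF P U, of "s i" "c i"] insert by simp
  then show ?case using insert.hyps by simp
qed (simp_all add: shom_zero[OF P])

lemma lser_superset:
  assumes "finite A" "{a. u a \<noteq> 0} \<subseteq> A"
  shows "lser n l u Q = (\<Sum>a\<in>A. u a * lmono n l a Q)"
  unfolding lser_def using assms by (intro sum.mono_neutral_left) auto

text \<open>P acts on sections over the torus as T acts on their coefficients. Nothing is required
  of T outside the finitely supported functions on \<open>lat n l\<close>, so T may be given by a
  formula that makes sense on all exponents.\<close>

definition matched :: "nat \<Rightarrow> int \<Rightarrow> int \<Rightarrow> sheaf_op \<Rightarrow> lin_op \<Rightarrow> bool" where
  "matched n l l' P T \<longleftrightarrow> gdop n l l' P \<and>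
     (\<forall>u\<in>fsupp n l. app T u \<in> fsupp n l' \<and> P (TT n) (lser n l u) = lser n l' (app T u))"

lemma matched_comp:
  assumes "matched n l' l'' P T" "matched n l l' R S"
  shows "matched n l l'' (\<lambda>U s. P U (R U s)) (T * S)"
  using assms gdop_comp unfolding matched_def by (auto simp: app_simps)

lemma matched_lincomb:
  assumes P: "matched n l l' P T" and R: "matched n l l' R S"
  shows "matched n l l' (\<lambda>U s Q. a * P U s Q + b * R U s Q) (scal a * T + scal b * S)"
  unfolding matched_def
proof (intro conjI ballI)
  show "gdop n l l' (\<lambda>U s Q. a * P U s Q + b * R U s Q)"
    using P R by (intro gdop_lincomb) (auto simp: matched_def)
  fix u assume u: "u \<in> fsupp n l"
  let ?v = "app T u" and ?w = "app S u"
  have v: "?v \<in> fsupp n l'" "P (TT n) (lser n l u) = lser n l' ?v"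
    and w: "?w \<in> fsupp n l'" "R (TT n) (lser n l u) = lser n l' ?w"
    using P R u by (auto simp: matched_def)
  have x: "app (scal a * T + scal b * S) u = (\<lambda>c. a * ?v c + b * ?w c)"
    by (simp add: app_simps app_scal)
  let ?A = "{c. ?v c \<noteq> 0} \<union> {c. ?w c \<noteq> 0}"
  have fin: "finite ?A" using v w by (simp add: fsupp_def)
  have sub: "{c. a * ?v c + b * ?w c \<noteq> 0} \<subseteq> ?A" by auto
  show "app (scal a * T + scal b * S) u \<in> fsupp n l'"
    unfolding x using finite_subset[OF sub fin] v(1) w(1) sub by (auto simp: fsupp_def)
  show "(\<lambda>Q. a * P (TT n) (lser n l u) Q + b * R (TT n) (lser n l u) Q) = lser n l' (app (scal a * T + scal b * S) u)"
    unfolding fun_eq_iff x v(2) w(2) lser_superset[OF fin sub] lser_superset[OF fin, of ?v, OF Un_upper1] lser_superset[OF fin, of ?w, OF Un_upper2]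
    by (simp add: algebra_simps sum.distrib sum_distrib_left)
qed

lemma matched_Sh:
  assumes n: "n \<ge> 1" and P: "gdop n l l' P"
    and e: "\<And>a. a \<in> lat n l \<Longrightarrow> (\<lambda>i. a i + e i) \<in> lat n l'"
    and act: "\<And>a. a \<in> lat n l \<Longrightarrow> P (TT n) (lmono n l a) = (\<lambda>Q. \<phi> a * lmono n l' (\<lambda>i. a i + e i) Q)"
  shows "matched n l l' P (Sh e \<phi>)"
  unfolding matched_def
proof (intro conjI ballI P)
  fix u assume u: "u \<in> fsupp n l"
  let ?A = "{a. u a \<noteq> 0}"
  let ?sh = "\<lambda>a i. a i + e i :: int"
  let ?v = "app (Sh e \<phi>) u"
  have fin: "finite ?A" and lat: "\<And>a. a \<in> ?A \<Longrightarrow> a \<in> lat n l" using u by (auto simp: fsupp_def)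
  have inj: "inj_on ?sh ?A" by (auto simp: inj_on_def fun_eq_iff)
  have sub: "{b. ?v b \<noteq> 0} \<subseteq> ?sh ` ?A"
  proof
    fix b assume "b \<in> {b. ?v b \<noteq> 0}"
    then have "(\<lambda>i. b i - e i) \<in> ?A" by (auto simp: app_simps)
    then have "?sh (\<lambda>i. b i - e i) \<in> ?sh ` ?A" by (rule imageI)
    then show "b \<in> ?sh ` ?A" by simp
  qed
  have fin': "finite (?sh ` ?A)" using fin by simp
  show "?v \<in> fsupp n l'"
    using finite_subset[OF sub fin'] sub e lat by (fastforce simp: fsupp_def)
  have "P (TT n) (lser n l u) = (\<lambda>Q. \<Sum>a\<in>?A. u a * P (TT n) (lmono n l a) Q)"
    unfolding lser_def[abs_def]
    by (rule shom_sum[OF _ Xt_open_TT[OF n]]) (use P lat lmono_section[OF n] in \<open>auto simp: gdop_def\<close>)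
  also have "\<dots> = (\<lambda>Q. \<Sum>a\<in>?A. ?v (?sh a) * lmono n l' (?sh a) Q)"
    using act lat by (auto simp: fun_eq_iff app_simps intro!: sum.cong)
  also have "\<dots> = lser n l' ?v"
    unfolding fun_eq_iff lser_superset[OF fin' sub] sum.reindex[OF inj] by simp
  finally show "P (TT n) (lser n l u) = lser n l' ?v" .
qed

lemma matched_idop: "n \<ge> 1 \<Longrightarrow> matched n l l (idop n l) 1"
  unfolding Sh_one[symmetric]
  by (rule matched_Sh[OF _ gdop_idop]) (auto simp: idop_def Xt_open_TT lmono_section)

lemma tor_index: "Q \<in> tor (n + 1) \<Longrightarrow> i < n + 1 \<Longrightarrow> Q $ i \<noteq> 0"
  by (auto simp: nz_def)

lemma lm_index_mult:
  assumes "Q \<in> tor N" "i < N"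
  shows "Q $ i * lm N \<beta> Q = lm N (\<beta>(i := \<beta> i + 1)) Q"
proof -
  have *: "lm N \<gamma> Q = Q $ i powi \<gamma> i * (\<Prod>j\<in>{..<N} - {i}. Q $ j powi \<gamma> j)" for \<gamma>
    unfolding lm_def using assms(2) by (subst prod.remove[of _ i]) auto
  have "Q $ i \<noteq> 0" using assms by (auto simp: nz_def)
  then show ?thesis unfolding * by (simp add: power_int_add mult.assoc mult.left_commute)
qed

lemma pd_lm:
  assumes Q: "Q \<in> tor N" and i: "i < N"
  shows "pd N i (lm N \<beta>) Q = of_int (\<beta> i) * lm N (\<beta>(i := \<beta> i - 1)) Q"
proof (rule pd_eqI)
  let ?R = "\<Prod>j\<in>{..<N} - {i}. Q $ j powi \<beta> j"
  have Qc: "Q \<in> carrier_vec N" and Qi: "Q $ i \<noteq> 0" using assms by (auto simp: nz_def)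
  have "lm N \<beta> (Q + z \<cdot>\<^sub>v unit_vec N i) = (Q $ i + z) powi \<beta> i * ?R" for z
    unfolding lm_def using i Qc by (subst prod.remove[of _ i]) (auto intro!: prod.cong)
  moreover have "((\<lambda>z. (Q $ i + z) powi \<beta> i * ?R) has_field_derivative of_int (\<beta> i) * Q $ i powi (\<beta> i - 1) * ?R) (at 0)"
    using Qi by (auto intro!: derivative_eq_intros)
  moreover have "lm N (\<beta>(i := \<beta> i - 1)) Q = Q $ i powi (\<beta> i - 1) * ?R"
    unfolding lm_def using i by (subst prod.remove[of _ i]) (auto intro!: prod.cong)
  ultimately show "((\<lambda>z. lm N \<beta> (Q + z \<cdot>\<^sub>v unit_vec N i)) has_field_derivative of_int (\<beta> i) * lm N (\<beta>(i := \<beta> i - 1)) Q) (at 0)"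
    by (simp add: mult.assoc)
qed

lemma sum_unit_exp: "i < n \<Longrightarrow> (\<Sum>j<n. a j + unit_exp i j) = sum a {..<n} + 1"
  "i < n \<Longrightarrow> (\<Sum>j<n. a j - unit_exp i j) = sum a {..<n} - 1"
  by (simp_all add: sum.distrib sum_subtractf unit_exp_def)

lemma mulop_lmono:
  assumes n: "n \<ge> 1" and a: "a \<in> lat n l" and i: "i < n + 1" and b: "mono_exp n (l + wgt n i) b = (mono_exp n l a)(i := mono_exp n l a i + 1)"
  shows "mulop n l i (TT n) (lmono n l a) = lmono n (l + wgt n i) b"
  using Xt_open_TT[OF n] lmono_section[OF n a] lm_index_mult[OF _ i] Union_TT[OF n]
  by (auto simp: mulop_def bop_def restr_def fun_eq_iff lmono_def b)

lemma pdop_lmono: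
  assumes n: "n \<ge> 1" and a: "a \<in> lat n l" and i: "i < n + 1" and b: "mono_exp n (l - wgt n i) b = (mono_exp n l a)(i := mono_exp n l a i - 1)"
  shows "pdop n l i (TT n) (lmono n l a) = (\<lambda>Q. of_int (mono_exp n l a i) * lmono n (l - wgt n i) b Q)"
proof -
  have "pd (n + 1) i (lmono n l a) Q = of_int (mono_exp n l a i) * lm (n + 1) (mono_exp n (l - wgt n i) b) Q"
    if "Q \<in> tor (n + 1)" for Q
    unfolding b pd_lm[OF that i, symmetric]
    by (rule pd_cong[OF zariski_open_tor that i regular_on_lm]) (simp add: lmono_def)
  then show ?thesis
    using Xt_open_TT[OF n] lmono_section[OF n a] Union_TT[OF n]
    by (auto simp: pdop_def bop_def restr_def fun_eq_iff lmono_def)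
qed

text \<open>The exponent of t enters only through \<open>tdeg\<close>. Lowering the twist by 2
  raises it by 1, so multiplication by t leaves a unchanged and is the identity; for the derivative
  in t the symbol is the exponent of t itself.\<close>

lemma matched_basic:
  assumes n: "n \<ge> 1"
  shows "i < n \<Longrightarrow> matched n l (l + 1) (mulop n l i) (Xop i)"
    "matched n l (l - 2) (mulop n l n) 1"
    "i < n \<Longrightarrow> matched n l (l - 1) (pdop n l i) (Dop i)"
    "matched n l (l + 2) (pdop n l n) (Sh (\<lambda>_. 0) (\<lambda>a. (of_int (sum a {..<n}) - of_int l) / 2))"
proof -
  assume i: "i < n"
  show "matched n l (l + 1) (mulop n l i) (Xop i)"
    unfolding Xop_def
  proof (rule matched_Sh[OF n])
    show "gdop n l (l + 1) (mulop n l i)" using gdop_mulop[of i n l] i by (simp add: wgt_def)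
    fix a assume a: "a \<in> lat n l"
    show "(\<lambda>j. a j + unit_exp i j) \<in> lat n (l + 1)"
      using a sum_unit_exp(1)[OF i, of a] i by (simp add: lat_def unit_exp_def)
    have "mulop n l i (TT n) (lmono n l a) = lmono n (l + wgt n i) (\<lambda>j. a j + unit_exp i j)"
      by (rule mulop_lmono[OF n a])
         (use i sum_unit_exp(1)[OF i, of a] in \<open>auto simp: mono_exp_def wgt_def tdeg_def unit_exp_def fun_eq_iff\<close>)
    then show "mulop n l i (TT n) (lmono n l a) = (\<lambda>Q. 1 * lmono n (l + 1) (\<lambda>j. a j + unit_exp i j) Q)"
      using i by (simp add: wgt_def)
  qed
next
  assume i: "i < n"
  show "matched n l (l - 1) (pdop n l i) (Dop i)"
    unfolding Dop_def
  proof (rule matched_Sh[OF n])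
    show "gdop n l (l - 1) (pdop n l i)" using gdop_pdop[of i n l] i by (simp add: wgt_def)
    fix a assume a: "a \<in> lat n l"
    show "(\<lambda>j. a j + - unit_exp i j) \<in> lat n (l - 1)"
      using a sum_unit_exp(2)[OF i, of a] i by (simp add: lat_def unit_exp_def)
    have "pdop n l i (TT n) (lmono n l a) = (\<lambda>Q. of_int (mono_exp n l a i) * lmono n (l - wgt n i) (\<lambda>j. a j + - unit_exp i j) Q)"
      by (rule pdop_lmono[OF n a])
         (use i sum_unit_exp(2)[OF i, of a] in \<open>auto simp: mono_exp_def wgt_def tdeg_def unit_exp_def fun_eq_iff\<close>)
    then show "pdop n l i (TT n) (lmono n l a) = (\<lambda>Q. of_int (a i) * lmono n (l - 1) (\<lambda>j. a j + - unit_exp i j) Q)"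
      using i by (simp add: wgt_def mono_exp_def)
  qed
next
  show "matched n l (l - 2) (mulop n l n) 1"
    unfolding Sh_one[symmetric]
  proof (rule matched_Sh[OF n])
    show "gdop n l (l - 2) (mulop n l n)" using gdop_mulop[of n n l] by (simp add: wgt_def)
    fix a assume a: "a \<in> lat n l"
    then show "(\<lambda>j. a j + 0) \<in> lat n (l - 2)" by (simp add: lat_def)
    have "tdeg n (l - 2) a = tdeg n l a + 1"
      by (simp add: tdeg_def)
    then have "mulop n l n (TT n) (lmono n l a) = lmono n (l + wgt n n) a"
      by (intro mulop_lmono[OF n a]) (auto simp: mono_exp_def wgt_def fun_eq_iff)
    then show "mulop n l n (TT n) (lmono n l a) = (\<lambda>Q. 1 * lmono n (l - 2) (\<lambda>j. a j + 0) Q)"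
      by (simp add: wgt_def)
  qed
  show "matched n l (l + 2) (pdop n l n) (Sh (\<lambda>_. 0) (\<lambda>a. (of_int (sum a {..<n}) - of_int l) / 2))"
  proof (rule matched_Sh[OF n])
    show "gdop n l (l + 2) (pdop n l n)" using gdop_pdop[of n n l] by (simp add: wgt_def)
    fix a assume a: "a \<in> lat n l"
    then show "(\<lambda>j. a j + 0) \<in> lat n (l + 2)" by (simp add: lat_def)
    have "tdeg n (l + 2) a = tdeg n l a - 1"
      by (simp add: tdeg_def)
    then have "pdop n l n (TT n) (lmono n l a) = (\<lambda>Q. of_int (mono_exp n l a n) * lmono n (l - wgt n n) a Q)"
      by (intro pdop_lmono[OF n a]) (auto simp: mono_exp_def wgt_def fun_eq_iff)
    moreover have "(of_int (sum a {..<n}) - of_int l) / 2 = (of_int (tdeg n l a) :: complex)"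
      using arg_cong[OF tdeg_eq[OF a], of "of_int :: int \<Rightarrow> complex"] by (simp add: mult.commute)
    ultimately show "pdop n l n (TT n) (lmono n l a) =
        (\<lambda>Q. (of_int (sum a {..<n}) - of_int l) / 2 * lmono n (l + 2) (\<lambda>j. a j + 0) Q)"
      by (simp add: wgt_def mono_exp_def)
  qed
qed

section \<open>Sheaf operators realizing the generators\<close>

definition realizable :: "nat \<Rightarrow> int \<Rightarrow> lin_op set" where
  "realizable n l = {T. \<exists>P. matched n l l P T}"

lemma realizable_lincomb:
  assumes "T \<in> realizable n l" "S \<in> realizable n l"
  shows "scal a * T + scal b * S \<in> realizable n l"
  using assms matched_lincomb unfolding realizable_def by blast

lemma realizable_add: "T \<in> realizable n l \<Longrightarrow> S \<in> realizable n l \<Longrightarrow> T + S \<in> realizable n l"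
  using realizable_lincomb[of T n l S 1 1] by (simp add: scal_simps)

lemma realizable_scale: "T \<in> realizable n l \<Longrightarrow> scal c * T \<in> realizable n l"
  using realizable_lincomb[of T n l T c 0] by (simp add: scal_simps)

lemma realizable_mult: "T \<in> realizable n l \<Longrightarrow> S \<in> realizable n l \<Longrightarrow> T * S \<in> realizable n l"
  using matched_comp unfolding realizable_def by blast

lemma realizable_one: "n \<ge> 1 \<Longrightarrow> 1 \<in> realizable n l"
  using matched_idop unfolding realizable_def by blast

lemma realizable_zero: "n \<ge> 1 \<Longrightarrow> 0 \<in> realizable n l"
  using realizable_scale[OF realizable_one, of n 0 l] by (simp add: scal_simps)

lemma realizable_sum:
  assumes "n \<ge> 1" "\<And>i. i \<in> A \<Longrightarrow> f i \<in> realizable n l"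
  shows "(\<Sum>i\<in>A. f i) \<in> realizable n l"
  using assms(2)
  by (induction A rule: infinite_finite_induct) (auto intro: realizable_add realizable_zero assms(1))

text \<open>The exponent of t, that is, the Euler operator of t. It is defined at all exponents,
  also those of the wrong parity, hence the division in the complex numbers.\<close>

definition tau :: "nat \<Rightarrow> int \<Rightarrow> lin_op" where
  "tau n l = Sh (\<lambda>_. 0) (\<lambda>a. (of_int (sum a {..<n}) - of_int l) / 2)"

text \<open>The twists of the factors have to add up to 0. This forces a factor t next to two
  coordinates and a derivative in t next to two derivatives, while a coordinate and a derivative
  balance each other.\<close>

lemma realizable_quadratic:
  assumes n: "n \<ge> 1" and ij: "i < n" "j < n"
  shows "Xop i * Xop j \<in> realizable n l" "Xop i * Dop j \<in> realizable n l" "Dop i * Xop j \<in> realizable n l"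
    "Dop i * Dop j * tau n l \<in> realizable n l"
proof -
  note B = matched_basic[OF n]
  have "l + 1 + 1 - 2 = l" "l - 1 + 1 = l" "l + 1 - 1 = l" "l + 2 - 1 - 1 = l" by auto
  note eq = this
  show "Xop i * Xop j \<in> realizable n l"
    using matched_comp[OF B(2) matched_comp[OF B(1)[OF ij(1)] B(1)[OF ij(2), of l]]]
    unfolding realizable_def eq by auto
  show "Xop i * Dop j \<in> realizable n l"
    using matched_comp[OF B(1)[OF ij(1)] B(3)[OF ij(2), of l]]
    unfolding realizable_def eq by auto
  show "Dop i * Xop j \<in> realizable n l"
    using matched_comp[OF B(3)[OF ij(1)] B(1)[OF ij(2), of l]]
    unfolding realizable_def eq by auto
  show "Dop i * Dop j * tau n l \<in> realizable n l"
    using matched_comp[OF B(3)[OF ij(1)] matched_comp[OF B(3)[OF ij(2)] B(4)[of l]]]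
    unfolding realizable_def eq tau_def mult.assoc by auto
qed

lemma realizable_wop:
  assumes n: "n \<ge> 1" and rc: "r < 2*n" "c < 2*n" and not: "\<not> (r < n \<and> c < n)"
  shows "wop n r * wop n c \<in> realizable n l"
  unfolding wop_def using realizable_quadratic[OF n] rc not by auto

text \<open>The coefficients of the products of two derivatives are the entries of the upper right
  block, which has degree 1 and is therefore zero in X.\<close>

lemma realizable_rho:
  assumes n: "n \<ge> 1" and X: "X \<in> graded_part n k" and k: "k \<noteq> 1"
  shows "rho n X \<in> realizable n l"
  unfolding rho_def
proof (rule realizable_scale, rule realizable_sum[OF n], rule realizable_sum[OF n])
  fix r c assume rc: "r \<in> {..<2*n}" "c \<in> {..<2*n}"
  show "scal (Sm n X r c) * (wop n r * wop n c) \<in> realizable n l"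
  proof (cases "r < n \<and> c < n")
    case True
    then have d: "c + n < 2*n" "wt n r (c + n) \<noteq> k" using k by (simp_all add: wt_def)
    then have "X $$ (r, c + n) = 0" using X rc unfolding graded_part_def by blast
    then have "Sm n X r c = 0" using True by (simp add: Sm_def)
    then show ?thesis using realizable_zero[OF n] by (simp add: scal_simps)
  next
    case False
    then show ?thesis using rc by (intro realizable_scale realizable_wop n) auto
  qed
qed

lemma sum_double: "(\<Sum>r<2*n. f r) = (\<Sum>r<n. f r) + (\<Sum>r<n. f (r + n))" for f :: "nat \<Rightarrow> 'a :: comm_monoid_add"
proof -
  have "(\<Sum>r<2*n. f r) = (\<Sum>r<n. f r) + (\<Sum>r=n..<n+n. f r)"
    unfolding lessThan_atLeast0 mult_2 by (rule sum.atLeastLessThan_concat[symmetric]) auto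
  also have "(\<Sum>r=n..<n+n. f r) = (\<Sum>r<n. f (r + n))"
    using sum.shift_bounds_nat_ivl[of f 0 n n] by (simp add: lessThan_atLeast0)
  finally show ?thesis .
qed

lemma Sh_sum: "(\<Sum>i\<in>A. Sh e (f i)) = Sh e (\<lambda>a. \<Sum>i\<in>A. f i a)"
  by (induction A rule: infinite_finite_induct) (auto simp: Sh_zero Sh_add)

lemma scal_Sh: "scal c * Sh e \<phi> = Sh e (\<lambda>a. c * \<phi> a)"
  by (simp add: scal_def Sh_mult)

lemma Xop_Dop: "Xop i * Dop i = Sh (\<lambda>_. 0) (\<lambda>a. of_int (a i))"
  "Dop i * Xop i = Sh (\<lambda>_. 0) (\<lambda>a. of_int (a i) + 1)"
  by (simp_all add: Xop_def Dop_def Sh_mult) (simp add: unit_exp_def)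

lemma z0_row:
  assumes r: "r < n"
  shows "(\<Sum>c<2*n. scal (Sm n (z0 n) r c) * (wop n r * wop n c)) = scal (-1/2) * (Dop r * Xop r)"
    "(\<Sum>c<2*n. scal (Sm n (z0 n) (r + n) c) * (wop n (r + n) * wop n c)) = scal (-1/2) * (Xop r * Dop r)"
proof -
  have S: "Sm n (z0 n) r c = (if c = r + n then -1/2 else 0)" "Sm n (z0 n) (r + n) c = (if c = r then -1/2 else 0)"
    if "c < 2*n" for c
    using r that by (auto simp: Sm_def z0_def)
  have "(\<Sum>c<2*n. scal (Sm n (z0 n) r c) * (wop n r * wop n c))
      = (\<Sum>c<2*n. if c = r + n then scal (-1/2) * (Dop r * Xop r) else 0)"
    using r by (intro sum.cong refl) (simp add: S wop_def scal_simps(1))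
  then show "(\<Sum>c<2*n. scal (Sm n (z0 n) r c) * (wop n r * wop n c)) = scal (-1/2) * (Dop r * Xop r)"
    using r by simp
  have "(\<Sum>c<2*n. scal (Sm n (z0 n) (r + n) c) * (wop n (r + n) * wop n c))
      = (\<Sum>c<2*n. if c = r then scal (-1/2) * (Xop r * Dop r) else 0)"
    using r by (intro sum.cong refl) (simp add: S wop_def scal_simps(1))
  then show "(\<Sum>c<2*n. scal (Sm n (z0 n) (r + n) c) * (wop n (r + n) * wop n c)) = scal (-1/2) * (Xop r * Dop r)"
    using r by simp
qed

lemma sum_half:
  "(\<Sum>r<n. -1/2 * (x r + 1)) = -1/2 * ((\<Sum>r<n. x r) + of_nat n :: complex)"
  "(\<Sum>r<n. -1/2 * x r) = -1/2 * ((\<Sum>r<n. x r) :: complex)"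
  unfolding sum_distrib_left[symmetric] by (simp_all add: sum.distrib)

lemma rho_z0_Sh:
  "rho n (z0 n) = Sh (\<lambda>_. 0) (\<lambda>a. 1/2 * (-1/2 * ((\<Sum>r<n. of_int (a r)) + of_nat n) + -1/2 * (\<Sum>r<n. of_int (a r))))"
proof -
  have "(\<Sum>r<2*n. \<Sum>c<2*n. scal (Sm n (z0 n) r c) * (wop n r * wop n c))
      = (\<Sum>r<n. scal (-1/2) * (Dop r * Xop r)) + (\<Sum>r<n. scal (-1/2) * (Xop r * Dop r))"
    unfolding sum_double[of "\<lambda>r. \<Sum>c<2*n. scal (Sm n (z0 n) r c) * (wop n r * wop n c)"]
    by (intro arg_cong2[where f = "(+)"] sum.cong refl) (simp_all only: z0_row lessThan_iff)
  then show ?thesis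
    unfolding rho_def by (simp only: Xop_Dop scal_Sh Sh_sum Sh_add sum_half)
qed

text \<open>Origin of the constant n/4: in the symmetric ordering each Euler operator x_r D_r
  appears with an extra 1/2, so \<open>rho n (z0 n)\<close> is -(|a| + n/2)/2. Adding l/2 + n/4
  leaves -(|a| - l)/2.\<close>

lemma rho_z0: "rho n (z0 n) + scal (of_int l / 2 + of_nat n / 4) = - tau n l"
proof -
  have e: "1/2 * (-1/2 * (S + N) + -1/2 * S) + (L / 2 + N / 4) = 0 - (S - L) / 2" for S N L :: complex
    by (simp add: field_simps)
  have "rho n (z0 n) + scal (of_int l / 2 + of_nat n / 4) = Sh (\<lambda>_. 0) (\<lambda>a. 0 - ((\<Sum>r<n. of_int (a r)) - of_int l) / 2)"
    unfolding rho_z0_Sh scal_def Sh_add by (intro arg_cong2[where f = Sh] refl ext) (rule e)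
  also have "\<dots> = 0 - Sh (\<lambda>_. 0) (\<lambda>a. ((\<Sum>r<n. of_int (a r)) - of_int l) / 2)"
    using Sh_diff[of "\<lambda>_. 0" "\<lambda>_. 0" "\<lambda>a. ((\<Sum>r<n. of_int (a r)) - of_int l) / 2"] unfolding Sh_zero by (rule sym)
  finally show ?thesis by (simp add: tau_def)
qed

text \<open>In degree 1 only the products of two derivatives survive, and \<open>tau\<close>
  completes each of them to an operator of twist 0.\<close>

lemma realizable_rho_shift:
  assumes n: "n \<ge> 1" and X: "X \<in> graded_part n 1"
  shows "rho n X * (- tau n l) \<in> realizable n l"
proof -
  have "scal (Sm n X r c) * (wop n r * wop n c) * tau n l \<in> realizable n l"
    if rc: "r < 2*n" "c < 2*n" for r c
  proof (cases "r < n \<and> c < n")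
    case True
    then show ?thesis
      unfolding mult.assoc using realizable_quadratic(4)[OF n, of r c l] True
      by (intro realizable_scale) (simp add: wop_def mult.assoc)
  next
    case False
    define d where "d = (if c < n then c + n else c - n)"
    have d: "d < 2*n" "wt n r d \<noteq> 1" using rc False by (auto simp: wt_def d_def)
    then have "X $$ (r, d) = 0" using X rc unfolding graded_part_def by blast
    then have "Sm n X r c = 0" by (auto simp: Sm_def d_def split: if_splits)
    then show ?thesis using realizable_zero[OF n] by (simp add: scal_simps)
  qed
  then have "(\<Sum>r<2*n. \<Sum>c<2*n. scal (Sm n X r c) * (wop n r * wop n c) * tau n l) \<in> realizable n l"
    by (intro realizable_sum n) auto
  then have "scal (-1) * (scal (1/2) * (\<Sum>r<2*n. \<Sum>c<2*n. scal (Sm n X r c) * (wop n r * wop n c) * tau n l)) \<in> realizable n l"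
    by (intro realizable_scale)
  then show ?thesis
    by (simp add: rho_def scal_simps sum_distrib_right mult.assoc)
qed

section \<open>Values of the oscillator representation on the generated subalgebra\<close>

definition gens :: "nat \<Rightarrow> int \<Rightarrow> (complex mat free_monoid \<Rightarrow>\<^sub>0 complex) set set" where
  "gens n l = {\<one>\<^bsub>env_algebra (sp n)\<^esub>} \<union> env_inj (sp n) ` levi n \<union> env_inj (sp n) ` rad_minus n
      \<union> {env_inj (sp n) x \<otimes>\<^bsub>env_algebra (sp n)\<^esub> z_shift n l | x. x \<in> rad_plus n}"

lemma frakA_gens: "frakA n l = subalgebra_generated (env_algebra (sp n)) (gens n l)"
  by (simp add: frakA_def gens_def)

lemma good_rho_inj: "good (rho n) (env_inj (sp n) x) (rho n x)"
  by (rule good_env_inj) (rule rho_kernel)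

lemma good_rho_one: "good (rho n) \<one>\<^bsub>env_algebra (sp n)\<^esub> 1"
  by (rule good_one) (rule rho_kernel)

lemma good_rho_add:
  "good (rho n) Z v \<Longrightarrow> good (rho n) W w \<Longrightarrow> good (rho n) (Z \<oplus>\<^bsub>env_algebra (sp n)\<^esub> W) (v + w)"
  by (rule good_add) (auto intro: rho_kernel)

lemma good_rho_mult:
  "good (rho n) Z v \<Longrightarrow> good (rho n) W w \<Longrightarrow> good (rho n) (Z \<otimes>\<^bsub>env_algebra (sp n)\<^esub> W) (v * w)"
  by (rule good_mult) (auto intro: rho_kernel)

lemma good_rho_scale:
  "good (rho n) Z v \<Longrightarrow> good (rho n) (c \<odot>\<^bsub>env_algebra (sp n)\<^esub> Z) (scal c * v)"
  by (rule good_scale) (auto intro: rho_kernel)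

lemma good_z_shift:
  assumes "n \<ge> 1"
  shows "good (rho n) (z_shift n l) (- tau n l)"
proof -
  have "good (rho n) (z_shift n l) (rho n (z0 n) + scal (of_int l / 2 + of_nat n / 4) * 1)"
    unfolding z_shift_def z_elt_eq[OF assms]
    by (intro good_rho_add good_rho_scale good_rho_one good_rho_inj)
  then show ?thesis by (simp add: rho_z0)
qed

lemma good_rad_plus:
  assumes "n \<ge> 1"
  shows "good (rho n) (env_inj (sp n) x \<otimes>\<^bsub>env_algebra (sp n)\<^esub> z_shift n l) (rho n x * (- tau n l))"
  by (intro good_rho_mult good_z_shift good_rho_inj assms)

text \<open>Shows that every element of the subalgebra has a value and that this value comes from a
  global differential operator; together with uniqueness this makes the homomorphism well
  defined.\<close>

lemma generated_good:
  assumes n: "n \<ge> 1" and Z: "Z \<in> generate_alg (env_algebra (sp n)) (gens n l)"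
  shows "\<exists>v\<in>realizable n l. good (rho n) Z v"
  using Z
proof induction
  case one
  show ?case using good_rho_one realizable_one[OF n] by blast
next
  case (incl Z)
  then have "Z = \<one>\<^bsub>env_algebra (sp n)\<^esub> \<or> Z \<in> env_inj (sp n) ` levi n \<or> Z \<in> env_inj (sp n) ` rad_minus n
      \<or> (\<exists>X. Z = env_inj (sp n) X \<otimes>\<^bsub>env_algebra (sp n)\<^esub> z_shift n l \<and> X \<in> rad_plus n)"
    by (simp add: gens_def disj_assoc)
  then show ?case
  proof (elim disjE imageE exE conjE)
    assume "Z = \<one>\<^bsub>env_algebra (sp n)\<^esub>"
    then show ?thesis using good_rho_one realizable_one[OF n] by blast
  next
    fix X assume X: "Z = env_inj (sp n) X" "X \<in> levi n"
    show ?thesis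
      unfolding X(1) using good_rho_inj realizable_rho[OF n levi_graded[OF n X(2)], of l] by (intro bexI) auto
  next
    fix X assume X: "Z = env_inj (sp n) X" "X \<in> rad_minus n"
    show ?thesis
      unfolding X(1) using good_rho_inj realizable_rho[OF n rad_graded(2)[OF n X(2)], of l] by (intro bexI) auto
  next
    fix X assume X: "Z = env_inj (sp n) X \<otimes>\<^bsub>env_algebra (sp n)\<^esub> z_shift n l" "X \<in> rad_plus n"
    show ?thesis
      unfolding X(1) using good_rad_plus[OF n] realizable_rho_shift[OF n rad_graded(1)[OF n X(2)], of l] by (intro bexI) auto
  qed
next
  case (add x y)
  then obtain v w where "v \<in> realizable n l" "good (rho n) x v" "w \<in> realizable n l" "good (rho n) y w" by blast
  then show ?case using good_rho_add[of n x v y w] realizable_add[of v n l w] by blast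
next
  case (mult x y)
  then obtain v w where "v \<in> realizable n l" "good (rho n) x v" "w \<in> realizable n l" "good (rho n) y w" by blast
  then show ?case using good_rho_mult[of n x v y w] realizable_mult[of v n l w] by blast
next
  case (scale x c)
  then obtain v where "v \<in> realizable n l" "good (rho n) x v" by blast
  then show ?case using good_rho_scale[of n x v c] realizable_scale[of v n l c] by blast
qed

section \<open>Operators coming from the generated subalgebra\<close>

text \<open>The image of the subalgebra under the oscillator representation. Surjectivity amounts to
  finding, for each differential operator, a matching element of this set.\<close>

definition attained :: "nat \<Rightarrow> int \<Rightarrow> lin_op set" where
  "attained n l = {v. \<exists>Z\<in>generate_alg (env_algebra (sp n)) (gens n l). good (rho n) Z v}"

lemma attained_one: "1 \<in> attained n l"
  using good_rho_one generate_alg.one unfolding attained_def by blast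

lemma attained_add: "v \<in> attained n l \<Longrightarrow> w \<in> attained n l \<Longrightarrow> v + w \<in> attained n l"
proof -
  assume "v \<in> attained n l" "w \<in> attained n l"
  then obtain Z W where Z: "Z \<in> generate_alg (env_algebra (sp n)) (gens n l)" "good (rho n) Z v"
    and W: "W \<in> generate_alg (env_algebra (sp n)) (gens n l)" "good (rho n) W w"
    unfolding attained_def by auto
  show ?thesis
    unfolding attained_def using generate_alg.add[OF Z(1) W(1)] good_rho_add[OF Z(2) W(2)] by blast
qed

lemma attained_mult: "v \<in> attained n l \<Longrightarrow> w \<in> attained n l \<Longrightarrow> v * w \<in> attained n l"
proof -
  assume "v \<in> attained n l" "w \<in> attained n l"
  then obtain Z W where Z: "Z \<in> generate_alg (env_algebra (sp n)) (gens n l)" "good (rho n) Z v"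
    and W: "W \<in> generate_alg (env_algebra (sp n)) (gens n l)" "good (rho n) W w"
    unfolding attained_def by auto
  show ?thesis
    unfolding attained_def using generate_alg.mult[OF Z(1) W(1)] good_rho_mult[OF Z(2) W(2)] by blast
qed

lemma attained_scale: "v \<in> attained n l \<Longrightarrow> scal c * v \<in> attained n l"
proof -
  assume "v \<in> attained n l"
  then obtain Z where Z: "Z \<in> generate_alg (env_algebra (sp n)) (gens n l)" "good (rho n) Z v"
    unfolding attained_def by auto
  show ?thesis
    unfolding attained_def using generate_alg.scale[OF Z(1)] good_rho_scale[OF Z(2)] by blast
qed

lemma attained_zero: "0 \<in> attained n l"
  using attained_scale[OF attained_one, of 0 n l] by (simp add: scal_simps)

lemma attained_sum: "(\<And>i. i \<in> A \<Longrightarrow> f i \<in> attained n l) \<Longrightarrow> (\<Sum>i\<in>A. f i) \<in> attained n l"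
  by (induction A rule: infinite_finite_induct) (auto intro: attained_add attained_zero)

lemma sum_two_entries:
  fixes f :: "nat \<Rightarrow> nat \<Rightarrow> lin_op"
  assumes "r1 < N" "c1 < N" "r2 < N" "c2 < N"
  shows "(\<Sum>r<N. \<Sum>c<N. scal ((if r = r1 \<and> c = c1 then a else 0) + (if r = r2 \<and> c = c2 then b else 0)) * f r c)
    = scal a * f r1 c1 + scal b * f r2 c2"
proof -
  have one: "(\<Sum>r<N. \<Sum>c<N. scal (if r = r1 \<and> c = c1 then a else 0) * f r c) = scal a * f r1 c1"
    if "r1 < N" "c1 < N" for r1 c1 a
  proof -
    have "(\<Sum>c<N. scal (if r = r1 \<and> c = c1 then a else 0) * f r c) = (if r = r1 then scal a * f r1 c1 else 0)" for r
    proof (cases "r = r1")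
      case True
      have "(\<Sum>c<N. scal (if r = r1 \<and> c = c1 then a else 0) * f r c) = (\<Sum>c<N. if c = c1 then scal a * f r1 c1 else 0)"
        using True by (intro sum.cong) (auto simp: scal_simps)
      then show ?thesis using True that by simp
    qed (simp add: scal_simps)
    then show ?thesis using that by simp
  qed
  show ?thesis
    unfolding scal_simps(3) distrib_right sum.distrib one[OF assms(1,2)] one[OF assms(3,4)] ..
qed

lemma scal_half: "scal (1/2) * (T + T) = T"
proof -
  have "scal (1/2) * (T + T) = (scal (1/2) + scal (1/2)) * T" by (simp only: distrib_left distrib_right)
  also have "scal (1/2) + scal (1/2) = scal (1/2 + 1/2)" by (rule scal_simps(3)[symmetric])
  also have "scal (1/2 + 1/2) = 1" using scal_simps(2) by simp
  finally show ?thesis by simp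
qed

lemma scal_minus_one: "scal (-1) * T = - T"
  unfolding scal_simps(6)[of 1] scal_simps(2) by simp

lemma rho_two_entries:
  assumes S1: "\<And>r c. r < 2*n \<Longrightarrow> c < n \<Longrightarrow>
      M $$ (r, c + n) = (if r = r1 \<and> c = c1 then a else 0) + (if r = r2 \<and> c = c2 then b else 0)"
    and S2: "\<And>r c. r < 2*n \<Longrightarrow> c < n \<Longrightarrow>
      - M $$ (r, c) = (if r = r1 \<and> c + n = c1 then a else 0) + (if r = r2 \<and> c + n = c2 then b else 0)"
    and lt: "r1 < 2*n" "c1 < 2*n" "r2 < 2*n" "c2 < 2*n"
  shows "rho n M = scal (1/2) * (scal a * (wop n r1 * wop n c1) + scal b * (wop n r2 * wop n c2))"
proof -
  have "Sm n M r c = (if r = r1 \<and> c = c1 then a else 0) + (if r = r2 \<and> c = c2 then b else 0)" if "r < 2*n" "c < 2*n" for r c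
  proof (cases "c < n")
    case True
    then show ?thesis using S1[OF that(1) True] by (simp add: Sm_def)
  next
    case False
    then have "c - n < n" "c - n + n = c" using that by auto
    then show ?thesis using S2[OF that(1), of "c - n"] False by (simp add: Sm_def)
  qed
  then have "(\<Sum>r<2*n. \<Sum>c<2*n. scal (Sm n M r c) * (wop n r * wop n c))
      = (\<Sum>r<2*n. \<Sum>c<2*n. scal ((if r = r1 \<and> c = c1 then a else 0) + (if r = r2 \<and> c = c2 then b else 0)) * (wop n r * wop n c))"
    by (intro sum.cong refl) simp
  also have "\<dots> = scal a * (wop n r1 * wop n c1) + scal b * (wop n r2 * wop n c2)"
    by (rule sum_two_entries[OF lt])
  finally show ?thesis by (simp only: rho_def)
qed

lemma rho_mC:
  assumes ij: "i < n" "j < n"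
  shows "rho n (mC n i j) = - (Xop i * Xop j)"
proof -
  have C: "mC n i j = mat (2*n) (2*n) (\<lambda>(r, c). (if r = i + n \<and> c = j then 1 else 0) + (if r = j + n \<and> c = i then 1 else 0))"
    by (simp only: mC_def add.commute[of n])
  have neg_if: "- ((if A then 1 else 0) + (if B then 1 else 0)) = (if A then -1 else 0) + (if B then -1 else (0::complex))" for A B
    by (cases A; cases B) simp_all
  have w: "wop n (k + n) = Xop k" for k
    by (simp add: wop_def)
  have "rho n (mC n i j) = scal (1/2) * (scal (-1) * (wop n (i + n) * wop n (j + n)) + scal (-1) * (wop n (j + n) * wop n (i + n)))"
  proof (rule rho_two_entries)
    fix r c assume rc: "r < 2 * n" "c < n"
    have "c + n \<noteq> i" "c + n \<noteq> j" using ij by auto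
    then show "mC n i j $$ (r, c + n) = (if r = i + n \<and> c = j + n then -1 else 0) + (if r = j + n \<and> c = i + n then -1 else 0)"
      unfolding C using rc by simp
    show "- mC n i j $$ (r, c) = (if r = i + n \<and> c + n = j + n then -1 else 0) + (if r = j + n \<and> c + n = i + n then -1 else 0)"
    proof -
      have "mC n i j $$ (r, c) = (if r = i + n \<and> c = j then 1 else 0) + (if r = j + n \<and> c = i then 1 else 0)"
        unfolding C using rc by simp
      then show ?thesis by (simp only: neg_if add_right_cancel)
    qed
  qed (use ij in linarith)+
  also have "\<dots> = scal (1/2) * (- (Xop i * Xop j) + - (Xop i * Xop j))"
    unfolding scal_minus_one w Xop_Dop_simps(1)[of j i] ..
  finally show ?thesis by (simp only: scal_half)
qed

lemma rho_mB:
  assumes ij: "i < n" "j < n"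
  shows "rho n (mB n i j) = Dop i * Dop j"
proof -
  have "rho n (mB n i j) = scal (1/2) * (scal 1 * (wop n i * wop n j) + scal 1 * (wop n j * wop n i))"
    by (rule rho_two_entries) (use ij in \<open>simp_all add: mB_def add.commute[of _ n]\<close>)
  also have "\<dots> = scal (1/2) * (Dop i * Dop j + Dop i * Dop j)"
    using ij by (simp add: wop_def scal_simps(2) Xop_Dop_simps(2)[of j i])
  finally show ?thesis by (simp only: scal_half)
qed

lemma rho_mA:
  assumes ij: "i < n" "j < n"
  shows "rho n (mA n i j) = - (Xop j * Dop i) + scal (if i = j then -1/2 else 0)"
proof -
  let ?\<delta> = "scal (if i = j then 1 else 0)"
  have "rho n (mA n i j) = scal (1/2) * (scal (-1) * (wop n i * wop n (n + j)) + scal (-1) * (wop n (n + j) * wop n i))"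
    by (rule rho_two_entries) (use ij in \<open>simp_all add: mA_def add.commute[of _ n]\<close>)
  also have "\<dots> = scal (1/2) * (- (Dop i * Xop j) + - (Xop j * Dop i))"
    unfolding scal_minus_one using ij by (simp add: wop_def)
  also have "Dop i * Xop j = ?\<delta> + Xop j * Dop i"
    using Xop_Dop_simps(3)[of i j] by (simp only: diff_eq_eq)
  also have "- (?\<delta> + Xop j * Dop i) + - (Xop j * Dop i) = (- (Xop j * Dop i) + - (Xop j * Dop i)) + - ?\<delta>"
    by (simp only: minus_add_distrib ac_simps)
  also have "scal (1/2) * \<dots> = - (Xop j * Dop i) + scal (1/2) * (- ?\<delta>)"
    by (simp only: distrib_left[of _ _ "- ?\<delta>"] scal_half)
  also have "scal (1/2) * (- ?\<delta>) = scal (if i = j then -1/2 else 0)"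
    by (cases "i = j") (use scal_simps(6)[of "1/2"] in \<open>simp_all add: scal_simps(1,2)\<close>)
  finally show ?thesis .
qed

lemma attainedI: "Z \<in> gens n l \<Longrightarrow> good (rho n) Z v \<Longrightarrow> v \<in> attained n l"
  unfolding attained_def using generate_alg.incl[of Z "gens n l"] by blast

lemma attained_uminus:
  assumes "- v \<in> attained n l"
  shows "v \<in> attained n l"
proof -
  have "scal (-1) * (- v) = v" using scal_simps(6)[of 1] by (simp add: scal_simps(2))
  then show ?thesis using attained_scale[OF assms, of "-1"] by simp
qed

lemma attained_generators:
  assumes ij: "i < n" "j < n"
  shows "Xop i * Xop j \<in> attained n l" "Xop j * Dop i \<in> attained n l" "Dop i * Dop j * tau n l \<in> attained n l"
proof -
  have n: "n \<ge> 1" using ij by simp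
  have "env_inj (sp n) (mC n i j) \<in> gens n l"
    using elementary_parts(3)[OF ij] unfolding gens_def by blast
  from attainedI[OF this good_rho_inj] show "Xop i * Xop j \<in> attained n l"
    unfolding rho_mC[OF ij] by (rule attained_uminus)
  have "env_inj (sp n) (mA n i j) \<in> gens n l"
    using elementary_parts(1)[OF ij] unfolding gens_def by blast
  \<comment> \<open>The symmetric ordering in \<open>rho_mA\<close> leaves the constant -1/2 when i
    = j; a multiple of 1 removes it.\<close>
  from attained_add[OF attainedI[OF this good_rho_inj] attained_scale[OF attained_one]]
  have "rho n (mA n i j) + scal (if i = j then 1/2 else 0) * 1 \<in> attained n l" .
  moreover have "scal (if i = j then -1/2 else 0) + scal (if i = j then 1/2 else 0) = 0"
    by (cases "i = j") (use scal_simps(6)[of "1/2"] in \<open>simp_all add: scal_simps(1)\<close>)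
  then have "rho n (mA n i j) + scal (if i = j then 1/2 else 0) * 1 = - (Xop j * Dop i)"
    unfolding rho_mA[OF ij] mult_1_right add.assoc by (simp only: add_0_right)
  ultimately show "Xop j * Dop i \<in> attained n l" using attained_uminus by simp
  have "env_inj (sp n) (mB n i j) \<otimes>\<^bsub>env_algebra (sp n)\<^esub> z_shift n l \<in> gens n l"
    using elementary_parts(2)[OF ij] unfolding gens_def by blast
  from attainedI[OF this good_rad_plus[OF n]] have "- (Dop i * Dop j * tau n l) \<in> attained n l"
    unfolding rho_mB[OF ij] by simp
  then show "Dop i * Dop j * tau n l \<in> attained n l" by (rule attained_uminus)
qed

section \<open>Sections over the torus and determination of operators\<close>

lemma torus_invD: "torus_inv n W \<Longrightarrow> Q \<in> W \<Longrightarrow> u \<noteq> 0 \<Longrightarrow> torus_act n u Q \<in> W"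
  unfolding torus_inv_def by blast

lemma tor_nonempty: "tor N \<noteq> {}"
  using ones_nz[of "{..<N}" N] by blast

lemma lser_zero: "lser n l (\<lambda>_. 0) = (\<lambda>_. 0)"
  by (simp add: lser_def fun_eq_iff)

lemma lser_add_single:
  assumes u: "u \<in> fsupp n l" and a: "a \<in> lat n l"
  shows "(\<lambda>b. u b + (if b = a then c else 0)) \<in> fsupp n l"
    "lser n l (\<lambda>b. u b + (if b = a then c else 0)) Q = lser n l u Q + c * lmono n l a Q"
proof -
  let ?u = "\<lambda>b. u b + (if b = a then c else 0)"
  let ?A = "insert a {b. u b \<noteq> 0}"
  have fin: "finite ?A" using u by (simp add: fsupp_def)
  have sub: "{b. ?u b \<noteq> 0} \<subseteq> ?A" by auto
  have "?A \<subseteq> lat n l" using u a by (auto simp: fsupp_def)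
  then show "?u \<in> fsupp n l"
    unfolding fsupp_def using finite_subset[OF sub fin] sub by blast
  have "lser n l ?u Q = (\<Sum>b\<in>?A. u b * lmono n l b Q) + (\<Sum>b\<in>?A. if b = a then c * lmono n l a Q else 0)"
    unfolding lser_superset[OF fin sub] sum.distrib[symmetric] by (intro sum.cong refl) (simp add: distrib_right)
  also have "(\<Sum>b\<in>?A. u b * lmono n l b Q) = lser n l u Q"
    by (rule lser_superset[OF fin, symmetric]) auto
  finally show "lser n l ?u Q = lser n l u Q + c * lmono n l a Q"
    using fin by simp
qed

text \<open>The exponents \<open>g \<beta>\<close> may coincide, as they can in
  \<open>section_lser\<close>; the coefficient function then adds up all contributions.\<close>

lemma lser_sum:
  assumes "finite S" "\<And>\<beta>. \<beta> \<in> S \<Longrightarrow> g \<beta> \<in> lat n l"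
  shows "(\<lambda>b. \<Sum>\<beta>\<in>S. if b = g \<beta> then c \<beta> else 0) \<in> fsupp n l \<and>
    lser n l (\<lambda>b. \<Sum>\<beta>\<in>S. if b = g \<beta> then c \<beta> else 0) Q = (\<Sum>\<beta>\<in>S. c \<beta> * lmono n l (g \<beta>) Q)"
  using assms
proof (induction S rule: finite_induct)
  case empty
  show ?case by (auto simp: lser_zero fsupp_def)
next
  case (insert \<beta> S)
  have g: "g \<beta> \<in> lat n l" using insert.prems by simp
  have IH: "(\<lambda>b. \<Sum>\<beta>\<in>S. if b = g \<beta> then c \<beta> else 0) \<in> fsupp n l"
    "lser n l (\<lambda>b. \<Sum>\<beta>\<in>S. if b = g \<beta> then c \<beta> else 0) Q = (\<Sum>\<beta>\<in>S. c \<beta> * lmono n l (g \<beta>) Q)"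
    using insert by auto
  have e: "(\<lambda>b. \<Sum>\<beta>\<in>insert \<beta> S. if b = g \<beta> then c \<beta> else 0) =
      (\<lambda>b. (\<Sum>\<beta>\<in>S. if b = g \<beta> then c \<beta> else 0) + (if b = g \<beta> then c \<beta> else 0))"
    using insert.hyps by (simp add: add.commute)
  show ?case
    unfolding e using lser_add_single[OF IH(1) g, of "c \<beta>"] insert.hyps IH(2) by (simp add: add.commute)
qed

text \<open>The representative of the torus orbit of \<open>Q\<close> whose coordinate with index \<open>0\<close> is \<open>1\<close>.\<close>

definition hat :: "nat \<Rightarrow> complex vec \<Rightarrow> complex vec" where
  "hat n Q = torus_act n (inverse (Q $ 0)) Q"

lemma hat_act:
  assumes n: "n \<ge> 1" and Q: "Q \<in> tor (n + 1)" and u: "u \<noteq> 0"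
  shows "hat n (torus_act n u Q) = hat n Q"
proof -
  have Q0: "Q $ 0 \<noteq> 0" using tor_index[OF Q, of 0] by simp
  have "torus_act n u Q $ 0 = u * Q $ 0" using torus_act_index[of 0 n u Q] n by (simp add: wgt_def)
  moreover have "inverse (u * Q $ 0) * u = inverse (Q $ 0)" using u by (simp add: field_simps)
  moreover have "torus_act n (inverse (u * Q $ 0)) (torus_act n u Q) = torus_act n (inverse (u * Q $ 0) * u) Q"
    using Q0 u by (intro torus_act_act) auto
  ultimately show ?thesis by (simp only: hat_def)
qed

lemma regular_on_hat:
  assumes n: "n \<ge> 1" and i: "i < n + 1"
  shows "regular_on (n + 1) (tor (n + 1)) (\<lambda>Q. hat n Q $ i)"
proof -
  have "regular_on (n + 1) (tor (n + 1)) (\<lambda>Q. inverse (Q $ 0) powi wgt n i * Q $ i)"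
    by (intro regular_on_mult regular_on_powi regular_on_inverse regular_on_coord zariski_open_tor nz_subset i)
       (auto simp: nz_def)
  then show ?thesis unfolding hat_def using torus_act_index[OF i] by simp
qed

lemma lm_nonzero: "Q \<in> tor N \<Longrightarrow> lm N \<beta> Q \<noteq> 0"
  by (auto simp: lm_def nz_def)

lemma section_hat:
  assumes n: "n \<ge> 1" and f: "f \<in> line_sheaf n l U" and U: "Xt_open n U" and Q: "Q \<in> tor (n + 1)"
  shows "f Q = (Q $ 0) powi l * f (hat n Q)"
proof -
  have Q0: "Q $ 0 \<noteq> 0" and Qc: "Q \<in> carrier_vec (n + 1)" using tor_index[OF Q, of 0] Q by (auto simp: nz_def)
  have "f (hat n Q) = inverse (Q $ 0) powi l * f Q"
    unfolding hat_def by (rule line_sheaf_act[OF U f _ Qc]) (use Q0 in simp)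
  then show ?thesis using Q0 by (simp add: power_int_inverse)
qed

text \<open>The Laurent expansion of f need not a priori consist of monomials of weight l.
  Evaluating it at the normalized representative and multiplying by the l-th power of the coordinate
  with index 0 corrects every monomial to weight l without changing f.\<close>

lemma section_lser:
  assumes n: "n \<ge> 1" and f: "f \<in> line_sheaf n l (TT n)"
  shows "\<exists>u\<in>fsupp n l. f = lser n l u"
proof -
  have "regular_on (n + 1) (tor (n + 1)) f" using line_sheafD(1)[OF f] by (simp only: Union_TT[OF n])
  then have "laurent (n + 1) f" by (rule laurent_if_regular)
  then obtain S c where S: "finite S" "\<And>\<beta>. \<beta> \<in> S \<Longrightarrow> \<forall>i\<ge>n + 1. \<beta> i = 0"
    "\<And>q. q \<in> tor (n + 1) \<Longrightarrow> f q = (\<Sum>\<beta>\<in>S. c \<beta> * lm (n + 1) \<beta> q)" unfolding laurent_def by blast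
  \<comment> \<open>The defect of the weight of a monomial from l; it is added to the exponent of
    the coordinate with index 0, which has weight 1.\<close>
  define d where "d \<beta> = l - (sum \<beta> {..<n} - 2 * \<beta> n)" for \<beta> :: "nat \<Rightarrow> int"
  define g where "g \<beta> = (\<lambda>i. if i = n then 0 else \<beta> i + (if i = 0 then d \<beta> else 0))" for \<beta>
  have sum_g: "sum (g \<beta>) {..<n} = l + 2 * \<beta> n" for \<beta>
  proof -
    have "sum (g \<beta>) {..<n} = (\<Sum>i<n. \<beta> i + (if i = 0 then d \<beta> else 0))"
      unfolding g_def by (intro sum.cong) auto
    then show ?thesis using n by (simp add: sum.distrib d_def)
  qed
  have glat: "g \<beta> \<in> lat n l" if "\<beta> \<in> S" for \<beta>
    using S(2)[OF that] sum_g[of \<beta>] n by (auto simp: lat_def g_def)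
  have gexp: "mono_exp n l (g \<beta>) = (\<lambda>i. (if i = 0 then d \<beta> else 0) + \<beta> i)" if "\<beta> \<in> S" for \<beta>
    using sum_g[of \<beta>] n by (auto simp: mono_exp_def tdeg_def g_def fun_eq_iff)
  have "f Q = (\<Sum>\<beta>\<in>S. c \<beta> * lmono n l (g \<beta>) Q)" for Q
  proof (cases "Q \<in> tor (n + 1)")
    case True
    have Q0: "Q $ 0 \<noteq> 0" using tor_index[OF True, of 0] by simp
    have hatT: "hat n Q \<in> tor (n + 1)"
      unfolding hat_def by (rule torus_invD[OF torus_inv_tor[OF n] True]) (use Q0 in simp)
    have "f Q = Q $ 0 powi l * (\<Sum>\<beta>\<in>S. c \<beta> * lm (n + 1) \<beta> (hat n Q))"
      using section_hat[OF n f Xt_open_TT[OF n] True] S(3)[OF hatT] by simp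
    also have "\<dots> = (\<Sum>\<beta>\<in>S. c \<beta> * (Q $ 0 powi l * lm (n + 1) \<beta> (hat n Q)))"
      by (simp add: sum_distrib_left mult.left_commute)
    also have "\<dots> = (\<Sum>\<beta>\<in>S. c \<beta> * lmono n l (g \<beta>) Q)"
    proof (intro sum.cong refl arg_cong2[where f = "(*)"])
      fix \<beta> assume \<beta>: "\<beta> \<in> S"
      have "lm (n + 1) \<beta> (hat n Q) = inverse (Q $ 0) powi (sum \<beta> {..<n} - 2 * \<beta> n) * lm (n + 1) \<beta> Q"
        unfolding hat_def by (rule lm_act) (use Q0 in simp)
      then have "Q $ 0 powi l * lm (n + 1) \<beta> (hat n Q) = Q $ 0 powi d \<beta> * lm (n + 1) \<beta> Q"
        using Q0 by (simp add: d_def power_int_inverse power_int_diff divide_inverse)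
      also have "\<dots> = lm (n + 1) (\<lambda>i. (if i = 0 then d \<beta> else 0) + \<beta> i) Q"
        unfolding lm_add[OF True, of "\<lambda>i. if i = 0 then d \<beta> else 0"] by (subst lm_single) auto
      finally show "Q $ 0 powi l * lm (n + 1) \<beta> (hat n Q) = lmono n l (g \<beta>) Q"
        using True by (simp add: lmono_def gexp[OF \<beta>])
    qed
    finally show ?thesis .
  next
    case False
    then show ?thesis using line_sheafD(3)[OF f, of Q] by (simp add: Union_TT[OF n] lmono_def)
  qed
  then have "f = lser n l (\<lambda>b. \<Sum>\<beta>\<in>S. if b = g \<beta> then c \<beta> else 0)"
    using lser_sum[where c = c and g = g, OF S(1) glat] by (intro ext) simp
  then show ?thesis using lser_sum[where c = c and g = g, OF S(1) glat] by blast
qed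

text \<open>The commutator of T with f again kills all f^(N+1) s and has smaller order, so by
  induction it kills s at Q. But its value on s is -f T s, and f Q can be divided out.\<close>

lemma nilpotent_vanishing:
  assumes "diff_order_less n l k V T" "Xt_open n V" "f \<in> line_sheaf n 0 V" "s \<in> line_sheaf n l V"
    and "\<And>N. T V (\<lambda>Q. f Q ^ Suc N * s Q) = (\<lambda>_. 0)" "f Q \<noteq> 0"
  shows "T V s Q = 0"
  using assms(1,5)
proof (induction k arbitrary: T)
  case 0
  then show ?case using assms(2,4) by simp
next
  case (Suc k)
  have f1: "(\<lambda>Q. f Q ^ 1 * s Q) = (\<lambda>Q. f Q * s Q)" by simp
  have "commutator T f V s Q = 0"
  proof (rule Suc.IH)
    show "diff_order_less n l k V (commutator T f)" using Suc.prems(1) assms(2,3) by auto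
    fix N
    have "(\<lambda>Q. f Q * (f Q ^ Suc N * s Q)) = (\<lambda>Q. f Q ^ Suc (Suc N) * s Q)" by (simp add: mult.assoc)
    then show "commutator T f V (\<lambda>Q. f Q ^ Suc N * s Q) = (\<lambda>_. 0)"
      using Suc.prems(2)[of N] Suc.prems(2)[of "Suc N"] by (simp only: commutator_def) simp
  qed
  then show ?case using Suc.prems(2)[of 0] assms(6) by (simp add: commutator_def)
qed

text \<open>
  Over the torus a section \<open>s\<close> of any open set is a fraction \<open>g/f\<close> of sections over the whole torus.
  Hence the difference of the two operators kills \<open>f\<^sup>N s\<close> for all \<open>N \<ge> 1\<close>, and therefore it kills \<open>s\<close>
  because taking commutators with \<open>f\<close> is nilpotent on it.
\<close>

lemma sheaf_hom_determined:
  assumes n: "n \<ge> 1" and P: "P \<in> shom n l l" and R: "R \<in> shom n l l"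
    and U0: "Xt_open n U0" "\<Union>U0 \<noteq> {}"
    and ord: "diff_order_less n l k U0 (\<lambda>W s Q. P W s Q - R W s Q)"
    and eq: "\<And>r. r \<in> line_sheaf n l (TT n) \<Longrightarrow> P (TT n) r = R (TT n) r"
  shows "P = R"
proof -
  have "P U s = R U s" if U: "Xt_open n U" and s: "s \<in> line_sheaf n l U" for U s
  proof (cases "\<Union>U = {}")
    case True
    then show ?thesis
      using line_sheafD(3)[OF shomD(1)[OF P U s]] line_sheafD(3)[OF shomD(1)[OF R U s]]
      by (intro ext) (simp only: True empty_iff not_False_eq_True)
  next
    case False
    define W0 where "W0 = \<Union>U \<inter> \<Union>U0 \<inter> tor (n + 1)"
    have W0open: "zariski_open (n + 1) W0"
      unfolding W0_def by (intro zariski_open_Int Xt_openD(2) U U0 zariski_open_tor)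
    have W0inv: "torus_inv n W0"
      unfolding W0_def by (intro torus_inv_Int Xt_openD(1) U U0 torus_inv_tor n)
    have ne: "\<Union>U \<inter> \<Union>U0 \<noteq> {}"
      by (rule zariski_open_Int_nonempty[OF Xt_openD(2)[OF U] Xt_openD(2)[OF U0(1)] False U0(2)])
    have "W0 \<noteq> {}"
      unfolding W0_def
      by (rule zariski_open_Int_nonempty[OF zariski_open_Int[OF Xt_openD(2)[OF U] Xt_openD(2)[OF U0(1)]]
            zariski_open_tor ne tor_nonempty])
    then obtain p0 where p0: "p0 \<in> W0" by blast
    then have p0T: "p0 \<in> tor (n + 1)" by (simp add: W0_def)
    \<comment> \<open>Passing to the normalized representative gives f p = b p for the section
      \<open>f\<close> built below, so that \<open>f\<close> does not vanish identically on
      \<open>W0\<close>.\<close>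
    define p where "p = hat n p0"
    have p0z: "p0 $ 0 \<noteq> 0" using tor_index[OF p0T, of 0] by simp
    have pW: "p \<in> W0" unfolding p_def hat_def by (rule torus_invD[OF W0inv p0]) (use p0z in simp)
    then have pT: "p \<in> tor (n + 1)" and pU: "p \<in> \<Union>U" by (auto simp: W0_def)
    have hatp: "hat n p = p"
      using hat_act[OF n p0T, of "inverse (p0 $ 0)"] p0z unfolding p_def by (simp add: hat_def)
    obtain a b where ab: "a \<in> polynomial_fun (n + 1)" "b \<in> polynomial_fun (n + 1)" "b p \<noteq> 0"
      "\<And>q. q \<in> \<Union>U \<Longrightarrow> b q * s q = a q"
      using global_fraction[OF line_sheafD(1)[OF s] Xt_openD(2)[OF U] pU] by blast
    \<comment> \<open>\<open>f\<close> and \<open>g\<close> are homogenizations of b and a: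
      evaluation at the normalized representative gives weight 0, and the power of the coordinate
      with index 0 restores weight l.\<close>
    define f where "f = (\<lambda>Q. if Q \<in> tor (n + 1) then b (hat n Q) else 0)"
    define g where "g = (\<lambda>Q. if Q \<in> tor (n + 1) then (Q $ 0) powi l * a (hat n Q) else 0)"
    have rh: "regular_on (n + 1) (tor (n + 1)) (\<lambda>Q. c (hat n Q))" if "c \<in> polynomial_fun (n + 1)" for c
      by (rule regular_on_poly_compose[OF that zariski_open_tor regular_on_hat[OF n]])
    have actT: "torus_act n u Q \<in> tor (n + 1)" if "Q \<in> tor (n + 1)" "u \<noteq> 0" for Q u
      by (rule torus_invD[OF torus_inv_tor[OF n] that])
    have fs: "f \<in> line_sheaf n 0 (TT n)"
    proof (rule line_sheafI, unfold Union_TT[OF n])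
      show "regular_on (n + 1) (tor (n + 1)) f"
        using rh[OF ab(2)] regular_on_cong[of "tor (n + 1)" f "\<lambda>Q. b (hat n Q)"] by (simp add: f_def)
      show "f (torus_act n u Q) = u powi 0 * f Q" if "Q \<in> tor (n + 1)" "u \<noteq> 0" for Q u
        using actT[OF that] hat_act[OF n that] that by (simp add: f_def)
    qed (simp add: f_def)
    have gs: "g \<in> line_sheaf n l (TT n)"
    proof (rule line_sheafI, unfold Union_TT[OF n])
      have "regular_on (n + 1) (tor (n + 1)) (\<lambda>Q. (Q $ 0) powi l * a (hat n Q))"
        by (intro regular_on_mult regular_on_powi regular_on_coord zariski_open_tor nz_subset rh ab) (auto simp: nz_def)
      then show "regular_on (n + 1) (tor (n + 1)) g"
        using regular_on_cong[of "tor (n + 1)" g "\<lambda>Q. (Q $ 0) powi l * a (hat n Q)"] by (simp add: g_def)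
      show "g (torus_act n u Q) = u powi l * g Q" if "Q \<in> tor (n + 1)" "u \<noteq> 0" for Q u
        using actT[OF that] hat_act[OF n that] that torus_act_index[of 0 n u Q] n
        by (simp add: g_def wgt_def power_int_mult_distrib)
    qed (simp add: g_def)
    have fsg: "f Q * s Q = g Q" if "Q \<in> W0" for Q
    proof -
      have QT: "Q \<in> tor (n + 1)" and QU: "Q \<in> \<Union>U" using that by (auto simp: W0_def)
      have "hat n Q \<in> \<Union>U"
        unfolding hat_def by (rule torus_invD[OF Xt_openD(1)[OF U] QU]) (use tor_index[OF QT, of 0] in simp)
      then show ?thesis
        using section_hat[OF n s U QT] ab(4)[of "hat n Q"] QT by (simp add: f_def g_def)
    qed
    define V where "V = orb n W0"
    have V: "Xt_open n V" unfolding V_def by (rule Xt_open_orb[OF W0inv W0open])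
    have UV: "\<Union>V = W0" unfolding V_def by (rule Union_orb[OF W0inv])
    have sub: "V \<subseteq> U" "V \<subseteq> U0" "V \<subseteq> TT n"
      unfolding V_def using U U0 Xt_open_TT[OF n] Union_TT[OF n]
      by (subst orb_subset_iff[OF W0inv]; auto simp: Xt_open_def W0_def)+
    define T where "T = (\<lambda>W s Q. P W s Q - R W s Q)"
    have Tord: "diff_order_less n l k V T" unfolding T_def by (rule diff_order_subset[OF ord sub(2)])
    have key: "T V (restr V s) Q = 0" if Q: "Q \<in> W0" and fQ: "f Q \<noteq> 0" for Q
    proof (rule nilpotent_vanishing[OF Tord V restr_line_sheaf[OF Xt_open_TT[OF n] V sub(3) fs] restr_line_sheaf[OF U V sub(1) s]])
      show "restr V f Q \<noteq> 0" using Q fQ UV by (simp add: restr_def)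
      fix N
      have fN: "(\<lambda>Q. f Q ^ N * g Q) \<in> line_sheaf n l (TT n)"
      proof (induction N)
        case 0
        then show ?case using gs by simp
      next
        case (Suc N)
        show ?case
          using line_sheaf_mult0[OF Xt_open_TT[OF n] Xt_open_TT[OF n] subset_refl fs Suc] by (simp add: mult.assoc)
      qed
      have "(\<lambda>Q. restr V f Q ^ Suc N * restr V s Q) = restr V (\<lambda>Q. f Q ^ N * g Q)"
      proof
        fix Q
        show "restr V f Q ^ Suc N * restr V s Q = restr V (\<lambda>Q. f Q ^ N * g Q) Q"
        proof (cases "Q \<in> \<Union>V")
          case True
          then have "f Q * s Q = g Q" using fsg UV by blast
          then have "f Q ^ N * (f Q * s Q) = f Q ^ N * g Q" by simp
          then show ?thesis using True by (simp only: restr_def if_True power_Suc2 mult.assoc)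
        qed (simp only: restr_def if_False mult_zero_right)
      qed
      moreover have "P V (restr V (\<lambda>Q. f Q ^ N * g Q)) = R V (restr V (\<lambda>Q. f Q ^ N * g Q))"
        using shomD(4)[OF P Xt_open_TT[OF n] V sub(3) fN] shomD(4)[OF R Xt_open_TT[OF n] V sub(3) fN] eq[OF fN] by simp
      ultimately show "T V (\<lambda>Q. restr V f Q ^ Suc N * restr V s Q) = (\<lambda>_. 0)"
        by (simp add: T_def)
    qed
    define D where "D = (\<lambda>Q. P U s Q - R U s Q)"
    have Dsec: "D \<in> line_sheaf n l U" unfolding D_def by (intro line_sheaf_diff U shomD(1)[OF P U s] shomD(1)[OF R U s])
    have Dzero: "D Q = 0" if Q: "Q \<in> W0" "f Q \<noteq> 0" for Q
    proof -
      have "P V (restr V s) Q = P U s Q" "R V (restr V s) Q = R U s Q"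
        using shomD(4)[OF P U V sub(1) s] shomD(4)[OF R U V sub(1) s] Q UV by (simp_all add: restr_def)
      then show ?thesis using key[OF Q] by (simp add: T_def D_def)
    qed
    have freg: "regular_on (n + 1) W0 f"
      using regular_on_subset[OF line_sheafD(1)[OF fs, unfolded Union_TT[OF n]] nz_subset W0open] by (simp add: W0_def)
    have "D Q = 0" for Q
    proof (cases "Q \<in> \<Union>U")
      case True
      show ?thesis
      proof (rule regular_on_eq_zero[OF line_sheafD(1)[OF Dsec] Xt_openD(3)[OF U] zariski_open_nonzero[OF freg W0open] _ _ True])
        show "{q \<in> W0. f q \<noteq> 0} \<noteq> {}" using pW ab(3) hatp pT by (auto simp: f_def)
      qed (use Dzero in blast)
    qed (rule line_sheafD(3)[OF Dsec])
    then show ?thesis by (simp add: D_def fun_eq_iff)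
  qed
  then have "P U s = R U s" for U s
  proof (cases "Xt_open n U \<and> s \<in> line_sheaf n l U")
    case False
    then show ?thesis using shomD(5)[OF P False] shomD(5)[OF R False] by (simp only:)
  qed simp
  then show ?thesis by (intro ext) simp
qed

section \<open>Symbols of differential operators are polynomial\<close>

text \<open>\<open>theta n l\<close> is a parametrization of the exponents of the monomial sections of \<open>\<O>(l D\<^sub>0)\<close> by
  the exponents of the coordinates \<open>t Q\<^sub>1\<^sup>2, Q\<^sub>2/Q\<^sub>1, \<dots>, Q\<^sub>n/Q\<^sub>1\<close> of a chart.\<close>

definition theta :: "nat \<Rightarrow> int \<Rightarrow> (nat \<Rightarrow> int) \<Rightarrow> nat \<Rightarrow> int" where
  "theta n l \<kappa> = (\<lambda>i. if i = 0 then l + 2 * \<kappa> 0 - sum \<kappa> {1..<n} else if i < n then \<kappa> i else 0)"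

text \<open>The exponents of Q_1, ..., Q_n in the i-th chart coordinate, equivalently the increment
  of \<open>theta\<close> in the direction i (\<open>theta_unit\<close>).\<close>

definition step :: "nat \<Rightarrow> nat \<Rightarrow> int" where
  "step i = (\<lambda>j. if j = 0 then (if i = 0 then 2 else -1) else if j = i then 1 else 0)"

lemma sum_theta:
  assumes "n \<ge> 1"
  shows "sum (theta n l \<kappa>) {..<n} = l + 2 * \<kappa> 0"
proof -
  have "{..<n} = insert 0 {1..<n}" using assms by auto
  then have "sum (theta n l \<kappa>) {..<n} = theta n l \<kappa> 0 + sum (theta n l \<kappa>) {1..<n}" by simp
  moreover have "sum (theta n l \<kappa>) {1..<n} = sum \<kappa> {1..<n}" by (intro sum.cong) (auto simp: theta_def)
  ultimately show ?thesis by (simp add: theta_def)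
qed

lemma theta_lat: "n \<ge> 1 \<Longrightarrow> theta n l \<kappa> \<in> lat n l"
  using sum_theta[of n l \<kappa>] by (auto simp: lat_def theta_def)

lemma tdeg_theta: "n \<ge> 1 \<Longrightarrow> tdeg n l (theta n l \<kappa>) = \<kappa> 0"
  using sum_theta[of n l \<kappa>] by (simp add: tdeg_def)

lemma theta_surj:
  assumes n: "n \<ge> 1" and a: "a \<in> lat n l"
  shows "a = theta n l (\<lambda>i. if i = 0 then tdeg n l a else a i)"
proof
  fix i
  have "{..<n} = insert 0 {1..<n}" using n by auto
  then have "sum a {..<n} = a 0 + sum a {1..<n}" by simp
  moreover have "sum (\<lambda>i. if i = 0 then tdeg n l a else a i) {1..<n} = sum a {1..<n}"
    by (intro sum.cong) auto
  ultimately show "a i = theta n l (\<lambda>i. if i = 0 then tdeg n l a else a i) i"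
    using tdeg_eq[OF a] a n by (auto simp: theta_def lat_def)
qed

lemma theta_unit:
  assumes "i < n"
  shows "theta n l (\<lambda>j. \<kappa> j + unit_exp i j) = (\<lambda>j. theta n l \<kappa> j + step i j)"
proof -
  have "sum (unit_exp i) {1..<n} = (if i = 0 then 0 else 1)"
    using assms by (simp add: unit_exp_def)
  then show ?thesis
    using assms by (auto simp: theta_def step_def fun_eq_iff sum.distrib unit_exp_def)
qed

lemma step_lat: "i < n \<Longrightarrow> step i \<in> lat n 0"
proof -
  assume i: "i < n"
  have "step i = theta n 0 (unit_exp i)"
    using theta_unit[OF i, of 0 "\<lambda>_. 0"] by (simp add: theta_def fun_eq_iff)
  then show ?thesis using theta_lat[of n 0] i by simp
qed

lemma lat_add: "a \<in> lat n l \<Longrightarrow> e \<in> lat n k \<Longrightarrow> (\<lambda>i. a i + e i) \<in> lat n (l + k)"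
  by (auto simp: lat_def sum.distrib)

lemma mono_exp_add:
  assumes "a \<in> lat n l" "e \<in> lat n k"
  shows "mono_exp n (l + k) (\<lambda>i. a i + e i) = (\<lambda>i. mono_exp n l a i + mono_exp n k e i)"
  using tdeg_eq[OF assms(1)] tdeg_eq[OF assms(2)] tdeg_eq[OF lat_add[OF assms]]
  by (auto simp: mono_exp_def fun_eq_iff sum.distrib)

lemma lmono_add:
  assumes "a \<in> lat n l" "e \<in> lat n k"
  shows "lmono n (l + k) (\<lambda>i. a i + e i) Q = lmono n k e Q * lmono n l a Q"
  unfolding lmono_def mono_exp_add[OF assms] using lm_add[of Q "n + 1"] by (simp add: mult.commute)

lemma lmono_nonzero: "Q \<in> tor (n + 1) \<Longrightarrow> lmono n l a Q \<noteq> 0"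
  by (simp add: lmono_def lm_nonzero)

definition Dl :: "nat \<Rightarrow> ((nat \<Rightarrow> int) \<Rightarrow> complex) \<Rightarrow> (nat \<Rightarrow> int) \<Rightarrow> complex" where
  "Dl i h = (\<lambda>\<kappa>. h (\<lambda>j. \<kappa> j + unit_exp i j) - h \<kappa>)"

lemma Dl_scale: "(Dl i ^^ k) (\<lambda>\<kappa>. c * h \<kappa>) = (\<lambda>\<kappa>. c * (Dl i ^^ k) h \<kappa>)"
  by (induction k) (simp_all add: Dl_def algebra_simps)

text \<open>For a chart monomial f, the difference T(f m)/(f m) - T(m)/m equals [T, f](m)/(f m).
  Hence commutators become finite differences of the symbol, up to the constant factor 1/f at Q, and
  a bounded order makes iterated differences vanish.\<close>

lemma Dl_nilpotent:
  assumes "diff_order_less n l k V T" "Xt_open n V" "V \<subseteq> TT n" "i < n" "Q \<in> \<Union>V"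
  shows "(Dl i ^^ k) (\<lambda>\<kappa>. T V (restr V (lmono n l (theta n l \<kappa>))) Q / lmono n l (theta n l \<kappa>) Q) \<kappa> = 0"
  using assms(1)
proof (induction k arbitrary: T \<kappa>)
  have n: "n \<ge> 1" using assms(4) by simp
  have sec: "restr V (lmono n l a) \<in> line_sheaf n l V" if "a \<in> lat n l" for a l
    by (rule restr_line_sheaf[OF Xt_open_TT[OF n] assms(2,3) lmono_section[OF n that]])
  {
    case 0
    then show ?case using assms(2) sec[OF theta_lat[OF n]] by simp
  next
    case (Suc k)
    let ?m = "\<lambda>\<kappa>. lmono n l (theta n l \<kappa>)"
    let ?f = "lmono n 0 (step i)"
    let ?f' = "restr V ?f"
    have QT: "Q \<in> tor (n + 1)" using assms(3,5) Union_TT[OF n] by blast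
    have fQ: "?f Q \<noteq> 0" and mQ: "?m \<kappa> Q \<noteq> 0" for \<kappa> using lmono_nonzero[OF QT] by auto
    have m: "?m (\<lambda>j. \<kappa> j + unit_exp i j) q = ?f q * ?m \<kappa> q" for \<kappa> q
      unfolding theta_unit[OF assms(4)] using lmono_add[OF theta_lat[OF n] step_lat[OF assms(4)], of l \<kappa> q] by simp
    have comm: "diff_order_less n l k V (commutator T ?f')"
      using Suc.prems assms(2) sec[OF step_lat[OF assms(4)]] by simp
    have E: "Dl i (\<lambda>\<kappa>. T V (restr V (?m \<kappa>)) Q / ?m \<kappa> Q) =
        (\<lambda>\<kappa>. inverse (?f Q) * (commutator T ?f' V (restr V (?m \<kappa>)) Q / ?m \<kappa> Q))"
    proof
      fix \<kappa>
      have r: "restr V (?m (\<lambda>j. \<kappa> j + unit_exp i j)) = (\<lambda>q. ?f' q * restr V (?m \<kappa>) q)"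
        by (auto simp: restr_def m)
      have f': "?f' Q = ?f Q" using assms(5) by (simp add: restr_def)
      show "Dl i (\<lambda>\<kappa>. T V (restr V (?m \<kappa>)) Q / ?m \<kappa> Q) \<kappa> =
        inverse (?f Q) * (commutator T ?f' V (restr V (?m \<kappa>)) Q / ?m \<kappa> Q)"
        unfolding Dl_def r m commutator_def f' using fQ mQ[of \<kappa>] by (simp add: field_simps)
    qed
    show ?case
      unfolding funpow_Suc_right comp_def E Dl_scale Suc.IH[OF comm] by simp
  }
qed

section \<open>Newton interpolation and polynomial dependence on the exponent\<close>

inductive_set poly_exp :: "nat \<Rightarrow> ((nat \<Rightarrow> int) \<Rightarrow> complex) set" for n :: nat where
  const: "(\<lambda>_. c) \<in> poly_exp n"
| coord: "i < n \<Longrightarrow> (\<lambda>\<kappa>. of_int (\<kappa> i)) \<in> poly_exp n"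
| add: "f \<in> poly_exp n \<Longrightarrow> g \<in> poly_exp n \<Longrightarrow> (\<lambda>\<kappa>. f \<kappa> + g \<kappa>) \<in> poly_exp n"
| mult: "f \<in> poly_exp n \<Longrightarrow> g \<in> poly_exp n \<Longrightarrow> (\<lambda>\<kappa>. f \<kappa> * g \<kappa>) \<in> poly_exp n"

lemma poly_exp_diff:
  assumes "f \<in> poly_exp n" "g \<in> poly_exp n"
  shows "(\<lambda>\<kappa>. f \<kappa> - g \<kappa>) \<in> poly_exp n"
  using poly_exp.add[OF assms(1) poly_exp.mult[OF poly_exp.const[of "-1"] assms(2)]] by simp

lemma poly_exp_prod: "(\<And>i. i \<in> A \<Longrightarrow> f i \<in> poly_exp n) \<Longrightarrow> (\<lambda>\<kappa>. \<Prod>i\<in>A. f i \<kappa>) \<in> poly_exp n"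
  by (induction A rule: infinite_finite_induct) (auto intro: poly_exp.intros)

lemma poly_exp_sum: "(\<And>i. i \<in> A \<Longrightarrow> f i \<in> poly_exp n) \<Longrightarrow> (\<lambda>\<kappa>. \<Sum>i\<in>A. f i \<kappa>) \<in> poly_exp n"
  by (induction A rule: infinite_finite_induct) (auto intro: poly_exp.intros)

lemma poly_exp_gbinomial:
  assumes "i < n"
  shows "(\<lambda>\<kappa>. (of_int (\<kappa> i) :: complex) gchoose r) \<in> poly_exp n"
proof -
  have "(\<lambda>\<kappa>. inverse (fact r) * (\<Prod>j = 0..<r. (of_int (\<kappa> i) :: complex) - of_nat j)) \<in> poly_exp n"
    by (intro poly_exp.mult poly_exp.const poly_exp_prod poly_exp_diff poly_exp.coord assms)
  then show ?thesis by (simp add: gbinomial_prod_rev divide_inverse mult.commute)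
qed

text \<open>Newton's forward difference formula at all integers, negative ones included. By
  induction the two sides have the same difference, so their difference is 1-periodic on the
  integers, and it vanishes at 0.\<close>

lemma newton_series:
  fixes g :: "int \<Rightarrow> complex"
  assumes "\<And>j. ((\<lambda>h j. h (j + 1) - h j) ^^ k) g j = 0"
  shows "g j = (\<Sum>r<k. (of_int j gchoose r) * ((\<lambda>h j. h (j + 1) - h j) ^^ r) g 0)"
  using assms
proof (induction k arbitrary: g j)
  case 0
  then show ?case by simp
next
  case (Suc k)
  let ?D = "\<lambda>h (j::int). h (j + 1) - h j :: complex"
  have IH: "?D g j = (\<Sum>r<k. (of_int j gchoose r) * (?D ^^ Suc r) g 0)" for j
    unfolding funpow_Suc_right comp_def
    by (rule Suc.IH) (use Suc.prems in \<open>simp only: funpow_Suc_right comp_def\<close>)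
  define h where "h j = g j - (\<Sum>r<Suc k. (of_int j gchoose r) * (?D ^^ r) g 0)" for j
  have "h (j + 1) = h j" for j
  proof -
    have "(\<Sum>r<Suc k. (of_int (j + 1) gchoose r) * (?D ^^ r) g 0) - (\<Sum>r<Suc k. (of_int j gchoose r) * (?D ^^ r) g 0)
        = (\<Sum>r<k. ((of_int j + 1 gchoose Suc r) - (of_int j gchoose Suc r)) * (?D ^^ Suc r) g 0)"
      unfolding sum.lessThan_Suc_shift by (simp add: sum_subtractf left_diff_distrib)
    also have "\<dots> = ?D g j" unfolding IH gbinomial_Suc_Suc by simp
    finally show ?thesis by (simp add: h_def algebra_simps)
  qed
  then have step: "h (j + 1) = h j" for j .
  have "h j = h 0" for j
  proof (induction j rule: int_induct[of _ 0])
    case (step2 i)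
    then show ?case using step[of "i - 1"] by simp
  qed (use step in auto)
  moreover have "h 0 = 0"
    unfolding h_def sum.lessThan_Suc_shift by simp
  ultimately have "h j = 0" by metis
  then show ?case by (simp add: h_def)
qed

text \<open>A family of Laurent polynomials with one finite set of exponents for all \<kappa> and
  coefficients polynomial in \<kappa>. The uniformity of \<open>E\<close> is the essential
  content.\<close>

definition sym_exp :: "nat \<Rightarrow> ((nat \<Rightarrow> int) \<Rightarrow> complex vec \<Rightarrow> complex) \<Rightarrow> bool" where
  "sym_exp n K \<longleftrightarrow> (\<exists>E p. finite E \<and> E \<subseteq> lat n 0 \<and> (\<forall>e\<in>E. p e \<in> poly_exp n) \<and>
     (\<forall>\<kappa>. \<forall>Q\<in>tor (n + 1). K \<kappa> Q = (\<Sum>e\<in>E. p e \<kappa> * lmono n 0 e Q)))"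

lemma sym_exp_zero: "sym_exp n (\<lambda>_ _. 0)"
  unfolding sym_exp_def by (rule exI[of _ "{}"]) simp

lemma sym_exp_mult:
  assumes "sym_exp n K" "q \<in> poly_exp n"
  shows "sym_exp n (\<lambda>\<kappa> Q. q \<kappa> * K \<kappa> Q)"
proof -
  obtain E p where E: "finite E" "E \<subseteq> lat n 0" "\<forall>e\<in>E. p e \<in> poly_exp n"
    "\<And>\<kappa> Q. Q \<in> tor (n + 1) \<Longrightarrow> K \<kappa> Q = (\<Sum>e\<in>E. p e \<kappa> * lmono n 0 e Q)"
    using assms(1) unfolding sym_exp_def by blast
  show ?thesis
    unfolding sym_exp_def
    by (rule exI[of _ E], rule exI[of _ "\<lambda>e \<kappa>. q \<kappa> * p e \<kappa>"])
       (use E assms(2) in \<open>auto intro!: poly_exp.mult simp: sum_distrib_left mult.assoc\<close>)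
qed

lemma sym_exp_add:
  assumes "sym_exp n K" "sym_exp n L"
  shows "sym_exp n (\<lambda>\<kappa> Q. K \<kappa> Q + L \<kappa> Q)"
proof -
  obtain E p where E: "finite E" "E \<subseteq> lat n 0" "\<forall>e\<in>E. p e \<in> poly_exp n"
    "\<And>\<kappa> Q. Q \<in> tor (n + 1) \<Longrightarrow> K \<kappa> Q = (\<Sum>e\<in>E. p e \<kappa> * lmono n 0 e Q)"
    using assms(1) unfolding sym_exp_def by blast
  obtain F q where F: "finite F" "F \<subseteq> lat n 0" "\<forall>e\<in>F. q e \<in> poly_exp n"
    "\<And>\<kappa> Q. Q \<in> tor (n + 1) \<Longrightarrow> L \<kappa> Q = (\<Sum>e\<in>F. q e \<kappa> * lmono n 0 e Q)"
    using assms(2) unfolding sym_exp_def by blast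
  let ?p = "\<lambda>e. if e \<in> E then p e else (\<lambda>_. 0)" and ?q = "\<lambda>e. if e \<in> F then q e else (\<lambda>_. 0)"
  have pq: "?p e \<in> poly_exp n" "?q e \<in> poly_exp n" for e using E(3) F(3) poly_exp.const by auto
  have "K \<kappa> Q + L \<kappa> Q = (\<Sum>e\<in>E \<union> F. (?p e \<kappa> + ?q e \<kappa>) * lmono n 0 e Q)" if Q: "Q \<in> tor (n + 1)" for \<kappa> Q
  proof -
    have "K \<kappa> Q = (\<Sum>e\<in>E \<union> F. ?p e \<kappa> * lmono n 0 e Q)"
      unfolding E(4)[OF Q] using E(1) F(1) by (intro sum.mono_neutral_cong_left) auto
    moreover have "L \<kappa> Q = (\<Sum>e\<in>E \<union> F. ?q e \<kappa> * lmono n 0 e Q)"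
      unfolding F(4)[OF Q] using E(1) F(1) by (intro sum.mono_neutral_cong_left) auto
    ultimately show ?thesis by (simp only: distrib_right sum.distrib)
  qed
  then show ?thesis
    unfolding sym_exp_def
    by - (rule exI[of _ "E \<union> F"], rule exI[of _ "\<lambda>e \<kappa>. ?p e \<kappa> + ?q e \<kappa>"],
        intro conjI ballI allI poly_exp.add pq, use E F in auto)
qed

lemma sym_exp_diff:
  assumes "sym_exp n K" "sym_exp n L"
  shows "sym_exp n (\<lambda>\<kappa> Q. K \<kappa> Q - L \<kappa> Q)"
  using sym_exp_add[OF assms(1) sym_exp_mult[OF assms(2) poly_exp.const[of "-1"]]] by simp

lemma sym_exp_sum: "(\<And>i. i \<in> A \<Longrightarrow> sym_exp n (K i)) \<Longrightarrow> sym_exp n (\<lambda>\<kappa> Q. \<Sum>i\<in>A. K i \<kappa> Q)"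
  by (induction A rule: infinite_finite_induct) (auto intro: sym_exp_zero sym_exp_add)

lemma sym_exp_section:
  assumes n: "n \<ge> 1" and g: "g \<in> line_sheaf n 0 (TT n)"
  shows "sym_exp n (\<lambda>_. g)"
proof -
  obtain u where u: "u \<in> fsupp n 0" "g = lser n 0 u" using section_lser[OF n g] by blast
  show ?thesis
    unfolding sym_exp_def
    by (rule exI[of _ "{a. u a \<noteq> 0}"], rule exI[of _ "\<lambda>e _. u e"])
       (use u in \<open>auto simp: fsupp_def lser_def intro: poly_exp.const\<close>)
qed

lemma sym_exp_cong:
  assumes "sym_exp n K" "\<And>\<kappa> Q. Q \<in> tor (n + 1) \<Longrightarrow> L \<kappa> Q = K \<kappa> Q"
  shows "sym_exp n L"
  using assms unfolding sym_exp_def by simp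

text \<open>The Newton formula is applied to one coordinate at a time.
  \<open>mix i \<rho> \<kappa>\<close> freezes the coordinates below i at \<rho>; the induction
  starts with all of them frozen and releases the last frozen one. The statement is for all \<rho>,
  because differences combine several frozen values.\<close>

lemma sym_exp_of_nilpotent:
  fixes h :: "(nat \<Rightarrow> int) \<Rightarrow> complex vec \<Rightarrow> complex"
  assumes sec: "\<And>\<rho>. sym_exp n (\<lambda>_. h \<rho>)"
    and nil: "\<And>i \<kappa> Q. i < n \<Longrightarrow> Q \<in> tor (n + 1) \<Longrightarrow> (Dl i ^^ k) (\<lambda>\<kappa>. h \<kappa> Q) \<kappa> = 0"
    and dep: "\<And>\<kappa> \<rho>. (\<And>j. j < n \<Longrightarrow> \<kappa> j = \<rho> j) \<Longrightarrow> h \<kappa> = h \<rho>"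
  shows "sym_exp n h"
proof -
  define mix where "mix i \<rho> \<kappa> = (\<lambda>j. if j < i then \<rho> j else \<kappa> j)" for i and \<rho> \<kappa> :: "nat \<Rightarrow> int"
  have "\<forall>\<rho>. sym_exp n (\<lambda>\<kappa>. h (mix (n - m) \<rho> \<kappa>))" for m
  proof (induction m)
    case 0
    have "h (mix n \<rho> \<kappa>) = h \<rho>" for \<rho> \<kappa> by (rule dep) (simp add: mix_def)
    then show ?case using sec by simp
  next
    case (Suc m)
    show ?case
    proof (cases "m < n")
      case False
      then show ?thesis using Suc by simp
    next
      case True
      define i where "i = n - Suc m"
      have i: "i < n" "n - m = Suc i" using True by (auto simp: i_def)
      have Dl_sym: "sym_exp n (\<lambda>\<kappa> Q. (Dl i ^^ r) (\<lambda>\<kappa>. h \<kappa> Q) (mix (Suc i) \<rho> \<kappa>))" for r \<rho>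
      proof (induction r arbitrary: \<rho>)
        case 0
        then show ?case using Suc.IH i by simp
      next
        case (Suc r)
        have m': "(\<lambda>j. mix (Suc i) \<rho> \<kappa> j + unit_exp i j) = mix (Suc i) (\<rho>(i := \<rho> i + 1)) \<kappa>" for \<kappa>
          by (auto simp: mix_def unit_exp_def)
        have e: "(Dl i ^^ Suc r) (\<lambda>\<kappa>. h \<kappa> Q) (mix (Suc i) \<rho> \<kappa>) =
            (Dl i ^^ r) (\<lambda>\<kappa>. h \<kappa> Q) (mix (Suc i) (\<rho>(i := \<rho> i + 1)) \<kappa>) - (Dl i ^^ r) (\<lambda>\<kappa>. h \<kappa> Q) (mix (Suc i) \<rho> \<kappa>)" for \<kappa> Q
          unfolding funpow.simps comp_def Dl_def m' ..
        show ?case unfolding e by (intro sym_exp_diff Suc)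
      qed
      have expand: "h (mix i \<rho> \<kappa>) Q = (\<Sum>r<k. (of_int (\<kappa> i) gchoose r) * (Dl i ^^ r) (\<lambda>\<kappa>. h \<kappa> Q) (mix (Suc i) (\<rho>(i := 0)) \<kappa>))"
        if Q: "Q \<in> tor (n + 1)" for \<rho> \<kappa> Q
      proof -
        define g where "g = (\<lambda>j. h ((mix i \<rho> \<kappa>)(i := j)) Q)"
        have Dg: "((\<lambda>h j. h (j + 1) - h j) ^^ r) g j = (Dl i ^^ r) (\<lambda>\<kappa>. h \<kappa> Q) ((mix i \<rho> \<kappa>)(i := j))" for r j
        proof (induction r arbitrary: j)
          case 0
          show ?case unfolding funpow.simps(1) id_apply g_def ..
        next
          case (Suc r)
          have m': "(\<lambda>c. ((mix i \<rho> \<kappa>)(i := j)) c + unit_exp i c) = (mix i \<rho> \<kappa>)(i := j + 1)"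
            by (auto simp: unit_exp_def)
          show ?case unfolding funpow.simps comp_def Dl_def m' Suc by (simp add: Dl_def[abs_def])
        qed
        have "g (\<kappa> i) = (\<Sum>r<k. (of_int (\<kappa> i) gchoose r) * ((\<lambda>h j. h (j + 1) - h j) ^^ r) g 0)"
          by (rule newton_series) (simp only: Dg nil[OF i(1) Q])
        moreover have "(mix i \<rho> \<kappa>)(i := \<kappa> i) = mix i \<rho> \<kappa>" "(mix i \<rho> \<kappa>)(i := 0) = mix (Suc i) (\<rho>(i := 0)) \<kappa>"
          by (auto simp: mix_def)
        ultimately show ?thesis unfolding Dg by (simp add: g_def)
      qed
      have "sym_exp n (\<lambda>\<kappa>. h (mix i \<rho> \<kappa>))" for \<rho>
      proof (rule sym_exp_cong)
        show "sym_exp n (\<lambda>\<kappa> Q. \<Sum>r<k. (of_int (\<kappa> i) gchoose r) * (Dl i ^^ r) (\<lambda>\<kappa>. h \<kappa> Q) (mix (Suc i) (\<rho>(i := 0)) \<kappa>))"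
          by (intro sym_exp_sum sym_exp_mult poly_exp_gbinomial Dl_sym i(1))
      qed (rule expand)
      then show ?thesis by (simp add: i_def)
    qed
  qed
  from this[of n] show ?thesis by (simp add: mix_def)
qed

text \<open>A bound near a single point is enough, since later identities spread from a nonempty
  open set by the identity theorem.\<close>

lemma diff_ops_order:
  assumes n: "n \<ge> 1" and P: "P \<in> diff_ops n l"
  obtains U k where "Xt_open n U" "\<Union>U \<noteq> {}" "diff_order_less n l k U P"
proof -
  have "cover n \<noteq> {}" using torus_inv_tor[OF n] tor_nonempty[of "n + 1"] unfolding torus_inv_def by blast
  then obtain x where x: "x \<in> Xt n" by (auto simp: Xt_def)
  have "\<exists>U k. Xt_open n U \<and> x \<in> U \<and> diff_order_less n l k U P"
    by (rule P[unfolded diff_ops_def, THEN CollectD, THEN conjunct2, THEN bspec, OF x])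
  then obtain U k where U: "Xt_open n U" "x \<in> U" "diff_order_less n l k U P" by (elim exE conjE)
  have "\<Union>U \<noteq> {}"
  proof -
    obtain Q where Q: "x = torus_orbit n Q" using x by (auto simp: Xt_def)
    have "torus_act n 1 Q \<in> torus_orbit n Q" unfolding torus_orbit_def by (rule CollectI, rule exI[of _ 1]) simp
    then have "torus_act n 1 Q \<in> x" by (simp only: Q)
    then have "torus_act n 1 Q \<in> \<Union>U" by (rule UnionI[OF U(2)])
    then show ?thesis by (metis empty_iff)
  qed
  then show thesis by (rule that[OF U(1) _ U(3)])
qed

lemma diff_op_expansion:
  assumes n: "n \<ge> 1" and P: "P \<in> diff_ops n l"
  shows "\<exists>E p. finite E \<and> E \<subseteq> lat n 0 \<and> (\<forall>e\<in>E. p e \<in> poly_exp n) \<and>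
     (\<forall>\<kappa>. P (TT n) (lmono n l (theta n l \<kappa>)) = (\<lambda>Q. \<Sum>e\<in>E. p e \<kappa> * lmono n l (\<lambda>i. theta n l \<kappa> i + e i) Q))"
proof -
  let ?m = "\<lambda>\<kappa>. lmono n l (theta n l \<kappa>)"
  \<comment> \<open>The symbol P(m)/m, written as a product with the inverse monomial so that it is
    visibly a section of weight 0 over the torus.\<close>
  define h where "h \<kappa> Q = P (TT n) (?m \<kappa>) Q * lmono n (- l) (\<lambda>i. - theta n l \<kappa> i) Q" for \<kappa> Q
  have Ps: "P \<in> shom n l l" using P by (simp add: diff_ops_def sheaf_endo_eq)
  note TT = Xt_open_TT[OF n]
  have lat': "(\<lambda>i. - theta n l \<kappa> i) \<in> lat n (- l)" for \<kappa>
    using theta_lat[OF n, of l \<kappa>] by (auto simp: lat_def sum_negf)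
  have inv: "lmono n (- l) (\<lambda>i. - theta n l \<kappa> i) Q * ?m \<kappa> Q = 1" if "Q \<in> tor (n + 1)" for \<kappa> Q
  proof -
    have "lmono n 0 (\<lambda>_. 0) Q = 1" using that by (simp add: lmono_def mono_exp_def tdeg_def lm_def)
    then show ?thesis using lmono_add[OF theta_lat[OF n, of l \<kappa>] lat'[of \<kappa>], of Q] by simp
  qed
  have hdiv: "h \<kappa> Q = P (TT n) (?m \<kappa>) Q / ?m \<kappa> Q" if "Q \<in> tor (n + 1)" for \<kappa> Q
    using inv[OF that, of \<kappa>] lmono_nonzero[OF that] by (simp add: h_def field_simps)
  have msec: "?m \<kappa> \<in> line_sheaf n l (TT n)" for \<kappa> by (rule lmono_section[OF n theta_lat[OF n]])
  have hsec: "h \<kappa> \<in> line_sheaf n 0 (TT n)" for \<kappa>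
    using line_sheaf_mult[OF TT TT subset_refl shomD(1)[OF Ps TT msec] lmono_section[OF n lat']]
    unfolding h_def[abs_def] by simp
  obtain U k where U: "Xt_open n U" and Une: "\<Union>U \<noteq> {}" and ord: "diff_order_less n l k U P"
    by (rule diff_ops_order[OF n P])
  define W where "W = \<Union>U \<inter> tor (n + 1)"
  have Wopen: "zariski_open (n + 1) W" unfolding W_def by (intro zariski_open_Int Xt_openD(2) U zariski_open_tor)
  have Winv: "torus_inv n W" unfolding W_def by (intro torus_inv_Int Xt_openD(1) U torus_inv_tor n)
  have Wne: "W \<noteq> {}"
    unfolding W_def by (rule zariski_open_Int_nonempty[OF Xt_openD(2)[OF U] zariski_open_tor Une tor_nonempty])
  define V where "V = orb n W"
  have V: "Xt_open n V" unfolding V_def by (rule Xt_open_orb[OF Winv Wopen])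
  have UV: "\<Union>V = W" unfolding V_def by (rule Union_orb[OF Winv])
  have Xt: "U \<subseteq> Xt n" "TT n \<subseteq> Xt n" using U TT by (simp_all only: Xt_open_def)
  have "W \<subseteq> \<Union>(TT n)" unfolding Union_TT[OF n] W_def by (rule Int_lower2)
  then have sub: "V \<subseteq> U" "V \<subseteq> TT n"
    unfolding V_def using orb_subset_iff[OF Winv Xt(1)] orb_subset_iff[OF Winv Xt(2)] Int_lower1[of "\<Union>U" "tor (n + 1)"]
    by (simp_all only: W_def)
  have "sym_exp n h"
  proof (rule sym_exp_of_nilpotent)
    show "sym_exp n (\<lambda>_. h \<rho>)" for \<rho> by (rule sym_exp_section[OF n hsec])
    show "h \<kappa> = h \<rho>" if "\<And>j. j < n \<Longrightarrow> \<kappa> j = \<rho> j" for \<kappa> \<rho>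
    proof -
      have "sum \<kappa> {1..<n} = sum \<rho> {1..<n}" using that by (intro sum.cong) auto
      then have "theta n l \<kappa> = theta n l \<rho>" using that n by (auto simp: theta_def)
      then show ?thesis by (intro ext) (simp only: h_def)
    qed
    fix i \<kappa> Q assume i: "i < n" and Q: "Q \<in> tor (n + 1)"
    have reg: "regular_on (n + 1) (tor (n + 1)) (\<lambda>Q. (Dl i ^^ r) (\<lambda>\<kappa>. h \<kappa> Q) \<kappa>)" for r \<kappa>
    proof (induction r arbitrary: \<kappa>)
      case 0
      then show ?case using line_sheafD(1)[OF hsec] by (simp add: Union_TT[OF n])
    next
      case (Suc r)
      show ?case unfolding funpow.simps comp_def Dl_def
        by (intro regular_on_diff zariski_open_tor Suc[unfolded Dl_def])
    qed
    have zero: "(Dl i ^^ k) (\<lambda>\<kappa>. h \<kappa> q) \<kappa> = 0" if q: "q \<in> W" for q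
    proof -
      have qT: "q \<in> tor (n + 1)" using q by (simp add: W_def)
      have "h \<kappa> q = P V (restr V (?m \<kappa>)) q / ?m \<kappa> q" for \<kappa>
        using hdiv[OF qT, of \<kappa>] shomD(4)[OF Ps TT V sub(2) msec, of \<kappa>] q UV by (simp add: restr_def)
      then show ?thesis
        using Dl_nilpotent[OF diff_order_subset[OF ord sub(1)] V sub(2) i, of q \<kappa>] q UV by simp
    qed
    show "(Dl i ^^ k) (\<lambda>\<kappa>. h \<kappa> Q) \<kappa> = 0"
      by (rule regular_on_eq_zero[OF reg nz_subset Wopen Wne _ Q]) (rule zero)
  qed
  then obtain E p where E: "finite E" "E \<subseteq> lat n 0" "\<forall>e\<in>E. p e \<in> poly_exp n"
    "\<And>\<kappa> Q. Q \<in> tor (n + 1) \<Longrightarrow> h \<kappa> Q = (\<Sum>e\<in>E. p e \<kappa> * lmono n 0 e Q)"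
    unfolding sym_exp_def by blast
  have "P (TT n) (?m \<kappa>) Q = (\<Sum>e\<in>E. p e \<kappa> * lmono n l (\<lambda>i. theta n l \<kappa> i + e i) Q)" for \<kappa> Q
  proof (cases "Q \<in> tor (n + 1)")
    case True
    have "P (TT n) (?m \<kappa>) Q = h \<kappa> Q * ?m \<kappa> Q"
      using hdiv[OF True] lmono_nonzero[OF True] by simp
    also have "\<dots> = (\<Sum>e\<in>E. p e \<kappa> * (lmono n 0 e Q * ?m \<kappa> Q))"
      unfolding E(4)[OF True] by (simp add: sum_distrib_right mult.assoc)
    also have "\<dots> = (\<Sum>e\<in>E. p e \<kappa> * lmono n l (\<lambda>i. theta n l \<kappa> i + e i) Q)"
      using E(2) lmono_add[OF theta_lat[OF n, of l \<kappa>], of _ 0 Q] by (intro sum.cong refl) auto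
    finally show ?thesis .
  next
    case False
    then show ?thesis
      using line_sheafD(3)[OF shomD(1)[OF Ps TT msec], of Q] by (simp add: Union_TT[OF n] lmono_def)
  qed
  then have "P (TT n) (?m \<kappa>) = (\<lambda>Q. \<Sum>e\<in>E. p e \<kappa> * lmono n l (\<lambda>i. theta n l \<kappa> i + e i) Q)" for \<kappa> by (intro ext)
  then show ?thesis by - (rule exI[of _ E], rule exI[of _ p], intro conjI E(1-3) allI)
qed

section \<open>Extension across the coordinate divisors\<close>

lemma regular_on_lm_nonneg:
  assumes "i < N" "\<beta> i \<ge> 0"
  shows "regular_on N (nz N ({..<N} - {i})) (lm N \<beta>)"
  unfolding lm_def[abs_def]
proof (rule regular_on_prod)
  have W: "zariski_open N (nz N ({..<N} - {i}))" by (rule zariski_open_nz) auto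
  show "regular_on N (nz N ({..<N} - {i})) (\<lambda>q. q $ j powi \<beta> j)" if "j \<in> {..<N}" for j
  proof (cases "j = i")
    case True
    have "regular_on N (nz N ({..<N} - {i})) (\<lambda>q. poly (monom 1 (nat (\<beta> i))) (q $ i))"
      by (rule regular_on_poly1[OF regular_on_coord[OF W assms(1)] W])
    then show ?thesis using assms(2) True by (simp add: poly_monom power_int_def)
  next
    case False
    show ?thesis
      by (rule regular_on_powi[OF regular_on_coord[OF W] W]) (use that False in \<open>auto simp: nz_def\<close>)
  qed
qed (rule zariski_open_nz, auto)

lemma lm_upd_zero:
  assumes "i < N"
  shows "lm N \<beta> (upd N q i 0) = (if \<beta> i = 0 then lm N (\<beta>(i := 0)) q else 0)"
proof -
  have "lm N \<beta> (upd N q i 0) = 0 powi \<beta> i * (\<Prod>j\<in>{..<N} - {i}. q $ j powi \<beta> j)"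
    unfolding lm_def using assms by (subst prod.remove[of _ i]) (auto intro!: prod.cong)
  moreover have "lm N (\<beta>(i := 0)) q = (\<Prod>j\<in>{..<N} - {i}. q $ j powi \<beta> j)"
    unfolding lm_def using assms by (subst prod.remove[of _ i]) (auto intro!: prod.cong)
  ultimately show ?thesis by simp
qed

text \<open>Let d be the lowest exponent of the i-th coordinate among the terms that occur. If d <
  0, then F times the power -d of this coordinate vanishes on the divisor because F is regular
  there, while exactly the terms with exponent d survive restriction. These are distinct monomials,
  so independence kills their coefficients.\<close>

lemma no_pole:
  assumes i: "i < N" and F: "regular_on N (nz N ({..<N} - {i})) F"
    and E: "finite E" "inj_on \<gamma> E" "\<And>e. e \<in> E \<Longrightarrow> \<forall>j\<ge>N. \<gamma> e j = (0 :: int)"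
    and eq: "\<And>q. q \<in> tor N \<Longrightarrow> F q = (\<Sum>e\<in>E. c e * lm N (\<gamma> e) q)"
    and e: "e \<in> E" "\<gamma> e i < 0"
  shows "c e = 0"
proof (rule ccontr)
  assume ce: "c e \<noteq> 0"
  let ?W = "nz N ({..<N} - {i})"
  have W: "zariski_open N ?W" by (rule zariski_open_nz) auto
  define M where "M = {e\<in>E. c e \<noteq> 0}"
  have finM: "finite M" using E(1) by (simp add: M_def)
  have eM: "e \<in> M" using e ce by (simp add: M_def)
  define d where "d = Min ((\<lambda>e. \<gamma> e i) ` M)"
  have dmin: "d \<le> \<gamma> b i" if "b \<in> M" for b unfolding d_def using finM that by simp
  have d0: "d < 0" using dmin[OF eM] e by simp
  have "d \<in> (\<lambda>e. \<gamma> e i) ` M" unfolding d_def using finM eM by (intro Min_in) auto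
  then obtain e0 where e0: "e0 \<in> M" "\<gamma> e0 i = d" by auto
  define \<delta> where "\<delta> b = (\<lambda>j. (if j = i then - d else 0) + \<gamma> b j)" for b
  define G where "G q = (\<Sum>b\<in>M. c b * lm N (\<delta> b) q)" for q
  have Greg: "regular_on N ?W G"
    unfolding G_def[abs_def] by (intro regular_on_sum regular_on_scale regular_on_lm_nonneg i W)
      (use dmin in \<open>auto simp: \<delta>_def\<close>)
  have FG: "q $ i ^ nat (- d) * F q = G q" if "q \<in> ?W" for q
  proof (rule regular_on_eq[OF _ Greg W zariski_open_tor tor_nonempty _ that])
    show "regular_on N ?W (\<lambda>q. q $ i ^ nat (- d) * F q)"
      using regular_on_mult[OF regular_on_poly1[OF regular_on_coord[OF W i] W, of "monom 1 (nat (- d))"] F nz_subset]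
      by (simp add: poly_monom)
    fix q assume q: "q \<in> tor N"
    have "F q = (\<Sum>b\<in>M. c b * lm N (\<gamma> b) q)"
      unfolding eq[OF q] M_def using E(1) by (intro sum.mono_neutral_right) auto
    moreover have "lm N (\<delta> b) q = q $ i ^ nat (- d) * lm N (\<gamma> b) q" for b
      unfolding \<delta>_def lm_add[OF q] lm_single[OF i] using d0 by (simp add: power_int_def)
    ultimately show "q $ i ^ nat (- d) * F q = G q"
      by (simp add: G_def sum_distrib_left mult.left_commute)
  qed
  define M0 where "M0 = {b\<in>M. \<gamma> b i = d}"
  \<comment> \<open>Restriction to the divisor forgets the i-th exponent; on \<open>M0\<close> that
    exponent is always d, so distinct terms stay distinct.\<close>
  define g where "g b = (\<gamma> b)(i := 0)" for b
  have inj: "inj_on g M0"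
  proof (rule inj_onI)
    fix a b assume ab: "a \<in> M0" "b \<in> M0" "g a = g b"
    have "\<gamma> a = (g a)(i := d)" "\<gamma> b = (g b)(i := d)" using ab(1,2) by (auto simp: g_def M0_def)
    then have "\<gamma> a = \<gamma> b" using ab(3) by simp
    then show "a = b" using E(2) ab by (auto simp: M0_def M_def dest: inj_onD)
  qed
  have sum0: "(\<Sum>b\<in>M0. c b * lm N (g b) q) = 0" if q: "q \<in> tor N" for q
  proof -
    have "upd N q i 0 \<in> ?W" using q by (auto simp: nz_def)
    then have "G (upd N q i 0) = 0" using FG[of "upd N q i 0"] d0 i by (simp add: power_0_left)
    moreover have "G (upd N q i 0) = (\<Sum>b\<in>M. if b \<in> M0 then c b * lm N (g b) q else 0)"
      unfolding G_def
    proof (intro sum.cong refl)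
      fix b assume b: "b \<in> M"
      have "(\<delta> b)(i := 0) = g b" by (auto simp: \<delta>_def g_def)
      moreover have "\<delta> b i = 0 \<longleftrightarrow> b \<in> M0" using b by (auto simp: \<delta>_def M0_def)
      ultimately show "c b * lm N (\<delta> b) (upd N q i 0) = (if b \<in> M0 then c b * lm N (g b) q else 0)"
        by (simp add: lm_upd_zero[OF i])
    qed
    moreover have "(\<Sum>b\<in>M. if b \<in> M0 then c b * lm N (g b) q else 0) = (\<Sum>b\<in>M0. c b * lm N (g b) q)"
      using finM by (subst sum.inter_restrict[symmetric]) (auto simp: M0_def intro!: sum.cong)
    ultimately show ?thesis by simp
  qed
  have "c (inv_into M0 g (g e0)) = 0"
  proof (rule lm_independent[where N = N and S = "g ` M0"])
    show "finite (g ` M0)" using finM by (simp add: M0_def)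
    show "\<forall>j\<ge>N. \<beta> j = 0" if "\<beta> \<in> g ` M0" for \<beta> using that E(3) by (auto simp: g_def M0_def M_def)
    show "g e0 \<in> g ` M0" using e0 by (auto simp: M0_def)
    show "(\<Sum>\<beta>\<in>g ` M0. c (inv_into M0 g \<beta>) * lm N \<beta> q) = 0" if "q \<in> tor N" for q
      using sum0[OF that] by (simp add: sum.reindex[OF inj] inv_into_f_f[OF inj])
  qed
  moreover have "inv_into M0 g (g e0) = e0" using e0 by (intro inv_into_f_f[OF inj]) (simp add: M0_def)
  ultimately show False using e0 by (simp add: M_def)
qed

text \<open>
  This needs \<open>n \<ge> 2\<close>: only then does some coordinate among \<open>Q\<^sub>1, \<dots>, Q\<^sub>n\<close> remain nonzero when one
  of them is allowed to vanish.
\<close>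

lemma coefficient_vanishes:
  assumes n: "n \<ge> 2" and P: "P \<in> shom n l l" and a: "a \<in> lat n l"
    and E: "finite E" "E \<subseteq> lat n 0"
    and act: "P (TT n) (lmono n l a) = (\<lambda>Q. \<Sum>e\<in>E. c e * lmono n l (\<lambda>j. a j + e j) Q)"
    and i: "i < n + 1" "mono_exp n l a i \<ge> 0" and e: "e \<in> E" "mono_exp n l (\<lambda>j. a j + e j) i < 0"
  shows "c e = 0"
proof -
  have n1: "n \<ge> 1" using n by simp
  let ?W = "nz (n + 1) ({..<n + 1} - {i})"
  define \<gamma> where "\<gamma> e = mono_exp n l (\<lambda>j. a j + e j)" for e
  \<comment> \<open>An index below n different from i; that coordinate stays nonzero, which keeps
    the enlarged set inside the cover.\<close>
  define k :: nat where "k = (if i = 0 then 1 else 0)"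
  have W: "zariski_open (n + 1) ?W" by (rule zariski_open_nz) auto
  have Winv: "torus_inv n ?W" by (rule torus_inv_nz[of _ _ k]) (use n in \<open>auto simp: k_def\<close>)
  define U where "U = orb n ?W"
  have U: "Xt_open n U" unfolding U_def by (rule Xt_open_orb[OF Winv W])
  have UU: "\<Union>U = ?W" unfolding U_def by (rule Union_orb[OF Winv])
  have TW: "tor (n + 1) \<subseteq> ?W" by (auto simp: nz_def)
  have sub: "TT n \<subseteq> U"
    unfolding TT_def using orb_subset_iff[OF torus_inv_tor[OF n1], of U] U TW UU by (simp only: Xt_open_def)
  define s where "s = (\<lambda>Q. if Q \<in> ?W then lm (n + 1) (mono_exp n l a) Q else 0)"
  have ss: "s \<in> line_sheaf n l U"
  proof (rule line_sheafI, unfold UU)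
    show "regular_on (n + 1) ?W s"
      using regular_on_cong[of ?W s "lm (n + 1) (mono_exp n l a)"] regular_on_lm_nonneg[where \<beta> = "mono_exp n l a", OF i]
      by (simp only: s_def if_True)
    fix Q u assume Q: "Q \<in> ?W" and u: "(u::complex) \<noteq> 0"
    have "torus_act n u Q \<in> ?W" by (rule torus_invD[OF Winv Q u])
    moreover have "sum (mono_exp n l a) {..<n} - 2 * mono_exp n l a n = l"
      using tdeg_eq[OF a] by (simp add: mono_exp_def)
    ultimately show "s (torus_act n u Q) = u powi l * s Q"
      using Q lm_act[OF u, of n "mono_exp n l a" Q] by (simp add: s_def)
  qed (simp add: s_def)
  have r: "restr (TT n) s = lmono n l a"
    unfolding restr_def Union_TT[OF n1] using TW by (auto simp: s_def lmono_def fun_eq_iff)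
  have F: "regular_on (n + 1) ?W (P U s)" using line_sheafD(1)[OF shomD(1)[OF P U ss]] by (simp only: UU)
  have eq: "P U s Q = (\<Sum>e\<in>E. c e * lm (n + 1) (\<gamma> e) Q)" if Q: "Q \<in> tor (n + 1)" for Q
  proof -
    have "restr (TT n) (P U s) Q = (\<Sum>e\<in>E. c e * lmono n l (\<lambda>j. a j + e j) Q)"
      using shomD(4)[OF P U Xt_open_TT[OF n1] sub ss] unfolding r act by metis
    then show ?thesis using Q by (simp add: restr_def Union_TT[OF n1] lmono_def \<gamma>_def)
  qed
  have lat: "\<forall>j\<ge>n. e j = 0" if "e \<in> E" for e using that E(2) by (auto simp: lat_def)
  have inj: "inj_on \<gamma> E"
  proof (rule inj_onI)
    fix b b' assume b: "b \<in> E" "b' \<in> E" "\<gamma> b = \<gamma> b'"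
    show "b = b'"
    proof
      fix j
      show "b j = b' j"
      proof (cases "j < n")
        case True
        then show ?thesis using fun_cong[OF b(3), of j] by (simp add: \<gamma>_def mono_exp_def)
      next
        case False
        then show ?thesis using lat[OF b(1)] lat[OF b(2)] by simp
      qed
    qed
  qed
  have supp: "\<forall>j\<ge>n + 1. \<gamma> e j = 0" if "e \<in> E" for e
    using lat[OF that] a by (auto simp: \<gamma>_def mono_exp_def lat_def)
  show ?thesis
    by (rule no_pole[OF i(1) F E(1) inj supp eq e(1)]) (use e(2) in \<open>simp_all add: \<gamma>_def\<close>)
qed

section \<open>Division by linear forms\<close>

text \<open>The exponent of the coordinate with index k, with k = n standing for t, in the monomial
  parametrized by \<kappa> (\<open>mono_exp_theta\<close>). It is an affine function of
  \<kappa>.\<close>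

definition lam :: "nat \<Rightarrow> int \<Rightarrow> nat \<Rightarrow> (nat \<Rightarrow> int) \<Rightarrow> int" where
  "lam n l k \<kappa> = (if k = n then \<kappa> 0 else theta n l \<kappa> k)"

lemma mono_exp_theta: "n \<ge> 1 \<Longrightarrow> mono_exp n l (theta n l \<kappa>) k = lam n l k \<kappa>"
  by (simp add: mono_exp_def lam_def tdeg_theta)

text \<open>Setting l = 0 gives the linear part of the affine function
  \<open>lam n l k\<close>.\<close>

lemma lam_line: "lam n l k (\<lambda>i. \<kappa> i + s * v i) = lam n l k \<kappa> + s * lam n 0 k v"
  by (simp add: lam_def theta_def sum.distrib sum_distrib_left algebra_simps)

lemma poly_exp_lam:
  assumes "n \<ge> 1" "k \<le> n"
  shows "(\<lambda>\<kappa>. of_int (lam n l k \<kappa> - c)) \<in> poly_exp n"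
proof -
  have c: "i < n \<Longrightarrow> (\<lambda>\<kappa>. of_int (\<kappa> i)) \<in> poly_exp n" for i by (rule poly_exp.coord)
  consider "k = n" | "k = 0" "k \<noteq> n" | "0 < k" "k < n" using assms by linarith
  then show ?thesis
  proof cases
    case 2
    have "(\<lambda>\<kappa>. of_int l + 2 * of_int (\<kappa> 0) - (\<Sum>i\<in>{1..<n}. of_int (\<kappa> i)) - of_int c) \<in> poly_exp n"
      using assms by (intro poly_exp_diff poly_exp.add poly_exp.mult poly_exp.const poly_exp_sum c) auto
    then show ?thesis using 2 by (simp add: lam_def theta_def)
  qed (use assms poly_exp_diff[OF c poly_exp.const, of _ "of_int c"] in \<open>auto simp: lam_def theta_def\<close>)
qed

text \<open>Modulo L the shift by L w is the identity, so it does not change a polynomial modulo L.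
  L takes integer values, which keeps the shifted argument in the lattice.\<close>

lemma poly_exp_shift_division:
  assumes "\<phi> \<in> poly_exp n" and L: "(\<lambda>\<kappa>. of_int (L \<kappa>)) \<in> poly_exp n"
  shows "\<exists>\<psi>\<in>poly_exp n. \<forall>\<kappa>. \<phi> \<kappa> - \<phi> (\<lambda>i. \<kappa> i - L \<kappa> * w i) = of_int (L \<kappa>) * \<psi> \<kappa>"
  using assms(1)
proof induction
  case (const c)
  show ?case by (rule bexI[of _ "\<lambda>_. 0"]) (auto intro: poly_exp.const)
next
  case (coord i)
  show ?case by (rule bexI[of _ "\<lambda>_. of_int (w i)"]) (auto intro: poly_exp.const)
next
  case (add f g)
  then obtain \<psi> \<psi>' where p: "\<psi> \<in> poly_exp n" "\<psi>' \<in> poly_exp n"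
    "\<And>\<kappa>. f \<kappa> - f (\<lambda>i. \<kappa> i - L \<kappa> * w i) = of_int (L \<kappa>) * \<psi> \<kappa>"
    "\<And>\<kappa>. g \<kappa> - g (\<lambda>i. \<kappa> i - L \<kappa> * w i) = of_int (L \<kappa>) * \<psi>' \<kappa>" by blast
  show ?case
  proof (rule bexI[OF _ poly_exp.add[OF p(1,2)]], rule allI)
    fix \<kappa>
    show "f \<kappa> + g \<kappa> - (f (\<lambda>i. \<kappa> i - L \<kappa> * w i) + g (\<lambda>i. \<kappa> i - L \<kappa> * w i)) = of_int (L \<kappa>) * (\<psi> \<kappa> + \<psi>' \<kappa>)"
      using p(3,4)[of \<kappa>] by (simp only: add_diff_add distrib_left)
  qed
next
  case (mult f g)
  then obtain \<psi> \<psi>' where p: "\<psi> \<in> poly_exp n" "\<psi>' \<in> poly_exp n"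
    "\<And>\<kappa>. f \<kappa> - f (\<lambda>i. \<kappa> i - L \<kappa> * w i) = of_int (L \<kappa>) * \<psi> \<kappa>"
    "\<And>\<kappa>. g \<kappa> - g (\<lambda>i. \<kappa> i - L \<kappa> * w i) = of_int (L \<kappa>) * \<psi>' \<kappa>" by blast
  have "(\<lambda>\<kappa>. \<psi> \<kappa> * g \<kappa> + (f \<kappa> - of_int (L \<kappa>) * \<psi> \<kappa>) * \<psi>' \<kappa>) \<in> poly_exp n"
    by (intro poly_exp.add poly_exp.mult poly_exp_diff p(1,2) L mult.hyps)
  then show ?case
  proof (rule bexI[rotated], intro allI)
    fix \<kappa>
    let ?f = "f (\<lambda>i. \<kappa> i - L \<kappa> * w i)" and ?g = "g (\<lambda>i. \<kappa> i - L \<kappa> * w i)"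
    have e: "?f = f \<kappa> - of_int (L \<kappa>) * \<psi> \<kappa>" "?g = g \<kappa> - of_int (L \<kappa>) * \<psi>' \<kappa>"
      using p(3,4)[of \<kappa>] by (simp_all add: algebra_simps)
    show "f \<kappa> * g \<kappa> - ?f * ?g = of_int (L \<kappa>) * (\<psi> \<kappa> * g \<kappa> + (f \<kappa> - of_int (L \<kappa>) * \<psi> \<kappa>) * \<psi>' \<kappa>)"
      unfolding e by (simp add: algebra_simps)
  qed
qed

lemma poly_exp_line:
  assumes "\<phi> \<in> poly_exp n"
  shows "\<exists>q. \<forall>s. \<phi> (\<lambda>i. \<kappa> i + s * v i) = poly q (of_int s)"
  using assms
proof induction
  case (const c)
  show ?case by (rule exI[of _ "[:c:]"]) simp
next
  case (coord i)
  show ?case by (rule exI[of _ "[:of_int (\<kappa> i), of_int (v i):]"]) simp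
next
  case (add f g)
  then obtain p q where "\<And>s. f (\<lambda>i. \<kappa> i + s * v i) = poly p (of_int s)" "\<And>s. g (\<lambda>i. \<kappa> i + s * v i) = poly q (of_int s)" by blast
  then show ?case by (intro exI[of _ "p + q"]) simp
next
  case (mult f g)
  then obtain p q where "\<And>s. f (\<lambda>i. \<kappa> i + s * v i) = poly p (of_int s)" "\<And>s. g (\<lambda>i. \<kappa> i + s * v i) = poly q (of_int s)" by blast
  then show ?case by (intro exI[of _ "p * q"]) simp
qed

lemma poly_exp_zero_by_line:
  assumes "\<phi> \<in> poly_exp n" "finite B" "\<And>s. s \<notin> B \<Longrightarrow> \<phi> (\<lambda>i. \<kappa> i + s * v i) = 0"
  shows "\<phi> \<kappa> = 0"
proof -
  obtain q where q: "\<And>s. \<phi> (\<lambda>i. \<kappa> i + s * v i) = poly q (of_int s)" using poly_exp_line[OF assms(1)] by blast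
  have "q = 0"
  proof (rule ccontr)
    assume "q \<noteq> 0"
    then have "finite {z. poly q z = 0}" by (rule poly_roots_finite)
    moreover have "of_int ` (- B) \<subseteq> {z. poly q z = 0}" using assms(3) q by auto
    ultimately have "finite ((of_int :: int \<Rightarrow> complex) ` (- B))" by (rule finite_subset[rotated])
    then have "finite (- B)" by (rule finite_imageD) (auto simp: inj_on_def)
    then have "finite (B \<union> - B)" using assms(2) by blast
    then show False by (simp add: infinite_UNIV_int)
  qed
  then show ?thesis using q[of 0] by simp
qed

text \<open>A direction inside the k-th hyperplane and transversal to all others. As exponents of
  the Q_i it is (n - 1, -1, ..., -1) with t-exponent 0 if k = n, and otherwise 0 at k and 2
  elsewhere with t-exponent n - 1.\<close>

lemma lam_direction:
  assumes n: "n \<ge> 2" and k: "k \<le> n"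
  obtains v where "lam n 0 k v = 0" "\<And>k'. k' \<le> n \<Longrightarrow> k' \<noteq> k \<Longrightarrow> lam n 0 k' v \<noteq> 0"
proof (cases "k = n")
  case True
  let ?v = "\<lambda>i::nat. if i = 0 then 0 else - 1 :: int"
  have "sum ?v {1..<n} = - (int n - 1)" using n by (simp add: of_nat_diff)
  then show thesis using n True by (intro that[of ?v]) (auto simp: lam_def theta_def)
next
  case False
  let ?v = "\<lambda>i. if i = 0 then int n - 1 else if i = k then 0 else 2"
  have "sum ?v {1..<n} = (\<Sum>i\<in>{1..<n}. 2 - (if i = k then 2 else 0))" by (intro sum.cong) auto
  also have "\<dots> = 2 * (int n - 1) - (if k = 0 then 0 else 2)"
    using n k False by (simp add: sum_subtractf of_nat_diff)
  finally show thesis using n k False by (intro that[of ?v]) (auto simp: lam_def theta_def)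
qed

text \<open>Each linear form takes the value 1 on the lattice, so that every lattice point can be
  moved onto a hyperplane by an integral shift.\<close>

lemma lam_unit:
  assumes n: "n \<ge> 2" and k: "k \<le> n"
  obtains w where "lam n 0 k w = 1"
proof (cases "k = 0")
  case True
  let ?w = "\<lambda>i::nat. if i = 1 then - 1 else 0 :: int"
  have "sum ?w {1..<n} = -1" using n by simp
  then show thesis using n True by (intro that[of ?w]) (auto simp: lam_def theta_def)
next
  case False
  show thesis
    using n k False by (intro that[of "\<lambda>i. if i = k mod n then 1 else 0"]) (auto simp: lam_def theta_def)
qed

text \<open>
  A further factor can be split off because a general line in the hyperplane \<open>lam n l k = c\<close> meets
  each of the other hyperplanes in at most one point.
\<close>

lemma hyperplane_division:
  assumes n: "n \<ge> 2" and S: "finite S" "fst ` S \<subseteq> {..n}" and "\<phi> \<in> poly_exp n"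
    and van: "\<And>k c \<kappa>. (k, c) \<in> S \<Longrightarrow> lam n l k \<kappa> = c \<Longrightarrow> \<phi> \<kappa> = 0"
  shows "\<exists>\<psi>\<in>poly_exp n. \<forall>\<kappa>. \<phi> \<kappa> = (\<Prod>(k, c)\<in>S. of_int (lam n l k \<kappa> - c)) * \<psi> \<kappa>"
  using S van
proof (induction S rule: finite_induct)
  case empty
  then show ?case using assms(4) by auto
next
  case (insert x S)
  obtain k c where x: "x = (k, c)" by force
  have k: "k \<le> n" using insert.prems(1) x by auto
  have "\<exists>\<psi>\<in>poly_exp n. \<forall>\<kappa>. \<phi> \<kappa> = (\<Prod>(k, c)\<in>S. of_int (lam n l k \<kappa> - c)) * \<psi> \<kappa>"
  proof (rule insert.IH)
    show "fst ` S \<subseteq> {..n}" using insert.prems(1) by auto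
    show "\<phi> \<kappa> = 0" if "(k, c) \<in> S" "lam n l k \<kappa> = c" for k c \<kappa>
      by (rule insert.prems(2)[OF insertI2[OF that(1)] that(2)])
  qed
  then obtain \<psi> where \<psi>0: "\<psi> \<in> poly_exp n"
    "\<forall>\<kappa>. \<phi> \<kappa> = (\<Prod>(k, c)\<in>S. of_int (lam n l k \<kappa> - c)) * \<psi> \<kappa>" by (rule bexE)
  note \<psi> = \<psi>0(1) spec[OF \<psi>0(2)]
  have zero: "\<psi> \<kappa> = 0" if \<kappa>: "lam n l k \<kappa> = c" for \<kappa>
  proof -
    obtain v where v: "lam n 0 k v = 0" "\<And>k'. k' \<le> n \<Longrightarrow> k' \<noteq> k \<Longrightarrow> lam n 0 k' v \<noteq> 0"
      using lam_direction[OF n k] by blast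
    \<comment> \<open>The parameters at which the line through \<kappa> meets one of the remaining
      hyperplanes. Those parallel to the k-th one miss the line, since their constants differ from
      c.\<close>
    define B where "B = (\<Union>(k', c')\<in>S. {s. lam n l k' \<kappa> + s * lam n 0 k' v = c'})"
    have fin: "finite {s. lam n l k' \<kappa> + s * lam n 0 k' v = c'}" if "(k', c') \<in> S" for k' c'
    proof (cases "k' = k")
      case True
      then have "c' \<noteq> c" using that insert.hyps x by auto
      then show ?thesis using True v(1) \<kappa> by simp
    next
      case False
      have k': "lam n 0 k' v \<noteq> 0" using v(2) False that insert.prems(1) by force
      have "{s. lam n l k' \<kappa> + s * lam n 0 k' v = c'} \<subseteq> {(c' - lam n l k' \<kappa>) div lam n 0 k' v}"
        using k' by auto
      then show ?thesis by (rule finite_subset) simp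
    qed
    show ?thesis
    proof (rule poly_exp_zero_by_line[OF \<psi>(1)])
      show "finite B" unfolding B_def using insert.hyps(1) fin by auto
      fix s assume s: "s \<notin> B"
      have "\<phi> (\<lambda>i. \<kappa> i + s * v i) = 0" by (rule insert.prems(2)[of k c]) (use x \<kappa> v(1) in \<open>simp_all add: lam_line\<close>)
      moreover have "(\<Prod>(k, c)\<in>S. of_int (lam n l k (\<lambda>i. \<kappa> i + s * v i) - c)) \<noteq> (0::complex)"
        using s insert.hyps(1)
        by (auto simp: B_def lam_line prod_zero_iff algebra_simps simp del: of_int_add of_int_diff of_int_mult)
      ultimately show "\<psi> (\<lambda>i. \<kappa> i + s * v i) = 0" using \<psi>(2) by simp
    qed
  qed
  \<comment> \<open>Subtracting the right multiple of w moves \<kappa> onto the hyperplane, where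
    \<psi> vanishes; \<open>poly_exp_shift_division\<close> then exhibits the linear factor.\<close>
  obtain w where w: "lam n 0 k w = 1" using lam_unit[OF n k] by blast
  obtain \<psi>' where \<psi>': "\<psi>' \<in> poly_exp n"
    "\<And>\<kappa>. \<psi> \<kappa> - \<psi> (\<lambda>i. \<kappa> i - (lam n l k \<kappa> - c) * w i) = of_int (lam n l k \<kappa> - c) * \<psi>' \<kappa>"
    using poly_exp_shift_division[OF \<psi>(1) poly_exp_lam[OF _ k, of l c], where w = w] n by auto
  have "\<psi> \<kappa> = of_int (lam n l k \<kappa> - c) * \<psi>' \<kappa>" for \<kappa>
  proof -
    have "lam n l k (\<lambda>i. \<kappa> i - (lam n l k \<kappa> - c) * w i) = c"
      using lam_line[of n l k \<kappa> "- (lam n l k \<kappa> - c)" w] w by (simp only: mult_minus_left) simp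
    then show ?thesis using zero \<psi>'(2)[of \<kappa>] by simp
  qed
  then show ?case using \<psi>'(1) \<psi>(2) insert.hyps x by (intro bexI[of _ \<psi>']) auto
qed

text \<open>A falling factorial of length -d, and 1 if d is nonnegative. On integers it vanishes
  exactly where a shift by d makes a nonnegative exponent negative.\<close>

definition fall :: "complex \<Rightarrow> int \<Rightarrow> complex" where
  "fall x d = (\<Prod>c\<in>{0..<- d}. x - of_int c)"

text \<open>If the k-th exponent c satisfies 0 \<le> c < -e_k, the monomial is regular along the
  k-th divisor and its shift by e has a pole there, so the coefficient vanishes. The product of
  these linear forms over c is \<open>fall\<close>; here e_k includes the t-exponent of e.\<close>

lemma symbol_division:
  assumes n: "n \<ge> 2" and P: "P \<in> shom n l l" and E: "finite E" "E \<subseteq> lat n 0"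
    and p: "p e \<in> poly_exp n"
    and act: "\<And>\<kappa>. P (TT n) (lmono n l (theta n l \<kappa>)) = (\<lambda>Q. \<Sum>e\<in>E. p e \<kappa> * lmono n l (\<lambda>i. theta n l \<kappa> i + e i) Q)"
    and e: "e \<in> E"
  shows "\<exists>\<psi>\<in>poly_exp n. \<forall>\<kappa>. p e \<kappa> = (\<Prod>k\<le>n. fall (of_int (lam n l k \<kappa>)) (mono_exp n 0 e k)) * \<psi> \<kappa>"
proof -
  have n1: "n \<ge> 1" using n by simp
  let ?S = "SIGMA k:{..n}. {0..<- mono_exp n 0 e k}"
  have "\<exists>\<psi>\<in>poly_exp n. \<forall>\<kappa>. p e \<kappa> = (\<Prod>(k, c)\<in>?S. of_int (lam n l k \<kappa> - c)) * \<psi> \<kappa>"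
  proof (rule hyperplane_division[OF n _ _ p])
    fix k c \<kappa> assume kc: "(k, c) \<in> ?S" "lam n l k \<kappa> = c"
    show "p e \<kappa> = 0"
    proof (rule coefficient_vanishes[where c = "\<lambda>e. p e \<kappa>" and i = k, OF n P theta_lat[OF n1] E act _ _ e])
      have "mono_exp n (l + 0) (\<lambda>j. theta n l \<kappa> j + e j) k = mono_exp n l (theta n l \<kappa>) k + mono_exp n 0 e k"
        using e E(2) by (subst mono_exp_add[OF theta_lat[OF n1]]) auto
      then show "mono_exp n l (\<lambda>j. theta n l \<kappa> j + e j) k < 0" using kc by (simp add: mono_exp_theta[OF n1])
    qed (use kc in \<open>auto simp: mono_exp_theta[OF n1]\<close>)
  qed auto
  moreover have "(\<Prod>(k, c)\<in>?S. of_int (lam n l k \<kappa> - c)) = (\<Prod>k\<le>n. fall (of_int (lam n l k \<kappa>)) (mono_exp n 0 e k))" for \<kappa>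
    unfolding fall_def by (subst prod.Sigma[symmetric]) auto
  ultimately show ?thesis by simp
qed

section \<open>Generation by quadratic operators\<close>

lemma fall_nonneg: "d \<ge> 0 \<Longrightarrow> fall x d = 1"
  by (simp add: fall_def)

lemma fall_neg:
  assumes "d < 0"
  shows "fall x d = x * fall (x - 1) (d + 1)"
proof -
  have "{0..<- d} = insert 0 ((\<lambda>c. c + 1) ` {0..<- (d + 1)})" using assms by (auto simp: image_iff intro: bexI[of _ "_ - 1"])
  then have "fall x d = x * (\<Prod>c\<in>(\<lambda>c. c + 1) ` {0..<- (d + 1)}. x - of_int c)"
    unfolding fall_def by (simp add: image_iff)
  also have "(\<Prod>c\<in>(\<lambda>c. c + 1) ` {0..<- (d + 1)}. x - of_int c) = fall (x - 1) (d + 1)"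
    unfolding fall_def by (subst prod.reindex) (auto simp: algebra_simps)
  finally show ?thesis .
qed

definition pfall :: "nat \<Rightarrow> (nat \<Rightarrow> int) \<Rightarrow> (nat \<Rightarrow> int) \<Rightarrow> complex" where
  "pfall n e a = (\<Prod>k<n. fall (of_int (a k)) (e k))"

lemma pfall_split:
  assumes "i < n"
  shows "pfall n e a = fall (of_int (a i)) (e i) * (\<Prod>k\<in>{..<n} - {i}. fall (of_int (a k)) (e k))"
  unfolding pfall_def using assms by (simp add: prod.remove)

lemma pfall_neg:
  assumes "i < n" "e i < 0"
  shows "pfall n e a = of_int (a i) * pfall n (\<lambda>k. e k + unit_exp i k) (\<lambda>k. a k - unit_exp i k)"
proof -
  have "(\<Prod>k\<in>{..<n} - {i}. fall (of_int (a k - unit_exp i k)) (e k + unit_exp i k)) = (\<Prod>k\<in>{..<n} - {i}. fall (of_int (a k)) (e k))"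
    by (intro prod.cong) (auto simp: unit_exp_def)
  then show ?thesis
    unfolding pfall_split[OF assms(1)] fall_neg[OF assms(2)] by (simp add: unit_exp_def mult.assoc)
qed

lemma pfall_pos:
  assumes "i < n" "e i > 0"
  shows "pfall n e a = pfall n (\<lambda>k. e k - unit_exp i k) (\<lambda>k. a k + unit_exp i k)"
proof -
  have "(\<Prod>k\<in>{..<n} - {i}. fall (of_int (a k + unit_exp i k)) (e k - unit_exp i k)) = (\<Prod>k\<in>{..<n} - {i}. fall (of_int (a k)) (e k))"
    by (intro prod.cong) (auto simp: unit_exp_def)
  then show ?thesis
    unfolding pfall_split[OF assms(1)] using assms(2) by (simp add: unit_exp_def fall_nonneg)
qed

definition tval :: "nat \<Rightarrow> int \<Rightarrow> (nat \<Rightarrow> int) \<Rightarrow> complex" where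
  "tval n l a = (of_int (sum a {..<n}) - of_int l) / 2"

lemma tval_unit:
  assumes "i < n"
  shows "tval n l (\<lambda>k. a k + unit_exp i k) = tval n l a + 1/2" "tval n l (\<lambda>k. a k - unit_exp i k) = tval n l a - 1/2"
  using assms by (simp_all add: tval_def sum_unit_exp diff_divide_distrib add_divide_distrib)

text \<open>The least symbol that a regular shift by e can have: one falling factorial for each
  divisor along which the shift lowers the exponent, the last factor belonging to t.\<close>

definition basic_symbol :: "nat \<Rightarrow> int \<Rightarrow> (nat \<Rightarrow> int) \<Rightarrow> (nat \<Rightarrow> int) \<Rightarrow> complex" where
  "basic_symbol n l e a = pfall n e a * fall (tval n l a) (tdeg n 0 e)"

lemma Sh_eqI: "(\<And>i. e i = e' i) \<Longrightarrow> (\<And>a. \<phi> a = \<phi>' a) \<Longrightarrow> Sh e \<phi> = Sh e' \<phi>'"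
  by presburger

lemma sum_abs_unit_less:
  fixes e :: "nat \<Rightarrow> int"
  assumes "i < n"
  shows "e i < 0 \<Longrightarrow> (\<Sum>k<n. \<bar>e k + unit_exp i k\<bar>) = (\<Sum>k<n. \<bar>e k\<bar>) - 1"
    "e i > 0 \<Longrightarrow> (\<Sum>k<n. \<bar>e k - unit_exp i k\<bar>) = (\<Sum>k<n. \<bar>e k\<bar>) - 1"
proof -
  have *: "(\<Sum>k<n. f k) = f i + (\<Sum>k\<in>{..<n} - {i}. f k)" for f :: "nat \<Rightarrow> int"
    using assms by (simp add: sum.remove)
  have r: "(\<Sum>k\<in>{..<n} - {i}. \<bar>e k + unit_exp i k\<bar>) = (\<Sum>k\<in>{..<n} - {i}. \<bar>e k\<bar>)"
    "(\<Sum>k\<in>{..<n} - {i}. \<bar>e k - unit_exp i k\<bar>) = (\<Sum>k\<in>{..<n} - {i}. \<bar>e k\<bar>)"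
    by (intro sum.cong; auto simp: unit_exp_def)+
  show "e i < 0 \<Longrightarrow> (\<Sum>k<n. \<bar>e k + unit_exp i k\<bar>) = (\<Sum>k<n. \<bar>e k\<bar>) - 1"
    "e i > 0 \<Longrightarrow> (\<Sum>k<n. \<bar>e k - unit_exp i k\<bar>) = (\<Sum>k<n. \<bar>e k\<bar>) - 1"
    unfolding *[of "\<lambda>k. \<bar>e k + unit_exp i k\<bar>"] *[of "\<lambda>k. \<bar>e k - unit_exp i k\<bar>"] *[of "\<lambda>k. \<bar>e k\<bar>"] r
    by (simp_all add: unit_exp_def)
qed

lemma sum_neg_entry:
  fixes e :: "nat \<Rightarrow> int"
  assumes "sum e {..<n} < 0"
  obtains i where "i < n" "e i < 0"
  using assms sum_nonneg[of "{..<n}" e] by force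

lemma sum_pos_entry:
  fixes e :: "nat \<Rightarrow> int"
  assumes "sum e {..<n} > 0"
  obtains i where "i < n" "e i > 0"
  using assms sum_nonpos[of "{..<n}" e] by force

text \<open>Induction on the size of e, splitting off one generator that moves towards e without
  overshooting. A product \<open>x_j D_i\<close> serves entries of opposite sign, a product of two
  derivatives with \<open>tau\<close> serves negative e, and a product of two coordinates serves
  positive e. Each generator contributes exactly the first factors of the falling factorials
  concerned.\<close>

lemma attained_basic_symbol:
  assumes "e \<in> lat n 0"
  shows "Sh e (basic_symbol n l e) \<in> attained n l"
  using assms
proof (induction "nat (\<Sum>k<n. \<bar>e k\<bar>)" arbitrary: e rule: less_induct)
  case less
  have e0: "e k = 0" if "k \<ge> n" for k using less.prems that by (simp add: lat_def)
  have ev: "even (sum e {..<n})" using less.prems by (simp add: lat_def)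
  have td: "2 * tdeg n 0 e = sum e {..<n}" using tdeg_eq[OF less.prems] by simp
  \<comment> \<open>The shift e is split as e' + g, where the generator with shift g is applied
    first; the symbol of the remaining shift is therefore evaluated at a + g.\<close>
  have step: "Sh e (basic_symbol n l e) \<in> attained n l"
    if lt: "(\<Sum>k<n. \<bar>e' k\<bar>) < (\<Sum>k<n. \<bar>e k\<bar>)" and l': "e' \<in> lat n 0" and g: "Sh g \<phi> \<in> attained n l"
      and sh: "\<And>k. e k = e' k + g k"
      and sym: "\<And>a. basic_symbol n l e a = basic_symbol n l e' (\<lambda>k. a k + g k) * \<phi> a" for e' g \<phi>
  proof -
    have "(\<Sum>k<n. \<bar>e' k\<bar>) \<ge> 0" by (intro sum_nonneg) simp
    then have "nat (\<Sum>k<n. \<bar>e' k\<bar>) < nat (\<Sum>k<n. \<bar>e k\<bar>)" using lt by (simp only: nat_less_eq_zless)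
    then have "Sh e' (basic_symbol n l e') * Sh g \<phi> \<in> attained n l"
      by (intro attained_mult less.hyps l' g)
    moreover have "Sh e' (basic_symbol n l e') * Sh g \<phi> = Sh e (basic_symbol n l e)"
      unfolding Sh_mult using sh sym by (intro Sh_eqI) simp_all
    ultimately show ?thesis by simp
  qed
  consider (mixed) i j where "i < n" "j < n" "e i < 0" "e j > 0"
    | (neg) "\<And>i. i < n \<Longrightarrow> e i \<le> 0" "sum e {..<n} < 0"
    | (pos) "\<And>i. i < n \<Longrightarrow> e i \<ge> 0" "sum e {..<n} > 0"
    | (zero) "\<And>i. i < n \<Longrightarrow> e i = 0"
  proof (cases "\<exists>i<n. e i < 0")
    case True
    then obtain i where i: "i < n" "e i < 0" by blast
    show thesis
    proof (cases "\<exists>j<n. e j > 0")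
      case True
      then show thesis using mixed i by blast
    next
      case False
      then have le: "e k \<le> 0" if "k < n" for k using that by force
      have "sum e {..<n} = e i + sum e ({..<n} - {i})" using i by (simp add: sum.remove)
      moreover have "sum e ({..<n} - {i}) \<le> 0" using le by (intro sum_nonpos) auto
      ultimately show thesis using neg le i by simp
    qed
  next
    case False
    then have ge: "e k \<ge> 0" if "k < n" for k using that by force
    show thesis
    proof (cases "sum e {..<n} > 0")
      case True
      then show thesis using pos ge by blast
    next
      case False
      then have "sum e {..<n} = 0" using sum_nonneg[of "{..<n}" e] ge by force
      then have "e k = 0" if "k < n" for k using sum_nonneg_eq_0_iff[of "{..<n}" e] ge that by simp
      then show thesis by (rule zero)
    qed
  qed
  then show ?case
  proof cases
    case mixed
    have ij: "i \<noteq> j" using mixed by auto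
    let ?f = "\<lambda>k. e k + unit_exp i k"
    let ?e = "\<lambda>k. ?f k - unit_exp j k"
    let ?g = "\<lambda>k. unit_exp j k - unit_exp i k"
    have fj: "?f j > 0" using mixed ij by (simp add: unit_exp_def)
    have sum: "sum ?e {..<n} = sum e {..<n}" using mixed sum_unit_exp by simp
    have XD: "Xop j * Dop i = Sh ?g (\<lambda>a. of_int (a i))"
      unfolding Xop_def Dop_def Sh_mult by (intro Sh_eqI) simp_all
    show ?thesis
    proof (rule step[of ?e])
      show "(\<Sum>k<n. \<bar>?e k\<bar>) < (\<Sum>k<n. \<bar>e k\<bar>)"
        using sum_abs_unit_less(2)[of j n ?f, OF mixed(2) fj] sum_abs_unit_less(1)[of i n e, OF mixed(1,3)] by linarith
      show "?e \<in> lat n 0" using ev sum e0 mixed(1,2) by (auto simp: lat_def unit_exp_def)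
      show "Sh ?g (\<lambda>a. of_int (a i)) \<in> attained n l"
        using attained_generators(2)[OF mixed(1,2)] by (simp only: XD)
      fix a
      have "pfall n e a = of_int (a i) * pfall n ?e (\<lambda>k. a k - unit_exp i k + unit_exp j k)"
        unfolding pfall_neg[of i n e a, OF mixed(1,3)] pfall_pos[of j n ?f, OF mixed(2) fj] ..
      moreover have "(\<lambda>k. a k + ?g k) = (\<lambda>k. a k - unit_exp i k + unit_exp j k)" by (rule ext) linarith
      moreover have "tval n l (\<lambda>k. a k - unit_exp i k + unit_exp j k) = tval n l a"
        using mixed by (simp add: tval_unit)
      moreover have "tdeg n 0 ?e = tdeg n 0 e" by (simp only: tdeg_def sum)
      ultimately show "basic_symbol n l e a = basic_symbol n l ?e (\<lambda>k. a k + ?g k) * of_int (a i)"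
        by (simp only: basic_symbol_def mult_ac)
    qed simp
  next
    case neg
    obtain i where i: "i < n" "e i < 0" by (rule sum_neg_entry[OF neg(2)])
    let ?f = "\<lambda>k. e k + unit_exp i k"
    \<comment> \<open>An even negative sum is at most -2, so a negative entry is still left for the
      second derivative after the first step.\<close>
    have "sum ?f {..<n} < 0" using neg(2) ev sum_unit_exp(1)[OF i(1), of e] by presburger
    then obtain j where j: "j < n" "?f j < 0" by (rule sum_neg_entry)
    let ?e = "\<lambda>k. ?f k + unit_exp j k"
    let ?g = "\<lambda>k. - unit_exp i k - unit_exp j k"
    have sum: "sum ?e {..<n} = sum e {..<n} + 2" using i j sum_unit_exp by simp
    have DDT: "Dop j * Dop i * tau n l = Sh ?g (\<lambda>a. of_int (a j - unit_exp i j) * of_int (a i) * tval n l a)"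
      unfolding Dop_def tau_def Sh_mult by (intro Sh_eqI) (simp_all add: tval_def)
    show ?thesis
    proof (rule step[of ?e])
      show "(\<Sum>k<n. \<bar>?e k\<bar>) < (\<Sum>k<n. \<bar>e k\<bar>)"
        using sum_abs_unit_less(1)[of j n ?f, OF j] sum_abs_unit_less(1)[of i n e, OF i] by linarith
      show "?e \<in> lat n 0" using ev sum e0 i j by (auto simp: lat_def unit_exp_def)
      show "Sh ?g (\<lambda>a. of_int (a j - unit_exp i j) * of_int (a i) * tval n l a) \<in> attained n l"
        using attained_generators(3)[where l = l, OF j(1) i(1)] by (simp only: DDT)
      fix a
      have 1: "pfall n e a = of_int (a i) * (of_int (a j - unit_exp i j) * pfall n ?e (\<lambda>k. a k - unit_exp i k - unit_exp j k))"
        unfolding pfall_neg[of i n e a, OF i] pfall_neg[of j n ?f, OF j] ..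
      have 2: "(\<lambda>k. a k + ?g k) = (\<lambda>k. a k - unit_exp i k - unit_exp j k)" by (rule ext) linarith
      have 3: "tval n l (\<lambda>k. a k - unit_exp i k - unit_exp j k) = tval n l a - 1"
        using i j by (simp add: tval_unit)
      have "tdeg n 0 e < 0" "tdeg n 0 ?e = tdeg n 0 e + 1" using td neg(2) sum by (simp_all add: tdeg_def)
      then have 4: "fall (tval n l a) (tdeg n 0 e) = tval n l a * fall (tval n l a - 1) (tdeg n 0 ?e)"
        by (simp only: fall_neg)
      show "basic_symbol n l e a = basic_symbol n l ?e (\<lambda>k. a k + ?g k) *
          (of_int (a j - unit_exp i j) * of_int (a i) * tval n l a)"
        unfolding basic_symbol_def 1 2 3 4 by (simp only: mult_ac)
    qed simp
  next
    case pos
    obtain i where i: "i < n" "e i > 0" by (rule sum_pos_entry[OF pos(2)])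
    let ?f = "\<lambda>k. e k - unit_exp i k"
    have "sum ?f {..<n} > 0" using pos(2) ev sum_unit_exp(2)[OF i(1), of e] by presburger
    then obtain j where j: "j < n" "?f j > 0" by (rule sum_pos_entry)
    let ?e = "\<lambda>k. ?f k - unit_exp j k"
    let ?g = "\<lambda>k. unit_exp i k + unit_exp j k"
    have sum: "sum ?e {..<n} = sum e {..<n} - 2" using i j sum_unit_exp by simp
    have XX: "Xop i * Xop j = Sh ?g (\<lambda>_. 1)"
      unfolding Xop_def Sh_mult by (intro Sh_eqI) simp_all
    show ?thesis
    proof (rule step[of ?e])
      show "(\<Sum>k<n. \<bar>?e k\<bar>) < (\<Sum>k<n. \<bar>e k\<bar>)"
        using sum_abs_unit_less(2)[of j n ?f, OF j] sum_abs_unit_less(2)[of i n e, OF i] by linarith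
      show "?e \<in> lat n 0" using ev sum e0 i j by (auto simp: lat_def unit_exp_def)
      show "Sh ?g (\<lambda>_. 1) \<in> attained n l"
        using attained_generators(1)[OF i(1) j(1)] by (simp only: XX)
      fix a
      have 1: "pfall n e a = pfall n ?e (\<lambda>k. a k + unit_exp i k + unit_exp j k)"
        unfolding pfall_pos[of i n e a, OF i] pfall_pos[of j n ?f, OF j] ..
      have 2: "(\<lambda>k. a k + ?g k) = (\<lambda>k. a k + unit_exp i k + unit_exp j k)" by (rule ext) linarith
      have "tdeg n 0 e \<ge> 0" "tdeg n 0 ?e \<ge> 0" using td pos(2) sum ev by (simp_all add: tdeg_def) presburger
      then show "basic_symbol n l e a = basic_symbol n l ?e (\<lambda>k. a k + ?g k) * 1"
        unfolding basic_symbol_def 1 2 by (simp only: fall_nonneg mult_1_right)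
    qed simp
  next
    case zero
    then have "e = (\<lambda>_. 0)" using e0 by (intro ext) (meson not_le)
    then show ?thesis using attained_one[of n l] by (simp add: basic_symbol_def[abs_def] pfall_def fall_def tdeg_def Sh_one)
  qed
qed

text \<open>The Euler operators \<open>x_i D_i\<close> generate all polynomials in the exponents.
  The symbol \<phi> is a function on all exponents, but only its values at those of the form
  \<open>theta n l \<kappa>\<close> matter.\<close>

lemma attained_poly_exp:
  assumes n: "n \<ge> 1" and "p \<in> poly_exp n"
  shows "\<exists>\<phi>. Sh (\<lambda>_. 0) \<phi> \<in> attained n l \<and> (\<forall>\<kappa>. \<phi> (theta n l \<kappa>) = p \<kappa>)"
  using assms(2)
proof induction
  case (const c)
  have "scal c \<in> attained n l" using attained_scale[OF attained_one, of c n l] by simp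
  then show ?case unfolding scal_def by (intro exI conjI) auto
next
  case (coord i)
  have xd: "Sh (\<lambda>_. 0) (\<lambda>a. of_int (a j)) \<in> attained n l" if "j < n" for j
    using attained_generators(2)[OF that that, of l] by (simp only: Xop_Dop)
  show ?case
  proof (cases "i = 0")
    case False
    then show ?thesis using xd[OF coord] coord
      by (intro exI[of _ "\<lambda>a. of_int (a i)"] conjI) (simp_all add: theta_def)
  next
    case True
    \<comment> \<open>The parameter \<kappa> 0 is the exponent of t, hence half of the total degree
      minus l.\<close>
    have "scal (1/2) * ((\<Sum>j<n. Sh (\<lambda>_. 0) (\<lambda>a. of_int (a j))) + scal (- of_int l) * 1) \<in> attained n l"
      by (intro attained_scale attained_add attained_sum attained_one xd) simp
    then have "Sh (\<lambda>_. 0) (\<lambda>a. 1/2 * ((\<Sum>j<n. of_int (a j)) + - of_int l)) \<in> attained n l"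
      by (simp only: scal_Sh Sh_sum mult_1_right scal_def[of "- of_int l"] Sh_add)
    moreover have "1/2 * ((\<Sum>j<n. of_int (theta n l \<kappa> j)) + - of_int l) = (of_int (\<kappa> i) :: complex)" for \<kappa>
    proof -
      have "(\<Sum>j<n. of_int (theta n l \<kappa> j)) = (of_int (l + 2 * \<kappa> 0) :: complex)"
        unfolding sum_theta[OF n, of l \<kappa>, symmetric] by simp
      then show ?thesis using True by simp
    qed
    ultimately show ?thesis by blast
  qed
next
  case (add f g)
  then obtain \<phi> \<psi> where "Sh (\<lambda>_. 0) \<phi> \<in> attained n l" "Sh (\<lambda>_. 0) \<psi> \<in> attained n l"
    and v: "\<And>\<kappa>. \<phi> (theta n l \<kappa>) = f \<kappa>" "\<And>\<kappa>. \<psi> (theta n l \<kappa>) = g \<kappa>" by blast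
  then have "Sh (\<lambda>_. 0) (\<lambda>a. \<phi> a + \<psi> a) \<in> attained n l" unfolding Sh_add[symmetric] by (intro attained_add)
  then show ?case using v by (intro exI[of _ "\<lambda>a. \<phi> a + \<psi> a"]) simp
next
  case (mult f g)
  then obtain \<phi> \<psi> where "Sh (\<lambda>_. 0) \<phi> \<in> attained n l" "Sh (\<lambda>_. 0) \<psi> \<in> attained n l"
    and v: "\<And>\<kappa>. \<phi> (theta n l \<kappa>) = f \<kappa>" "\<And>\<kappa>. \<psi> (theta n l \<kappa>) = g \<kappa>" by blast
  then have "Sh (\<lambda>_. 0) \<phi> * Sh (\<lambda>_. 0) \<psi> \<in> attained n l" by (intro attained_mult)
  then have "Sh (\<lambda>_. 0) (\<lambda>a. \<phi> a * \<psi> a) \<in> attained n l" by (simp add: Sh_mult)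
  then show ?case using v by (intro exI[of _ "\<lambda>a. \<phi> a * \<psi> a"]) simp
qed

lemma tval_theta: "n \<ge> 1 \<Longrightarrow> tval n l (theta n l \<kappa>) = of_int (\<kappa> 0)"
  by (simp add: tval_def sum_theta)

lemma basic_symbol_theta:
  assumes "n \<ge> 1"
  shows "basic_symbol n l e (theta n l \<kappa>) = (\<Prod>k\<le>n. fall (of_int (lam n l k \<kappa>)) (mono_exp n 0 e k))"
proof -
  have "(\<Prod>k<n. fall (of_int (lam n l k \<kappa>)) (mono_exp n 0 e k)) = pfall n e (theta n l \<kappa>)"
    unfolding pfall_def by (intro prod.cong) (auto simp: lam_def mono_exp_def)
  then show ?thesis
    using assms unfolding lessThan_Suc_atMost[symmetric] prod.lessThan_Suc
    by (simp add: basic_symbol_def tval_theta) (simp add: lam_def mono_exp_def)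
qed

lemma attained_symbol:
  assumes n: "n \<ge> 1" and e: "e \<in> lat n 0" and \<psi>: "\<psi> \<in> poly_exp n"
    and p: "\<And>\<kappa>. p \<kappa> = (\<Prod>k\<le>n. fall (of_int (lam n l k \<kappa>)) (mono_exp n 0 e k)) * \<psi> \<kappa>"
  shows "\<exists>\<phi>. Sh e \<phi> \<in> attained n l \<and> (\<forall>\<kappa>. \<phi> (theta n l \<kappa>) = p \<kappa>)"
proof -
  obtain \<phi> where \<phi>: "Sh (\<lambda>_. 0) \<phi> \<in> attained n l" "\<And>\<kappa>. \<phi> (theta n l \<kappa>) = \<psi> \<kappa>"
    using attained_poly_exp[OF n \<psi>] by blast
  have "Sh e (basic_symbol n l e) * Sh (\<lambda>_. 0) \<phi> \<in> attained n l"
    by (intro attained_mult attained_basic_symbol e \<phi>(1))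
  then have "Sh e (\<lambda>a. basic_symbol n l e a * \<phi> a) \<in> attained n l" by (simp add: Sh_mult)
  then show ?thesis
    using \<phi>(2) by (intro exI[of _ "\<lambda>a. basic_symbol n l e a * \<phi> a"]) (simp add: p basic_symbol_theta[OF n])
qed

section \<open>The homomorphism\<close>

text \<open>The order bounds of P and R live on different open sets; after restriction to the
  smaller set, their sum bounds the order of P - R as \<open>sheaf_hom_determined\<close>
  requires.\<close>

lemma gdop_determined:
  assumes n: "n \<ge> 1" and P: "P \<in> diff_ops n l" and R: "gdop n l l R"
    and eq: "\<And>u. u \<in> fsupp n l \<Longrightarrow> P (TT n) (lser n l u) = R (TT n) (lser n l u)"
  shows "P = R"
proof -
  have Ps: "P \<in> shom n l l" using P by (simp add: diff_ops_def sheaf_endo_eq)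
  obtain U k where U: "Xt_open n U" "\<Union>U \<noteq> {}" and k: "diff_order_less n l k U P"
    by (rule diff_ops_order[OF n P])
  obtain k' where Rs: "R \<in> shom n l l" and k': "diff_order_less n l k' (Xt n) R"
    using R unfolding gdop_def by blast
  have "diff_order_less n l (k + k') U (\<lambda>W s Q. 1 * P W s Q + (-1) * R W s Q)"
  proof (rule diff_order_lincomb)
    show "diff_order_less n l (k + k') U P" by (rule diff_order_mono[OF _ k]) simp
    have "U \<subseteq> Xt n" using U(1) by (simp only: Xt_open_def)
    then show "diff_order_less n l (k + k') U R"
      by (intro diff_order_mono[OF _ diff_order_subset[OF k']]) simp
  qed
  then have ord: "diff_order_less n l (k + k') U (\<lambda>W s Q. P W s Q - R W s Q)" by simp
  show ?thesis
  proof (rule sheaf_hom_determined[OF n Ps Rs U ord])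
    fix r assume "r \<in> line_sheaf n l (TT n)"
    then obtain u where "u \<in> fsupp n l" "r = lser n l u" using section_lser[OF n] by blast
    then show "P (TT n) r = R (TT n) r" using eq by simp
  qed
qed

lemma matched_unique:
  assumes "n \<ge> 1" "matched n l l P v" "matched n l l R v"
  shows "P = R"
  using assms by (intro gdop_determined) (auto simp: matched_def gdop_diff_ops)

lemma shom_eq_on_series:
  assumes n: "n \<ge> 1" and P: "P \<in> shom n l l" and R: "R \<in> shom n l l"
    and eq: "\<And>a. a \<in> lat n l \<Longrightarrow> P (TT n) (lmono n l a) = R (TT n) (lmono n l a)"
    and u: "u \<in> fsupp n l"
  shows "P (TT n) (lser n l u) = R (TT n) (lser n l u)"
proof -
  have lat: "a \<in> lat n l" if "a \<in> {a. u a \<noteq> 0}" for a using u that by (simp add: fsupp_def)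
  have "lser n l u = (\<lambda>Q. \<Sum>a | u a \<noteq> 0. u a * lmono n l a Q)" by (rule ext) (rule lser_def)
  moreover have "S (TT n) (\<lambda>Q. \<Sum>a | u a \<noteq> 0. u a * lmono n l a Q) = (\<lambda>Q. \<Sum>a | u a \<noteq> 0. u a * S (TT n) (lmono n l a) Q)"
    if "S \<in> shom n l l" for S
    by (rule shom_sum[OF that Xt_open_TT[OF n] lmono_section[OF n lat]])
  ultimately show ?thesis using P R eq lat by simp
qed

lemma app_sum: "app (\<Sum>i\<in>A. f i) u = (\<lambda>b. \<Sum>i\<in>A. app (f i) u b)"
  by (induction A rule: infinite_finite_induct) (simp_all add: app_simps)

lemma matched_lmono:
  assumes n: "n \<ge> 1" and R: "matched n l l R (\<Sum>e\<in>E. Sh e (\<phi> e))" and E: "finite E" "E \<subseteq> lat n 0"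
    and a: "a \<in> lat n l"
  shows "R (TT n) (lmono n l a) = (\<lambda>Q. \<Sum>e\<in>E. \<phi> e a * lmono n l (\<lambda>i. a i + e i) Q)"
proof -
  \<comment> \<open>A monomial is the series of an indicator function, written as a sum over a
    singleton to fit \<open>lser_sum\<close>.\<close>
  let ?\<delta> = "\<lambda>b. \<Sum>\<beta>\<in>{a}. if b = \<beta> then 1 else 0 :: complex"
  have \<delta>: "?\<delta> \<in> fsupp n l" "lser n l ?\<delta> = lmono n l a"
    using lser_sum[where S = "{a}" and g = "\<lambda>b. b" and c = "\<lambda>_. 1" and n = n and l = l] a
    by (auto intro: ext)
  have eq: "(b = (\<lambda>i. a i + e i)) = ((\<lambda>i. b i - e i) = a)" for b e :: "nat \<Rightarrow> int"
    by (auto simp: fun_eq_iff algebra_simps)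
  have ae: "(\<lambda>i. a i + e i) \<in> lat n l" if "e \<in> E" for e
    using lat_add[OF a, of e 0] E(2) that by auto
  have "app (\<Sum>e\<in>E. Sh e (\<phi> e)) ?\<delta> = (\<lambda>b. \<Sum>e\<in>E. if b = (\<lambda>i. a i + e i) then \<phi> e a else 0)"
    unfolding app_sum app_simps eq by (intro ext sum.cong) auto
  moreover have "lser n l (\<lambda>b. \<Sum>e\<in>E. if b = (\<lambda>i. a i + e i) then \<phi> e a else 0) Q =
      (\<Sum>e\<in>E. \<phi> e a * lmono n l (\<lambda>i. a i + e i) Q)" for Q
    using lser_sum[where g = "\<lambda>e i. a i + e i" and c = "\<lambda>e. \<phi> e a" and Q = Q, OF E(1) ae] by simp
  ultimately have res: "lser n l (app (\<Sum>e\<in>E. Sh e (\<phi> e)) ?\<delta>) = (\<lambda>Q. \<Sum>e\<in>E. \<phi> e a * lmono n l (\<lambda>i. a i + e i) Q)"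
    by (intro ext) simp
  have "R (TT n) (lser n l ?\<delta>) = lser n l (app (\<Sum>e\<in>E. Sh e (\<phi> e)) ?\<delta>)"
    by (rule R[unfolded matched_def, THEN conjunct2, THEN bspec, OF \<delta>(1), THEN conjunct2])
  then show ?thesis by (simp only: \<delta>(2) res)
qed

text \<open>The value is arbitrary unless \<open>Z\<close> lies in the subalgebra generated by \<open>gens n l\<close>.\<close>

definition op_of :: "nat \<Rightarrow> int \<Rightarrow> (complex mat free_monoid \<Rightarrow>\<^sub>0 complex) set \<Rightarrow> sheaf_op" where
  "op_of n l Z = (SOME P. \<exists>v. good (rho n) Z v \<and> matched n l l P v)"

lemma op_of_eq:
  assumes "n \<ge> 1" "good (rho n) Z v" "matched n l l P v"
  shows "op_of n l Z = P"
  unfolding op_of_def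
proof (rule some_equality)
  show "\<exists>v. good (rho n) Z v \<and> matched n l l P v" using assms by blast
  fix R assume "\<exists>v. good (rho n) Z v \<and> matched n l l R v"
  then obtain w where "good (rho n) Z w" "matched n l l R w" by blast
  then show "R = P" using good_unique[OF assms(2), of w] matched_unique[OF assms(1) _ assms(3)] by simp
qed

lemma diff_op_in_image:
  assumes n: "n \<ge> 2" and P: "P \<in> diff_ops n l"
  shows "\<exists>Z\<in>generate_alg (env_algebra (sp n)) (gens n l). op_of n l Z = P"
proof -
  have n1: "n \<ge> 1" using n by simp
  have Ps: "P \<in> shom n l l" using P by (simp add: diff_ops_def sheaf_endo_eq)
  obtain E p where E: "finite E" "E \<subseteq> lat n 0" and p: "\<forall>e\<in>E. p e \<in> poly_exp n"
    and act: "\<And>\<kappa>. P (TT n) (lmono n l (theta n l \<kappa>)) = (\<lambda>Q. \<Sum>e\<in>E. p e \<kappa> * lmono n l (\<lambda>i. theta n l \<kappa> i + e i) Q)"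
    using diff_op_expansion[OF n1 P] by blast
  have "\<exists>\<phi>. Sh e \<phi> \<in> attained n l \<and> (\<forall>\<kappa>. \<phi> (theta n l \<kappa>) = p e \<kappa>)" if e: "e \<in> E" for e
  proof -
    obtain \<psi> where "\<psi> \<in> poly_exp n" "\<And>\<kappa>. p e \<kappa> = (\<Prod>k\<le>n. fall (of_int (lam n l k \<kappa>)) (mono_exp n 0 e k)) * \<psi> \<kappa>"
      using symbol_division[where p = p and e = e, OF n Ps E p[rule_format, OF e] act e] by blast
    then show ?thesis using E(2) e by (intro attained_symbol[OF n1]) auto
  qed
  then obtain \<phi> where \<phi>: "\<And>e. e \<in> E \<Longrightarrow> Sh e (\<phi> e) \<in> attained n l" "\<And>e \<kappa>. e \<in> E \<Longrightarrow> \<phi> e (theta n l \<kappa>) = p e \<kappa>"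
    by metis
  let ?v = "\<Sum>e\<in>E. Sh e (\<phi> e)"
  have "?v \<in> attained n l" by (intro attained_sum \<phi>(1))
  then obtain Z where Z: "Z \<in> generate_alg (env_algebra (sp n)) (gens n l)" "good (rho n) Z ?v"
    unfolding attained_def by blast
  \<comment> \<open>Z also has a realizable value, and by uniqueness this value is
    \<open>?v\<close>; so \<open>?v\<close> is matched by some global operator R.\<close>
  obtain w where w: "w \<in> realizable n l" "good (rho n) Z w" using generated_good[OF n1 Z(1)] by blast
  then obtain R where R: "matched n l l R ?v"
    unfolding realizable_def good_unique[OF Z(2) w(2)] by blast
  have Rg: "gdop n l l R" using R by (simp add: matched_def)
  then have Rs: "R \<in> shom n l l" by (simp add: gdop_def)
  have "P = R"
  proof (rule gdop_determined[OF n1 P Rg], rule shom_eq_on_series[OF n1 Ps Rs])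
    fix a assume a: "a \<in> lat n l"
    define \<kappa> where "\<kappa> = (\<lambda>i. if i = 0 then tdeg n l a else a i)"
    have a\<kappa>: "a = theta n l \<kappa>" unfolding \<kappa>_def by (rule theta_surj[OF n1 a])
    have "(\<lambda>Q. \<Sum>e\<in>E. \<phi> e a * lmono n l (\<lambda>i. a i + e i) Q) = (\<lambda>Q. \<Sum>e\<in>E. p e \<kappa> * lmono n l (\<lambda>i. a i + e i) Q)"
      unfolding a\<kappa> by (intro ext sum.cong refl) (simp add: \<phi>(2))
    then show "P (TT n) (lmono n l a) = R (TT n) (lmono n l a)"
      unfolding matched_lmono[OF n1 R E a] using act[of \<kappa>] by (simp only: a\<kappa>)
  qed
  then show ?thesis using op_of_eq[OF n1 Z(2) R] Z(1) by blast
qed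

theorem theorem1p1:
  fixes n :: nat
  assumes "n \<ge> 2"
  shows "\<forall>l::int. \<exists>h \<in> alg_hom (frakA n l) (diff_op_algebra n l).
           h ` carrier (frakA n l) = carrier (diff_op_algebra n l)"
proof
  fix l :: int
  have n: "n \<ge> 1" using assms by simp
  let ?U = "env_algebra (sp n)"
  let ?h = "op_of n l"
  have car: "carrier (frakA n l) = generate_alg ?U (gens n l)"
    by (simp add: frakA_gens subalgebra_generated_def)
  have ops: "x \<otimes>\<^bsub>frakA n l\<^esub> y = x \<otimes>\<^bsub>?U\<^esub> y" "x \<oplus>\<^bsub>frakA n l\<^esub> y = x \<oplus>\<^bsub>?U\<^esub> y"
    "\<one>\<^bsub>frakA n l\<^esub> = \<one>\<^bsub>?U\<^esub>" "c \<odot>\<^bsub>frakA n l\<^esub> x = c \<odot>\<^bsub>?U\<^esub> x" for x y c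
    by (simp_all add: frakA_gens subalgebra_generated_def)
  have ex: "\<exists>P v. good (rho n) Z v \<and> matched n l l P v" if "Z \<in> carrier (frakA n l)" for Z
    using generated_good[OF n, of Z l] that unfolding car realizable_def by blast
  have "?h \<in> alg_hom (frakA n l) (diff_op_algebra n l)"
    unfolding alg_hom_def
  proof (intro CollectI conjI allI ballI ring_hom_memI)
    fix Z assume "Z \<in> carrier (frakA n l)"
    then obtain P v where Z: "good (rho n) Z v" "matched n l l P v" using ex by blast
    then show "?h Z \<in> carrier (diff_op_algebra n l)"
      by (simp add: op_of_eq[OF n Z] diff_op_algebra_def gdop_diff_ops matched_def)
    fix c
    have "good (rho n) (c \<odot>\<^bsub>?U\<^esub> Z) (scal c * v)" by (rule good_rho_scale[OF Z(1)])
    moreover have "matched n l l (\<lambda>U s Q. c * P U s Q) (scal c * v)"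
      using matched_lincomb[OF Z(2) Z(2), of c 0] by (simp add: scal_simps)
    ultimately show "?h (c \<odot>\<^bsub>frakA n l\<^esub> Z) = c \<odot>\<^bsub>diff_op_algebra n l\<^esub> ?h Z"
      by (simp add: ops op_of_eq[OF n] op_of_eq[OF n Z] diff_op_algebra_def)
  next
    fix Z W assume "Z \<in> carrier (frakA n l)" "W \<in> carrier (frakA n l)"
    then obtain P v R w where Z: "good (rho n) Z v" "matched n l l P v" and W: "good (rho n) W w" "matched n l l R w"
      using ex by metis
    show "?h (Z \<otimes>\<^bsub>frakA n l\<^esub> W) = ?h Z \<otimes>\<^bsub>diff_op_algebra n l\<^esub> ?h W"
      using op_of_eq[OF n good_rho_mult[OF Z(1) W(1)] matched_comp[OF Z(2) W(2)]]
      by (simp add: ops op_of_eq[OF n Z] op_of_eq[OF n W] diff_op_algebra_def)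
    have "matched n l l (\<lambda>U s Q. P U s Q + R U s Q) (v + w)"
      using matched_lincomb[OF Z(2) W(2), of 1 1] by (simp add: scal_simps)
    then show "?h (Z \<oplus>\<^bsub>frakA n l\<^esub> W) = ?h Z \<oplus>\<^bsub>diff_op_algebra n l\<^esub> ?h W"
      using op_of_eq[OF n good_rho_add[OF Z(1) W(1)]]
      by (simp add: ops op_of_eq[OF n Z] op_of_eq[OF n W] diff_op_algebra_def)
  next
    show "?h \<one>\<^bsub>frakA n l\<^esub> = \<one>\<^bsub>diff_op_algebra n l\<^esub>"
      using op_of_eq[OF n good_rho_one matched_idop[OF n]] by (simp add: ops diff_op_algebra_def idop_def)
  qed
  moreover have "?h ` carrier (frakA n l) = carrier (diff_op_algebra n l)"
  proof
    show "?h ` carrier (frakA n l) \<subseteq> carrier (diff_op_algebra n l)"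
      using calculation by (auto simp: alg_hom_def dest: ring_hom_closed)
    show "carrier (diff_op_algebra n l) \<subseteq> ?h ` carrier (frakA n l)"
      using diff_op_in_image[OF assms] by (force simp: car diff_op_algebra_def)
  qed
  ultimately show "\<exists>h\<in>alg_hom (frakA n l) (diff_op_algebra n l). h ` carrier (frakA n l) = carrier (diff_op_algebra n l)"
    by blast
qed


end
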